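(* Let $X_+=\{-1,1\}^{\mathbb{Z}_+}$ and let $\phi(x)=\beta\sum_{n=1}^\infty\frac{x_0x_n}{n^\alpha}$ be the Dyson potential with $\alpha>1$ and $\beta>0$ sufficiently small (depending on $\alpha$). Then: (i) $\phi$ admits a unique equilibrium state $\mu_+$ on $X_+$ and a unique half-line Gibbs measure $\nu$; (ii) $\mu_+$ and $\nu$ are equivalent ($\mu_+\ll\nu$ and $\nu\ll\mu_+$), and thus the transfer operator $\mathcal L_\phi$ has an eigenfunction in $L^1(X_+,\nu)$; (iii) if moreover $\alpha>\frac32$, the Radon–Nikodym density $\frac{d\mu_+}{d\nu}$ has a continuous version, and thus $\mathcal L_\phi$ has a continuous eigenfunction.
   Context: $S$ is the left shift on $X_+$ and $S_n\phi=\sum_{k=0}^{n-1}\phi\circ S^k$. The transfer operator is $\mathcal L_\phi f(x)=\sum_{a\in\{-1,1\}}e^{\phi(ax)}f(ax)$, where $ax$ is the concatenation; $P(\phi)=\lim_n\frac1n\log\sup_x\mathcal L_\phi^n\mathbf 1(x)$ is the topological pressure. In this paper "$\mathcal L_\phi$ has an eigenfunction" means a non-negative non-trivial $h$ with $\mathcal L_\phi h=e^{P(\phi)}h$. A half-line Gibbs measure for $\phi$ is a probability $\nu$ on $X_+$ with $\nu(x_0^{n-1}=a_0^{n-1}\mid x_n^\infty)=\exp(S_n\phi(a_0^{n-1}x_n^\infty))/\sum_{\bar a_0^{n-1}}\exp(S_n\phi(\bar a_0^{n-1}x_n^\infty))$ a.s. for every $n\ge1$. An equilibrium state for $\phi$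 is a shift-invariant probability $\mu$ on $X_+$ maximizing $h(S,\mu)+\int\phi\,d\mu$ over shift-invariant probabilities ($h(S,\cdot)$ the Kolmogorov–Sinai entropy). *)

theory Defs
  imports "HOL-Probability.Probability"
begin

text \<open>Configuration space X_+ = {-1,1}^N with the product sigma-algebra.
  Points are functions nat => real taking values in {-1,1}; the topology is the
  product topology on nat => real (restricted to this set).\<close>
definition Xp :: "(nat \<Rightarrow> real) measure" where
  "Xp = PiM UNIV (\<lambda>_. count_space {-1, 1})"

definition shift :: "(nat \<Rightarrow> real) \<Rightarrow> (nat \<Rightarrow> real)" where
  "shift x = (\<lambda>n. x (Suc n))"

definition concat1 :: "real \<Rightarrow> (nat \<Rightarrow> real) \<Rightarrow> (nat \<Rightarrow> real)" where
  "concat1 a x = case_nat a x"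

definition dyson :: "real \<Rightarrow> real \<Rightarrow> (nat \<Rightarrow> real) \<Rightarrow> real" where
  "dyson \<alpha> \<beta> x = \<beta> * (\<Sum>n. x 0 * x (Suc n) / real (Suc n) powr \<alpha>)"

definition birkhoff_sum :: "nat \<Rightarrow> ((nat \<Rightarrow> real) \<Rightarrow> real) \<Rightarrow> (nat \<Rightarrow> real) \<Rightarrow> real" where
  "birkhoff_sum n \<phi> x = (\<Sum>k<n. \<phi> ((shift ^^ k) x))"

definition transfer :: "((nat \<Rightarrow> real) \<Rightarrow> real) \<Rightarrow> ((nat \<Rightarrow> real) \<Rightarrow> real) \<Rightarrow> (nat \<Rightarrow> real) \<Rightarrow> real" where
  "transfer \<phi> f x = (\<Sum>a\<in>{-1, 1::real}. exp (\<phi> (concat1 a x)) * f (concat1 a x))"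

definition pressure :: "((nat \<Rightarrow> real) \<Rightarrow> real) \<Rightarrow> real" where
  "pressure \<phi> = lim (\<lambda>n. ln (SUP x\<in>space Xp. ((transfer \<phi> ^^ n) (\<lambda>_. 1) x)) / real n)"

definition shift_invariant :: "(nat \<Rightarrow> real) measure \<Rightarrow> bool" where
  "shift_invariant \<mu> \<longleftrightarrow> prob_space \<mu> \<and> sets \<mu> = sets Xp \<and> distr \<mu> Xp shift = \<mu>"

text \<open>Kolmogorov--Sinai entropy. A finite measurable partition is given by a measurable
  labelling function with finitely many values; its n-fold refinement under the shift is
  the joint labelling x |-> [xi(x), xi(S x), ..., xi(S^(n-1) x)].\<close>
definition part_entropy :: "'a measure \<Rightarrow> ('a \<Rightarrow> 'b) \<Rightarrow> real" where
  "part_entropy \<mu> f = (\<Sum>v\<in>f ` space \<mu>.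
      (let p = measure \<mu> (f -` {v} \<inter> space \<mu>) in if p = 0 then 0 else - p * ln p))"

definition refine :: "nat \<Rightarrow> ((nat \<Rightarrow> real) \<Rightarrow> nat) \<Rightarrow> (nat \<Rightarrow> real) \<Rightarrow> nat list" where
  "refine n \<xi> x = map (\<lambda>k. \<xi> ((shift ^^ k) x)) [0..<n]"

definition entropy_rate :: "(nat \<Rightarrow> real) measure \<Rightarrow> ((nat \<Rightarrow> real) \<Rightarrow> nat) \<Rightarrow> real" where
  "entropy_rate \<mu> \<xi> = lim (\<lambda>n. part_entropy \<mu> (refine n \<xi>) / real n)"

definition finite_partition :: "((nat \<Rightarrow> real) \<Rightarrow> nat) \<Rightarrow> bool" where
  "finite_partition \<xi> \<longleftrightarrow> \<xi> \<in> measurable Xp (count_space UNIV) \<and> finite (\<xi> ` space Xp)"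

definition ks_entropy :: "(nat \<Rightarrow> real) measure \<Rightarrow> real" where
  "ks_entropy \<mu> = Sup {entropy_rate \<mu> \<xi> | \<xi>. finite_partition \<xi>}"

definition equilibrium_state :: "((nat \<Rightarrow> real) \<Rightarrow> real) \<Rightarrow> (nat \<Rightarrow> real) measure \<Rightarrow> bool" where
  "equilibrium_state \<phi> \<mu> \<longleftrightarrow> shift_invariant \<mu> \<and>
     (\<forall>\<mu>'. shift_invariant \<mu>' \<longrightarrow>
        ks_entropy \<mu>' + integral\<^sup>L \<mu>' \<phi> \<le> ks_entropy \<mu> + integral\<^sup>L \<mu> \<phi>)"

definition tail_from :: "nat \<Rightarrow> (nat \<Rightarrow> real) measure" where
  "tail_from n = sigma (space Xp) {{x\<in>space Xp. x k \<in> A} | k A. n \<le> k}"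

definition words :: "nat \<Rightarrow> (nat \<Rightarrow> real) set" where
  "words n = PiE {..<n} (\<lambda>_. {-1, 1})"

definition glue :: "nat \<Rightarrow> (nat \<Rightarrow> real) \<Rightarrow> (nat \<Rightarrow> real) \<Rightarrow> (nat \<Rightarrow> real)" where
  "glue n a x = (\<lambda>k. if k < n then a k else x k)"

definition half_line_gibbs :: "((nat \<Rightarrow> real) \<Rightarrow> real) \<Rightarrow> (nat \<Rightarrow> real) measure \<Rightarrow> bool" where
  "half_line_gibbs \<phi> \<nu> \<longleftrightarrow> prob_space \<nu> \<and> sets \<nu> = sets Xp \<and>
     (\<forall>n\<ge>1. \<forall>a\<in>words n.
        AE x in \<nu>. real_cond_exp \<nu> (tail_from n)
             (indicator {y\<in>space Xp. \<forall>i<n. y i = a i}) x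
          = exp (birkhoff_sum n \<phi> (glue n a x)) /
            (\<Sum>b\<in>words n. exp (birkhoff_sum n \<phi> (glue n b x))))"

end

theory Submission
  imports Defs
begin

text \<open>For small \<open>\<beta>\<close> Dobrushin's comparison theorem, with a supersolution \<open>G\<close> decaying like the interaction,
  controls all finite-volume expectations: the half-line measure \<open>\<nu>\<close> and the two-sided measure \<open>\<mu>\<close> exist as
  limits of free finite-volume measures, \<open>\<nu>\<close> is the only half-line Gibbs measure, and every observable has
  Gaussian exponential moments.
  The law of the right half of a block of length \<open>2 r\<close> has, up to a constant, density
  \<open>D\<^sub>r(x) = E\<^sub>y exp W(y, x)\<close> with respect to the free measure on a block of length \<open>r\<close>. By spin-flip symmetry
  \<open>D\<^sub>r \<ge> 1\<close>, and \<open>D\<^sub>r\<close> is bounded in \<open>L\<^sup>2\<close> because pair correlations are dominated by \<open>w\<close> and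
  \<open>\<Sum>i<0. \<Sum>j\<ge>0. w(i, j)\<^sup>2\<close> is finite for \<open>\<alpha> > 1\<close>; this gives the equivalence of \<open>\<mu>\<close> and \<open>\<nu>\<close>. If
  \<open>\<alpha> > 3/2\<close>, the fields exerted by the right half-line on the left one are uniformly square summable and
  \<open>D\<^sub>r\<close> converges uniformly.
  Gibbs' inequality combined with the Gaussian bound shows that for every invariant \<open>\<mu>'\<close>, every local \<open>\<psi>\<close> and all
  real \<open>t\<close>, \<open>h(\<mu>') + \<integral>\<phi> d\<mu>' \<le> P(\<phi>) + t (\<integral>\<psi> d\<mu> - \<integral>\<psi> d\<mu>') + C t\<^sup>2\<close>. Taking \<open>t = 0\<close> is the variational
  inequality; equality at \<open>\<mu>'\<close> forces \<open>\<integral>\<psi> d\<mu>' = \<integral>\<psi> d\<mu>\<close>, hence uniqueness.\<close>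

section \<open>Dobrushin's comparison theorem\<close>

text \<open>The energy between the two half-lines grows like the sum of n * n^(-\<alpha>), which
  diverges for \<alpha> \<le> 2, and then the variations of \<phi> are not summable either: no
  distortion bound holds uniformly in the boundary condition. What survives is cancellation. The
  spins of the free left half-line are centred and weakly dependent, so exponential moments of the
  coupling energy are governed by sums of squares, and n * n^(-2\<alpha>) is summable for every
  \<alpha> > 1. With the right half frozen, the squares are those of its fields, of order
  n^(1-\<alpha>); hence the exponent 3/2.

  For this, correlations must decay like the interaction itself. They do because, for any
  intermediate site k, one of the distances |i - k|, |k - j| is at least |i - j| / 2, so
  convolutions of the kernel stay below a multiple of it.

  Exchanging a boundary condition costs a sum of tails of the interaction, possibly divergent but
  o(n), hence invisible to pressure and entropy.\<close>

abbreviation cfg :: "'i set \<Rightarrow> ('i \<Rightarrow> real) set" where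
  "cfg V \<equiv> PiE V (\<lambda>_. {-1, 1})"

definition gE :: "'i set \<Rightarrow> (('i \<Rightarrow> real) \<Rightarrow> real) \<Rightarrow> (('i \<Rightarrow> real) \<Rightarrow> real) \<Rightarrow> real" where
  "gE V U f = (\<Sum>x\<in>cfg V. exp (U x) * f x) / (\<Sum>x\<in>cfg V. exp (U x))"

definition fld :: "(('i \<Rightarrow> real) \<Rightarrow> real) \<Rightarrow> 'i \<Rightarrow> ('i \<Rightarrow> real) \<Rightarrow> real" where
  "fld U i x = (U (x(i := 1)) - U (x(i := -1))) / 2"

definition plus_prob :: "real \<Rightarrow> real" where
  "plus_prob h = 1 / (1 + exp (- (2 * h)))"

text \<open>Heat-bath resampling of the spin at i, that is, conditional expectation given the other
  spins: \<open>fld\<close> is half the log-odds of +1, so \<open>plus_prob (fld U i x)\<close> is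
  its conditional probability.\<close>

definition site_avg :: "(('i \<Rightarrow> real) \<Rightarrow> real) \<Rightarrow> 'i \<Rightarrow> (('i \<Rightarrow> real) \<Rightarrow> real) \<Rightarrow> ('i \<Rightarrow> real) \<Rightarrow> real" where
  "site_avg U i f x = plus_prob (fld U i x) * f (x(i := 1)) + (1 - plus_prob (fld U i x)) * f (x(i := -1))"

definition osc_le :: "'i set \<Rightarrow> (('i \<Rightarrow> real) \<Rightarrow> real) \<Rightarrow> ('i \<Rightarrow> real) \<Rightarrow> bool" where
  "osc_le V f d \<longleftrightarrow> (\<forall>x\<in>cfg V. \<forall>i\<in>V. \<bar>f (x(i := 1)) - f (x(i := -1))\<bar> \<le> d i)"

lemma finite_cfg [simp, intro]: "finite V \<Longrightarrow> finite (cfg V)"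
  by (intro finite_PiE) auto

lemma cfg_nonempty [simp]: "cfg V \<noteq> {}"
  by (simp add: PiE_eq_empty_iff)

lemma cfg_ex: obtains x where "x \<in> cfg V"
  using cfg_nonempty[of V] by (metis ex_in_conv)

lemma cfg_upd: "x \<in> cfg V \<Longrightarrow> i \<in> V \<Longrightarrow> s \<in> {-1, 1} \<Longrightarrow> x(i := s) \<in> cfg V"
  by (auto simp: PiE_iff extensional_def)

lemma cfg_val: "x \<in> cfg V \<Longrightarrow> i \<in> V \<Longrightarrow> x i = -1 \<or> x i = 1"
  by (auto simp: PiE_iff)

lemma cfg_abs: "x \<in> cfg V \<Longrightarrow> i \<in> V \<Longrightarrow> \<bar>x i\<bar> = 1"
  by (auto simp: PiE_iff)

lemma cfg_sq: "x \<in> cfg V \<Longrightarrow> i \<in> V \<Longrightarrow> x i * x i = 1"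
  by (auto simp: PiE_iff)

lemma partition_pos: "finite V \<Longrightarrow> 0 < (\<Sum>x\<in>cfg V. exp (U x :: real))"
  by (intro sum_pos) auto

lemma gE_cong: "(\<And>x. x \<in> cfg V \<Longrightarrow> U x = U' x) \<Longrightarrow> (\<And>x. x \<in> cfg V \<Longrightarrow> f x = f' x) \<Longrightarrow> gE V U f = gE V U' f'"
  unfolding gE_def by (auto intro!: arg_cong2[where f="(/)"] sum.cong)

lemma gE_const [simp]: "finite V \<Longrightarrow> gE V U (\<lambda>_. c) = c"
  using partition_pos[of V U] by (auto simp: gE_def sum_distrib_right[symmetric])

lemma gE_add: "gE V U (\<lambda>x. f x + g x) = gE V U f + gE V U g"
  by (simp add: gE_def distrib_left sum.distrib add_divide_distrib)

lemma gE_diff: "gE V U (\<lambda>x. f x - g x) = gE V U f - gE V U g"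
  by (simp add: gE_def right_diff_distrib sum_subtractf diff_divide_distrib)

lemma gE_cmult: "gE V U (\<lambda>x. c * f x) = c * gE V U f"
  by (simp add: gE_def sum_distrib_left mult.left_commute)

lemma gE_sum: "finite I \<Longrightarrow> gE V U (\<lambda>x. \<Sum>i\<in>I. f i x) = (\<Sum>i\<in>I. gE V U (f i))"
  by (simp add: gE_def sum_distrib_left sum_divide_distrib[symmetric] sum.swap[of _ I])

lemma gE_mono: "finite V \<Longrightarrow> (\<And>x. x \<in> cfg V \<Longrightarrow> f x \<le> g x) \<Longrightarrow> gE V U f \<le> gE V U g"
  unfolding gE_def using partition_pos[of V U]
  by (intro divide_right_mono sum_mono mult_left_mono) auto

lemma gE_abs_le: "finite V \<Longrightarrow> (\<And>x. x \<in> cfg V \<Longrightarrow> \<bar>f x\<bar> \<le> c) \<Longrightarrow> \<bar>gE V U f\<bar> \<le> c"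
  using gE_mono[of V f "\<lambda>_. c" U] gE_mono[of V "\<lambda>_. -c" f U]
  by (auto simp: abs_le_iff) (metis abs_le_iff minus_le_iff)

lemma gE_near: "finite V \<Longrightarrow> (\<And>x. x \<in> cfg V \<Longrightarrow> \<bar>f x - c\<bar> \<le> e) \<Longrightarrow> \<bar>gE V U f - c\<bar> \<le> e"
  using gE_abs_le[of V "\<lambda>x. f x - c" e U] by (simp add: gE_diff)

lemma gE_diff_le: "finite V \<Longrightarrow> (\<And>x. x \<in> cfg V \<Longrightarrow> \<bar>f x - g x\<bar> \<le> e) \<Longrightarrow> \<bar>gE V U f - gE V U g\<bar> \<le> e"
  using gE_abs_le[of V "\<lambda>x. f x - g x" e U] by (simp add: gE_diff)

text \<open>Lets energy terms that do not involve the resampled spins be dropped after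
  conditioning.\<close>

lemma gE_shift_energy:
  assumes "\<And>x. x \<in> cfg V \<Longrightarrow> U' x = U x + c"
  shows "gE V U' f = gE V U f"
proof -
  have "gE V U' f = (exp c * (\<Sum>x\<in>cfg V. exp (U x) * f x)) / (exp c * (\<Sum>x\<in>cfg V. exp (U x)))"
    using assms by (auto simp: gE_def sum_distrib_left exp_add mult_ac intro!: arg_cong2[where f="(/)"] sum.cong)
  then show ?thesis by (simp add: gE_def)
qed

lemma gE_Cauchy_Schwarz:
  assumes "finite V"
  shows "(gE V U (\<lambda>x. f x * g x))\<^sup>2 \<le> gE V U (\<lambda>x. (f x)\<^sup>2) * gE V U (\<lambda>x. (g x)\<^sup>2)"
proof -
  let ?Z = "\<Sum>x\<in>cfg V. exp (U x)"
  have "(\<Sum>x\<in>cfg V. exp (U x) * (f x * g x))\<^sup>2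
      = (\<Sum>x\<in>cfg V. (exp (U x / 2) * f x) * (exp (U x / 2) * g x))\<^sup>2"
  proof -
    have "exp (U x) = exp (U x / 2) * exp (U x / 2)" for x
      by (simp add: exp_add[symmetric])
    then show ?thesis by (simp add: mult_ac)
  qed
  also have "\<dots> \<le> (\<Sum>x\<in>cfg V. (exp (U x / 2) * f x)\<^sup>2) * (\<Sum>x\<in>cfg V. (exp (U x / 2) * g x)\<^sup>2)"
    by (rule Cauchy_Schwarz_ineq_sum)
  also have "\<dots> = (\<Sum>x\<in>cfg V. exp (U x) * (f x)\<^sup>2) * (\<Sum>x\<in>cfg V. exp (U x) * (g x)\<^sup>2)"
  proof -
    have "(exp (u / 2))\<^sup>2 = exp u" for u :: real
      by (simp add: power2_eq_square exp_add[symmetric])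
    then show ?thesis by (simp add: power_mult_distrib)
  qed
  finally show ?thesis
    by (simp add: gE_def power_divide power2_eq_square divide_right_mono)
qed

lemma gE_reindex:
  assumes "bij_betw \<pi> B A" and "\<And>x. x \<in> cfg A \<Longrightarrow> U x = U' (\<lambda>i\<in>B. x (\<pi> i))"
    and "\<And>x. x \<in> cfg A \<Longrightarrow> f x = f' (\<lambda>i\<in>B. x (\<pi> i))"
  shows "gE A U f = gE B U' f'"
proof -
  let ?\<rho> = "inv_into B \<pi>"
  have r1: "\<And>i. i \<in> A \<Longrightarrow> \<pi> (?\<rho> i) = i" and r2: "\<And>i. i \<in> B \<Longrightarrow> ?\<rho> (\<pi> i) = i"
    and r3: "\<And>i. i \<in> A \<Longrightarrow> ?\<rho> i \<in> B" and r4: "\<And>i. i \<in> B \<Longrightarrow> \<pi> i \<in> A"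
    using assms(1) by (auto simp: bij_betw_inv_into_right bij_betw_inv_into_left bij_betw_def inv_into_into)
  have re: "(\<Sum>x\<in>cfg A. F (\<lambda>i\<in>B. x (\<pi> i))) = (\<Sum>x\<in>cfg B. F x)" for F :: "_ \<Rightarrow> real"
    by (rule sum.reindex_bij_witness[where i="\<lambda>x. \<lambda>i\<in>A. x (?\<rho> i)" and j="\<lambda>x. \<lambda>i\<in>B. x (\<pi> i)"])
      (auto simp: fun_eq_iff r1 r2 r3 r4 PiE_iff extensional_def)
  show ?thesis
    unfolding gE_def using re[of "\<lambda>x. exp (U' x)"] re[of "\<lambda>x. exp (U' x) * f' x"] assms(2,3) by simp
qed

lemma sum_cfg_split:
  assumes "A \<subseteq> V"
  shows "(\<Sum>x\<in>cfg V. F x) = (\<Sum>z\<in>cfg (V - A). \<Sum>a\<in>cfg A. F (\<lambda>i. if i \<in> A then a i else z i))"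
proof -
  have "(\<Sum>x\<in>cfg V. F x) = (\<Sum>(z, a)\<in>cfg (V - A) \<times> cfg A. F (\<lambda>i. if i \<in> A then a i else z i))"
    by (rule sum.reindex_bij_witness[where j="\<lambda>x. (restrict x (V - A), restrict x A)"
          and i="\<lambda>(z, a). (\<lambda>i. if i \<in> A then a i else z i)"])
      (use assms in \<open>force simp: fun_eq_iff PiE_iff extensional_def intro!: arg_cong[where f=F]\<close>)+
  then show ?thesis by (simp add: sum.cartesian_product)
qed

text \<open>The finite-volume DLR equation: the inner expectation depends only on the spins off A,
  so it can be pulled out of the sum over each fibre of the restriction to
  \<open>V - A\<close>.\<close>

lemma gE_tower:
  assumes V: "finite V" "A \<subseteq> V"
  shows "gE V U f = gE V U (\<lambda>x. gE A (\<lambda>a. U (\<lambda>i. if i \<in> A then a i else x i))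
                                     (\<lambda>a. f (\<lambda>i. if i \<in> A then a i else x i)))"
    (is "_ = gE V U ?g")
proof -
  have fA: "finite A" using V finite_subset by blast
  have "(\<Sum>x\<in>cfg V. exp (U x) * f x) = (\<Sum>x\<in>cfg V. exp (U x) * ?g x)"
  proof -
    have "(\<Sum>a\<in>cfg A. exp (U (\<lambda>i. if i \<in> A then a i else z i)) * ?g (\<lambda>i. if i \<in> A then a i else z i))
       = (\<Sum>a\<in>cfg A. exp (U (\<lambda>i. if i \<in> A then a i else z i)) * f (\<lambda>i. if i \<in> A then a i else z i))" for z
    proof -
      have g: "?g (\<lambda>i. if i \<in> A then a i else z i) = ?g z" for a
        by (rule gE_cong; rule arg_cong[where f=U] arg_cong[where f=f]; auto)
      show ?thesis
        unfolding g sum_distrib_right[symmetric]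
        using partition_pos[OF fA, of "\<lambda>a. U (\<lambda>i. if i \<in> A then a i else z i)"] by (simp add: gE_def)
    qed
    then show ?thesis by (simp add: sum_cfg_split[OF V(2)])
  qed
  then show ?thesis by (simp add: gE_def)
qed

lemma sum_cfg_flip:
  assumes i: "i \<in> V"
  shows "2 * (\<Sum>x\<in>cfg V. F x) = (\<Sum>x\<in>cfg V. F (x(i := 1)) + F (x(i := -1)) :: real)"
proof -
  have "(\<Sum>x\<in>cfg V. F x) = (\<Sum>x\<in>cfg V. F (x(i := - x i)))"
    by (rule sum.reindex_bij_witness[where i="\<lambda>x. x(i := - x i)" and j="\<lambda>x. x(i := - x i)"])
      (use i in \<open>auto simp: PiE_iff extensional_def\<close>)
  then have "2 * (\<Sum>x\<in>cfg V. F x) = (\<Sum>x\<in>cfg V. F x + F (x(i := - x i)))"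
    by (simp add: sum.distrib)
  also have "\<dots> = (\<Sum>x\<in>cfg V. F (x(i := 1)) + F (x(i := -1)))"
  proof (rule sum.cong[OF refl])
    fix x assume "x \<in> cfg V"
    then have "x i = 1 \<or> x i = -1" using i by (auto simp: PiE_iff)
    then show "F x + F (x(i := - x i)) = F (x(i := 1)) + F (x(i := -1))"
      by (metis add.commute fun_upd_triv minus_minus)
  qed
  finally show ?thesis .
qed

lemma plus_prob_bounds: "0 < plus_prob h" "plus_prob h < 1"
  by (auto simp: plus_prob_def field_simps add_pos_pos)

text \<open>The derivative is 2u/(1+u)^2 with u = exp (-2z), at most 1/2 because (1-u)^2 \<ge> 0.
  This 1/2 explains the factors 2 in front of \<open>C\<close> and \<open>b\<close> in the field
  hypotheses below.\<close>

lemma plus_prob_Lipschitz: "\<bar>plus_prob h - plus_prob k\<bar> \<le> \<bar>h - k\<bar> / 2"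
proof -
  have der: "(plus_prob has_field_derivative (2 * exp (- (2 * z)) / (1 + exp (- (2 * z)))\<^sup>2)) (at z)" for z
  proof -
    have nz: "1 + exp (- (2 * z)) \<noteq> 0" using exp_gt_zero[of "- (2 * z)"] by linarith
    show ?thesis unfolding plus_prob_def
      by (auto intro!: derivative_eq_intros simp: nz power2_eq_square)
  qed
  have bound: "\<bar>2 * exp (- (2 * z)) / (1 + exp (- (2 * z)))\<^sup>2\<bar> \<le> 1/2" for z :: real
  proof -
    have "4 * exp (- (2 * z)) \<le> (1 + exp (- (2 * z)))\<^sup>2"
      using zero_le_power2[of "1 - exp (- (2 * z))"] by (simp add: power2_eq_square algebra_simps)
    moreover have "0 < (1 + exp (- (2 * z)))\<^sup>2" by (intro zero_less_power add_pos_pos) auto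
    ultimately show ?thesis by (simp add: field_simps abs_mult)
  qed
  have "norm (plus_prob h - plus_prob k) \<le> 1/2 * norm (h - k)"
    by (rule field_differentiable_bound[of UNIV plus_prob]) (use der bound in \<open>auto intro: has_field_derivative_at_within\<close>)
  then show ?thesis by simp
qed

lemma fld_upd [simp]: "fld U i (x(i := s)) = fld U i x"
  by (simp add: fld_def)

text \<open>On each pair of configurations differing only at i, with weights P and M,
  \<open>plus_prob\<close> equals P/(P+M), so resampling only redistributes the mass within the
  pair.\<close>

lemma gE_site_avg:
  assumes "finite V" "i \<in> V"
  shows "gE V U (site_avg U i f) = gE V U f"
proof -
  have eq: "exp (U (x(i := 1))) * site_avg U i f (x(i := 1)) + exp (U (x(i := -1))) * site_avg U i f (x(i := -1))
      = exp (U (x(i := 1))) * f (x(i := 1)) + exp (U (x(i := -1))) * f (x(i := -1))" for x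
  proof -
    define P M where "P = exp (U (x(i := 1)))" and "M = exp (U (x(i := -1)))"
    have PM: "P > 0" "M > 0" by (auto simp: P_def M_def)
    have pp: "plus_prob (fld U i x) = P / (P + M)"
    proof -
      have *: "exp (- (2 * fld U i x)) = M / P"
        by (simp add: fld_def P_def M_def exp_diff[symmetric] field_simps)
      show ?thesis unfolding plus_prob_def * using PM by (simp add: divide_simps)
    qed
    have "1 - P / (P + M) = M / (P + M)" using PM by (simp add: field_simps)
    then have "site_avg U i f (x(i := s)) = (P * f (x(i := 1)) + M * f (x(i := -1))) / (P + M)" for s
      by (simp add: site_avg_def pp add_divide_distrib)
    then show ?thesis
      unfolding P_def[symmetric] M_def[symmetric] using PM
      by (simp add: add_divide_distrib[symmetric] distrib_right[symmetric])
  qed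
  have "2 * (\<Sum>x\<in>cfg V. exp (U x) * site_avg U i f x) = 2 * (\<Sum>x\<in>cfg V. exp (U x) * f x)"
    unfolding sum_cfg_flip[OF assms(2)] eq ..
  then show ?thesis by (simp add: gE_def)
qed

lemma osc_le_nonneg: "osc_le V f d \<Longrightarrow> i \<in> V \<Longrightarrow> 0 \<le> d i"
proof -
  assume a: "osc_le V f d" "i \<in> V"
  obtain x where "x \<in> cfg V" by (rule cfg_ex)
  then have "\<bar>f (x(i := 1)) - f (x(i := -1))\<bar> \<le> d i" using a by (auto simp: osc_le_def)
  then show ?thesis by linarith
qed

text \<open>Resampling removes the dependence on the spin at i, but its law still depends on the
  other spins: the spin at j moves the probability by at most \<open>C j\<close>, which is charged
  with the old oscillation at i.\<close>

lemma osc_le_site_avg: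
  assumes f: "osc_le V f d" and i: "i \<in> V"
    and C: "\<And>x j. x \<in> cfg V \<Longrightarrow> j \<in> V \<Longrightarrow> j \<noteq> i \<Longrightarrow> \<bar>fld U i (x(j := 1)) - fld U i (x(j := -1))\<bar> \<le> 2 * C j"
  shows "osc_le V (site_avg U i f) (\<lambda>j. if j = i then 0 else d j + C j * d i)"
  unfolding osc_le_def
proof (intro ballI)
  fix x j assume x: "x \<in> cfg V" and j: "j \<in> V"
  show "\<bar>site_avg U i f (x(j := 1)) - site_avg U i f (x(j := -1))\<bar> \<le> (if j = i then 0 else d j + C j * d i)"
  proof (cases "j = i")
    case True
    then show ?thesis by (simp add: site_avg_def)
  next
    case False
    define p q where "p = plus_prob (fld U i (x(j := 1)))" and "q = plus_prob (fld U i (x(j := -1)))"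
    define a b c e where "a = f (x(i := 1, j := 1))" and "b = f (x(i := -1, j := 1))"
      and "c = f (x(i := 1, j := -1))" and "e = f (x(i := -1, j := -1))"
    have tw: "x(j := s, i := t) = x(i := t, j := s)" for s t using False by (simp add: fun_upd_twist)
    have pq: "\<bar>p - q\<bar> \<le> C j"
      using plus_prob_Lipschitz[of "fld U i (x(j := 1))" "fld U i (x(j := -1))"] C[OF x j False] by (simp add: p_def q_def)
    have ac: "\<bar>a - c\<bar> \<le> d j" and be: "\<bar>b - e\<bar> \<le> d j"
      using f cfg_upd[OF x i] j by (auto simp: osc_le_def a_def b_def c_def e_def)
    have ce: "\<bar>c - e\<bar> \<le> d i"
      using f cfg_upd[OF x j, of "-1"] i by (auto simp: osc_le_def c_def e_def tw[symmetric])
    have p: "0 \<le> p" "0 \<le> 1 - p" using plus_prob_bounds[of "fld U i (x(j := 1))"] by (auto simp: p_def)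
    \<comment> \<open>The first two terms form a convex combination of oscillations in j at a fixed
      spin i; the last one isolates the change of the resampling probability.\<close>
    have "site_avg U i f (x(j := 1)) - site_avg U i f (x(j := -1)) = p * (a - c) + (1 - p) * (b - e) + (p - q) * (c - e)"
      by (simp add: site_avg_def tw p_def q_def a_def b_def c_def e_def algebra_simps)
    also have "\<bar>\<dots>\<bar> \<le> p * \<bar>a - c\<bar> + (1 - p) * \<bar>b - e\<bar> + \<bar>p - q\<bar> * \<bar>c - e\<bar>"
      using p by (intro order_trans[OF abs_triangle_ineq] add_mono) (auto simp: abs_mult intro!: order_trans[OF abs_triangle_ineq])
    also have "\<dots> \<le> p * d j + (1 - p) * d j + C j * d i"
      using p pq ac be ce by (intro add_mono mult_left_mono mult_mono) auto
    also have "\<dots> = d j + C j * d i" by (simp add: algebra_simps)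
    finally show ?thesis using False by simp
  qed
qed

lemma osc_le_total:
  assumes "finite V" "osc_le V f d" "x \<in> cfg V" "y \<in> cfg V"
  shows "\<bar>f x - f y\<bar> \<le> (\<Sum>i\<in>V. d i)"
proof -
  \<comment> \<open>\<open>override_on x y F\<close> is y on F and x elsewhere: x is turned into y
    one site at a time.\<close>
  have "F \<subseteq> V \<Longrightarrow> \<bar>f (override_on x y F) - f x\<bar> \<le> (\<Sum>i\<in>F. d i)" if "finite F" for F
    using that
  proof induction
    case (insert i F)
    define z where "z = override_on x y F"
    have z: "z \<in> cfg V" using assms(3,4) insert.prems
      by (auto simp: z_def PiE_iff extensional_def override_on_def)
    have i: "i \<in> V" using insert.prems by auto
    have o: "override_on x y (insert i F) = z(i := y i)"
      by (auto simp: z_def override_on_def)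
    have "\<bar>f (z(i := 1)) - f (z(i := -1))\<bar> \<le> d i" using assms(2) z i by (auto simp: osc_le_def)
    moreover have "y i = 1 \<or> y i = -1" "z i = 1 \<or> z i = -1" using cfg_val[OF _ i] assms(4) z by blast+
    ultimately have "\<bar>f (z(i := y i)) - f (z(i := z i))\<bar> \<le> d i"
      by (metis abs_minus_commute abs_zero diff_self order_trans abs_ge_zero)
    then have "\<bar>f (z(i := y i)) - f z\<bar> \<le> d i" by simp
    moreover have "\<bar>f z - f x\<bar> \<le> sum d F" using insert by (auto simp: z_def)
    ultimately show ?case using insert.hyps by (simp add: o del: fun_upd_apply)
  qed simp
  note this[OF assms(1)]
  moreover have "override_on x y V = y"
    using assms(3,4) by (auto simp: override_on_def fun_eq_iff PiE_iff extensional_def)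
  ultimately show ?thesis by (simp add: abs_minus_commute)
qed

text \<open>A vector of weights \<open>a\<close> is admissible when it bounds the difference of the two expectations on
  every observable; resampling the spin at one site improves the weight of that site.\<close>
definition compares :: "'i set \<Rightarrow> (('i \<Rightarrow> real) \<Rightarrow> real) \<Rightarrow> (('i \<Rightarrow> real) \<Rightarrow> real) \<Rightarrow> ('i \<Rightarrow> real) \<Rightarrow> bool" where
  "compares V U U' a \<longleftrightarrow> (\<forall>f d. osc_le V f d \<longrightarrow> \<bar>gE V U f - gE V U' f\<bar> \<le> (\<Sum>i\<in>V. a i * d i))"

lemma compares_mono:
  "compares V U U' a \<Longrightarrow> (\<And>i. i \<in> V \<Longrightarrow> a i \<le> a' i) \<Longrightarrow> compares V U U' a'"
  unfolding compares_def
  by (meson order_trans sum_mono mult_right_mono osc_le_nonneg)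

text \<open>Each expectation lies within the total oscillation of the value at one fixed
  configuration, which accounts for the 2.\<close>

lemma compares_init: "finite V \<Longrightarrow> compares V U U' (\<lambda>_. 2)"
  unfolding compares_def
proof (intro allI impI)
  fix f d assume V: "finite V" and f: "osc_le V f d"
  obtain y where y: "y \<in> cfg V" by (rule cfg_ex)
  have "\<bar>gE V W f - f y\<bar> \<le> (\<Sum>i\<in>V. d i)" for W
    by (rule gE_near[OF V]) (rule osc_le_total[OF V f _ y])
  from this[of U] this[of U'] show "\<bar>gE V U f - gE V U' f\<bar> \<le> (\<Sum>i\<in>V. 2 * d i)"
    by (simp add: sum_distrib_left[symmetric])
qed

text \<open>Each expectation may be resampled with its own kernel. Moving both to the kernel of U
  leaves one observable under two measures, controlled by \<open>a\<close> with the old weight of i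
  dropping out, and the change of kernel costs \<open>b\<close>.\<close>

lemma compares_step:
  assumes V: "finite V" "i \<in> V" and a: "compares V U U' a"
    and C: "\<And>x j. x \<in> cfg V \<Longrightarrow> j \<in> V \<Longrightarrow> j \<noteq> i \<Longrightarrow> \<bar>fld U i (x(j := 1)) - fld U i (x(j := -1))\<bar> \<le> 2 * C j"
    and b: "\<And>x. x \<in> cfg V \<Longrightarrow> \<bar>fld U i x - fld U' i x\<bar> \<le> 2 * b"
  shows "compares V U U' (a(i := (\<Sum>j\<in>V - {i}. C j * a j) + b))"
  unfolding compares_def
proof (intro allI impI)
  fix f d assume f: "osc_le V f d"
  have "\<bar>gE V U f - gE V U' f\<bar> = \<bar>gE V U (site_avg U i f) - gE V U' (site_avg U' i f)\<bar>"
    using V by (simp add: gE_site_avg)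
  also have "\<dots> \<le> \<bar>gE V U (site_avg U i f) - gE V U' (site_avg U i f)\<bar> + \<bar>gE V U' (site_avg U i f) - gE V U' (site_avg U' i f)\<bar>"
    by linarith
  also have "\<dots> \<le> (\<Sum>j\<in>V. a j * (if j = i then 0 else d j + C j * d i)) + b * d i"
  proof (intro add_mono)
    show "\<bar>gE V U (site_avg U i f) - gE V U' (site_avg U i f)\<bar> \<le> (\<Sum>j\<in>V. a j * (if j = i then 0 else d j + C j * d i))"
      using a osc_le_site_avg[OF f V(2) C] unfolding compares_def by blast
    show "\<bar>gE V U' (site_avg U i f) - gE V U' (site_avg U' i f)\<bar> \<le> b * d i"
    proof (rule gE_diff_le[OF V(1)])
      fix x assume x: "x \<in> cfg V"
      have "\<bar>plus_prob (fld U i x) - plus_prob (fld U' i x)\<bar> \<le> b"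
        using plus_prob_Lipschitz[of "fld U i x" "fld U' i x"] b[OF x] by simp
      moreover have "\<bar>f (x(i := 1)) - f (x(i := -1))\<bar> \<le> d i" using f x V by (auto simp: osc_le_def)
      moreover have "site_avg U i f x - site_avg U' i f x
          = (plus_prob (fld U i x) - plus_prob (fld U' i x)) * (f (x(i := 1)) - f (x(i := -1)))"
        by (simp add: site_avg_def algebra_simps)
      ultimately show "\<bar>site_avg U i f x - site_avg U' i f x\<bar> \<le> b * d i"
        by (simp add: abs_mult mult_mono)
    qed
  qed
  also have "\<dots> = (\<Sum>j\<in>V. (a(i := (\<Sum>j\<in>V - {i}. C j * a j) + b)) j * d j)"
    using V by (simp add: sum.remove[of V i] algebra_simps sum.distrib sum_distrib_left sum_distrib_right)
  finally show "\<bar>gE V U f - gE V U' f\<bar> \<le> \<dots>" .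
qed

text \<open>Gauss-Seidel iteration: one sweep over V shrinks the excess of the weights over the
  supersolution \<open>e\<close> by the factor q, so the excess, initially 2, tends to 0.\<close>

theorem Dobrushin_comparison:
  assumes V: "finite V"
    and C: "\<And>x i j. x \<in> cfg V \<Longrightarrow> i \<in> V \<Longrightarrow> j \<in> V \<Longrightarrow> j \<noteq> i \<Longrightarrow> \<bar>fld U i (x(j := 1)) - fld U i (x(j := -1))\<bar> \<le> 2 * C i j"
    and C0: "\<And>i j. 0 \<le> C i j" and q: "\<And>i. i \<in> V \<Longrightarrow> (\<Sum>j\<in>V - {i}. C i j) \<le> q" "0 \<le> q" "q < 1"
    and b: "\<And>x i. x \<in> cfg V \<Longrightarrow> i \<in> V \<Longrightarrow> \<bar>fld U i x - fld U' i x\<bar> \<le> 2 * b i"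
    and e: "\<And>i. i \<in> V \<Longrightarrow> (\<Sum>j\<in>V - {i}. C i j * e j) + b i \<le> e i" "\<And>i. i \<in> V \<Longrightarrow> 0 \<le> e i"
    and f: "osc_le V f d"
  shows "\<bar>gE V U f - gE V U' f\<bar> \<le> (\<Sum>i\<in>V. e i * d i)"
proof -
  \<comment> \<open>F is the set of sites already updated in the current sweep.\<close>
  have sweep: "compares V U U' (\<lambda>i. e i + (if i \<in> F then q * t else t))"
    if t: "0 \<le> t" and c: "compares V U U' (\<lambda>i. e i + t)" and F: "finite F" "F \<subseteq> V" for F t
    using F
  proof induction
    case empty
    then show ?case using c by simp
  next
    case (insert i F)
    then have i: "i \<in> V" and c': "compares V U U' (\<lambda>i. e i + (if i \<in> F then q * t else t))" by auto
    have qt: "q * t \<le> t" using q t by (simp add: mult_left_le_one_le)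
    show ?case
    proof (rule compares_mono[OF compares_step[OF V i c', of "C i" "b i"]])
      fix k assume k: "k \<in> V"
      have "(\<Sum>j\<in>V - {i}. C i j * (e j + (if j \<in> F then q * t else t))) \<le> (\<Sum>j\<in>V - {i}. C i j * (e j + t))"
        using qt by (intro sum_mono mult_left_mono C0) auto
      also have "\<dots> = (\<Sum>j\<in>V - {i}. C i j * e j) + (\<Sum>j\<in>V - {i}. C i j) * t"
        by (simp add: algebra_simps sum.distrib sum_distrib_left)
      also have "\<dots> \<le> (\<Sum>j\<in>V - {i}. C i j * e j) + q * t"
        using q(1)[OF i] t by (simp add: mult_right_mono)
      finally have "(\<Sum>j\<in>V - {i}. C i j * (e j + (if j \<in> F then q * t else t))) + b i \<le> e i + q * t"
        using e(1)[OF i] by linarith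
      then show "((\<lambda>i. e i + (if i \<in> F then q * t else t))
         (i := (\<Sum>j\<in>V - {i}. C i j * (e j + (if j \<in> F then q * t else t))) + b i)) k
         \<le> e k + (if k \<in> insert i F then q * t else t)" by auto
    qed (use C b i in auto)
  qed
  have pow: "compares V U U' (\<lambda>i. e i + q ^ n * 2)" for n
  proof (induction n)
    case 0
    then show ?case using compares_mono[OF compares_init[OF V], of "\<lambda>i. e i + 2" U U'] e(2) by simp
  next
    case (Suc n)
    have "compares V U U' (\<lambda>i. e i + (if i \<in> V then q * (q ^ n * 2) else q ^ n * 2))"
      by (rule sweep[OF _ Suc V subset_refl]) (use q in simp)
    then show ?case by (rule compares_mono) (simp add: mult.assoc)
  qed
  have lim: "(\<lambda>n. \<Sum>i\<in>V. (e i + q ^ n * 2) * d i) \<longlonglongrightarrow> (\<Sum>i\<in>V. (e i + 0 * 2) * d i)"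
    by (intro tendsto_intros LIMSEQ_power_zero) (use q in auto)
  have "\<bar>gE V U f - gE V U' f\<bar> \<le> (\<Sum>i\<in>V. (e i + 0 * 2) * d i)"
    by (rule LIMSEQ_le_const[OF lim]) (use pow f in \<open>auto simp: compares_def\<close>)
  then show ?thesis by simp
qed

section \<open>The Dyson interaction at high temperature\<close>

text \<open>\<open>0 powr (- \<alpha>)\<close> is 0, so there is no self-interaction.\<close>

definition wt :: "real \<Rightarrow> nat \<Rightarrow> nat \<Rightarrow> real" where
  "wt \<alpha> i j = \<bar>real i - real j\<bar> powr (- \<alpha>)"

text \<open>By the same convention a term with m + l = 0 vanishes, so the value at m = 0 agrees with
  that at m = 1.\<close>

definition tail_sum :: "real \<Rightarrow> nat \<Rightarrow> real" where
  "tail_sum \<alpha> m = (\<Sum>l. real (m + l) powr (- \<alpha>))"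

lemma wt_nonneg [simp]: "0 \<le> wt \<alpha> i j"
  by (simp add: wt_def)

lemma wt_same [simp]: "wt \<alpha> i i = 0"
  by (simp add: wt_def)

lemma wt_sym: "wt \<alpha> i j = wt \<alpha> j i"
  by (simp add: wt_def abs_minus_commute)

lemma wt_add [simp]: "wt \<alpha> (i + k) (j + k) = wt \<alpha> i j" "wt \<alpha> (k + i) (k + j) = wt \<alpha> i j"
  by (simp_all add: wt_def)

lemma wt_less: "i \<le> j \<Longrightarrow> wt \<alpha> i j = real (j - i) powr (- \<alpha>)"
  by (simp add: wt_def of_nat_diff)

lemma wt_antimono:
  assumes "0 < \<alpha>" "i \<noteq> j" "\<bar>real i - real j\<bar> \<le> \<bar>real k - real l\<bar>"
  shows "wt \<alpha> k l \<le> wt \<alpha> i j"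
  unfolding wt_def using assms by (intro powr_mono2') auto

lemma wt_le_1: "0 < \<alpha> \<Longrightarrow> wt \<alpha> i j \<le> 1"
proof (cases "i = j")
  case False
  assume "0 < \<alpha>"
  moreover have "1 \<le> \<bar>real i - real j\<bar>" using False by linarith
  ultimately show ?thesis unfolding wt_def using powr_mono2'[of "-\<alpha>" 1 "\<bar>real i - real j\<bar>"] by simp
qed simp

lemma summable_tail: "1 < \<alpha> \<Longrightarrow> summable (\<lambda>l. real (m + l) powr (- \<alpha>))"
  using summable_ignore_initial_segment[of "\<lambda>n. real n powr (-\<alpha>)" m]
  by (simp add: summable_real_powr_iff add.commute)

lemma tail_sum_nonneg: "1 < \<alpha> \<Longrightarrow> 0 \<le> tail_sum \<alpha> m"
  unfolding tail_sum_def by (intro suminf_nonneg summable_tail) auto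

lemma tail_sum_tendsto: "1 < \<alpha> \<Longrightarrow> tail_sum \<alpha> \<longlonglongrightarrow> 0"
proof -
  assume a: "1 < \<alpha>"
  have s: "summable (\<lambda>n. real n powr (-\<alpha>))" using a by (simp add: summable_real_powr_iff)
  have "tail_sum \<alpha> = (\<lambda>m. (\<Sum>n. real n powr (-\<alpha>)) - (\<Sum>n<m. real n powr (-\<alpha>)))"
    using suminf_minus_initial_segment[OF s] by (auto simp: fun_eq_iff tail_sum_def add.commute)
  moreover have "(\<lambda>m. (\<Sum>n. real n powr (-\<alpha>)) - (\<Sum>n<m. real n powr (-\<alpha>))) \<longlonglongrightarrow> 0"
    using tendsto_diff[OF tendsto_const[of "\<Sum>n. real n powr (-\<alpha>)"] summable_LIMSEQ[OF s]] by simp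
  ultimately show ?thesis by simp
qed

lemma sum_le_tail_sum:
  assumes "1 < \<alpha>" "finite B" "\<And>l. l \<in> B \<Longrightarrow> i + r \<le> l"
  shows "(\<Sum>l\<in>B. wt \<alpha> i l) \<le> tail_sum \<alpha> r"
proof -
  have "(\<Sum>l\<in>B. wt \<alpha> i l) = (\<Sum>k\<in>(\<lambda>l. l - (i + r)) ` B. real (r + k) powr (-\<alpha>))"
  proof (subst sum.reindex)
    show "inj_on (\<lambda>l. l - (i + r)) B" using assms(3) by (intro inj_onI) (metis le_add_diff_inverse)
    show "(\<Sum>l\<in>B. wt \<alpha> i l) = sum ((\<lambda>k. real (r + k) powr (-\<alpha>)) \<circ> (\<lambda>l. l - (i + r))) B"
    proof (rule sum.cong[OF refl])
      fix l assume "l \<in> B"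
      then have "i + r \<le> l" by (rule assms(3))
      then have "wt \<alpha> i l = real (l - i) powr (-\<alpha>)" "l - i = r + (l - (i + r))" by (auto simp: wt_less)
      then show "wt \<alpha> i l = ((\<lambda>k. real (r + k) powr (-\<alpha>)) \<circ> (\<lambda>l. l - (i + r))) l" by simp
    qed
  qed
  also have "\<dots> \<le> tail_sum \<alpha> r"
    unfolding tail_sum_def using assms by (intro sum_le_suminf summable_tail) auto
  finally show ?thesis .
qed

text \<open>Reflection of l about i reduces this to sites on the right.\<close>

lemma sum_le_tail_sum':
  assumes "1 < \<alpha>" "finite B" "\<And>l. l \<in> B \<Longrightarrow> l + r \<le> i"
  shows "(\<Sum>l\<in>B. wt \<alpha> i l) \<le> tail_sum \<alpha> r"
proof -
  have "(\<Sum>l\<in>B. wt \<alpha> i l) = (\<Sum>m\<in>(\<lambda>l. i + (i - l)) ` B. wt \<alpha> i m)"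
  proof (subst sum.reindex)
    show "inj_on (\<lambda>l. i + (i - l)) B"
      using assms(3) by (intro inj_onI) (smt (verit, best) add_leD1 diff_diff_cancel nat_add_left_cancel_less diff_add_inverse)
    show "(\<Sum>l\<in>B. wt \<alpha> i l) = sum ((\<lambda>m. wt \<alpha> i m) \<circ> (\<lambda>l. i + (i - l))) B"
    proof (rule sum.cong[OF refl])
      fix l assume "l \<in> B"
      from assms(3)[OF this] have "l \<le> i" by simp
      then show "wt \<alpha> i l = ((\<lambda>m. wt \<alpha> i m) \<circ> (\<lambda>l. i + (i - l))) l"
        by (simp add: wt_def of_nat_diff)
    qed
  qed
  also have "\<dots> \<le> tail_sum \<alpha> r"
    by (rule sum_le_tail_sum[OF assms(1)]) (use assms in \<open>auto dest!: assms(3)\<close>)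
  finally show ?thesis .
qed

lemma sum_wt_far:
  assumes "1 < \<alpha>" "finite B" "\<And>l. l \<in> B \<Longrightarrow> i + r \<le> l \<or> l + r \<le> i"
  shows "(\<Sum>l\<in>B. wt \<alpha> i l) \<le> 2 * tail_sum \<alpha> r"
proof -
  let ?P = "{l\<in>B. i + r \<le> l}" let ?M = "{l\<in>B. l + r \<le> i}"
  have "(\<Sum>l\<in>B. wt \<alpha> i l) \<le> (\<Sum>l\<in>?P \<union> ?M. wt \<alpha> i l)"
    using assms by (intro sum_mono2) auto
  also have "\<dots> \<le> (\<Sum>l\<in>?P. wt \<alpha> i l) + (\<Sum>l\<in>?M. wt \<alpha> i l)"
    using assms(2) by (subst sum.union_inter[symmetric]) (auto intro: sum_nonneg)
  also have "\<dots> \<le> 2 * tail_sum \<alpha> r"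
  proof -
    have "(\<Sum>l\<in>?P. wt \<alpha> i l) \<le> tail_sum \<alpha> r" using assms(2) by (intro sum_le_tail_sum assms(1)) auto
    moreover have "(\<Sum>l\<in>?M. wt \<alpha> i l) \<le> tail_sum \<alpha> r" using assms(2) by (intro sum_le_tail_sum' assms(1)) auto
    ultimately show ?thesis by linarith
  qed
  finally show ?thesis .
qed

lemma sum_wt_row:
  assumes "1 < \<alpha>" "finite B"
  shows "(\<Sum>l\<in>B. wt \<alpha> i l) \<le> 2 * tail_sum \<alpha> 1"
proof -
  have "(\<Sum>l\<in>B. wt \<alpha> i l) = (\<Sum>l\<in>B - {i}. wt \<alpha> i l)"
    using assms(2) by (intro sum.mono_neutral_right) auto
  also have "\<dots> \<le> 2 * tail_sum \<alpha> 1"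
    by (rule sum_wt_far) (use assms in auto)
  finally show ?thesis .
qed

text \<open>Of the distances from k to i and to j, one is at least half of |i - j|; the
  corresponding factor is at most \<open>2 powr \<alpha> * wt \<alpha> i j\<close>, and the other
  factor remains.\<close>

lemma wt_mult_le:
  assumes "1 < \<alpha>" "i \<noteq> j"
  shows "wt \<alpha> i k * wt \<alpha> k j \<le> 2 powr \<alpha> * wt \<alpha> i j * (wt \<alpha> i k + wt \<alpha> k j)"
proof -
  have half: "wt \<alpha> a b \<le> 2 powr \<alpha> * wt \<alpha> i j" if "\<bar>real i - real j\<bar> \<le> 2 * \<bar>real a - real b\<bar>" for a b
  proof -
    have "wt \<alpha> a b \<le> (\<bar>real i - real j\<bar> / 2) powr (-\<alpha>)"
      unfolding wt_def using assms that by (intro powr_mono2') auto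
    also have "\<dots> = 2 powr \<alpha> * wt \<alpha> i j"
      unfolding wt_def powr_divide powr_minus by (simp add: divide_inverse mult.commute)
    finally show ?thesis .
  qed
  have "\<bar>real i - real j\<bar> \<le> 2 * \<bar>real i - real k\<bar> \<or> \<bar>real i - real j\<bar> \<le> 2 * \<bar>real k - real j\<bar>"
    using abs_triangle_ineq[of "real i - real k" "real k - real j"]
    by (cases "\<bar>real i - real k\<bar> \<le> \<bar>real k - real j\<bar>") auto
  then show ?thesis
  proof
    assume 1: "\<bar>real i - real j\<bar> \<le> 2 * \<bar>real i - real k\<bar>"
    have "wt \<alpha> i k * wt \<alpha> k j \<le> (2 powr \<alpha> * wt \<alpha> i j) * wt \<alpha> k j" by (intro mult_right_mono half 1) auto
    also have "\<dots> \<le> 2 powr \<alpha> * wt \<alpha> i j * (wt \<alpha> i k + wt \<alpha> k j)" by (intro mult_left_mono) auto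
    finally show ?thesis .
  next
    assume 2: "\<bar>real i - real j\<bar> \<le> 2 * \<bar>real k - real j\<bar>"
    have "wt \<alpha> i k * wt \<alpha> k j \<le> wt \<alpha> i k * (2 powr \<alpha> * wt \<alpha> i j)" by (intro mult_left_mono half 2) auto
    also have "\<dots> \<le> (2 powr \<alpha> * wt \<alpha> i j) * (wt \<alpha> i k + wt \<alpha> k j)" by (simp add: algebra_simps)
    finally show ?thesis .
  qed
qed

lemma tail_sum_1_ge_1: "1 < \<alpha> \<Longrightarrow> 1 \<le> tail_sum \<alpha> 1"
  using sum_le_suminf[OF summable_tail[of \<alpha> 1], of "{0}"] by (simp add: tail_sum_def)

text \<open>Summing \<open>wt_mult_le\<close> over k gives two row sums, each at most
  \<open>2 * tail_sum \<alpha> 1\<close>; hence the 4 and the power of 2.\<close>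

definition conv_const :: "real \<Rightarrow> real" where
  "conv_const \<alpha> = 4 * 2 powr \<alpha> * tail_sum \<alpha> 1"

locale high_temperature =
  fixes \<alpha> \<beta> :: real
  assumes alpha: "1 < \<alpha>" and beta: "0 < \<beta>" and small: "8 * \<beta> * conv_const \<alpha> \<le> 1"
begin

abbreviation "w \<equiv> wt \<alpha>"
abbreviation "K \<equiv> conv_const \<alpha>"
abbreviation "\<tau> \<equiv> tail_sum \<alpha>"

lemma K_ge: "2 * \<tau> 1 \<le> K" "1 \<le> K"
proof -
  have "1 \<le> \<tau> 1" "1 \<le> 2 powr \<alpha>" using tail_sum_1_ge_1[OF alpha] alpha by (auto intro: ge_one_powr_ge_zero)
  then have "1 * 1 \<le> 2 powr \<alpha> * \<tau> 1" "1 * \<tau> 1 \<le> 2 powr \<alpha> * \<tau> 1" by (intro mult_mono; simp)+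
  then show "2 * \<tau> 1 \<le> K" "1 \<le> K" using \<open>1 \<le> \<tau> 1\<close> unfolding conv_const_def by linarith+
qed

lemma beta_le: "\<beta> \<le> 1 / 8"
proof -
  have "\<beta> * 1 \<le> \<beta> * K" using K_ge beta by (intro mult_left_mono) auto
  then show ?thesis using small by linarith
qed

lemma sum_w_le_K: "finite V \<Longrightarrow> (\<Sum>j\<in>V. w i j) \<le> K"
  using sum_wt_row[OF alpha, of V i] K_ge(1) by linarith

lemma sum_w_w_le:
  assumes "finite V" "i \<noteq> j"
  shows "(\<Sum>k\<in>V. w i k * w k j) \<le> K * w i j"
proof -
  have "(\<Sum>k\<in>V. w i k * w k j) \<le> (\<Sum>k\<in>V. 2 powr \<alpha> * w i j * (w i k + w k j))"
    using assms(2) by (intro sum_mono wt_mult_le alpha)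
  also have "\<dots> = 2 powr \<alpha> * w i j * ((\<Sum>k\<in>V. w i k) + (\<Sum>k\<in>V. w j k))"
    by (simp add: sum_distrib_left[symmetric] sum.distrib wt_sym[of _ _ j])
  also have "\<dots> \<le> 2 powr \<alpha> * w i j * (2 * \<tau> 1 + 2 * \<tau> 1)"
    by (intro mult_left_mono add_mono sum_wt_row alpha assms) auto
  finally show ?thesis by (simp add: conv_const_def mult_ac)
qed

text \<open>The diagonal case, where a bound by a multiple of \<open>w i i\<close> is impossible
  because that weight is 0; one factor is simply bounded by 1.\<close>

lemma sum_w_sq_le: "finite V \<Longrightarrow> (\<Sum>k\<in>V. w i k * w k i) \<le> K"
proof -
  assume V: "finite V"
  have "(\<Sum>k\<in>V. w i k * w k i) \<le> (\<Sum>k\<in>V. w i k * 1)"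
    using wt_le_1 alpha by (intro sum_mono mult_left_mono) auto
  then show ?thesis using sum_w_le_K[OF V, of i] by simp
qed

text \<open>The interaction kernel reproduces itself, \<open>w * w \<le> K w\<close> off the diagonal, so \<open>G\<close> is a supersolution of the
  Dobrushin equation that decays no slower than \<open>w\<close>.\<close>
definition G :: "nat \<Rightarrow> nat \<Rightarrow> real" where
  "G i j = 2 * (of_bool (i = j) + w i j)"

lemma G_nonneg [simp]: "0 \<le> G i j"
  by (simp add: G_def)

lemma G_sym: "G i j = G j i"
  by (auto simp: G_def wt_sym)

lemma sum_G_le: "finite V \<Longrightarrow> (\<Sum>j\<in>V. G i j) \<le> 2 * (1 + K)"
proof -
  assume V: "finite V"
  have "(\<Sum>j\<in>V. of_bool (i = j) :: real) \<le> 1" using V by (simp add: of_bool_def)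
  then show ?thesis using sum_w_le_K[OF V, of i]
    by (simp add: G_def sum_distrib_left[symmetric] sum.distrib)
qed

text \<open>Propagating the influence of a spin at l through the correlations costs only a constant:
  the effect on site i decays like the bare interaction. Boundary fields are treated with this
  bound.\<close>

lemma sum_G_w_le:
  assumes "finite V" "i \<noteq> l"
  shows "(\<Sum>j\<in>V. G i j * w j l) \<le> 2 * (1 + K) * w i l"
proof -
  have "(\<Sum>j\<in>V. G i j * w j l) = 2 * ((\<Sum>j\<in>V. of_bool (i = j) * w j l) + (\<Sum>j\<in>V. w i j * w j l))"
    by (simp add: G_def algebra_simps sum.distrib sum_distrib_left)
  also have "(\<Sum>j\<in>V. of_bool (i = j) * w j l) \<le> w i l"
    using assms(1) by (simp add: of_bool_def if_distrib[of "\<lambda>b. b * _"] cong: if_cong)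
  finally show ?thesis using sum_w_w_le[OF assms] by (simp add: algebra_simps)
qed

lemma G_supersolution:
  assumes "finite V" "i \<in> V"
  shows "(\<Sum>k\<in>V - {i}. 2 * \<beta> * w i k * G k j) + of_bool (i = j) \<le> G i j"
proof -
  have 1: "(\<Sum>k\<in>V - {i}. of_bool (k = j) * w i k) \<le> w i j"
    using assms(1) by (simp add: of_bool_def if_distrib[of "\<lambda>b. b * _"] cong: if_cong)
  have eq: "(\<Sum>k\<in>V - {i}. 2 * \<beta> * w i k * G k j)
      = 4 * \<beta> * ((\<Sum>k\<in>V - {i}. of_bool (k = j) * w i k) + (\<Sum>k\<in>V - {i}. w i k * w k j))"
    by (simp add: G_def algebra_simps sum.distrib sum_distrib_left)
  show ?thesis
  \<comment> \<open>The diagonal needs 4 \<beta> K \<le> 1, the off-diagonal part 4 \<beta> (1 + K)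
    \<le> 2; the factor 2 in \<open>G\<close> leaves room for both.\<close>
  proof (cases "i = j")
    case True
    have "(\<Sum>k\<in>V - {i}. of_bool (k = j) * w i k) + (\<Sum>k\<in>V - {i}. w i k * w k j) \<le> 0 + K"
      using 1 sum_w_sq_le[of "V - {i}" i] assms True by (intro add_mono) auto
    then have "4 * \<beta> * ((\<Sum>k\<in>V - {i}. of_bool (k = j) * w i k) + (\<Sum>k\<in>V - {i}. w i k * w k j)) \<le> 4 * \<beta> * K"
      using beta by (intro mult_left_mono) auto
    then show ?thesis using small True unfolding eq by (simp add: G_def)
  next
    case False
    have "(\<Sum>k\<in>V - {i}. of_bool (k = j) * w i k) + (\<Sum>k\<in>V - {i}. w i k * w k j) \<le> w i j + K * w i j"
      using 1 sum_w_w_le[OF _ False, of "V - {i}"] assms by (intro add_mono) auto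
    then have "4 * \<beta> * ((\<Sum>k\<in>V - {i}. of_bool (k = j) * w i k) + (\<Sum>k\<in>V - {i}. w i k * w k j)) \<le> 4 * \<beta> * (w i j + K * w i j)"
      using beta by (intro mult_left_mono) auto
    also have "\<dots> = (4 * \<beta> + 4 * \<beta> * K) * w i j" by (simp add: algebra_simps)
    also have "\<dots> \<le> 2 * w i j" using small beta_le by (intro mult_right_mono) auto
    finally show ?thesis using False unfolding eq by (simp add: G_def)
  qed
qed

text \<open>The bound is twice the change of field caused by flipping one spin under the true
  couplings, so that couplings up to \<open>2 * \<beta> * w i j\<close> are covered.\<close>

definition weakly_coupled :: "nat set \<Rightarrow> ((nat \<Rightarrow> real) \<Rightarrow> real) \<Rightarrow> bool" where
  "weakly_coupled V U \<longleftrightarrow> (\<forall>x\<in>cfg V. \<forall>i\<in>V. \<forall>j\<in>V. j \<noteq> i \<longrightarrow>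
     \<bar>fld U i (x(j := 1)) - fld U i (x(j := -1))\<bar> \<le> 4 * \<beta> * w i j)"

text \<open>By linearity \<open>G\<close> turns the field perturbation b into the supersolution e =
  G b. The coupling bound concerns U alone, so U' may contain an arbitrary tilt.\<close>

lemma comparison:
  assumes V: "finite V" and U: "weakly_coupled V U"
    and b: "\<And>x i. x \<in> cfg V \<Longrightarrow> i \<in> V \<Longrightarrow> \<bar>fld U i x - fld U' i x\<bar> \<le> 2 * b i" "\<And>i. i \<in> V \<Longrightarrow> 0 \<le> b i"
    and f: "osc_le V f d"
  shows "\<bar>gE V U f - gE V U' f\<bar> \<le> (\<Sum>i\<in>V. (\<Sum>j\<in>V. G i j * b j) * d i)"
proof (rule Dobrushin_comparison[where C="\<lambda>i j. 2 * \<beta> * w i j" and q="1/4" and b=b, OF V _ _ _ _ _ b(1) _ _ f])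
  fix x i j assume "x \<in> cfg V" "i \<in> V" "j \<in> V" "j \<noteq> i"
  then show "\<bar>fld U i (x(j := 1)) - fld U i (x(j := - 1))\<bar> \<le> 2 * (2 * \<beta> * w i j)"
    using U by (auto simp: weakly_coupled_def mult.assoc[symmetric])
next
  fix i assume i: "i \<in> V"
  have "2 * \<beta> * (\<Sum>j\<in>V - {i}. w i j) \<le> 2 * \<beta> * K"
    using beta V by (intro mult_left_mono sum_w_le_K) auto
  then show "(\<Sum>j\<in>V - {i}. 2 * \<beta> * w i j) \<le> 1 / 4" using small by (simp add: sum_distrib_left)
next
  fix i assume i: "i \<in> V"
  have "(\<Sum>k\<in>V - {i}. 2 * \<beta> * w i k * (\<Sum>j\<in>V. G k j * b j)) + b i
      = (\<Sum>j\<in>V. ((\<Sum>k\<in>V - {i}. 2 * \<beta> * w i k * G k j) + of_bool (i = j)) * b j)"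
  proof -
    have "b i = (\<Sum>j\<in>V. of_bool (i = j) * b j)"
      using V i by (simp add: of_bool_def if_distrib[of "\<lambda>b. b * _"] cong: if_cong)
    moreover have "(\<Sum>k\<in>V - {i}. 2 * \<beta> * w i k * (\<Sum>j\<in>V. G k j * b j)) = (\<Sum>j\<in>V. (\<Sum>k\<in>V - {i}. 2 * \<beta> * w i k * G k j) * b j)"
      by (simp add: sum_distrib_left sum_distrib_right mult.assoc sum.swap[of _ V])
    ultimately show ?thesis by (simp add: distrib_right sum.distrib)
  qed
  also have "\<dots> \<le> (\<Sum>j\<in>V. G i j * b j)"
    using V i b(2) by (intro sum_mono mult_right_mono G_supersolution) auto
  finally show "(\<Sum>k\<in>V - {i}. 2 * \<beta> * w i k * (\<Sum>j\<in>V. G k j * b j)) + b i \<le> (\<Sum>j\<in>V. G i j * b j)" .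
qed (use beta b(2) in \<open>auto intro!: sum_nonneg\<close>)

end

section \<open>Exponential moments and pair correlations\<close>

lemma has_deriv_log_partition:
  assumes "finite V"
  shows "((\<lambda>t. ln (\<Sum>x\<in>cfg V. exp (U x + t * F x))) has_real_derivative gE V (\<lambda>x. U x + t * F x) F) (at t)"
proof -
  have "((\<lambda>t. \<Sum>x\<in>cfg V. exp (U x + t * F x)) has_real_derivative (\<Sum>x\<in>cfg V. exp (U x + t * F x) * F x)) (at t)"
    by (auto intro!: derivative_eq_intros sum.cong)
  from DERIV_chain2[OF DERIV_ln_divide[OF partition_pos[OF assms, of "\<lambda>x. U x + t * F x"]] this]
  show ?thesis by (simp add: gE_def)
qed

text \<open>The mean value theorem on the log-moment generating function: a bound on the mean of F
  under all intermediate tilts becomes a bound on its exponential moment.\<close>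

lemma log_mgf_mean_value:
  assumes "finite V"
  obtains t where "0 < t" "t < 1" "gE V U (\<lambda>x. exp (F x)) = exp (gE V (\<lambda>x. U x + t * F x) F)"
proof -
  let ?g = "\<lambda>t. ln (\<Sum>x\<in>cfg V. exp (U x + t * F x))"
  obtain t where t: "0 < t" "t < 1" "?g 1 - ?g 0 = (1 - 0) * gE V (\<lambda>x. U x + t * F x) F"
    using MVT2[of 0 1 ?g "\<lambda>t. gE V (\<lambda>x. U x + t * F x) F"] has_deriv_log_partition[OF assms] by auto
  have "gE V U (\<lambda>x. exp (F x)) = exp (?g 1 - ?g 0)"
    using partition_pos[OF assms, of U] partition_pos[OF assms, of "\<lambda>x. U x + F x"]
    by (simp add: gE_def exp_diff exp_add)
  with t show ?thesis by (intro that[of t]) auto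
qed

definition even_on :: "'i set \<Rightarrow> (('i \<Rightarrow> real) \<Rightarrow> real) \<Rightarrow> bool" where
  "even_on V U \<longleftrightarrow> (\<forall>x\<in>cfg V. U (\<lambda>k\<in>V. - x k) = U x)"

lemma gE_neg:
  assumes "even_on V U"
  shows "gE V U (\<lambda>x. f (\<lambda>k\<in>V. - x k)) = gE V U f"
proof -
  have re: "(\<Sum>x\<in>cfg V. F (\<lambda>k\<in>V. - x k)) = (\<Sum>x\<in>cfg V. F x)" for F :: "_ \<Rightarrow> real"
    by (rule sum.reindex_bij_witness[where i="\<lambda>x. \<lambda>k\<in>V. - x k" and j="\<lambda>x. \<lambda>k\<in>V. - x k"])
      (auto simp: fun_eq_iff PiE_iff extensional_def)
  show ?thesis
    unfolding gE_def re[of "\<lambda>x. exp (U x) * f x", symmetric] using assms by (simp add: even_on_def)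
qed

lemma gE_odd:
  assumes "even_on V U" "i \<in> V"
  shows "gE V U (\<lambda>x. x i) = 0"
proof -
  have "gE V U (\<lambda>x. x i) = gE V U (\<lambda>x. (-1) * x i)"
    using gE_neg[of V U "\<lambda>x. x i"] assms by simp
  also have "\<dots> = - gE V U (\<lambda>x. x i)" by (rule trans[OF gE_cmult]) simp
  finally show ?thesis by simp
qed

context high_temperature
begin

text \<open>Schur's test: each product of two entries of d is bounded by half the sum of their
  squares, and the symmetry of \<open>G\<close> then leaves only its row sums.\<close>

lemma Schur_G:
  assumes "finite V"
  shows "(\<Sum>i\<in>V. (\<Sum>j\<in>V. G i j * d j) * d i) \<le> 2 * (1 + K) * (\<Sum>i\<in>V. (d i)\<^sup>2)"
proof -
  have "(\<Sum>i\<in>V. (\<Sum>j\<in>V. G i j * d j) * d i) \<le> (\<Sum>i\<in>V. \<Sum>j\<in>V. G i j * ((d i)\<^sup>2 + (d j)\<^sup>2) / 2)"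
  proof -
    have "G i j * d j * d i \<le> G i j * ((d i)\<^sup>2 + (d j)\<^sup>2) / 2" for i j
      using mult_left_mono[OF sum_squares_bound[of "d i" "d j"] G_nonneg[of i j]] by (simp add: mult_ac)
    then show ?thesis by (simp add: sum_distrib_right sum_mono)
  qed
  also have "\<dots> = (\<Sum>i\<in>V. \<Sum>j\<in>V. G i j * (d i)\<^sup>2)"
  proof -
    have "(\<Sum>i\<in>V. \<Sum>j\<in>V. G i j * (d j)\<^sup>2) = (\<Sum>i\<in>V. \<Sum>j\<in>V. G i j * (d i)\<^sup>2)"
      by (subst sum.swap) (simp add: G_sym)
    then show ?thesis
      by (simp add: distrib_left add_divide_distrib sum.distrib sum_divide_distrib[symmetric])
  qed
  also have "\<dots> \<le> (\<Sum>i\<in>V. 2 * (1 + K) * (d i)\<^sup>2)"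
    unfolding sum_distrib_right[symmetric] by (intro sum_mono mult_right_mono sum_G_le assms) auto
  finally show ?thesis by (simp add: sum_distrib_left)
qed

text \<open>Along the tilt by \<open>t F\<close> the base potential keeps its couplings, so comparison with the untilted measure bounds
  the change of the mean of \<open>F\<close>, that is, the derivative of the log-moment generating function.\<close>
lemma Gaussian_bound:
  assumes V: "finite V" and U: "weakly_coupled V U" and F: "osc_le V F d"
  shows "gE V U (\<lambda>x. exp (F x)) \<le> exp (gE V U F + (1 + K) / 2 * (\<Sum>i\<in>V. (d i)\<^sup>2))"
proof -
  obtain t where t: "0 < t" "t < 1" "gE V U (\<lambda>x. exp (F x)) = exp (gE V (\<lambda>x. U x + t * F x) F)"
    using log_mgf_mean_value[OF V] by blast
  \<comment> \<open>Tilting by t F changes the field at i by at most d i / 2, which is 2 * (d i / 4)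
    as \<open>comparison\<close> measures it.\<close>
  have "\<bar>gE V U F - gE V (\<lambda>x. U x + t * F x) F\<bar> \<le> (\<Sum>i\<in>V. (\<Sum>j\<in>V. G i j * (d j / 4)) * d i)"
  proof (rule comparison[OF V U _ _ F])
    fix x i assume x: "x \<in> cfg V" "i \<in> V"
    have "fld U i x - fld (\<lambda>x. U x + t * F x) i x = - (t * (F (x(i := 1)) - F (x(i := -1))) / 2)"
      by (simp add: fld_def field_simps)
    moreover have "t * \<bar>F (x(i := 1)) - F (x(i := -1))\<bar> \<le> 1 * d i"
      using F x t by (intro mult_mono) (auto simp: osc_le_def)
    ultimately show "\<bar>fld U i x - fld (\<lambda>x. U x + t * F x) i x\<bar> \<le> 2 * (d i / 4)"
      using t by (simp add: abs_mult)
  qed (use osc_le_nonneg[OF F] in auto)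
  also have "\<dots> = (\<Sum>i\<in>V. (\<Sum>j\<in>V. G i j * d j) * d i) / 4"
    by (simp add: sum_divide_distrib[symmetric])
  also have "\<dots> \<le> (1 + K) / 2 * (\<Sum>i\<in>V. (d i)\<^sup>2)"
    using Schur_G[OF V, of d] by (simp add: algebra_simps)
  finally have "gE V (\<lambda>x. U x + t * F x) F \<le> gE V U F + (1 + K) / 2 * (\<Sum>i\<in>V. (d i)\<^sup>2)" by linarith
  then show ?thesis using t by simp
qed

text \<open>The mean of \<open>x\<^sub>i\<close> vanishes by symmetry; tilting by \<open>x\<^sub>j\<close> changes it by \<open>tanh 1\<close> times the correlation.\<close>
lemma pair_bound:
  assumes V: "finite V" and U: "weakly_coupled V U" and even: "even_on V U"
    and i: "i \<in> V" and j: "j \<in> V"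
  shows "\<bar>gE V U (\<lambda>x. x i * x j)\<bar> \<le> 2 * G i j"
proof -
  define U' where "U' x = U x + x j" for x
  have os: "osc_le V (\<lambda>x. x i) (\<lambda>k. 2 * of_bool (k = i))"
    by (auto simp: osc_le_def)
  have fl: "fld U k x - fld U' k x = - of_bool (k = j)" for k x
    by (auto simp: U'_def fld_def field_simps)
  \<comment> \<open>The tilt changes only the field at j, and by 1, hence the weight 1/2 there; the
    observable oscillates by 2 at i.\<close>
  have "\<bar>gE V U (\<lambda>x. x i) - gE V U' (\<lambda>x. x i)\<bar>
      \<le> (\<Sum>k\<in>V. (\<Sum>l\<in>V. G k l * (of_bool (l = j) / 2)) * (2 * of_bool (k = i)))"
    by (rule comparison[OF V U _ _ os]) (auto simp: fl)
  also have "\<dots> = G i j"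
    using V i j by (simp add: of_bool_def if_distrib[of "\<lambda>b. _ * b"] if_distrib[of "\<lambda>b. b / 2"] cong: if_cong)
  finally have tilted: "\<bar>gE V U' (\<lambda>x. x i)\<bar> \<le> G i j"
    by (simp add: gE_odd[OF even i])
  \<comment> \<open>On spin values the exponential is affine, which makes numerator and denominator
    of the tilted mean explicit.\<close>
  have ex: "exp s = cosh 1 + sinh 1 * s" if "s = -1 \<or> s = 1" for s :: real
    using that by (auto simp: cosh_def sinh_def field_simps)
  have "gE V U' (\<lambda>x. x i) = gE V U (\<lambda>x. exp (x j) * x i) / gE V U (\<lambda>x. exp (x j))"
    using partition_pos[OF V, of U] by (simp add: gE_def U'_def exp_add mult.assoc)
  also have "gE V U (\<lambda>x. exp (x j)) = gE V U (\<lambda>x. cosh 1 + sinh 1 * x j)"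
    by (rule gE_cong[OF refl ex]) (use cfg_val j in blast)
  also have "\<dots> = cosh 1" by (simp add: gE_add gE_cmult gE_odd[OF even j] V)
  also have "gE V U (\<lambda>x. exp (x j) * x i) = gE V U (\<lambda>x. cosh 1 * x i + sinh 1 * (x i * x j))"
  proof (rule gE_cong[OF refl])
    fix x assume "x \<in> cfg V"
    then have "exp (x j) = cosh 1 + sinh 1 * x j" using cfg_val j by (intro ex) blast
    then show "exp (x j) * x i = cosh 1 * x i + sinh 1 * (x i * x j)" by (simp add: algebra_simps)
  qed
  also have "\<dots> = sinh 1 * gE V U (\<lambda>x. x i * x j)" by (simp add: gE_add gE_cmult gE_odd[OF even i])
  finally have "sinh 1 * \<bar>gE V U (\<lambda>x. x i * x j)\<bar> \<le> G i j * cosh 1"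
  proof -
    assume "gE V U' (\<lambda>x. x i) = sinh 1 * gE V U (\<lambda>x. x i * x j) / cosh 1"
    then have "sinh 1 * gE V U (\<lambda>x. x i * x j) = cosh 1 * gE V U' (\<lambda>x. x i)" by simp
    then have "\<bar>sinh 1 * gE V U (\<lambda>x. x i * x j)\<bar> = cosh 1 * \<bar>gE V U' (\<lambda>x. x i)\<bar>" by (simp add: abs_mult)
    then show ?thesis using mult_left_mono[OF tilted, of "cosh 1"] by (simp add: abs_mult mult.commute)
  qed
  \<comment> \<open>That is, \<open>tanh 1\<close> is at least 1/2, which follows from e^2 \<ge> 3;
    this produces the factor 2 in the claim.\<close>
  moreover have "cosh 1 \<le> 2 * sinh (1 :: real)"
  proof -
    have e: "2 \<le> exp (1 :: real)" using exp_ge_add_one_self[of 1] by simp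
    have "3 * exp (- 1 :: real) \<le> exp 1"
      using mult_mono[OF e e] by (simp add: exp_minus field_simps)
    then show ?thesis by (simp add: cosh_def sinh_def)
  qed
  ultimately have "sinh 1 * \<bar>gE V U (\<lambda>x. x i * x j)\<bar> \<le> G i j * (2 * sinh 1)"
    by (meson G_nonneg mult_left_mono order_trans)
  then have "sinh 1 * \<bar>gE V U (\<lambda>x. x i * x j)\<bar> \<le> sinh 1 * (2 * G i j)" by (simp add: mult_ac)
  then show ?thesis by (simp add: mult_le_cancel_left_pos)
qed

end

section \<open>Ising energies and boundary effects\<close>

definition ising :: "'i set \<Rightarrow> ('i \<Rightarrow> 'i \<Rightarrow> real) \<Rightarrow> ('i \<Rightarrow> real) \<Rightarrow> ('i \<Rightarrow> real) \<Rightarrow> real" where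
  "ising V J c x = (\<Sum>i\<in>V. \<Sum>j\<in>V. J i j * x i * x j) / 2 + (\<Sum>i\<in>V. c i * x i)"

lemma ising_cong: "(\<And>i. i \<in> V \<Longrightarrow> x i = y i) \<Longrightarrow> ising V J c x = ising V J c y"
  by (simp add: ising_def)

text \<open>Without self-coupling the energy is affine in the spin at i, with slope the local field.
  The reference value 0 is no spin but makes the slope explicit.\<close>

lemma ising_upd:
  assumes V: "finite V" "i \<in> V" and J: "\<And>k l. J k l = J l k" "\<And>k. J k k = 0"
  shows "ising V J c (x(i := s)) = ising V J c (x(i := 0)) + s * ((\<Sum>j\<in>V. J i j * x j) + c i)"
proof -
  define y where "y = x(i := 0)"
  have x: "(x(i := s)) k = y k + (if k = i then s else 0)" for k by (auto simp: y_def)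
  have d1: "(\<Sum>k\<in>V. h k * (if k = i then s else 0)) = h i * s" for h :: "_ \<Rightarrow> real"
    using V by (simp add: if_distrib[of "\<lambda>b. _ * b"] cong: if_cong)
  have sym: "(\<Sum>k\<in>V. J k i * y k) = (\<Sum>k\<in>V. J i k * y k)" using J by (intro sum.cong) auto
  have Jy: "(\<Sum>k\<in>V. J i k * y k) = (\<Sum>k\<in>V. J i k * x k)"
    using J(2) by (intro sum.cong) (auto simp: y_def)
  have "(\<Sum>k\<in>V. \<Sum>l\<in>V. J k l * (x(i := s)) k * (x(i := s)) l)
      = (\<Sum>k\<in>V. (\<Sum>l\<in>V. J k l * (x(i := s)) k * y l) + J k i * (x(i := s)) k * s)"
    unfolding x by (simp add: distrib_left sum.distrib d1 del: mult_zero_right)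
  also have "\<dots> = (\<Sum>k\<in>V. (\<Sum>l\<in>V. J k l * y k * y l) + (\<Sum>l\<in>V. J k l * y l) * (if k = i then s else 0)
      + J k i * y k * s + J k i * s * (if k = i then s else 0))"
    unfolding x by (simp add: algebra_simps sum.distrib sum_distrib_left)
  also have "\<dots> = (\<Sum>k\<in>V. \<Sum>l\<in>V. J k l * y k * y l) + (\<Sum>l\<in>V. J i l * y l) * s + (\<Sum>k\<in>V. J k i * y k) * s + J i i * s * s"
    by (simp add: sum.distrib d1 sum_distrib_right[symmetric])
  finally have "(\<Sum>k\<in>V. \<Sum>l\<in>V. J k l * (x(i := s)) k * (x(i := s)) l)
      = (\<Sum>k\<in>V. \<Sum>l\<in>V. J k l * y k * y l) + 2 * s * (\<Sum>k\<in>V. J i k * x k)"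
    by (simp add: sym Jy J(2))
  moreover have "(\<Sum>k\<in>V. c k * (x(i := s)) k) = (\<Sum>k\<in>V. c k * y k) + c i * s"
    unfolding x by (simp add: distrib_left sum.distrib d1)
  ultimately show ?thesis by (simp add: ising_def y_def[symmetric] field_simps)
qed

lemma fld_ising:
  assumes "finite V" "i \<in> V" "\<And>k l. J k l = J l k" "\<And>k. J k k = 0"
  shows "fld (ising V J c) i x = (\<Sum>j\<in>V. J i j * x j) + c i"
  unfolding fld_def ising_upd[OF assms, where s=1] ising_upd[OF assms, where s="-1"] by simp

lemma even_on_ising: "even_on V (ising V J (\<lambda>_. 0))"
  by (auto simp: even_on_def ising_def intro!: sum.cong)

definition win :: "nat \<Rightarrow> nat \<Rightarrow> (nat \<Rightarrow> real) \<Rightarrow> nat \<Rightarrow> real" where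
  "win k m x = (\<lambda>i\<in>{..<m}. x (k + i))"

definition ext :: "nat \<Rightarrow> (nat \<Rightarrow> real) \<Rightarrow> nat \<Rightarrow> real" where
  "ext n x = (\<lambda>i. if i < n then x i else 0)"

text \<open>Finite configurations are continued by 0 (\<open>ext\<close>), which leaves \<open>space Xp\<close>; hence continuity is required on
  the larger compact set \<open>cube\<close>.\<close>
definition cube :: "(nat \<Rightarrow> real) set" where
  "cube = {x. \<forall>i. x i \<in> {-1..1}}"

lemma cube_abs: "x \<in> cube \<Longrightarrow> \<bar>x i\<bar> \<le> 1"
  unfolding cube_def abs_le_iff by (simp add: minus_le_iff)

lemma cfg_ivl: "x \<in> cfg V \<Longrightarrow> i \<in> V \<Longrightarrow> x i \<in> {-1..1}"
  using cfg_val[of x V i] by auto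

lemma ext_cube: "x \<in> cfg {..<n} \<Longrightarrow> ext n x \<in> cube"
  unfolding cube_def ext_def using cfg_ivl[of x "{..<n}"] by simp

lemma glue_cube: "a \<in> cfg {..<n} \<Longrightarrow> x \<in> cube \<Longrightarrow> glue n a x \<in> cube"
  unfolding cube_def glue_def using cfg_ivl[of a "{..<n}"] by simp

lemma win_cfg: "x \<in> cfg V \<Longrightarrow> {k..<k + m} \<subseteq> V \<Longrightarrow> win k m x \<in> cfg {..<m}"
proof -
  assume x: "x \<in> cfg V" and kV: "{k..<k + m} \<subseteq> V"
  have "x (k + i) = -1 \<or> x (k + i) = 1" if "i < m" for i
    using that kV by (intro cfg_val[OF x]) auto
  then show ?thesis by (auto simp: win_def PiE_iff)
qed

text \<open>A crude oscillation vector for a local observable: only the sites of its support B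
  count.\<close>

lemma osc_le_ising_kernel:
  assumes "\<And>x. x \<in> cfg V \<Longrightarrow> \<bar>f x\<bar> \<le> M" "\<And>x y. (\<And>i. i \<in> B \<Longrightarrow> x i = y i) \<Longrightarrow> f x = f y"
  shows "osc_le V f (\<lambda>i. 2 * M * of_bool (i \<in> B))"
  unfolding osc_le_def
proof (intro ballI)
  fix x i assume x: "x \<in> cfg V" "i \<in> V"
  show "\<bar>f (x(i := 1)) - f (x(i := - 1))\<bar> \<le> 2 * M * of_bool (i \<in> B)"
  proof (cases "i \<in> B")
    case True
    have "\<bar>f (x(i := 1))\<bar> \<le> M" "\<bar>f (x(i := -1))\<bar> \<le> M"
      by (rule assms(1)[OF cfg_upd[OF x]], simp)+
    then show ?thesis using True by simp
  next
    case False
    have "f (x(i := 1)) = f (x(i := -1))" by (rule assms(2)) (use False in auto)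
    then show ?thesis using False by simp
  qed
qed

lemma shift_funpow: "(shift ^^ k) x = (\<lambda>i. x (k + i))"
  by (induction k arbitrary: x) (auto simp: shift_def funpow_swap1)

lemma sum_upper_triangle:
  fixes f :: "nat \<Rightarrow> nat \<Rightarrow> real"
  assumes "\<And>i j. f i j = f j i" "\<And>i. f i i = 0"
  shows "(\<Sum>k<n. \<Sum>j\<in>{k<..<n}. f k j) = (\<Sum>k<n. \<Sum>j<n. f k j) / 2"
proof (induction n)
  case (Suc n)
  have "(\<Sum>k<Suc n. \<Sum>j\<in>{k<..<Suc n}. f k j) = (\<Sum>k<n. (\<Sum>j\<in>{k<..<n}. f k j) + f k n)"
  proof -
    have "{k<..<Suc n} = insert n {k<..<n}" if "k < n" for k using that by auto
    then have "(\<Sum>j\<in>{k<..<Suc n}. f k j) = (\<Sum>j\<in>{k<..<n}. f k j) + f k n" if "k < n" for k using that by simp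
    moreover have "{n<..<Suc n} = {}" by auto
    ultimately show ?thesis by simp
  qed
  also have "\<dots> = (\<Sum>k<n. \<Sum>j<n. f k j) / 2 + (\<Sum>k<n. f k n)"
    by (simp add: sum.distrib Suc)
  also have "\<dots> = (\<Sum>k<Suc n. \<Sum>j<Suc n. f k j) / 2"
    using assms by (simp add: sum.distrib add_divide_distrib)
  finally show ?case .
qed simp

context high_temperature
begin

abbreviation "\<phi> \<equiv> dyson \<alpha> \<beta>"

definition H :: "nat set \<Rightarrow> (nat \<Rightarrow> real) \<Rightarrow> real" where
  "H V = ising V (\<lambda>i j. \<beta> * w i j) (\<lambda>_. 0)"

abbreviation gibbs :: "nat \<Rightarrow> ((nat \<Rightarrow> real) \<Rightarrow> real) \<Rightarrow> real" where
  "gibbs n f \<equiv> gE {..<n} (H {..<n}) f"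

text \<open>The field that the configuration from site n on exerts at k, without the factor \<beta>;
  for k below n it is the boundary field on a block ending at n.\<close>

definition bfield :: "nat \<Rightarrow> (nat \<Rightarrow> real) \<Rightarrow> nat \<Rightarrow> real" where
  "bfield n x k = (\<Sum>l. w k (n + l) * x (n + l))"

lemma weakly_coupled_ising:
  assumes "finite V" "\<And>i j. J i j = J j i" "\<And>i. J i i = 0" "\<And>i j. \<bar>J i j\<bar> \<le> 2 * \<beta> * w i j"
  shows "weakly_coupled V (ising V J c)"
  unfolding weakly_coupled_def
proof (intro ballI impI)
  fix x i j assume x: "x \<in> cfg V" and ij: "i \<in> V" "j \<in> V" "j \<noteq> i"
  have "fld (ising V J c) i (x(j := 1)) - fld (ising V J c) i (x(j := -1))
      = (\<Sum>k\<in>V. J i k * (x(j := 1)) k) - (\<Sum>k\<in>V. J i k * (x(j := -1)) k)"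
    by (simp add: fld_ising[OF assms(1) ij(1) assms(2,3)])
  also have "\<dots> = (\<Sum>k\<in>V. J i k * (if k = j then 2 else 0))"
    by (simp add: sum_subtractf[symmetric] right_diff_distrib[symmetric] del: fun_upd_apply)
       (intro sum.cong, auto)
  also have "\<dots> = 2 * J i j" using assms(1) ij by (simp add: if_distrib[of "\<lambda>b. _ * b"] cong: if_cong)
  finally show "\<bar>fld (ising V J c) i (x(j := 1)) - fld (ising V J c) i (x(j := - 1))\<bar> \<le> 4 * \<beta> * w i j"
    using assms(4)[of i j] by (simp add: abs_mult)
qed

lemma weakly_coupled_w: "finite V \<Longrightarrow> weakly_coupled V (ising V (\<lambda>i j. \<beta> * w i j) c)"
  using beta by (intro weakly_coupled_ising) (auto simp: wt_sym abs_mult mult_right_mono)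

lemma weakly_coupled_H: "finite V \<Longrightarrow> weakly_coupled V (H V)"
  unfolding H_def by (rule weakly_coupled_w)

lemma fld_H: "finite V \<Longrightarrow> i \<in> V \<Longrightarrow> fld (H V) i x = (\<Sum>j\<in>V. \<beta> * w i j * x j)"
  unfolding H_def by (subst fld_ising) (auto simp: wt_sym)

lemma summable_w: "summable (\<lambda>l. w k (n + l))"
proof (rule summable_comparison_test'[of "\<lambda>l. real (n + l - k) powr (-\<alpha>)" k])
  have "summable (\<lambda>l. real (0 + l) powr (-\<alpha>))" using summable_tail[OF alpha] .
  then have "summable (\<lambda>l. real (n + (l + k) - k) powr (-\<alpha>))"
    using summable_ignore_initial_segment[of "\<lambda>l. real l powr (-\<alpha>)" n] by (simp add: add.commute)
  then show "summable (\<lambda>l. real (n + l - k) powr (-\<alpha>))"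
    using summable_iff_shift[of "\<lambda>l. real (n + l - k) powr (-\<alpha>)" k] by simp
qed (simp add: wt_less)

lemma summable_w_cube: "x \<in> cube \<Longrightarrow> summable (\<lambda>l. w k (n + l) * x (n + l))"
proof (rule summable_comparison_test'[OF summable_w])
  fix l assume "x \<in> cube"
  then show "norm (w k (n + l) * x (n + l)) \<le> w k (n + l)"
    using cube_abs[of x "n + l"] mult_left_mono[of "\<bar>x (n + l)\<bar>" 1 "w k (n + l)"] by (simp add: abs_mult)
qed

lemma suminf_w: "k \<le> n \<Longrightarrow> (\<Sum>l. w k (n + l)) = \<tau> (n - k)"
  unfolding tail_sum_def by (intro suminf_cong) (simp add: wt_less)

lemma abs_suminf_w_le:
  assumes "\<And>l. \<bar>y l\<bar> \<le> 1" "k \<le> n"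
  shows "\<bar>\<Sum>l. w k (n + l) * y l\<bar> \<le> \<tau> (n - k)"
proof -
  have le: "\<bar>w k (n + l) * y l\<bar> \<le> w k (n + l)" for l
    using assms(1)[of l] mult_left_mono[of "\<bar>y l\<bar>" 1 "w k (n + l)"] by (simp add: abs_mult)
  have sa: "summable (\<lambda>l. \<bar>w k (n + l) * y l\<bar>)"
    by (rule summable_comparison_test'[OF summable_w[of k n]]) (use le in auto)
  have "\<bar>\<Sum>l. w k (n + l) * y l\<bar> \<le> (\<Sum>l. \<bar>w k (n + l) * y l\<bar>)" by (rule summable_rabs[OF sa])
  also have "\<dots> \<le> (\<Sum>l. w k (n + l))" by (intro suminf_le le sa summable_w)
  finally show ?thesis using assms(2) by (simp add: suminf_w)
qed

lemma bfield_le: "x \<in> cube \<Longrightarrow> k \<le> n \<Longrightarrow> \<bar>bfield n x k\<bar> \<le> \<tau> (n - k)"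
  unfolding bfield_def by (intro abs_suminf_w_le cube_abs)

lemma dyson_eq: "\<phi> (\<lambda>i. x (k + i)) = \<beta> * (x k * bfield (Suc k) x k)" if "x \<in> cube"
proof -
  have "(\<Sum>n. x (k + 0) * x (k + Suc n) / real (Suc n) powr \<alpha>) = (\<Sum>n. x k * (w k (Suc k + n) * x (Suc k + n)))"
    by (intro suminf_cong) (simp add: wt_less powr_minus divide_inverse mult_ac)
  also have "\<dots> = x k * bfield (Suc k) x k"
    unfolding bfield_def by (intro suminf_mult summable_w_cube that)
  finally show ?thesis by (simp add: dyson_def)
qed

lemma bfield_split:
  assumes "x \<in> cube" "k < n"
  shows "bfield (Suc k) x k = (\<Sum>j\<in>{k<..<n}. w k j * x j) + bfield n x k"
proof -
  obtain p where n: "n = Suc k + p" using assms(2) less_iff_Suc_add by auto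
  have "bfield (Suc k) x k = bfield n x k + (\<Sum>l<p. w k (Suc k + l) * x (Suc k + l))"
    unfolding bfield_def
    using suminf_split_initial_segment[OF summable_w_cube[OF assms(1), of k "Suc k"], of p]
    by (simp add: n add_ac)
  also have "(\<Sum>l<p. w k (Suc k + l) * x (Suc k + l)) = (\<Sum>j\<in>{k<..<n}. w k j * x j)"
    by (rule sum.reindex_bij_witness[where i="\<lambda>j. j - Suc k" and j="\<lambda>l. Suc k + l"]) (auto simp: n)
  finally show ?thesis by simp
qed

text \<open>The term at k of the Birkhoff sum collects the interaction of site k with everything to
  its right, so each pair with left end below n is counted once: inner pairs give \<open>H\<close>,
  the others the boundary field.\<close>

lemma birkhoff_decomp:
  assumes "y \<in> cube"
  shows "birkhoff_sum n \<phi> y = H {..<n} y + \<beta> * (\<Sum>k<n. y k * bfield n y k)"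
proof -
  have "birkhoff_sum n \<phi> y = (\<Sum>k<n. \<beta> * (y k * ((\<Sum>j\<in>{k<..<n}. w k j * y j) + bfield n y k)))"
    unfolding birkhoff_sum_def shift_funpow using assms by (intro sum.cong) (auto simp: dyson_eq bfield_split)
  also have "\<dots> = (\<Sum>k<n. \<Sum>j\<in>{k<..<n}. \<beta> * w k j * y k * y j) + \<beta> * (\<Sum>k<n. y k * bfield n y k)"
    by (simp add: algebra_simps sum.distrib sum_distrib_left)
  also have "(\<Sum>k<n. \<Sum>j\<in>{k<..<n}. \<beta> * w k j * y k * y j) = H {..<n} y"
    unfolding H_def ising_def by (subst sum_upper_triangle) (auto simp: wt_sym)
  finally show ?thesis .
qed

lemma bfield_cong: "(\<And>i. n \<le> i \<Longrightarrow> x i = y i) \<Longrightarrow> bfield n x k = bfield n y k"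
  by (simp add: bfield_def)

text \<open>This identifies the half-line specification with an Ising measure in an external field,
  to which the comparison theorem applies.\<close>

lemma birkhoff_glue:
  assumes "a \<in> cfg {..<n}" "x \<in> cube"
  shows "birkhoff_sum n \<phi> (glue n a x) = ising {..<n} (\<lambda>i j. \<beta> * w i j) (\<lambda>i. \<beta> * bfield n x i) a"
proof -
  have "bfield n (glue n a x) k = bfield n x k" for k by (rule bfield_cong) (simp add: glue_def)
  then show ?thesis unfolding birkhoff_decomp[OF glue_cube[OF assms]]
    by (simp add: H_def ising_def glue_def sum_distrib_left mult_ac)
qed

text \<open>Zero spins exert no field, so continuation by \<open>ext\<close> realises the free
  boundary condition as a point of \<open>cube\<close>.\<close>

lemma birkhoff_ext: "a \<in> cfg {..<n} \<Longrightarrow> birkhoff_sum n \<phi> (ext n a) = H {..<n} a"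
proof -
  assume a: "a \<in> cfg {..<n}"
  have "bfield n (ext n a) k = 0" for k by (simp add: bfield_def ext_def)
  then have "birkhoff_sum n \<phi> (ext n a) = H {..<n} (ext n a)"
    by (simp add: birkhoff_decomp[OF ext_cube[OF a]])
  then show ?thesis unfolding H_def using ising_cong[of "{..<n}" "ext n a" a] by (simp add: ext_def)
qed

section \<open>Insensitivity of local expectations to distant boundaries\<close>

text \<open>Given the spins off A, the law on A differs from the free one by an outside field
  controlled by \<open>b\<close>; after propagation by \<open>G\<close> only the sites of the
  support B enter.\<close>

lemma block_comparison:
  assumes V: "finite V" "A \<subseteq> V" and B: "B \<subseteq> A"
    and U: "\<And>x i. x \<in> cfg V \<Longrightarrow> i \<in> A \<Longrightarrow> \<bar>fld U i x - (\<Sum>j\<in>A. \<beta> * w i j * x j)\<bar> \<le> 2 * b i"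
    and b: "\<And>i. i \<in> A \<Longrightarrow> 0 \<le> b i" "\<And>i. i \<in> B \<Longrightarrow> (\<Sum>j\<in>A. G i j * b j) \<le> e"
    and f: "\<And>x. x \<in> cfg A \<Longrightarrow> \<bar>f x\<bar> \<le> M" "\<And>x y. (\<And>i. i \<in> B \<Longrightarrow> x i = y i) \<Longrightarrow> f x = f y"
  shows "\<bar>gE V U f - gE A (H A) f\<bar> \<le> real (card B) * (2 * M * e)"
proof -
  have fA: "finite A" by (rule finite_subset[OF V(2,1)])
  obtain z where "z \<in> cfg A" by (rule cfg_ex)
  then have M: "0 \<le> M" using f(1)[of z] by linarith
  show ?thesis
    unfolding gE_tower[OF V, of U f]
  proof (rule gE_near[OF V(1)])
    fix x assume x: "x \<in> cfg V"
    have "gE A (\<lambda>a. U (\<lambda>i. if i \<in> A then a i else x i)) (\<lambda>a. f (\<lambda>i. if i \<in> A then a i else x i))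
        = gE A (\<lambda>a. U (\<lambda>i. if i \<in> A then a i else x i)) f" (is "_ = gE A ?U f")
      by (rule gE_cong) (use B in \<open>auto intro!: f(2)\<close>)
    moreover have "\<bar>gE A (H A) f - gE A ?U f\<bar> \<le> (\<Sum>i\<in>A. (\<Sum>j\<in>A. G i j * b j) * (2 * M * of_bool (i \<in> B)))"
    proof (rule comparison[OF fA weakly_coupled_H[OF fA] _ b(1) osc_le_ising_kernel[OF f]])
      fix a i assume a: "a \<in> cfg A" and i: "i \<in> A"
      let ?y = "\<lambda>k. if k \<in> A then a k else x k"
      have y: "?y \<in> cfg V" using x a V(2) by (auto simp: PiE_iff extensional_def)
      have "fld ?U i a = fld U i ?y"
      proof -
        have "(\<lambda>k. if k \<in> A then (a(i := s)) k else x k) = ?y(i := s)" for s using i by auto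
        then show ?thesis by (simp add: fld_def)
      qed
      moreover have "fld (H A) i a = (\<Sum>j\<in>A. \<beta> * w i j * ?y j)" using fld_H[OF fA i] by simp
      ultimately show "\<bar>fld (H A) i a - fld ?U i a\<bar> \<le> 2 * b i"
        using U[OF y i] by (simp add: abs_minus_commute)
    qed (use M in auto)
    moreover have "\<dots> = (\<Sum>i\<in>B. (\<Sum>j\<in>A. G i j * b j) * (2 * M))"
      using B fA by (intro sum.mono_neutral_cong_right) auto
    moreover have "\<dots> \<le> (\<Sum>i\<in>B. e * (2 * M))"
      using b(2) M by (intro sum_mono mult_right_mono) auto
    ultimately show "\<bar>gE A ?U (\<lambda>a. f (\<lambda>i. if i \<in> A then a i else x i)) - gE A (H A) f\<bar> \<le> real (card B) * (2 * M * e)"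
      by (simp add: abs_minus_commute mult_ac)
  qed
qed

lemma free_block_comparison:
  assumes V: "finite V" "A \<subseteq> V" and B: "B \<subseteq> A" and far: "\<And>i l. i \<in> B \<Longrightarrow> l \<in> V - A \<Longrightarrow> i + r \<le> l \<or> l + r \<le> i"
    and f: "\<And>x. x \<in> cfg A \<Longrightarrow> \<bar>f x\<bar> \<le> M" "\<And>x y. (\<And>i. i \<in> B \<Longrightarrow> x i = y i) \<Longrightarrow> f x = f y"
  shows "\<bar>gE V (H V) f - gE A (H A) f\<bar> \<le> real (card B) * (2 * M * (2 * (1 + K) * \<beta> * \<tau> r))"
proof (rule block_comparison[OF V B _ _ _ f])
  have fA: "finite A" by (rule finite_subset[OF V(2,1)])
  fix i assume iB: "i \<in> B"
  \<comment> \<open>Each outside spin l is treated separately; \<open>sum_G_w_le\<close> turns its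
    field on the whole block into its direct interaction with i.\<close>
  have "(\<Sum>j\<in>A. G i j * (\<beta> / 2 * (\<Sum>l\<in>V - A. w j l))) = \<beta> / 2 * (\<Sum>l\<in>V - A. \<Sum>j\<in>A. G i j * w j l)"
    by (simp add: sum_distrib_left mult_ac sum.swap[of _ A])
  also have "\<dots> \<le> \<beta> / 2 * (\<Sum>l\<in>V - A. 2 * (1 + K) * w i l)"
    using iB B beta fA by (intro mult_left_mono sum_mono sum_G_w_le) auto
  also have "\<dots> = \<beta> * (1 + K) * (\<Sum>l\<in>V - A. w i l)" by (simp add: sum_distrib_left[symmetric])
  also have "\<dots> \<le> \<beta> * (1 + K) * (2 * \<tau> r)"
    using beta K_ge(2) V far[OF iB] by (intro mult_left_mono sum_wt_far alpha) auto
  finally show "(\<Sum>j\<in>A. G i j * (\<beta> / 2 * (\<Sum>l\<in>V - A. w j l))) \<le> 2 * (1 + K) * \<beta> * \<tau> r" by (simp only: mult_ac)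
next
  fix x i assume x: "x \<in> cfg V" and i: "i \<in> A"
  have "fld (H V) i x - (\<Sum>j\<in>A. \<beta> * w i j * x j) = (\<Sum>j\<in>V - A. \<beta> * w i j * x j)"
    using V i by (subst fld_H) (auto simp: sum.subset_diff[OF V(2) V(1)])
  also have "\<bar>\<dots>\<bar> \<le> (\<Sum>j\<in>V - A. \<beta> * w i j)"
    using cfg_abs[OF x] beta by (intro order_trans[OF sum_abs] sum_mono) (auto simp: abs_mult)
  finally show "\<bar>fld (H V) i x - (\<Sum>j\<in>A. \<beta> * w i j * x j)\<bar> \<le> 2 * (\<beta> / 2 * (\<Sum>l\<in>V - A. w i l))"
    by (simp add: sum_distrib_left)
next
  fix i show "0 \<le> \<beta> / 2 * (\<Sum>l\<in>V - A. w i l)" using beta by (auto intro!: mult_nonneg_nonneg sum_nonneg)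
qed

text \<open>The analogous estimate for an infinite boundary condition. Its uniformity in x is the
  source of the uniqueness of the half-line Gibbs measure.\<close>

lemma boundary_comparison:
  assumes x: "x \<in> cube" and m: "m \<le> n"
    and f: "\<And>a. a \<in> cfg {..<m} \<Longrightarrow> \<bar>f a\<bar> \<le> M"
  shows "\<bar>gE {..<n} (\<lambda>a. birkhoff_sum n \<phi> (glue n a x)) (\<lambda>a. f (win 0 m a)) - gibbs n (\<lambda>a. f (win 0 m a))\<bar>
      \<le> real m * (2 * M * ((1 + K) * \<beta> * \<tau> (n - m)))"
proof -
  let ?c = "\<lambda>i. \<beta> * bfield n x i"
  have eq: "gE {..<n} (\<lambda>a. birkhoff_sum n \<phi> (glue n a x)) (\<lambda>a. f (win 0 m a))
      = gE {..<n} (ising {..<n} (\<lambda>i j. \<beta> * w i j) ?c) (\<lambda>a. f (win 0 m a))"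
    by (rule gE_cong) (auto intro: birkhoff_glue x)
  have "\<bar>gE {..<n} (ising {..<n} (\<lambda>i j. \<beta> * w i j) ?c) (\<lambda>a. f (win 0 m a)) - gibbs n (\<lambda>a. f (win 0 m a))\<bar>
      \<le> real (card {..<m}) * (2 * M * ((1 + K) * \<beta> * \<tau> (n - m)))"
  proof (rule block_comparison[where b="\<lambda>i. \<beta> / 2 * \<tau> (n - i)"])
    fix i assume "i \<in> {..<m}"
    then have i: "i < m" "i < n" using m by auto
    have s1: "summable (\<lambda>l. \<Sum>j<n. G i j * w j (n + l))" by (intro summable_sum summable_mult summable_w)
    have "(\<Sum>j<n. G i j * \<tau> (n - j)) = (\<Sum>j<n. \<Sum>l. G i j * w j (n + l))"
      by (intro sum.cong refl) (simp add: suminf_mult summable_w suminf_w)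
    also have "\<dots> = (\<Sum>l. \<Sum>j<n. G i j * w j (n + l))"
      by (intro suminf_sum[symmetric] summable_mult summable_w)
    also have "\<dots> \<le> (\<Sum>l. 2 * (1 + K) * w i (n + l))"
      using i by (intro suminf_le s1 sum_G_w_le summable_mult summable_w) auto
    also have "\<dots> = 2 * (1 + K) * \<tau> (n - i)"
      using i by (subst suminf_mult) (auto simp: suminf_w summable_w)
    also have "\<dots> \<le> 2 * (1 + K) * \<tau> (n - m)"
    proof -
      have "\<tau> (n - i) \<le> \<tau> (n - m)" if "0 < n - m"
        unfolding tail_sum_def using i alpha that
        by (intro suminf_le summable_tail powr_mono2') auto
      \<comment> \<open>For n = m the term l = 0 on the right is 0 by the convention on
        \<open>powr\<close>, so a tail is compared with the whole series instead of comparing term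
        by term.\<close>
      moreover have "\<tau> (n - i) \<le> \<tau> (n - m)" if "n - m = 0"
      proof -
        have "\<tau> (n - i) = (\<Sum>l. real (l + (n - i)) powr (-\<alpha>))" by (simp add: tail_sum_def add.commute)
        also have "\<dots> = (\<Sum>l. real l powr (-\<alpha>)) - (\<Sum>l<n - i. real l powr (-\<alpha>))"
          using summable_tail[OF alpha, of 0] by (intro suminf_minus_initial_segment) simp
        also have "\<dots> \<le> (\<Sum>l. real l powr (-\<alpha>))" by (simp add: sum_nonneg)
        finally show ?thesis using that by (simp add: tail_sum_def)
      qed
      ultimately have "\<tau> (n - i) \<le> \<tau> (n - m)" by blast
      then show ?thesis using K_ge(2) by (intro mult_left_mono) auto
    qed
    finally show "(\<Sum>j<n. G i j * (\<beta> / 2 * \<tau> (n - j))) \<le> (1 + K) * \<beta> * \<tau> (n - m)"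
    proof -
      assume le: "(\<Sum>j<n. G i j * \<tau> (n - j)) \<le> 2 * (1 + K) * \<tau> (n - m)"
      have "(\<Sum>j<n. G i j * (\<beta> / 2 * \<tau> (n - j))) = \<beta> / 2 * (\<Sum>j<n. G i j * \<tau> (n - j))"
        by (simp add: sum_distrib_left mult_ac)
      also have "\<dots> \<le> \<beta> / 2 * (2 * (1 + K) * \<tau> (n - m))" using le beta by (intro mult_left_mono) auto
      also have "\<dots> = (1 + K) * \<beta> * \<tau> (n - m)" by simp
      finally show ?thesis .
    qed
  next
    fix a i assume "a \<in> cfg {..<n}" "i \<in> {..<n}"
    then show "\<bar>fld (ising {..<n} (\<lambda>i j. \<beta> * w i j) ?c) i a - (\<Sum>j<n. \<beta> * w i j * a j)\<bar> \<le> 2 * (\<beta> / 2 * \<tau> (n - i))"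
      using bfield_le[OF x, of i n] beta by (subst fld_ising) (auto simp: wt_sym abs_mult)
  next
    fix i show "0 \<le> \<beta> / 2 * \<tau> (n - i)" using beta tail_sum_nonneg[OF alpha] by simp
  next
    fix a assume "a \<in> cfg {..<n}"
    then show "\<bar>f (win 0 m a)\<bar> \<le> M" using f[OF win_cfg[of a "{..<n}" 0 m]] m by (simp add: atLeast0LessThan)
  next
    fix a b :: "nat \<Rightarrow> real" assume "\<And>i. i \<in> {..<m} \<Longrightarrow> a i = b i"
    then show "f (win 0 m a) = f (win 0 m b)" by (auto simp: win_def intro!: arg_cong[where f=f])
  qed (use m in auto)
  then show ?thesis by (simp add: eq)
qed

lemma gE_translate:
  assumes "p \<le> k" "k + m \<le> p + n"
  shows "gE {p..<p + n} (H {p..<p + n}) (\<lambda>x. f (win k m x)) = gibbs n (\<lambda>x. f (win (k - p) m x))"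
proof (rule gE_reindex)
  show b: "bij_betw (\<lambda>i. p + i) {..<n} {p..<p + n}"
    by (rule bij_betwI[where g="\<lambda>i. i - p"]) auto
  fix x assume "x \<in> cfg {p..<p + n}"
  show "H {p..<p + n} x = H {..<n} (\<lambda>i\<in>{..<n}. x (p + i))"
    unfolding H_def ising_def by (simp add: sum.reindex_bij_betw[OF b, symmetric])
  show "f (win k m x) = f (win (k - p) m (\<lambda>i\<in>{..<n}. x (p + i)))"
  proof -
    have "k + i - p < n" "p + (k + i - p) = k + i" if "i < m" for i using assms that by auto
    then show ?thesis using assms(1) by (auto simp: win_def fun_eq_iff intro!: arg_cong[where f=f])
  qed
qed

lemma win_cong: "(\<And>i. i \<in> {k..<k + m} \<Longrightarrow> x i = y i) \<Longrightarrow> win k m x = win k m y"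
  by (auto simp: win_def)

lemma half_line_Cauchy:
  assumes "m \<le> n" "n \<le> N" and f: "\<And>a. a \<in> cfg {..<m} \<Longrightarrow> \<bar>f a\<bar> \<le> M"
  shows "\<bar>gibbs N (\<lambda>x. f (win 0 m x)) - gibbs n (\<lambda>x. f (win 0 m x))\<bar> \<le> real m * (2 * M * (2 * (1 + K) * \<beta> * \<tau> (n - m)))"
proof -
  have "\<bar>gibbs N (\<lambda>x. f (win 0 m x)) - gibbs n (\<lambda>x. f (win 0 m x))\<bar>
      \<le> real (card {..<m}) * (2 * M * (2 * (1 + K) * \<beta> * \<tau> (n - m)))"
  proof (rule free_block_comparison)
    fix a assume "a \<in> cfg {..<n}"
    then show "\<bar>f (win 0 m a)\<bar> \<le> M" using f[OF win_cfg[of a "{..<n}" 0 m]] assms(1) by (simp add: atLeast0LessThan)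
  qed (use assms in \<open>auto intro!: arg_cong[where f=f] win_cong\<close>)
  then show ?thesis by simp
qed

text \<open>The reference value depends on m and r alone: the window sits in a block with r further
  sites on either side, and that block is moved to the origin.\<close>

lemma bulk_Cauchy:
  assumes r: "r \<le> k" "k + m + r \<le> N" and f: "\<And>a. a \<in> cfg {..<m} \<Longrightarrow> \<bar>f a\<bar> \<le> M"
  shows "\<bar>gibbs N (\<lambda>x. f (win k m x)) - gibbs (m + 2 * r) (\<lambda>x. f (win r m x))\<bar>
      \<le> real m * (2 * M * (2 * (1 + K) * \<beta> * \<tau> r))"
proof -
  define p where "p = k - r"
  have k: "k = p + r" using r by (simp add: p_def)
  have tr: "gE {p..<p + (m + 2 * r)} (H {p..<p + (m + 2 * r)}) (\<lambda>x. f (win k m x)) = gibbs (m + 2 * r) (\<lambda>x. f (win r m x))"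
    using gE_translate[of p k m "m + 2 * r" f] k by simp
  have "\<bar>gibbs N (\<lambda>x. f (win k m x)) - gE {p..<p + (m + 2 * r)} (H {p..<p + (m + 2 * r)}) (\<lambda>x. f (win k m x))\<bar>
      \<le> real (card {k..<k + m}) * (2 * M * (2 * (1 + K) * \<beta> * \<tau> r))"
  proof (rule free_block_comparison)
    fix a assume "a \<in> cfg {p..<p + (m + 2 * r)}"
    then show "\<bar>f (win k m a)\<bar> \<le> M" using f[OF win_cfg[of a "{p..<p + (m + 2 * r)}" k m]] k by simp
  qed (use k r in \<open>auto intro!: arg_cong[where f=f] win_cong\<close>)
  then show ?thesis by (simp add: tr)
qed

section \<open>Coupling the two halves of a block\<close>

text \<open>Interpolates between independent halves at t = 0 and the full block at t = 1; values up
  to 2 serve the second moment of the density.\<close>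

definition Jcross :: "nat \<Rightarrow> real \<Rightarrow> nat \<Rightarrow> nat \<Rightarrow> real" where
  "Jcross r t i j = \<beta> * w i j * (if (i < r) = (j < r) then 1 else t)"

definition Wcross :: "nat \<Rightarrow> (nat \<Rightarrow> real) \<Rightarrow> real" where
  "Wcross r x = (\<Sum>i<r. \<Sum>j\<in>{r..<2 * r}. \<beta> * w i j * (x i * x j))"

lemma Jcross_blocks:
  "(\<Sum>i<2 * r. \<Sum>j<2 * r. Jcross r t i j * x i * x j)
     = (\<Sum>i<r. \<Sum>j<r. \<beta> * w i j * x i * x j) + (\<Sum>i\<in>{r..<2 * r}. \<Sum>j\<in>{r..<2 * r}. \<beta> * w i j * x i * x j) + 2 * t * Wcross r x"
proof -
  have sp: "{..<2 * r} = {..<r} \<union> {r..<2 * r}" by auto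
  have "(\<Sum>i<2 * r. \<Sum>j<2 * r. Jcross r t i j * x i * x j)
    = ((\<Sum>i<r. \<Sum>j<r. Jcross r t i j * x i * x j) + (\<Sum>i<r. \<Sum>j\<in>{r..<2 * r}. Jcross r t i j * x i * x j))
    + ((\<Sum>i\<in>{r..<2 * r}. \<Sum>j<r. Jcross r t i j * x i * x j) + (\<Sum>i\<in>{r..<2 * r}. \<Sum>j\<in>{r..<2 * r}. Jcross r t i j * x i * x j))"
    unfolding sp by (simp add: sum.union_disjoint ivl_disj_int sum.distrib)
  moreover have "(\<Sum>i\<in>{r..<2 * r}. \<Sum>j<r. Jcross r t i j * x i * x j) = t * Wcross r x"
    unfolding Wcross_def sum_distrib_left by (subst sum.swap, intro sum.cong refl) (auto simp: Jcross_def wt_sym mult_ac)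
  moreover have "(\<Sum>i<r. \<Sum>j\<in>{r..<2 * r}. Jcross r t i j * x i * x j) = t * Wcross r x"
    unfolding Wcross_def sum_distrib_left by (intro sum.cong refl) (auto simp: Jcross_def mult_ac)
  moreover have "(\<Sum>i<r. \<Sum>j<r. Jcross r t i j * x i * x j) = (\<Sum>i<r. \<Sum>j<r. \<beta> * w i j * x i * x j)"
    by (intro sum.cong refl) (auto simp: Jcross_def)
  moreover have "(\<Sum>i\<in>{r..<2 * r}. \<Sum>j\<in>{r..<2 * r}. Jcross r t i j * x i * x j) = (\<Sum>i\<in>{r..<2 * r}. \<Sum>j\<in>{r..<2 * r}. \<beta> * w i j * x i * x j)"
    by (intro sum.cong refl) (auto simp: Jcross_def)
  ultimately show ?thesis by simp
qed

lemma ising_Jcross: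
  "ising {..<2 * r} (Jcross r t) (\<lambda>_. 0) x = ising {..<2 * r} (Jcross r 0) (\<lambda>_. 0) x + t * Wcross r x"
  unfolding ising_def Jcross_blocks by simp

lemma Jcross_1: "ising {..<2 * r} (Jcross r 1) (\<lambda>_. 0) = H {..<2 * r}"
  by (simp add: H_def Jcross_def[abs_def] cong: if_cong)

text \<open>Since i < r \<le> j, one factor is at most \<open>w i r\<close>, and the double sum
  splits into two row sums. The bound is uniform in r, whereas the sum of \<open>w i j\<close>
  itself is unbounded for \<alpha> \<le> 2.\<close>

lemma sum_cross_sq_le: "(\<Sum>i<r. \<Sum>j\<in>{r..<2 * r}. w i j * w i j) \<le> K * K"
proof -
  have "(\<Sum>i<r. \<Sum>j\<in>{r..<2 * r}. w i j * w i j) \<le> (\<Sum>i<r. \<Sum>j\<in>{r..<2 * r}. w i r * w i j)"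
    using alpha by (intro sum_mono mult_right_mono wt_antimono) auto
  also have "\<dots> \<le> (\<Sum>i<r. w r i * K)"
    unfolding sum_distrib_left[symmetric] wt_sym[of _ r] by (intro sum_mono mult_left_mono sum_w_le_K) auto
  also have "\<dots> \<le> K * K"
    unfolding sum_distrib_right[symmetric] using K_ge by (intro mult_right_mono sum_w_le_K) auto
  finally show ?thesis .
qed

text \<open>The mean of the cross energy under a tilt is a sum of couplings times pair correlations,
  and the latter are again of order w: \<open>pair_bound\<close> gives 4 w, so the exponent is at
  most 8 \<beta> times the sum of squares, hence at most 8 \<beta> K K \<le> K.\<close>

lemma cross_mgf:
  assumes t: "0 \<le> t" "t \<le> 2"
  shows "gE {..<2 * r} (ising {..<2 * r} (Jcross r 0) (\<lambda>_. 0)) (\<lambda>x. exp (t * Wcross r x)) \<le> exp K"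
proof -
  let ?V = "{..<2 * r}"
  obtain s where s: "0 < s" "s < 1"
    and eq: "gE ?V (ising ?V (Jcross r 0) (\<lambda>_. 0)) (\<lambda>x. exp (t * Wcross r x))
      = exp (gE ?V (\<lambda>x. ising ?V (Jcross r 0) (\<lambda>_. 0) x + s * (t * Wcross r x)) (\<lambda>x. t * Wcross r x))"
    by (rule log_mgf_mean_value[OF finite_lessThan[of "2 * r"], of "ising ?V (Jcross r 0) (\<lambda>_. 0)" "\<lambda>x. t * Wcross r x"])
  \<comment> \<open>The intermediate tilt only rescales the cross couplings, by s * t \<le> 2, so
    the tilted measure is still weakly coupled and even.\<close>
  let ?U = "ising ?V (Jcross r (s * t)) (\<lambda>_. 0)"
  have U: "(\<lambda>x. ising ?V (Jcross r 0) (\<lambda>_. 0) x + s * (t * Wcross r x)) = ?U"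
    by (simp add: fun_eq_iff ising_Jcross[of r "s * t"] mult.assoc)
  have st: "0 \<le> s * t" "s * t \<le> 2" using s t mult_mono[of s 1 t 2] by auto
  have wc: "weakly_coupled ?V ?U"
  proof (rule weakly_coupled_ising)
    fix i j
    have "\<bar>if (i < r) = (j < r) then 1 else s * t\<bar> \<le> 2" using st by auto
    then have "\<beta> * w i j * \<bar>if (i < r) = (j < r) then 1 else s * t\<bar> \<le> \<beta> * w i j * 2"
      using beta by (intro mult_left_mono) auto
    then show "\<bar>Jcross r (s * t) i j\<bar> \<le> 2 * \<beta> * w i j"
      using beta by (simp only: Jcross_def abs_mult abs_of_pos abs_of_nonneg wt_nonneg mult_ac)
    show "Jcross r (s * t) i j = Jcross r (s * t) j i" by (auto simp: Jcross_def wt_sym)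
  qed (auto simp: Jcross_def)
  have "gE ?V ?U (\<lambda>x. t * Wcross r x) = t * (\<Sum>i<r. \<Sum>j\<in>{r..<2 * r}. \<beta> * w i j * gE ?V ?U (\<lambda>x. x i * x j))"
    by (simp add: Wcross_def gE_cmult gE_sum)
  also have "\<dots> \<le> 2 * (\<Sum>i<r. \<Sum>j\<in>{r..<2 * r}. \<beta> * w i j * (4 * w i j))"
  proof -
    have "\<bar>\<Sum>i<r. \<Sum>j\<in>{r..<2 * r}. \<beta> * w i j * gE ?V ?U (\<lambda>x. x i * x j)\<bar> \<le> (\<Sum>i<r. \<Sum>j\<in>{r..<2 * r}. \<beta> * w i j * (4 * w i j))"
    proof (intro order_trans[OF sum_abs] sum_mono)
      fix i j assume ij: "i \<in> {..<r}" "j \<in> {r..<2 * r}"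
      have "\<bar>gE ?V ?U (\<lambda>x. x i * x j)\<bar> \<le> 2 * G i j"
        using ij by (intro pair_bound wc even_on_ising) auto
      then have "\<bar>gE ?V ?U (\<lambda>x. x i * x j)\<bar> \<le> 4 * w i j" using ij by (auto simp: G_def)
      then show "\<bar>\<beta> * w i j * gE ?V ?U (\<lambda>x. x i * x j)\<bar> \<le> \<beta> * w i j * (4 * w i j)"
        using beta by (simp add: abs_mult mult_left_mono)
    qed
    moreover have "t * y \<le> 2 * z" if "\<bar>y\<bar> \<le> z" for y z :: real
    proof -
      have "t * y \<le> t * z" using that t by (intro mult_left_mono) auto
      also have "\<dots> \<le> 2 * z" using that t by (intro mult_right_mono) auto
      finally show ?thesis .
    qed
    ultimately show ?thesis by blast
  qed
  also have "\<dots> = 8 * \<beta> * (\<Sum>i<r. \<Sum>j\<in>{r..<2 * r}. w i j * w i j)"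
    by (simp add: sum_distrib_left mult_ac)
  also have "\<dots> \<le> 8 * \<beta> * (K * K)" using beta by (intro mult_left_mono sum_cross_sq_le) auto
  also have "\<dots> \<le> K" using small K_ge mult_right_mono[of "8 * \<beta> * K" 1 K] by (simp add: mult_ac)
  finally show ?thesis unfolding eq U by simp
qed

end

section \<open>Limits of finite-volume measures\<close>

declare PiE_E [rule del] PiE_I [rule del]

lemma cube_eq_PiE: "cube = PiE UNIV (\<lambda>_. {-1..1})"
  by (auto simp: cube_def PiE_iff)

lemma compact_cube: "compact cube"
proof -
  have "compactin (product_topology (\<lambda>_. euclidean) UNIV) (PiE UNIV (\<lambda>_::nat. {-1..1::real}))"
    by (subst compactin_PiE) auto
  then show ?thesis
    by (simp add: cube_eq_PiE euclidean_product_topology del: PiE_UNIV_domain)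
qed

lemma continuous_cube_local:
  fixes F :: "(nat \<Rightarrow> real) \<Rightarrow> real"
  assumes F: "continuous_on cube F" and "0 < e"
  obtains m where "\<And>x y. x \<in> cube \<Longrightarrow> y \<in> cube \<Longrightarrow> (\<And>i. i < m \<Longrightarrow> x i = y i) \<Longrightarrow> \<bar>F x - F y\<bar> < e"
proof -
  have "uniformly_continuous_on cube F" by (rule compact_uniformly_continuous[OF F compact_cube])
  then obtain d where d: "0 < d" "\<And>x y. x \<in> cube \<Longrightarrow> y \<in> cube \<Longrightarrow> dist y x < d \<Longrightarrow> dist (F y) (F x) < e"
    using \<open>0 < e\<close> unfolding uniformly_continuous_on_def by blast
  obtain N where N: "(1/2 :: real) ^ N < d" using real_arch_pow_inv[OF d(1), of "1/2"] by auto
  \<comment> \<open>The metric weighs coordinate \<open>from_nat n\<close> by 2^(-n); m exceeds all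
    coordinates enumerated up to N.\<close>
  define m where "m = Suc (Max (from_nat ` {..N} :: nat set))"
  show ?thesis
  proof (rule that[of m])
    fix x y :: "nat \<Rightarrow> real" assume xy: "x \<in> cube" "y \<in> cube" and eq: "\<And>i. i < m \<Longrightarrow> x i = y i"
    have "x (from_nat n) = y (from_nat n)" if "n \<le> N" for n
      using that by (intro eq) (auto simp: m_def less_Suc_eq_le)
    then have "{dist (x (from_nat n)) (y (from_nat n)) |n. n \<le> N} = {0}" by (auto intro!: exI[of _ 0])
    then have "dist x y \<le> (1/2) ^ N" using dist_fun_le_dist_first_terms[of x y N] by simp
    then have "dist (F x) (F y) < e" using N xy by (intro d) auto
    then show "\<bar>F x - F y\<bar> < e" by (simp add: dist_real_def)
  qed
qed

lemma continuous_cube_bounded: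
  fixes F :: "(nat \<Rightarrow> real) \<Rightarrow> real"
  assumes "continuous_on cube F"
  obtains B where "0 \<le> B" "\<And>x. x \<in> cube \<Longrightarrow> \<bar>F x\<bar> \<le> B"
proof -
  have "bounded (F ` cube)" by (intro compact_imp_bounded compact_continuous_image assms compact_cube)
  then obtain B where "\<And>x. x \<in> cube \<Longrightarrow> \<bar>F x\<bar> \<le> B" by (auto simp: bounded_iff)
  then show ?thesis by (intro that[of "max 0 B"]) (auto simp: le_max_iff_disj)
qed

lemma continuous_on_coord [continuous_intros]: "continuous_on A (\<lambda>x :: nat \<Rightarrow> real. x i)"
  by (rule continuous_on_product_then_coordinatewise[OF continuous_on_id])

lemma space_Xp: "space Xp = {x. \<forall>i. x i = -1 \<or> x i = 1}"
  by (auto simp: Xp_def space_PiM PiE_iff)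

lemma Xp_cube: "x \<in> space Xp \<Longrightarrow> x \<in> cube"
  unfolding cube_def space_Xp by (simp; smt (verit))

lemma Xp_ivl_cfg: "x \<in> space Xp \<Longrightarrow> win k m x \<in> cfg {..<m}"
  by (simp add: space_Xp win_def PiE_iff)

lemma coord_measurable [measurable]: "(\<lambda>x. x i) \<in> measurable Xp (count_space {-1, 1 :: real})"
  unfolding Xp_def by measurable

definition local_set :: "nat \<Rightarrow> (nat \<Rightarrow> real) set \<Rightarrow> (nat \<Rightarrow> real) set" where
  "local_set m Q = {x\<in>space Xp. win 0 m x \<in> Q}"

abbreviation cyl :: "nat \<Rightarrow> (nat \<Rightarrow> real) \<Rightarrow> (nat \<Rightarrow> real) set" where
  "cyl m a \<equiv> {x\<in>space Xp. \<forall>i<m. x i = a i}"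

lemma win_win: "m \<le> n \<Longrightarrow> win 0 m (win k n x) = win k m x"
  by (auto simp: win_def)

lemma win_eq_iff: "a \<in> cfg {..<m} \<Longrightarrow> win 0 m x = a \<longleftrightarrow> (\<forall>i<m. x i = a i)"
  by (auto simp: win_def fun_eq_iff PiE_iff extensional_def)

lemma cyl_sets [measurable]: "cyl m a \<in> sets Xp"
proof -
  have "{x\<in>space Xp. x i = a i} \<in> sets Xp" for i
  proof -
    have "(\<lambda>x. x i) -` ({a i} \<inter> {-1, 1}) \<inter> space Xp \<in> sets Xp"
      by (rule measurable_sets[OF coord_measurable]) auto
    also have "(\<lambda>x. x i) -` ({a i} \<inter> {-1, 1}) \<inter> space Xp = {x\<in>space Xp. x i = a i}"
      by (auto simp: space_Xp)
    finally show ?thesis .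
  qed
  then show ?thesis by measurable
qed

lemma local_set_eq: "local_set m Q = (\<Union>a\<in>Q \<inter> cfg {..<m}. cyl m a)"
  by (auto simp: local_set_def win_eq_iff[symmetric] Xp_ivl_cfg simp del: PiE_iff)

lemma local_set_sets [measurable]: "local_set m Q \<in> sets Xp"
  unfolding local_set_eq by (intro sets.finite_UN) auto

lemma local_set_mono: "m \<le> n \<Longrightarrow> local_set m Q = local_set n {a. win 0 m a \<in> Q}"
  by (auto simp: local_set_def win_win)

lemma local_set_Int: "local_set m P \<inter> local_set n Q = local_set (max m n) {a. win 0 m a \<in> P \<and> win 0 n a \<in> Q}"
  by (auto simp: local_set_def win_win)

lemma local_set_Un: "local_set m P \<union> local_set n Q = local_set (max m n) {a. win 0 m a \<in> P \<or> win 0 n a \<in> Q}"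
  by (auto simp: local_set_def win_win)

lemma local_set_compl: "space Xp - local_set m Q = local_set m (- Q)"
  by (auto simp: local_set_def)

definition local_sets :: "(nat \<Rightarrow> real) set set" where
  "local_sets = {local_set m Q | m Q. True}"

lemma sets_Xp_local: "sets Xp = sigma_sets (space Xp) local_sets"
proof
  have s: "space Xp = (\<Pi>\<^sub>E i\<in>UNIV. space (count_space {-1, 1 :: real}))" by (simp add: Xp_def space_PiM)
  have "{f \<in> space Xp. f i \<in> A} = local_set (Suc i) {a. a i \<in> A}" for i A
    by (auto simp: local_set_def win_def)
  then have "sigma_sets (space Xp) {{f \<in> space Xp. f i \<in> A} |i A. i \<in> UNIV \<and> A \<in> sets (count_space {-1, 1 :: real})}
      \<subseteq> sigma_sets (space Xp) local_sets"
    by (intro sigma_sets_mono') (auto simp: local_sets_def)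
  then show "sets Xp \<subseteq> sigma_sets (space Xp) local_sets"
    unfolding s by (simp add: Xp_def sets_PiM_single)
  show "sigma_sets (space Xp) local_sets \<subseteq> sets Xp"
    by (rule sets.sigma_sets_subset) (auto simp: local_sets_def)
qed

lemma measure_local_set:
  assumes "finite_measure M" "sets M = sets Xp"
  shows "measure M (local_set m Q) = (\<Sum>a\<in>Q \<inter> cfg {..<m}. measure M (cyl m a))"
  unfolding local_set_eq
proof (rule finite_measure.finite_measure_finite_Union[OF assms(1)])
  show "disjoint_family_on (cyl m) (Q \<inter> cfg {..<m})"
    unfolding disjoint_family_on_def
  proof (intro ballI impI)
    fix a b assume ab: "a \<in> Q \<inter> cfg {..<m}" "b \<in> Q \<inter> cfg {..<m}" "a \<noteq> b"
    then have "a \<in> cfg {..<m}" "b \<in> cfg {..<m}" by auto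
    then have c: "cyl m a = {x\<in>space Xp. win 0 m x = a}" "cyl m b = {x\<in>space Xp. win 0 m x = b}" by (simp_all add: win_eq_iff)
    show "cyl m a \<inter> cyl m b = {}" unfolding c using ab(3) by blast
  qed
  show "finite (Q \<inter> cfg {..<m})" by (simp add: finite_cfg)
  show "cyl m ` (Q \<inter> cfg {..<m}) \<subseteq> sets M" unfolding assms(2) by (intro image_subsetI cyl_sets)
qed

text \<open>Local sets are stable under intersection and generate the sigma-algebra, and each is a
  finite disjoint union of cylinders.\<close>

lemma measure_eq_Xp:
  assumes M: "finite_measure M" "sets M = sets Xp" and N: "finite_measure N" "sets N = sets Xp"
    and eq: "\<And>m a. a \<in> cfg {..<m} \<Longrightarrow> measure M (cyl m a) = measure N (cyl m a)"
  shows "M = N"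
proof (rule measure_eqI_generator_eq[where E=local_sets and \<Omega>="space Xp" and A="\<lambda>_. space Xp"])
  show "Int_stable local_sets"
    unfolding Int_stable_def local_sets_def by (auto simp: local_set_Int) metis
  show "local_sets \<subseteq> Pow (space Xp)" by (auto simp: local_sets_def local_set_def)
  show "sets M = sigma_sets (space Xp) local_sets" "sets N = sigma_sets (space Xp) local_sets"
    using M N sets_Xp_local by auto
  have "space Xp = local_set 0 UNIV" by (auto simp: local_set_def)
  then show "range (\<lambda>_::nat. space Xp) \<subseteq> local_sets" by (auto simp: local_sets_def)
  show "emeasure M (space Xp) \<noteq> \<infinity>" using finite_measure.emeasure_finite[OF M(1)] by simp
  fix X assume "X \<in> local_sets"
  then obtain m Q where X: "X = local_set m Q" by (auto simp: local_sets_def)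
  show "emeasure M X = emeasure N X"
    using M N by (simp add: X finite_measure.emeasure_eq_measure measure_local_set eq)
qed auto

lemma win_measurable [measurable]: "win k m \<in> measurable Xp (count_space UNIV)"
proof -
  have "win k m \<in> measurable Xp (count_space (cfg {..<m}))"
  proof (rule measurable_count_space_eq2[OF finite_cfg[OF finite_lessThan], THEN iffD2], intro conjI ballI)
    show "win k m \<in> space Xp \<rightarrow> cfg {..<m}" by (simp add: Xp_ivl_cfg)
    fix a assume a: "a \<in> cfg {..<m}"
    have "win k m -` {a} \<inter> space Xp = {x\<in>space Xp. \<forall>i<m. x (k + i) = a i}"
      using a by (auto simp: win_def fun_eq_iff PiE_iff extensional_def)
    also have "\<dots> \<in> sets Xp" by measurable
    finally show "win k m -` {a} \<inter> space Xp \<in> sets Xp" .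
  qed
  then show ?thesis by (rule measurable_compose) simp
qed

lemma local_fun_measurable [measurable]: "(\<lambda>x. f (win k m x)) \<in> measurable Xp (count_space UNIV)"
  by (rule measurable_compose[OF win_measurable]) simp

lemma local_fun_borel [measurable]: "(\<lambda>x. f (win k m x)) \<in> borel_measurable Xp"
  by (rule measurable_compose[OF win_measurable]) simp

lemma integral_local:
  assumes "prob_space M" "sets M = sets Xp"
  shows "integral\<^sup>L M (\<lambda>x. f (win 0 m x)) = (\<Sum>a\<in>cfg {..<m}. measure M (cyl m a) * (f a :: real))"
proof -
  interpret prob_space M by fact
  have sp: "space M = space Xp" using assms(2) by (rule sets_eq_imp_space_eq)
  have "integral\<^sup>L M (\<lambda>x. f (win 0 m x)) = integral\<^sup>L M (\<lambda>x. \<Sum>a\<in>cfg {..<m}. indicator (cyl m a) x * f a)"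
  proof (rule Bochner_Integration.integral_cong[OF refl])
    fix x assume "x \<in> space M"
    then have x: "x \<in> space Xp" by (simp add: sp)
    have "(\<Sum>a\<in>cfg {..<m}. indicator (cyl m a) x * f a) = (\<Sum>a\<in>cfg {..<m}. if a = win 0 m x then f a else 0)"
      using x win_eq_iff[of _ m x] by (intro sum.cong) (auto simp: indicator_def)
    then show "f (win 0 m x) = (\<Sum>a\<in>cfg {..<m}. indicator (cyl m a) x * f a)"
      using Xp_ivl_cfg[OF x, of 0 m] by (simp add: finite_cfg)
  qed
  also have "\<dots> = (\<Sum>a\<in>cfg {..<m}. integral\<^sup>L M (\<lambda>x. indicator (cyl m a) x * f a))"
  proof -
    have "emeasure M (cyl m a) < \<infinity>" "cyl m a \<in> sets M" for a
      using emeasure_finite[of "cyl m a"] assms(2) by (simp_all add: less_top[symmetric] cyl_sets)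
    then have "integrable M (\<lambda>x. indicator (cyl m a) x * f a)" for a
      by (intro integrable_mult_left integrable_real_indicator)
    then show ?thesis by (rule Bochner_Integration.integral_sum)
  qed
  also have "\<dots> = (\<Sum>a\<in>cfg {..<m}. measure M (cyl m a) * f a)"
  proof (rule sum.cong[OF refl])
    fix a
    have "cyl m a \<inter> space M = cyl m a" using sp by blast
    then show "integral\<^sup>L M (\<lambda>x. indicator (cyl m a) x * f a) = measure M (cyl m a) * f a"
      by (simp only: Bochner_Integration.integral_mult_left_zero Bochner_Integration.integral_indicator)
  qed
  finally show ?thesis .
qed

lemma measure_local_set_integral:
  assumes "prob_space M" "sets M = sets Xp"
  shows "measure M (local_set m Q) = integral\<^sup>L M (\<lambda>x. of_bool (win 0 m x \<in> Q))"
proof -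
  have sp: "space M = space Xp" using assms(2) by (rule sets_eq_imp_space_eq)
  have "integral\<^sup>L M (\<lambda>x. of_bool (win 0 m x \<in> Q) :: real) = integral\<^sup>L M (indicator (local_set m Q))"
    by (rule Bochner_Integration.integral_cong) (auto simp: sp local_set_def indicator_def)
  moreover have "local_set m Q \<subseteq> space M" by (auto simp: sp local_set_def)
  then have "integral\<^sup>L M (indicator (local_set m Q)) = measure M (local_set m Q)" by (simp add: Int_absorb2)
  ultimately show ?thesis by linarith
qed

lemma cyl_eq_local_set: "a \<in> cfg {..<m} \<Longrightarrow> cyl m a = local_set m {a}"
  by (simp add: local_set_def win_eq_iff)

lemma continuous_cube_measurable:
  fixes F :: "(nat \<Rightarrow> real) \<Rightarrow> real"
  assumes F: "continuous_on cube F"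
  shows "F \<in> borel_measurable Xp"
proof (rule borel_measurable_LIMSEQ_real)
  show "(\<lambda>x. F (ext n (win 0 n x))) \<in> borel_measurable Xp" for n by measurable
  fix x assume "x \<in> space Xp"
  then have x: "x \<in> cube" by (rule Xp_cube)
  show "(\<lambda>n. F (ext n (win 0 n x))) \<longlonglongrightarrow> F x"
  proof (rule LIMSEQ_I)
    fix e :: real assume "0 < e"
    then obtain m where m: "\<And>x y. x \<in> cube \<Longrightarrow> y \<in> cube \<Longrightarrow> (\<And>i. i < m \<Longrightarrow> x i = y i) \<Longrightarrow> \<bar>F x - F y\<bar> < e"
      using continuous_cube_local[OF F] by blast
    have "ext n (win 0 n x) \<in> cube" for n using x by (auto simp: cube_def ext_def win_def)
    then have "norm (F (ext n (win 0 n x)) - F x) < e" if "m \<le> n" for n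
      using that x m[of "ext n (win 0 n x)" x] by (auto simp: ext_def win_def)
    then show "\<exists>no. \<forall>n\<ge>no. norm (F (ext n (win 0 n x)) - F x) < e" by blast
  qed
qed

lemma continuous_cube_integrable:
  fixes F :: "(nat \<Rightarrow> real) \<Rightarrow> real"
  assumes F: "continuous_on cube F" and M: "prob_space M" "sets M = sets Xp"
  shows "integrable M F"
proof -
  interpret prob_space M by fact
  have sp: "space M = space Xp" using M(2) by (rule sets_eq_imp_space_eq)
  obtain B where "\<And>x. x \<in> cube \<Longrightarrow> \<bar>F x\<bar> \<le> B" using continuous_cube_bounded[OF F] by blast
  then show ?thesis
    using continuous_cube_measurable[OF F] M(2) Xp_cube
    by (intro integrable_const_bound[of _ B]) (auto simp: sp cong: measurable_cong_sets)
qed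

text \<open>A continuous F on the compact cube is uniformly close to a function of finitely many
  coordinates, so convergence on local observables suffices. Finite configurations are fed to F with
  zeros behind them, outside \<open>space Xp\<close>.\<close>

lemma gE_tendsto_continuous:
  fixes F :: "(nat \<Rightarrow> real) \<Rightarrow> real"
  assumes F: "continuous_on cube F" and M: "prob_space M" "sets M = sets Xp"
    and loc: "\<And>m f. (\<lambda>n. gE {..<N n} (U n) (\<lambda>x. f (win (k n) m x))) \<longlonglongrightarrow> integral\<^sup>L M (\<lambda>x. f (win 0 m x))"
    and L: "filterlim L at_top sequentially" "\<And>n. k n + L n \<le> N n"
  shows "(\<lambda>n. gE {..<N n} (U n) (\<lambda>x. F (ext (L n) (\<lambda>i. x (k n + i))))) \<longlonglongrightarrow> integral\<^sup>L M F"
proof (rule LIMSEQ_I)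
  fix e :: real assume e: "0 < e"
  interpret prob_space M by fact
  have sp: "space M = space Xp" using M(2) by (rule sets_eq_imp_space_eq)
  \<comment> \<open>The quarter of e is spent three times: truncation of F under the limit measure,
    truncation in finite volume, and convergence of the local observable.\<close>
  obtain m where m: "\<And>x y. x \<in> cube \<Longrightarrow> y \<in> cube \<Longrightarrow> (\<And>i. i < m \<Longrightarrow> x i = y i) \<Longrightarrow> \<bar>F x - F y\<bar> < e / 4"
    using continuous_cube_local[OF F, of "e / 4"] e by auto
  define g where "g a = F (ext m a)" for a
  have extc: "ext j x \<in> cube" if "\<And>i. i < j \<Longrightarrow> x i \<in> {-1..1}" for j x
    using that by (auto simp: cube_def ext_def)
  have extw: "ext m (win 0 m x) \<in> cube" if "x \<in> cube" for x
    using that by (intro extc) (auto simp: cube_def win_def)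
  have 1: "\<bar>integral\<^sup>L M F - integral\<^sup>L M (\<lambda>x. g (win 0 m x))\<bar> \<le> e / 4"
  proof -
    have ig: "integrable M (\<lambda>x. g (win 0 m x))"
    proof -
      obtain B where "\<And>x. x \<in> cube \<Longrightarrow> \<bar>F x\<bar> \<le> B" using continuous_cube_bounded[OF F] by blast
      then show ?thesis
        using M(2) extw[OF Xp_cube] local_fun_borel[of g 0 m]
        by (intro integrable_const_bound[of _ B]) (auto simp: sp g_def cong: measurable_cong_sets)
    qed
    have "integral\<^sup>L M F - integral\<^sup>L M (\<lambda>x. g (win 0 m x)) = integral\<^sup>L M (\<lambda>x. F x - g (win 0 m x))"
      using continuous_cube_integrable[OF F M] ig by simp
    also have "\<bar>\<dots>\<bar> \<le> integral\<^sup>L M (\<lambda>x. \<bar>F x - g (win 0 m x)\<bar>)" by (rule integral_abs_bound)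
    also have "\<dots> \<le> integral\<^sup>L M (\<lambda>x. e / 4)"
    proof (rule integral_mono)
      show "integrable M (\<lambda>x. \<bar>F x - g (win 0 m x)\<bar>)" using continuous_cube_integrable[OF F M] ig by simp
      fix x assume "x \<in> space M"
      then have x: "x \<in> cube" by (simp add: sp Xp_cube)
      have "\<bar>F x - g (win 0 m x)\<bar> < e / 4"
        unfolding g_def by (intro m x extw) (auto simp: ext_def win_def)
      then show "\<bar>F x - g (win 0 m x)\<bar> \<le> e / 4" by simp
    qed simp
    finally show ?thesis by (simp add: prob_space)
  qed
  have "eventually (\<lambda>n. norm (gE {..<N n} (U n) (\<lambda>x. g (win (k n) m x)) - integral\<^sup>L M (\<lambda>x. g (win 0 m x))) < e / 4) sequentially"
    using tendstoD[OF loc[of g m], of "e / 4"] e by (simp add: dist_real_def)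
  moreover have "eventually (\<lambda>n. m \<le> L n) sequentially" using L(1) by (auto simp: filterlim_at_top)
  ultimately have "eventually (\<lambda>n. norm (gE {..<N n} (U n) (\<lambda>x. F (ext (L n) (\<lambda>i. x (k n + i)))) - integral\<^sup>L M F) < e) sequentially"
  proof eventually_elim
    case (elim n)
    have "\<bar>gE {..<N n} (U n) (\<lambda>x. F (ext (L n) (\<lambda>i. x (k n + i)))) - gE {..<N n} (U n) (\<lambda>x. g (win (k n) m x))\<bar> \<le> e / 4"
    proof (rule gE_diff_le[OF finite_lessThan])
      fix x assume x: "x \<in> cfg {..<N n}"
      have v: "x (k n + i) \<in> {-1..1}" if "i < L n" for i
        using that L(2)[of n] by (intro cfg_ivl[OF x]) auto
      have "\<bar>F (ext (L n) (\<lambda>i. x (k n + i))) - g (win (k n) m x)\<bar> < e / 4"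
        unfolding g_def
      proof (rule m)
        show "ext (L n) (\<lambda>i. x (k n + i)) \<in> cube" using v by (intro extc)
        show "ext m (win (k n) m x) \<in> cube"
        proof (rule extc)
          fix i assume "i < m"
          then show "win (k n) m x i \<in> {-1..1}" using v[of i] elim(2) by (simp add: win_def)
        qed
      qed (use elim(2) in \<open>auto simp: ext_def win_def\<close>)
      then show "\<bar>F (ext (L n) (\<lambda>i. x (k n + i))) - g (win (k n) m x)\<bar> \<le> e / 4" by simp
    qed
    then show ?case using 1 elim(1) unfolding real_norm_def by linarith
  qed
  then show "\<exists>no. \<forall>n\<ge>no. norm (gE {..<N n} (U n) (\<lambda>x. F (ext (L n) (\<lambda>i. x (k n + i)))) - integral\<^sup>L M F) < e"
    by (simp add: eventually_sequentially)
qed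

section \<open>Construction of limit measures\<close>

text \<open>Kolmogorov's extension theorem for words. The projective limit lives on sequences of
  reals with Borel coordinates and is then pushed onto spin sequences.\<close>

lemma extension_Xp:
  fixes pm :: "nat \<Rightarrow> (nat \<Rightarrow> real) pmf"
  assumes supp: "\<And>m. set_pmf (pm m) \<subseteq> cfg {..<m}"
    and cons: "\<And>m. map_pmf (win 0 m) (pm (Suc m)) = pm m"
  shows "\<exists>M. prob_space M \<and> sets M = sets Xp \<and> (\<forall>m. \<forall>a\<in>cfg {..<m}. measure M (cyl m a) = pmf (pm m) a)"
proof -
  have consn: "map_pmf (win 0 m) (pm (m + n)) = pm m" for m n
  proof (induction n)
    case 0
    have "map_pmf (win 0 m) (pm m) = map_pmf (\<lambda>x. x) (pm m)"
      using supp[of m] by (intro map_pmf_cong) (auto simp: win_eq_iff)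
    then show ?case by (simp add: map_pmf_ident)
  next
    case (Suc n)
    have "map_pmf (win 0 m) (pm (m + n)) = map_pmf (win 0 m) (map_pmf (win 0 (m + n)) (pm (Suc (m + n))))"
      by (simp add: cons)
    also have "\<dots> = map_pmf (win 0 m) (pm (m + Suc n))"
      by (simp add: pmf.map_comp comp_def win_win)
    finally show ?case using Suc by simp
  qed
  \<comment> \<open>Marginals on a finite J are read off from words of the least sufficient length;
    \<open>P_eq\<close> shows that every sufficient length gives the same.\<close>
  define b where "b J = (LEAST m. J \<subseteq> {..<m})" for J :: "nat set"
  have b: "J \<subseteq> {..<b J}" if "finite J" for J
  proof -
    obtain m where "J \<subseteq> {..<m}" using finite_nat_bounded[OF \<open>finite J\<close>] by blast
    then show ?thesis unfolding b_def by (rule LeastI)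
  qed
  define P where "P J = distr (measure_pmf (pm (b J))) (PiM J (\<lambda>_. borel)) (\<lambda>a. restrict a J)" for J :: "nat set"
  have P_eq: "P J = distr (measure_pmf (pm m)) (PiM J (\<lambda>_. borel)) (\<lambda>a. restrict a J)" if "finite J" "J \<subseteq> {..<m}" for J m
  proof -
    have rr: "restrict a J = restrict (win 0 n a) J" if "J \<subseteq> {..<n}" for a n
      using that by (auto simp: win_def fun_eq_iff)
    have *: "distr (measure_pmf (pm n)) (PiM J (\<lambda>_. borel)) (\<lambda>a. restrict a J)
       = distr (measure_pmf (pm (n + k))) (PiM J (\<lambda>_. borel)) (\<lambda>a. restrict a J)" if "J \<subseteq> {..<n}" for n k
    proof -
      have "distr (measure_pmf (pm n)) (PiM J (\<lambda>_. borel)) (\<lambda>a. restrict a J)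
          = distr (distr (measure_pmf (pm (n + k))) (count_space UNIV) (win 0 n)) (PiM J (\<lambda>_. borel)) (\<lambda>a. restrict a J)"
        unfolding map_pmf_rep_eq[symmetric] consn ..
      also have "\<dots> = distr (measure_pmf (pm (n + k))) (PiM J (\<lambda>_. borel)) ((\<lambda>a. restrict a J) \<circ> win 0 n)"
        by (subst distr_distr) (auto simp: space_PiM)
      also have "(\<lambda>a. restrict a J) \<circ> win 0 n = (\<lambda>a. restrict a J)" using rr[OF that] by (auto simp: comp_def)
      finally show ?thesis .
    qed
    have "distr (measure_pmf (pm (b J))) (PiM J (\<lambda>_. borel)) (\<lambda>a. restrict a J)
        = distr (measure_pmf (pm (b J + m))) (PiM J (\<lambda>_. borel)) (\<lambda>a. restrict a J)"
      by (rule *[OF b[OF that(1)]])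
    also have "\<dots> = distr (measure_pmf (pm m)) (PiM J (\<lambda>_. borel)) (\<lambda>a. restrict a J)"
      using *[OF that(2), of "b J"] by (simp add: add.commute)
    finally show ?thesis by (simp add: P_def)
  qed
  have proj: "P J = distr (P Hs) (PiM J (\<lambda>_. borel)) (\<lambda>f. restrict f J)"
    if JH: "J \<subseteq> Hs" "finite Hs" for J Hs :: "nat set"
  proof -
    have J: "finite J" "J \<subseteq> {..<b Hs}" using JH finite_subset b[OF JH(2)] by auto
    have "distr (P Hs) (PiM J (\<lambda>_. borel)) (\<lambda>f. restrict f J)
        = distr (measure_pmf (pm (b Hs))) (PiM J (\<lambda>_. borel)) ((\<lambda>f. restrict f J) \<circ> (\<lambda>a. restrict a Hs))"
      unfolding P_def using JH(1) by (subst distr_distr) (auto simp: space_PiM intro!: measurable_restrict_subset)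
    also have "(\<lambda>f. restrict f J) \<circ> (\<lambda>a. restrict a Hs) = (\<lambda>a. restrict a J :: nat \<Rightarrow> real)"
      using JH(1) by (auto simp: fun_eq_iff)
    finally have e: "distr (P Hs) (PiM J (\<lambda>_. borel)) (\<lambda>f. restrict f J)
        = distr (measure_pmf (pm (b Hs))) (PiM J (\<lambda>_. borel)) (\<lambda>a. restrict a J)" .
    show ?thesis unfolding e by (rule P_eq[OF J])
  qed
  have probP: "prob_space (P J)" for J :: "nat set"
    unfolding P_def by (rule prob_space.prob_space_distr) (auto simp: measure_pmf.prob_space_axioms space_PiM)
  interpret polish_projective UNIV P
    by (intro polish_projective.intro projective_family.intro probP) (rule proj)
  \<comment> \<open>\<open>clip\<close> is the identity on spins and only serves to land in
    \<open>space Xp\<close>.\<close>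
  define clip :: "(nat \<Rightarrow> real) \<Rightarrow> nat \<Rightarrow> real" where "clip x = (\<lambda>i. if x i = 1 then 1 else -1)" for x
  have clip_meas: "clip \<in> measurable lim Xp"
    unfolding Xp_def
  proof (rule measurable_PiM_single')
    show "clip \<in> space lim \<rightarrow> (\<Pi>\<^sub>E i\<in>UNIV. space (count_space {-1, 1}))" by (auto simp: clip_def PiE_iff)
    fix i :: nat
    have [measurable]: "(\<lambda>x. x i) \<in> borel_measurable lim"
      by (simp add: measurable_component_singleton cong: measurable_cong_sets)
    have "(\<lambda>x. if x i = 1 then 1 else -1) \<in> measurable lim (count_space {-1, 1})"
      by (rule measurable_If) auto
    then show "(\<lambda>x. clip x i) \<in> measurable lim (count_space {-1, 1})" by (simp add: clip_def)
  qed
  define M where "M = distr lim Xp clip"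
  have "prob_space M" unfolding M_def by (rule prob_space.prob_space_distr[OF P.prob_space_axioms clip_meas])
  moreover have "sets M = sets Xp" by (simp add: M_def)
  moreover have "measure M (cyl m a) = pmf (pm m) a" if a: "a \<in> cfg {..<m}" for m a
  proof -
    let ?X = "PiE {..<m} (\<lambda>i. {t :: real. (if t = 1 then 1 else -1) = a i})"
    have mX: "?X \<in> sets (PiM {..<m} (\<lambda>_. borel))"
      by (intro sets_PiM_I_finite) auto
    have "measure M (cyl m a) = measure lim (clip -` cyl m a \<inter> space lim)"
      unfolding M_def by (rule measure_distr[OF clip_meas cyl_sets])
    also have "clip -` cyl m a \<inter> space lim = emb UNIV {..<m} ?X"
      by (auto simp: prod_emb_def clip_def space_Xp space_PiM)
    also have "measure lim \<dots> = measure (P {..<m}) ?X"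
      unfolding measure_def by (subst emeasure_lim_emb) (use mX in auto)
    also have "\<dots> = measure (measure_pmf (pm m)) ((\<lambda>a. restrict a {..<m}) -` ?X \<inter> space (measure_pmf (pm m)))"
      unfolding P_eq[OF finite_lessThan order_refl] by (rule measure_distr) (use mX in \<open>auto simp: space_PiM\<close>)
    also have "\<dots> = measure (measure_pmf (pm m)) {a}"
    proof (rule measure_pmf.finite_measure_eq_AE)
      show "AE x in measure_pmf (pm m). (x \<in> (\<lambda>a. restrict a {..<m}) -` ?X \<inter> space (measure_pmf (pm m))) = (x \<in> {a})"
      proof (rule AE_pmfI)
        fix x assume "x \<in> set_pmf (pm m)"
        then have x: "x \<in> cfg {..<m}" using supp by blast
        have imp: "x = a" if "\<And>i. i < m \<Longrightarrow> (if x i = 1 then 1 else -1) = a i"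
        proof -
          have "win 0 m x = a" unfolding win_eq_iff[OF a]
          proof (intro allI impI)
            fix i assume "i < m"
            then show "x i = a i" using that[of i] cfg_val[OF x, of i] by auto
          qed
          moreover have "win 0 m x = x" using win_eq_iff[OF x] by blast
          ultimately show ?thesis by simp
        qed
        have rfl: "(if a i = 1 then 1 else -1) = a i" if "i < m" for i
          using cfg_val[OF a, of i] that by auto
        have iff: "restrict x {..<m} \<in> ?X \<longleftrightarrow> (\<forall>i<m. (if x i = 1 then 1 else -1) = a i)"
          by (simp add: PiE_iff Ball_def)
        have "restrict x {..<m} \<in> ?X \<longleftrightarrow> x = a"
          unfolding iff
        proof
          assume "\<forall>i<m. (if x i = 1 then 1 else -1) = a i"
          then show "x = a" by (intro imp) simp
        next
          assume "x = a"
          then show "\<forall>i<m. (if x i = 1 then 1 else -1) = a i" using rfl by simp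
        qed
        then show "(x \<in> (\<lambda>a. restrict a {..<m}) -` ?X \<inter> space (measure_pmf (pm m))) = (x \<in> {a})"
          by simp
      qed
    qed auto
    also have "\<dots> = pmf (pm m) a" by (simp add: measure_pmf_single)
    finally show ?thesis .
  qed
  ultimately show ?thesis by blast
qed

lemma gE_nonneg: "finite V \<Longrightarrow> (\<And>x. x \<in> cfg V \<Longrightarrow> 0 \<le> f x) \<Longrightarrow> 0 \<le> gE V U f"
  using gE_mono[of V "\<lambda>_. 0" f U] by simp

text \<open>Limits of word probabilities are consistent because a shorter window is the beginning of
  a longer one at the same place \<open>k n\<close>; \<open>room\<close> guarantees that the window
  eventually lies in the volume.\<close>

lemma ex_limit_measure:
  assumes conv: "\<And>m f. convergent (\<lambda>n. gE {..<N n} (U n) (\<lambda>x. f (win (k n) m x)))"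
    and room: "\<And>m. eventually (\<lambda>n. k n + m \<le> N n) sequentially"
  shows "\<exists>M. prob_space M \<and> sets M = sets Xp \<and>
    (\<forall>m f. (\<lambda>n. gE {..<N n} (U n) (\<lambda>x. f (win (k n) m x))) \<longlonglongrightarrow> integral\<^sup>L M (\<lambda>x. f (win 0 m x)))"
proof -
  define E where "E m f = lim (\<lambda>n. gE {..<N n} (U n) (\<lambda>x. f (win (k n) m x)))" for m f
  have E: "(\<lambda>n. gE {..<N n} (U n) (\<lambda>x. f (win (k n) m x))) \<longlonglongrightarrow> E m f" for m f
    using conv[of f m] by (simp add: E_def convergent_LIMSEQ_iff)
  \<comment> \<open>The value 0 off \<open>cfg\<close> makes p m a probability mass function on all
    functions.\<close>
  define p where "p m a = (if a \<in> cfg {..<m} then E m (\<lambda>b. of_bool (b = a)) else 0)" for m a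
  have p0: "0 \<le> p m a" for m a
    unfolding p_def by (auto intro!: LIMSEQ_le_const[OF E] exI[of _ 0] gE_nonneg)
  have Esum: "E m f = (\<Sum>a\<in>cfg {..<m}. p m a * f a)" for m f
  proof (rule LIMSEQ_unique[OF E])
    have "(\<lambda>n. \<Sum>a\<in>cfg {..<m}. gE {..<N n} (U n) (\<lambda>x. of_bool (win (k n) m x = a)) * f a) \<longlonglongrightarrow> (\<Sum>a\<in>cfg {..<m}. p m a * f a)"
      unfolding p_def using E[of "\<lambda>b. of_bool (b = _)" m] by (intro tendsto_sum tendsto_mult tendsto_const) auto
    moreover have "eventually (\<lambda>n. (\<Sum>a\<in>cfg {..<m}. gE {..<N n} (U n) (\<lambda>x. of_bool (win (k n) m x = a)) * f a)
        = gE {..<N n} (U n) (\<lambda>x. f (win (k n) m x))) sequentially"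
      using room[of m]
    proof eventually_elim
      case (elim n)
      have "(\<Sum>a\<in>cfg {..<m}. gE {..<N n} (U n) (\<lambda>x. of_bool (win (k n) m x = a)) * f a)
          = gE {..<N n} (U n) (\<lambda>x. \<Sum>a\<in>cfg {..<m}. f a * of_bool (win (k n) m x = a))"
        by (simp only: gE_sum[OF finite_cfg[OF finite_lessThan]] gE_cmult) (intro sum.cong refl mult.commute)
      also have "\<dots> = gE {..<N n} (U n) (\<lambda>x. f (win (k n) m x))"
      proof (rule gE_cong[OF refl])
        fix x assume "x \<in> cfg {..<N n}"
        then have "win (k n) m x \<in> cfg {..<m}" by (rule win_cfg) (use elim in auto)
        then show "(\<Sum>a\<in>cfg {..<m}. f a * of_bool (win (k n) m x = a)) = f (win (k n) m x)"
          by (simp add: of_bool_def if_distrib[of "\<lambda>b. _ * b"] finite_cfg cong: if_cong)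
      qed
      finally show ?case .
    qed
    ultimately show "(\<lambda>n. gE {..<N n} (U n) (\<lambda>x. f (win (k n) m x))) \<longlonglongrightarrow> (\<Sum>a\<in>cfg {..<m}. p m a * f a)"
      by (rule Lim_transform_eventually)
  qed
  have p1: "(\<Sum>a\<in>cfg {..<m}. p m a) = 1" for m
  proof -
    have "E m (\<lambda>_. 1) = 1" by (rule LIMSEQ_unique[OF E]) simp
    then show ?thesis using Esum[of m "\<lambda>_. 1"] by simp
  qed
  define pm where "pm m = embed_pmf (p m)" for m
  have nn: "(\<integral>\<^sup>+x. ennreal (p m x) \<partial>count_space UNIV) = 1" for m
  proof -
    have "(\<integral>\<^sup>+x. ennreal (p m x) \<partial>count_space UNIV) = (\<Sum>x\<in>cfg {..<m}. ennreal (p m x))"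
      by (rule nn_integral_count_space'[OF finite_cfg]) (auto simp: p_def)
    then show ?thesis using p0 p1 by (simp add: sum_ennreal)
  qed
  have pm: "pmf (pm m) a = p m a" for m a
    unfolding pm_def by (rule pmf_embed_pmf[OF p0 nn])
  have supp: "set_pmf (pm m) \<subseteq> cfg {..<m}" for m
    by (auto simp: set_pmf_eq pm p_def)
  have "map_pmf (win 0 m) (pm (Suc m)) = pm m" for m
  proof (rule pmf_eqI)
    fix a
    have "pmf (map_pmf (win 0 m) (pm (Suc m))) a = measure (measure_pmf (pm (Suc m))) (win 0 m -` {a} \<inter> set_pmf (pm (Suc m)))"
      by (simp add: pmf_map measure_Int_set_pmf)
    also have "win 0 m -` {a} \<inter> set_pmf (pm (Suc m)) = {b\<in>cfg {..<Suc m}. win 0 m b = a} \<inter> set_pmf (pm (Suc m))"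
      using supp[of "Suc m"] by blast
    also have "measure (measure_pmf (pm (Suc m))) \<dots> = (\<Sum>b\<in>{b\<in>cfg {..<Suc m}. win 0 m b = a}. p (Suc m) b)"
      unfolding measure_Int_set_pmf by (subst measure_measure_pmf_finite) (auto simp: pm)
    also have "\<dots> = (\<Sum>b\<in>cfg {..<Suc m}. p (Suc m) b * of_bool (win 0 m b = a))"
      by (rule sum.mono_neutral_cong_left) auto
    also have "\<dots> = E (Suc m) (\<lambda>b. of_bool (win 0 m b = a))" by (simp add: Esum)
    also have "\<dots> = E m (\<lambda>b. of_bool (b = a))" unfolding E_def by (simp add: win_win)
    also have "\<dots> = p m a"
    proof -
      have "(\<Sum>b\<in>cfg {..<m}. p m b * of_bool (b = a)) = (\<Sum>b\<in>cfg {..<m}. if b = a then p m b else 0)"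
        by (rule sum.cong) simp_all
      also have "\<dots> = (if a \<in> cfg {..<m} then p m a else 0)" by (rule sum.delta) (simp add: finite_cfg)
      also have "\<dots> = p m a" by (simp add: p_def)
      finally show ?thesis unfolding Esum .
    qed
    finally show "pmf (map_pmf (win 0 m) (pm (Suc m))) a = pmf (pm m) a" by (simp add: pm)
  qed
  from extension_Xp[OF supp this] obtain M where M: "prob_space M" "sets M = sets Xp"
    "\<And>m a. a \<in> cfg {..<m} \<Longrightarrow> measure M (cyl m a) = pmf (pm m) a" by blast
  have "integral\<^sup>L M (\<lambda>x. f (win 0 m x)) = E m f" for m f
    by (simp add: integral_local[OF M(1,2)] M(3) pm Esum)
  with E M show ?thesis by auto
qed

section \<open>The half-line Gibbs measure\<close>

lemma convergent_if_Cauchy_bound: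
  fixes a :: "nat \<Rightarrow> real"
  assumes "\<And>n N. n0 \<le> n \<Longrightarrow> n \<le> N \<Longrightarrow> \<bar>a N - a n\<bar> \<le> c n" "c \<longlonglongrightarrow> 0"
  shows "convergent a"
proof -
  have "Cauchy a"
  proof (rule metric_CauchyI)
    fix e :: real assume "0 < e"
    then have "eventually (\<lambda>n. c n < e / 2 \<and> n0 \<le> n) sequentially"
      using order_tendstoD(2)[OF assms(2), of "e / 2"] eventually_ge_at_top[of n0] by (auto intro: eventually_conj)
    then obtain n where n: "c n < e / 2" "n0 \<le> n" by (auto simp: eventually_sequentially)
    have "dist (a i) (a j) < e" if "n \<le> i" "n \<le> j" for i j
      using assms(1)[OF n(2) that(1)] assms(1)[OF n(2) that(2)] n(1) unfolding dist_real_def by linarith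
    then show "\<exists>M. \<forall>m\<ge>M. \<forall>n\<ge>M. dist (a m) (a n) < e" by blast
  qed
  then show ?thesis by (simp add: Cauchy_convergent_iff)
qed

lemma cfg_fun_bounded:
  fixes f :: "_ \<Rightarrow> real"
  assumes "finite V" shows "\<exists>M. \<forall>a. a \<in> cfg V \<longrightarrow> \<bar>f a\<bar> \<le> M"
proof (intro exI allI impI)
  fix a assume "a \<in> cfg V"
  then show "\<bar>f a\<bar> \<le> (\<Sum>b\<in>cfg V. \<bar>f b\<bar>)"
    by (intro member_le_sum) (simp_all add: finite_cfg assms)
qed

lemma Cesaro:
  fixes a :: "nat \<Rightarrow> real"
  assumes "a \<longlonglongrightarrow> L"
  shows "(\<lambda>n. (\<Sum>k<n. a k) / real n) \<longlonglongrightarrow> L"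
proof (rule LIMSEQ_I)
  fix e :: real assume e: "0 < e"
  then obtain n0 where n0: "\<And>n. n0 \<le> n \<Longrightarrow> \<bar>a n - L\<bar> < e / 2"
    using LIMSEQ_D[OF assms, of "e / 2"] by auto
  define C where "C = (\<Sum>k<n0. \<bar>a k - L\<bar>)"
  have C: "0 \<le> C" by (simp add: C_def sum_nonneg)
  obtain n1 where n1: "C < real n1 * (e / 2)" using reals_Archimedean3[of "e / 2"] e by auto
  have "norm ((\<Sum>k<n. a k) / real n - L) < e" if n: "max (Suc n0) n1 \<le> n" for n
  proof -
    have np: "0 < real n" using n by simp
    have "(\<Sum>k<n. a k) / real n - L = (\<Sum>k<n. a k - L) / real n"
      using np by (simp add: sum_subtractf field_simps)
    moreover have "\<bar>\<Sum>k<n. a k - L\<bar> \<le> C + real n * (e / 2)"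
    proof -
      have "\<bar>\<Sum>k<n. a k - L\<bar> \<le> (\<Sum>k<n. \<bar>a k - L\<bar>)" by (rule sum_abs)
      also have "\<dots> \<le> (\<Sum>k<n. (if k < n0 then \<bar>a k - L\<bar> else 0) + e / 2)"
        using n0 e by (intro sum_mono) (auto simp: not_less less_imp_le)
      also have "\<dots> = (\<Sum>k<n. (if k < n0 then \<bar>a k - L\<bar> else 0)) + real n * (e / 2)" by (simp add: sum.distrib)
      also have "(\<Sum>k<n. (if k < n0 then \<bar>a k - L\<bar> else 0)) = C"
        unfolding C_def using n by (intro sum.mono_neutral_cong_right) auto
      finally show ?thesis .
    qed
    moreover have "C < real n * (e / 2)"
    proof -
      have "real n1 * (e / 2) \<le> real n * (e / 2)" using n e by (intro mult_right_mono) auto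
      then show ?thesis using n1 by linarith
    qed
    ultimately have "(\<Sum>k<n. a k) / real n - L = (\<Sum>k<n. a k - L) / real n" "\<bar>\<Sum>k<n. a k - L\<bar> < real n * e"
      by linarith+
    then have "\<bar>(\<Sum>k<n. a k) / real n - L\<bar> < (real n * e) / real n"
      using np by (simp add: abs_divide divide_less_eq mult.commute)
    then show ?thesis using np by simp
  qed
  then show "\<exists>no. \<forall>n\<ge>no. norm ((\<Sum>k<n. a k) / real n - L) < e" by blast
qed

lemma birkhoff_sum_add:
  "birkhoff_sum (m + n) f x = birkhoff_sum m f x + birkhoff_sum n f (\<lambda>i. x (m + i))"
proof -
  have "(\<Sum>k<m + n. g k) = (\<Sum>k<m. g k) + (\<Sum>k<n. g (m + k))" for g :: "nat \<Rightarrow> real"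
    by (induction n) auto
  then show ?thesis by (simp add: birkhoff_sum_def shift_funpow add.assoc)
qed

lemma shift_measurable [measurable]: "(\<lambda>x i. x (k + i)) \<in> measurable Xp Xp"
proof -
  have "(\<lambda>x. \<lambda>i\<in>UNIV. x (k + i)) \<in> measurable Xp (PiM UNIV (\<lambda>_. count_space {-1, 1 :: real}))"
    by (rule measurable_restrict) measurable
  moreover have "(\<lambda>x. \<lambda>i\<in>UNIV. x (k + i)) = (\<lambda>(x :: nat \<Rightarrow> real) i. x (k + i))" by (simp add: restrict_def)
  ultimately show ?thesis by (simp only: Xp_def)
qed

text \<open>The polynomial extension to \<open>cube\<close> of the indicator of a cylinder.\<close>
definition chi :: "nat \<Rightarrow> (nat \<Rightarrow> real) \<Rightarrow> (nat \<Rightarrow> real) \<Rightarrow> real" where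
  "chi m a x = (\<Prod>i<m. (1 + a i * x i) / 2)"

lemma chi_eq:
  assumes "a \<in> cfg {..<m}" "\<And>i. i < m \<Longrightarrow> x i = -1 \<or> x i = 1"
  shows "chi m a x = of_bool (\<forall>i<m. x i = a i)"
proof (cases "\<forall>i<m. x i = a i")
  case True
  then have "(1 + a i * x i) / 2 = 1" if "i < m" for i using cfg_sq[OF assms(1), of i] that by simp
  then show ?thesis using True by (simp add: chi_def)
next
  case False
  then obtain i where i: "i < m" "x i \<noteq> a i" by blast
  then have "(1 + a i * x i) / 2 = 0" using cfg_val[OF assms(1), of i] assms(2)[of i] by auto
  then show ?thesis using False i(1) by (auto simp: chi_def prod_zero_iff)
qed

lemma chi_Xp: "a \<in> cfg {..<m} \<Longrightarrow> x \<in> space Xp \<Longrightarrow> chi m a x = indicator (cyl m a) x"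
  by (subst chi_eq) (simp_all add: space_Xp indicator_def)

lemma continuous_chi [continuous_intros]: "continuous_on A (\<lambda>x. chi m a (\<lambda>i. x (k + i)))"
  unfolding chi_def by (intro continuous_intros) simp

lemma cyl_Int_space: "cyl m a \<inter> space Xp = cyl m a"
  by blast

lemma integral_chi:
  assumes M: "prob_space M" "sets M = sets Xp" and a: "a \<in> cfg {..<m}"
  shows "integral\<^sup>L M (chi m a) = measure M (cyl m a)"
proof -
  have sp: "space M = space Xp" using M(2) by (rule sets_eq_imp_space_eq)
  have "integral\<^sup>L M (chi m a) = integral\<^sup>L M (indicator (cyl m a))"
    by (rule Bochner_Integration.integral_cong[OF refl]) (simp only: sp chi_Xp[OF a])
  also have "\<dots> = measure M (cyl m a)"
    by (simp only: Bochner_Integration.integral_indicator sp cyl_Int_space)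
  finally show ?thesis .
qed

lemma concat1_cube: "x \<in> cube \<Longrightarrow> \<bar>c\<bar> \<le> 1 \<Longrightarrow> concat1 c x \<in> cube"
  by (auto simp: cube_def concat1_def abs_le_iff split: nat.split)

lemma continuous_glue:
  assumes F: "continuous_on cube F" and a: "a \<in> cfg {..<n}"
  shows "continuous_on cube (\<lambda>x. F (glue n a x))"
proof (rule continuous_on_compose2[OF F])
  show "continuous_on cube (glue n a)"
  proof (rule continuous_on_coordinatewise_then_product)
    fix i show "continuous_on cube (\<lambda>x. glue n a x i)"
      by (cases "i < n") (simp_all add: glue_def continuous_on_coord)
  qed
qed (use glue_cube[OF a] in blast)

lemma continuous_concat1:
  assumes F: "continuous_on cube F" and c: "\<bar>c\<bar> \<le> 1"
  shows "continuous_on cube (\<lambda>x. F (concat1 c x))"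
proof (rule continuous_on_compose2[OF F])
  show "continuous_on cube (concat1 c)"
  proof (rule continuous_on_coordinatewise_then_product)
    fix i show "continuous_on cube (\<lambda>x. concat1 c x i)"
      by (cases i) (simp_all add: concat1_def continuous_on_coord)
  qed
qed (use concat1_cube[OF _ c] in blast)

context high_temperature
begin

lemma continuous_bfield: "continuous_on cube (\<lambda>x. bfield n x k)"
proof -
  have "uniform_limit cube (\<lambda>N x. \<Sum>l<N. w k (n + l) * x (n + l)) (\<lambda>x. \<Sum>l. w k (n + l) * x (n + l)) sequentially"
  proof (rule Weierstrass_m_test[OF _ summable_w])
    fix l and x :: "nat \<Rightarrow> real" assume "x \<in> cube"
    then show "norm (w k (n + l) * x (n + l)) \<le> w k (n + l)"
      using cube_abs[of x "n + l"] mult_left_mono[of "\<bar>x (n + l)\<bar>" 1 "w k (n + l)"] by (simp add: abs_mult)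
  qed
  then show ?thesis unfolding bfield_def
    by (rule uniform_limit_theorem[rotated]) (auto intro!: continuous_intros always_eventually)
qed

lemma continuous_dyson: "continuous_on cube \<phi>"
proof (rule continuous_on_eq)
  show "continuous_on cube (\<lambda>x. \<beta> * (x 0 * bfield 1 x 0))"
    by (intro continuous_intros continuous_bfield)
  fix x assume "x \<in> cube"
  then show "\<beta> * (x 0 * bfield 1 x 0) = \<phi> x" using dyson_eq[of x 0] by simp
qed

lemma continuous_birkhoff_glue:
  assumes a: "a \<in> cfg {..<n}"
  shows "continuous_on cube (\<lambda>x. birkhoff_sum n \<phi> (glue n a x))"
proof (rule continuous_on_eq)
  show "continuous_on cube (\<lambda>x. ising {..<n} (\<lambda>i j. \<beta> * w i j) (\<lambda>i. \<beta> * bfield n x i) a)"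
    unfolding ising_def by (intro continuous_intros continuous_bfield) auto
qed (simp add: birkhoff_glue[OF a])

text \<open>The half-line Gibbs specification: the first n spins are resampled given the rest;
  \<open>kern\<close> holds its weights.\<close>

definition spec :: "nat \<Rightarrow> ((nat \<Rightarrow> real) \<Rightarrow> real) \<Rightarrow> (nat \<Rightarrow> real) \<Rightarrow> real" where
  "spec n F x = gE {..<n} (\<lambda>b. birkhoff_sum n \<phi> (glue n b x)) (\<lambda>b. F (glue n b x))"

definition kern :: "nat \<Rightarrow> (nat \<Rightarrow> real) \<Rightarrow> (nat \<Rightarrow> real) \<Rightarrow> real" where
  "kern n a x = exp (birkhoff_sum n \<phi> (glue n a x)) / (\<Sum>b\<in>cfg {..<n}. exp (birkhoff_sum n \<phi> (glue n b x)))"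

lemma continuous_spec:
  assumes F: "continuous_on cube F"
  shows "continuous_on cube (spec n F)"
  unfolding spec_def[abs_def] gE_def
proof (intro continuous_on_divide continuous_on_sum continuous_on_mult continuous_on_exp
    continuous_birkhoff_glue continuous_glue[OF F] ballI)
  fix x
  show "(\<Sum>b\<in>cfg {..<n}. exp (birkhoff_sum n \<phi> (glue n b x))) \<noteq> 0"
    using partition_pos[OF finite_lessThan, of "\<lambda>b. birkhoff_sum n \<phi> (glue n b x)" n] by linarith
qed

lemma continuous_kern: "a \<in> cfg {..<n} \<Longrightarrow> continuous_on cube (kern n a)"
  unfolding kern_def[abs_def]
proof (intro continuous_on_divide continuous_on_sum continuous_on_exp continuous_birkhoff_glue ballI)
  fix x
  show "(\<Sum>b\<in>cfg {..<n}. exp (birkhoff_sum n \<phi> (glue n b x))) \<noteq> 0"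
    using partition_pos[OF finite_lessThan, of "\<lambda>b. birkhoff_sum n \<phi> (glue n b x)" n] by linarith
qed

lemma kern_pos: "0 < kern n a x"
  unfolding kern_def using partition_pos[OF finite_lessThan, of "\<lambda>b. birkhoff_sum n \<phi> (glue n b x)" n] by simp

lemma spec_eq_sum: "spec n F x = (\<Sum>b\<in>cfg {..<n}. kern n b x * F (glue n b x))"
  by (simp add: spec_def gE_def kern_def sum_divide_distrib)

definition is_half_line_limit :: "(nat \<Rightarrow> real) measure \<Rightarrow> bool" where
  "is_half_line_limit M \<longleftrightarrow> prob_space M \<and> sets M = sets Xp \<and>
    (\<forall>m f. (\<lambda>n. gibbs n (\<lambda>x. f (win 0 m x))) \<longlonglongrightarrow> integral\<^sup>L M (\<lambda>x. f (win 0 m x)))"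

text \<open>Free blocks as for the half-line limit, but seen from the middle: the limit is the right
  half of the two-sided measure.\<close>

definition is_bulk_limit :: "(nat \<Rightarrow> real) measure \<Rightarrow> bool" where
  "is_bulk_limit M \<longleftrightarrow> prob_space M \<and> sets M = sets Xp \<and>
    (\<forall>m f. (\<lambda>r. gibbs (2 * r) (\<lambda>x. f (win r m x))) \<longlonglongrightarrow> integral\<^sup>L M (\<lambda>x. f (win 0 m x)))"

lemma tendsto_tail_bound: "filterlim g at_top sequentially \<Longrightarrow> (\<lambda>n. c * \<tau> (g n)) \<longlonglongrightarrow> 0"
  using tendsto_mult[OF tendsto_const[of c] filterlim_compose[OF tail_sum_tendsto[OF alpha]]] by fastforce

lemma filterlim_minus_nat: "filterlim (\<lambda>n. n - m :: nat) at_top sequentially"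
  unfolding filterlim_at_top
proof
  fix Z show "eventually (\<lambda>n. Z \<le> n - m) sequentially"
    using eventually_ge_at_top[of "Z + m"] by eventually_elim simp
qed

lemma ex_half_line_limit: "\<exists>M. is_half_line_limit M"
proof -
  have "convergent (\<lambda>n. gibbs n (\<lambda>x. f (win 0 m x)))" for m f
  proof -
    obtain M where M: "\<And>a. a \<in> cfg {..<m} \<Longrightarrow> \<bar>f a\<bar> \<le> M" using cfg_fun_bounded[of "{..<m}" f] by auto
    show ?thesis
    proof (rule convergent_if_Cauchy_bound[of m])
      show "(\<lambda>n. (real m * (2 * M * (2 * (1 + K) * \<beta>))) * \<tau> (n - m)) \<longlonglongrightarrow> 0"
        by (rule tendsto_tail_bound[OF filterlim_minus_nat])
      fix n N :: nat assume "m \<le> n" "n \<le> N"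
      from half_line_Cauchy[OF this M]
      show "\<bar>gibbs N (\<lambda>x. f (win 0 m x)) - gibbs n (\<lambda>x. f (win 0 m x))\<bar> \<le> (real m * (2 * M * (2 * (1 + K) * \<beta>))) * \<tau> (n - m)"
        by (simp only: mult.assoc)
    qed
  qed
  then show ?thesis
    using ex_limit_measure[of "\<lambda>n. n" "\<lambda>n. H {..<n}" "\<lambda>_. 0"]
    by (simp add: is_half_line_limit_def eventually_ge_at_top)
qed

lemma ex_bulk_limit: "\<exists>M. is_bulk_limit M"
proof -
  have "convergent (\<lambda>r. gibbs (2 * r) (\<lambda>x. f (win r m x)))" for m f
  proof -
    obtain M where M: "\<And>a. a \<in> cfg {..<m} \<Longrightarrow> \<bar>f a\<bar> \<le> M" using cfg_fun_bounded[of "{..<m}" f] by auto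
    show ?thesis
    proof (rule convergent_if_Cauchy_bound[of m])
      show "(\<lambda>n. (real m * (2 * M * (4 * (1 + K) * \<beta>))) * \<tau> (n - m)) \<longlonglongrightarrow> 0"
        by (rule tendsto_tail_bound[OF filterlim_minus_nat])
      fix n N :: nat assume nN: "m \<le> n" "n \<le> N"
      have 1: "\<bar>gibbs (2 * N) (\<lambda>x. f (win N m x)) - gibbs (m + 2 * (n - m)) (\<lambda>x. f (win (n - m) m x))\<bar>
          \<le> real m * (2 * M * (2 * (1 + K) * \<beta> * \<tau> (n - m)))"
        by (rule bulk_Cauchy[OF _ _ M]) (use nN in auto)
      have 2: "\<bar>gibbs (2 * n) (\<lambda>x. f (win n m x)) - gibbs (m + 2 * (n - m)) (\<lambda>x. f (win (n - m) m x))\<bar>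
          \<le> real m * (2 * M * (2 * (1 + K) * \<beta> * \<tau> (n - m)))"
        by (rule bulk_Cauchy[OF _ _ M]) (use nN in auto)
      show "\<bar>gibbs (2 * N) (\<lambda>x. f (win N m x)) - gibbs (2 * n) (\<lambda>x. f (win n m x))\<bar>
          \<le> (real m * (2 * M * (4 * (1 + K) * \<beta>))) * \<tau> (n - m)"
      proof -
        have "(real m * (2 * M * (4 * (1 + K) * \<beta>))) * \<tau> (n - m) = 2 * (real m * (2 * M * (2 * (1 + K) * \<beta> * \<tau> (n - m))))"
          by simp
        then show ?thesis using 1 2 by linarith
      qed
    qed
  qed
  moreover have "eventually (\<lambda>n. n + m \<le> 2 * n) sequentially" for m
    using eventually_ge_at_top[of m] by eventually_elim simp
  ultimately show ?thesis
    using ex_limit_measure[of "\<lambda>n. 2 * n" "\<lambda>n. H {..<2 * n}" "\<lambda>n. n"]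
    by (simp add: is_bulk_limit_def)
qed

definition \<nu> where "\<nu> = (SOME M. is_half_line_limit M)"
definition \<mu> where "\<mu> = (SOME M. is_bulk_limit M)"

lemma is_half_line_limit_nu: "is_half_line_limit \<nu>"
  unfolding \<nu>_def by (rule someI_ex[OF ex_half_line_limit])

lemma is_bulk_limit_mu: "is_bulk_limit \<mu>"
  unfolding \<mu>_def by (rule someI_ex[OF ex_bulk_limit])

lemma nu_prob: "prob_space \<nu>" and nu_sets [measurable_cong, simp]: "sets \<nu> = sets Xp"
  and nu_lim: "(\<lambda>n. gibbs n (\<lambda>x. f (win 0 m x))) \<longlonglongrightarrow> integral\<^sup>L \<nu> (\<lambda>x. f (win 0 m x))"
  using is_half_line_limit_nu unfolding is_half_line_limit_def by blast+

lemma mu_prob: "prob_space \<mu>" and mu_sets [measurable_cong, simp]: "sets \<mu> = sets Xp"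
  and mu_lim: "(\<lambda>r. gibbs (2 * r) (\<lambda>x. f (win r m x))) \<longlonglongrightarrow> integral\<^sup>L \<mu> (\<lambda>x. f (win 0 m x))"
  using is_bulk_limit_mu unfolding is_bulk_limit_def by blast+

lemma nu_space [simp]: "space \<nu> = space Xp" and mu_space [simp]: "space \<mu> = space Xp"
  by (rule sets_eq_imp_space_eq, simp)+

lemma nu_lim_continuous:
  assumes "continuous_on cube F"
  shows "(\<lambda>n. gibbs n (\<lambda>x. F (ext n x))) \<longlonglongrightarrow> integral\<^sup>L \<nu> F"
  using gE_tendsto_continuous[OF assms nu_prob nu_sets, of "\<lambda>n. n" "\<lambda>n. H {..<n}" "\<lambda>_. 0" "\<lambda>n. n"] nu_lim
  by (simp add: filterlim_ident)

lemma nu_cyl: "a \<in> cfg {..<m} \<Longrightarrow> (\<lambda>n. gibbs n (\<lambda>x. of_bool (win 0 m x = a))) \<longlonglongrightarrow> measure \<nu> (cyl m a)"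
  using nu_lim[of "\<lambda>b. of_bool (b \<in> {a})" m] measure_local_set_integral[OF nu_prob nu_sets, of m "{a}"]
  by (simp add: cyl_eq_local_set del: mem_Collect_eq)

text \<open>The second summand does not involve the first n spins, so it cancels when they are
  resampled.\<close>

lemma birkhoff_merge:
  assumes "n \<le> N" "x \<in> cfg {..<N}" "a \<in> cfg {..<n}"
  shows "H {..<N} (\<lambda>i. if i < n then a i else x i) = birkhoff_sum n \<phi> (glue n a (ext N x)) + birkhoff_sum (N - n) \<phi> (\<lambda>i. ext N x (n + i))"
    "ext N (\<lambda>i. if i < n then a i else x i) = glue n a (ext N x)"
proof -
  show e: "ext N (\<lambda>i. if i < n then a i else x i) = glue n a (ext N x)"
    using assms(1) by (auto simp: ext_def glue_def)
  have "(\<lambda>i. if i < n then a i else x i) \<in> cfg {..<N}"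
    using assms by (simp add: PiE_iff extensional_def)
  then have "H {..<N} (\<lambda>i. if i < n then a i else x i) = birkhoff_sum N \<phi> (glue n a (ext N x))"
    by (simp add: birkhoff_ext[symmetric] e)
  also have "\<dots> = birkhoff_sum n \<phi> (glue n a (ext N x)) + birkhoff_sum (N - n) \<phi> (\<lambda>i. glue n a (ext N x) (n + i))"
    using birkhoff_sum_add[of n "N - n"] assms(1) by simp
  finally show "H {..<N} (\<lambda>i. if i < n then a i else x i) = birkhoff_sum n \<phi> (glue n a (ext N x)) + birkhoff_sum (N - n) \<phi> (\<lambda>i. ext N x (n + i))"
    by (simp add: glue_def)
qed

text \<open>Exact already in finite volume, since zeros beyond N are an admissible boundary
  condition for the specification extended to \<open>cube\<close>.\<close>

lemma gibbs_spec:
  assumes "n \<le> N"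
  shows "gibbs N (\<lambda>x. F (ext N x)) = gibbs N (\<lambda>x. spec n F (ext N x))"
proof -
  have "gibbs N (\<lambda>x. F (ext N x)) = gibbs N (\<lambda>x. gE {..<n} (\<lambda>a. H {..<N} (\<lambda>i. if i \<in> {..<n} then a i else x i))
      (\<lambda>a. F (ext N (\<lambda>i. if i \<in> {..<n} then a i else x i))))"
    using assms by (intro gE_tower) auto
  also have "\<dots> = gibbs N (\<lambda>x. spec n F (ext N x))"
  proof (rule gE_cong[OF refl])
    fix x assume x: "x \<in> cfg {..<N}"
    have "gE {..<n} (\<lambda>a. H {..<N} (\<lambda>i. if i \<in> {..<n} then a i else x i)) (\<lambda>a. F (ext N (\<lambda>i. if i \<in> {..<n} then a i else x i)))
        = gE {..<n} (\<lambda>a. birkhoff_sum n \<phi> (glue n a (ext N x)) + birkhoff_sum (N - n) \<phi> (\<lambda>i. ext N x (n + i))) (\<lambda>a. F (glue n a (ext N x)))"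
      using birkhoff_merge[OF assms x] by (intro gE_cong) simp_all
    also have "\<dots> = spec n F (ext N x)"
      unfolding spec_def by (rule gE_shift_energy) (rule refl)
    finally show "gE {..<n} (\<lambda>a. H {..<N} (\<lambda>i. if i \<in> {..<n} then a i else x i)) (\<lambda>a. F (ext N (\<lambda>i. if i \<in> {..<n} then a i else x i)))
        = spec n F (ext N x)" .
  qed
  finally show ?thesis .
qed

text \<open>The specification maps continuous functions to continuous functions, so the
  finite-volume identity passes to the limit.\<close>

lemma nu_DLR:
  assumes F: "continuous_on cube F"
  shows "integral\<^sup>L \<nu> F = integral\<^sup>L \<nu> (spec n F)"
proof (rule LIMSEQ_unique[OF nu_lim_continuous[OF F]])
  have "eventually (\<lambda>N. gibbs N (\<lambda>x. spec n F (ext N x)) = gibbs N (\<lambda>x. F (ext N x))) sequentially"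
    using eventually_ge_at_top[of n] by eventually_elim (rule gibbs_spec[symmetric])
  then show "(\<lambda>N. gibbs N (\<lambda>x. F (ext N x))) \<longlonglongrightarrow> integral\<^sup>L \<nu> (spec n F)"
    by (rule Lim_transform_eventually[OF nu_lim_continuous[OF continuous_spec[OF F]]])
qed

text \<open>The DLR equation tested on a word in the first n spins times a word in the following
  ones; these products determine the conditional probability given the tail.\<close>

lemma nu_DLR_cyl:
  assumes a: "a \<in> cfg {..<n}" and b: "b \<in> cfg {..<m}"
  shows "integral\<^sup>L \<nu> (\<lambda>x. chi n a x * chi m b (\<lambda>i. x (n + i))) = integral\<^sup>L \<nu> (\<lambda>x. kern n a x * chi m b (\<lambda>i. x (n + i)))"
proof -
  let ?F = "\<lambda>x. chi n a x * chi m b (\<lambda>i. x (n + i))"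
  have F: "continuous_on cube ?F"
    using continuous_chi[of cube n a 0] by (intro continuous_intros) simp
  have "spec n ?F x = kern n a x * chi m b (\<lambda>i. x (n + i))" for x
  proof -
    have ch: "chi n a (glue n c x) = of_bool (c = a)" if c: "c \<in> cfg {..<n}" for c
    proof -
      have "chi n a (glue n c x) = of_bool (\<forall>i<n. glue n c x i = a i)"
        by (rule chi_eq[OF a]) (use cfg_val[OF c] in \<open>simp add: glue_def\<close>)
      moreover have "(\<forall>i<n. glue n c x i = a i) \<longleftrightarrow> c = a"
      proof -
        have "(\<forall>i<n. c i = a i) \<longleftrightarrow> win 0 n c = a" by (rule win_eq_iff[OF a, symmetric])
        moreover have "win 0 n c = c" using win_eq_iff[OF c, of c] by blast
        ultimately show ?thesis by (simp add: glue_def)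
      qed
      ultimately show ?thesis by simp
    qed
    have "spec n ?F x = (\<Sum>c\<in>cfg {..<n}. if c = a then kern n c x * chi m b (\<lambda>i. x (n + i)) else 0)"
      unfolding spec_eq_sum
    proof (rule sum.cong[OF refl])
      fix c assume "c \<in> cfg {..<n}"
      from ch[OF this] show "kern n c x * (chi n a (glue n c x) * chi m b (\<lambda>i. glue n c x (n + i)))
          = (if c = a then kern n c x * chi m b (\<lambda>i. x (n + i)) else 0)" by (simp add: glue_def)
    qed
    also have "\<dots> = kern n a x * chi m b (\<lambda>i. x (n + i))"
      using a by (subst sum.delta) (simp_all add: finite_cfg)
    finally show ?thesis .
  qed
  then show ?thesis using nu_DLR[OF F, of n] by (simp add: cong: Bochner_Integration.integral_cong)
qed

end

section \<open>Conditioning on the spins from n on\<close>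

lemma space_tail_from [simp]: "space (tail_from n) = space Xp"
  unfolding tail_from_def by (simp add: space_measure_of_conv)

lemma sets_tail_from: "sets (tail_from n) = sigma_sets (space Xp) {{x\<in>space Xp. x k \<in> A} | k A. n \<le> k}"
  unfolding tail_from_def by (rule sets_measure_of) auto

lemma shift_Xp: "x \<in> space Xp \<Longrightarrow> (\<lambda>i. x (n + i)) \<in> space Xp"
  by (simp add: space_Xp)

lemma shift_tail_measurable: "(\<lambda>x i. x (n + i)) \<in> measurable (tail_from n) Xp"
proof -
  have "(\<lambda>x i. x (n + i)) \<in> measurable (tail_from n) (PiM UNIV (\<lambda>_. count_space {-1, 1 :: real}))"
  proof (rule measurable_PiM_single')
    show "(\<lambda>x i. x (n + i)) \<in> space (tail_from n) \<rightarrow> (\<Pi>\<^sub>E i\<in>UNIV. space (count_space {-1, 1 :: real}))"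
      by (simp add: space_Xp PiE_iff)
    fix i :: nat
    show "(\<lambda>x. x (n + i)) \<in> measurable (tail_from n) (count_space {-1, 1 :: real})"
    proof (rule measurableI)
      fix A
      have "(\<lambda>x. x (n + i)) -` A \<inter> space (tail_from n) = {x\<in>space Xp. x (n + i) \<in> A}" by auto
      then show "(\<lambda>x. x (n + i)) -` A \<inter> space (tail_from n) \<in> sets (tail_from n)"
        unfolding sets_tail_from by (auto intro!: sigma_sets.Basic exI[of _ "n + i"] exI[of _ A])
    qed (simp add: space_Xp; blast)
  qed
  then show ?thesis by (simp add: Xp_def)
qed

text \<open>The spins from n on generate the same events as the n-fold shift, so identities on tail
  events become equalities of measures on \<open>Xp\<close>.\<close>

lemma tail_from_preimage:
  assumes "A \<in> sets (tail_from n)"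
  shows "\<exists>B\<in>sets Xp. A = {x\<in>space Xp. (\<lambda>i. x (n + i)) \<in> B}"
  using assms unfolding sets_tail_from
proof (induction rule: sigma_sets.induct)
  case (Basic A)
  then obtain k C where A: "A = {x\<in>space Xp. x k \<in> C}" "n \<le> k" by blast
  have "{y\<in>space Xp. y (k - n) \<in> C} = local_set (Suc (k - n)) {a. a (k - n) \<in> C}"
    by (auto simp: local_set_def win_def)
  then have "{y\<in>space Xp. y (k - n) \<in> C} \<in> sets Xp" by (simp add: local_set_sets)
  moreover have "A = {x\<in>space Xp. (\<lambda>i. x (n + i)) \<in> {y\<in>space Xp. y (k - n) \<in> C}}"
    using A shift_Xp by auto
  ultimately show ?case by blast
next
  case Empty
  then show ?case by (intro bexI[of _ "{}"]) auto
next
  case (Compl A)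
  then obtain B where "B \<in> sets Xp" "A = {x\<in>space Xp. (\<lambda>i. x (n + i)) \<in> B}" by blast
  then show ?case by (intro bexI[of _ "space Xp - B"]) (auto simp: shift_Xp)
next
  case (Union A)
  then have "\<forall>i. \<exists>B. B \<in> sets Xp \<and> A i = {x\<in>space Xp. (\<lambda>j. x (n + j)) \<in> B}" by blast
  then obtain B where "\<forall>i. B i \<in> sets Xp \<and> A i = {x\<in>space Xp. (\<lambda>j. x (n + j)) \<in> B i}" by (rule choice[THEN exE])
  then show ?case by (intro bexI[of _ "\<Union>i. B i"]) auto
qed

lemma subalgebra_tail:
  assumes "sets M = sets Xp"
  shows "subalgebra M (tail_from n)"
  unfolding subalgebra_def
proof
  show "space (tail_from n) = space M" using assms sets_eq_imp_space_eq[OF assms] by simp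
  show "sets (tail_from n) \<subseteq> sets M"
  proof
    fix A assume "A \<in> sets (tail_from n)"
    then obtain B where B: "B \<in> sets Xp" "A = {x\<in>space Xp. (\<lambda>i. x (n + i)) \<in> B}" using tail_from_preimage by blast
    have "(\<lambda>x i. x (n + i)) -` B \<inter> space Xp \<in> sets Xp" by (rule measurable_sets[OF shift_measurable B(1)])
    then show "A \<in> sets M" unfolding B(2) assms by (simp add: vimage_def Int_def conj_commute)
  qed
qed

lemma sigma_finite_tail:
  assumes "prob_space M" "sets M = sets Xp"
  shows "sigma_finite_subalgebra M (tail_from n)"
proof -
  interpret prob_space M by fact
  have "finite_measure_subalgebra M (tail_from n)"
    by (intro finite_measure_subalgebra.intro finite_measure_axioms finite_measure_subalgebra_axioms.intro subalgebra_tail assms)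
  then interpret finite_measure_subalgebra M "tail_from n" .
  show ?thesis by (rule sigma_finite_subalgebra_axioms)
qed

context high_temperature
begin

lemma words_eq: "words n = cfg {..<n}"
  by (simp add: words_def)

text \<open>\<open>glue\<close> overwrites the first n spins before they are read, so any fixed word
  may be put there.\<close>

lemma kern_tail: "kern n a x = kern n a (glue n (\<lambda>_. 1) x)"
  unfolding kern_def by (simp add: glue_def if_distrib cong: if_cong)

lemma kern_measurable_tail: "a \<in> cfg {..<n} \<Longrightarrow> kern n a \<in> borel_measurable (tail_from n)"
proof -
  assume a: "a \<in> cfg {..<n}"
  let ?g = "\<lambda>y i. if i < n then 1 else y (i - n) :: real"
  have c: "continuous_on cube (\<lambda>y. kern n a (?g y))"
  proof (rule continuous_on_compose2[OF continuous_kern[OF a]])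
    show "continuous_on cube ?g"
    proof (rule continuous_on_coordinatewise_then_product)
      fix i show "continuous_on cube (\<lambda>y. ?g y i)"
        by (cases "i < n") (simp_all add: continuous_on_coord)
    qed
    show "?g ` cube \<subseteq> cube" by (auto simp: cube_def)
  qed
  have "(\<lambda>x. kern n a (?g (\<lambda>i. x (n + i)))) \<in> borel_measurable (tail_from n)"
    by (rule measurable_compose[OF shift_tail_measurable continuous_cube_measurable[OF c]])
  moreover have "kern n a (?g (\<lambda>i. x (n + i))) = kern n a x" for x
  proof -
    have "?g (\<lambda>i. x (n + i)) = glue n (\<lambda>_. 1) x" by (auto simp: glue_def)
    then show ?thesis using kern_tail[of n a x] by simp
  qed
  ultimately show ?thesis by (simp cong: measurable_cong)
qed

text \<open>Weighting \<nu> by g and pushing it forward by the n-fold shift gives a measure that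
  records all integrals of g over tail events. For the cylinder indicator and for
  \<open>kern\<close> these measures agree on cylinders by \<open>nu_DLR_cyl\<close>.\<close>

lemma nu_half_line_gibbs: "half_line_gibbs \<phi> \<nu>"
  unfolding half_line_gibbs_def words_eq
proof (intro conjI allI impI ballI)
  show "prob_space \<nu>" "sets \<nu> = sets Xp" by (simp_all add: nu_prob)
  fix n :: nat and a assume a: "a \<in> cfg {..<n}"
  interpret prob_space \<nu> by (rule nu_prob)
  interpret T: sigma_finite_subalgebra \<nu> "tail_from n" by (rule sigma_finite_tail[OF nu_prob nu_sets])
  let ?S = "\<lambda>x i. x (n + i)"
  have km: "kern n a \<in> borel_measurable Xp" by (rule continuous_cube_measurable[OF continuous_kern[OF a]])
  have ki: "integrable \<nu> (kern n a)" by (rule continuous_cube_integrable[OF continuous_kern[OF a] nu_prob nu_sets])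
  have ci: "integrable \<nu> (indicator (cyl n a) :: _ \<Rightarrow> real)"
    using emeasure_finite[of "cyl n a"] by (intro integrable_real_indicator) (simp_all add: less_top[symmetric] cyl_sets)
  define M where "M g = distr (density \<nu> (\<lambda>x. ennreal (g x))) Xp ?S" for g :: "_ \<Rightarrow> real"
  have M_meas: "measure (M g) B = integral\<^sup>L \<nu> (\<lambda>x. g x * indicator B (?S x))"
    and M_fin: "finite_measure (M g)"
    if g: "integrable \<nu> g" "\<And>x. 0 \<le> g x" and B: "B \<in> sets Xp" for g B
  proof -
    have [measurable]: "g \<in> borel_measurable Xp" using borel_measurable_integrable[OF g(1)] by simp
    have em: "emeasure (M g) B = ennreal (integral\<^sup>L \<nu> (\<lambda>x. g x * indicator B (?S x)))" if B: "B \<in> sets Xp" for B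
    proof -
      have "?S -` B \<inter> space Xp \<in> sets Xp" by (rule measurable_sets[OF shift_measurable B])
      then have "emeasure (M g) B = (\<integral>\<^sup>+x. ennreal (g x) * indicator (?S -` B \<inter> space Xp) x \<partial>\<nu>)"
        unfolding M_def using B
        by (subst emeasure_distr) (simp_all add: emeasure_density)
      also have "\<dots> = (\<integral>\<^sup>+x. ennreal (g x * indicator B (?S x)) \<partial>\<nu>)"
        by (intro nn_integral_cong) (auto simp: indicator_def)
      also have "\<dots> = ennreal (integral\<^sup>L \<nu> (\<lambda>x. g x * indicator B (?S x)))"
      proof (rule nn_integral_eq_integral)
        have "integrable \<nu> (\<lambda>x. g x * indicator (?S -` B \<inter> space Xp) x)"
          using integrable_mult_indicator[of "?S -` B \<inter> space Xp" \<nu> g] \<open>?S -` B \<inter> space Xp \<in> sets Xp\<close> g(1) by (simp add: mult.commute)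
        moreover have "g x * indicator (?S -` B \<inter> space Xp) x = g x * indicator B (?S x)" if "x \<in> space \<nu>" for x
          using that by (auto simp: indicator_def)
        ultimately show "integrable \<nu> (\<lambda>x. g x * indicator B (?S x))"
          by (subst (asm) Bochner_Integration.integrable_cong[OF refl])
      qed (use g(2) in auto)
      finally show ?thesis .
    qed
    show "measure (M g) B = integral\<^sup>L \<nu> (\<lambda>x. g x * indicator B (?S x))"
      unfolding measure_def em[OF B] using g(2) by (simp add: integral_nonneg_AE)
    have "emeasure (M g) (space (M g)) \<noteq> \<infinity>"
      using em[OF sets.top] by (simp add: M_def)
    then show "finite_measure (M g)" by (rule finite_measureI)
  qed
  have "M (indicator (cyl n a)) = M (kern n a)"
  proof (rule measure_eq_Xp)
    show "finite_measure (M (indicator (cyl n a)))" by (rule M_fin[OF ci _ sets.empty_sets]) simp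
    show "finite_measure (M (kern n a))" by (rule M_fin[OF ki _ sets.empty_sets]) (simp add: kern_pos less_imp_le)
    show "sets (M (indicator (cyl n a))) = sets Xp" "sets (M (kern n a)) = sets Xp" by (simp_all add: M_def)
    fix m :: nat and b assume b: "b \<in> cfg {..<m}"
    have "measure (M (indicator (cyl n a))) (cyl m b) = integral\<^sup>L \<nu> (\<lambda>x. indicator (cyl n a) x * indicator (cyl m b) (?S x))"
      by (rule M_meas[OF ci _ cyl_sets]) simp
    also have "\<dots> = integral\<^sup>L \<nu> (\<lambda>x. chi n a x * chi m b (?S x))"
      by (rule Bochner_Integration.integral_cong[OF refl]) (simp only: nu_space chi_Xp[OF a] chi_Xp[OF b] shift_Xp)
    also have "\<dots> = integral\<^sup>L \<nu> (\<lambda>x. kern n a x * chi m b (?S x))" by (rule nu_DLR_cyl[OF a b])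
    also have "\<dots> = integral\<^sup>L \<nu> (\<lambda>x. kern n a x * indicator (cyl m b) (?S x))"
      by (rule Bochner_Integration.integral_cong[OF refl]) (simp only: nu_space chi_Xp[OF b] shift_Xp)
    also have "\<dots> = measure (M (kern n a)) (cyl m b)"
      by (rule M_meas[OF ki _ cyl_sets, symmetric]) (simp add: kern_pos less_imp_le)
    finally show "measure (M (indicator (cyl n a))) (cyl m b) = measure (M (kern n a)) (cyl m b)" .
  qed
  then have eq: "integral\<^sup>L \<nu> (\<lambda>x. indicator (cyl n a) x * indicator B (?S x)) = integral\<^sup>L \<nu> (\<lambda>x. kern n a x * indicator B (?S x))"
    if "B \<in> sets Xp" for B
    using M_meas[OF ci _ that] M_meas[OF ki _ that] by (simp add: kern_pos less_imp_le)
  have "AE x in \<nu>. real_cond_exp \<nu> (tail_from n) (indicator (cyl n a)) x = kern n a x"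
  proof (rule T.real_cond_exp_charact[OF _ ci ki kern_measurable_tail[OF a]])
    fix A assume "A \<in> sets (tail_from n)"
    then obtain B where B: "B \<in> sets Xp" "A = {x\<in>space Xp. ?S x \<in> B}" using tail_from_preimage by blast
    have "(\<integral>x\<in>A. g x \<partial>\<nu>) = integral\<^sup>L \<nu> (\<lambda>x. g x * indicator B (?S x))" for g :: "_ \<Rightarrow> real"
      unfolding set_lebesgue_integral_def
      by (rule Bochner_Integration.integral_cong[OF refl]) (simp add: B(2) indicator_def)
    then show "(\<integral>x\<in>A. indicator (cyl n a) x \<partial>\<nu>) = (\<integral>x\<in>A. kern n a x \<partial>\<nu>)" using eq[OF B(1)] by simp
  qed
  then show "AE x in \<nu>. real_cond_exp \<nu> (tail_from n) (indicator (cyl n a)) x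
      = exp (birkhoff_sum n \<phi> (glue n a x)) / (\<Sum>b\<in>cfg {..<n}. exp (birkhoff_sum n \<phi> (glue n b x)))"
    by (simp only: kern_def)
qed

text \<open>Averaging \<open>boundary_comparison\<close> over boundary conditions drawn from \<nu>'
  puts every cylinder probability within o(1) of its free finite-volume value, which does not depend
  on \<nu>'.\<close>

lemma half_line_gibbs_unique:
  assumes "half_line_gibbs \<phi> \<nu>'"
  shows "\<nu>' = \<nu>"
proof -
  have N: "prob_space \<nu>'" "sets \<nu>' = sets Xp"
    and ce: "\<And>n a. 1 \<le> n \<Longrightarrow> a \<in> cfg {..<n} \<Longrightarrow> AE x in \<nu>'. real_cond_exp \<nu>' (tail_from n) (indicator (cyl n a)) x = kern n a x"
    using assms unfolding half_line_gibbs_def words_eq kern_def by auto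
  interpret N: prob_space \<nu>' by fact
  have sp: "space \<nu>' = space Xp" using N(2) by (rule sets_eq_imp_space_eq)
  have cylk: "measure \<nu>' (cyl n a) = integral\<^sup>L \<nu>' (kern n a)" if "1 \<le> n" and a: "a \<in> cfg {..<n}" for n a
  proof -
    interpret T: sigma_finite_subalgebra \<nu>' "tail_from n" by (rule sigma_finite_tail[OF N])
    have ci: "integrable \<nu>' (indicator (cyl n a) :: _ \<Rightarrow> real)"
      using N.emeasure_finite[of "cyl n a"] by (intro integrable_real_indicator) (simp_all add: less_top[symmetric] cyl_sets N(2))
    have "integral\<^sup>L \<nu>' (kern n a) = integral\<^sup>L \<nu>' (real_cond_exp \<nu>' (tail_from n) (indicator (cyl n a)))"
      using ce[OF that] borel_measurable_cond_exp2[of \<nu>' "tail_from n"] continuous_cube_measurable[OF continuous_kern[OF a]]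
      by (intro integral_cong_AE) (auto simp: N(2) cong: measurable_cong_sets)
    also have "\<dots> = integral\<^sup>L \<nu>' (indicator (cyl n a))" by (rule T.real_cond_exp_int(2)[OF ci])
    also have "\<dots> = measure \<nu>' (cyl n a)"
      by (simp only: Bochner_Integration.integral_indicator sp cyl_Int_space)
    finally show ?thesis by simp
  qed
  show ?thesis
  proof (rule measure_eq_Xp)
    show "finite_measure \<nu>'" "finite_measure \<nu>" using N nu_prob by (auto simp: prob_space_def)
    fix m :: nat and b assume b: "b \<in> cfg {..<m}"
    let ?f = "\<lambda>c. of_bool (c = b) :: real"
    let ?e = "\<lambda>n. real m * (2 * 1 * ((1 + K) * \<beta> * \<tau> (n - m)))"
    have "\<bar>measure \<nu>' (cyl m b) - gibbs n (\<lambda>x. ?f (win 0 m x))\<bar> \<le> ?e n" if n: "m \<le> n" "1 \<le> n" for n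
    proof -
      \<comment> \<open>g is the conditional probability of the word b given the spins from n
        on.\<close>
      define g where "g x = gE {..<n} (\<lambda>a. birkhoff_sum n \<phi> (glue n a x)) (\<lambda>a. ?f (win 0 m a))" for x
      have g: "g x = (\<Sum>a\<in>{a\<in>cfg {..<n}. win 0 m a = b}. kern n a x)" for x
      proof -
        have "g x = (\<Sum>a\<in>cfg {..<n}. kern n a x * ?f (win 0 m a))"
          by (simp only: g_def gE_def kern_def sum_divide_distrib times_divide_eq_left)
        also have "\<dots> = (\<Sum>a\<in>{a\<in>cfg {..<n}. win 0 m a = b}. kern n a x)"
          by (rule sum.mono_neutral_cong_right) (auto simp: finite_cfg)
        finally show ?thesis .
      qed
      have ik: "integrable \<nu>' (kern n a)" if "a \<in> cfg {..<n}" for a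
        by (rule continuous_cube_integrable[OF continuous_kern[OF that] N])
      have "cyl m b = local_set n {a. win 0 m a = b}"
        using local_set_mono[OF n(1), of "{b}"] cyl_eq_local_set[OF b] by simp
      then have "measure \<nu>' (cyl m b) = (\<Sum>a\<in>{a. win 0 m a = b} \<inter> cfg {..<n}. measure \<nu>' (cyl n a))"
        by (simp only: measure_local_set[OF N.finite_measure_axioms N(2)])
      also have "\<dots> = (\<Sum>a\<in>{a\<in>cfg {..<n}. win 0 m a = b}. integral\<^sup>L \<nu>' (kern n a))"
        using n(2) by (intro sum.cong) (auto simp: cylk)
      also have "\<dots> = integral\<^sup>L \<nu>' g"
        unfolding g by (rule Bochner_Integration.integral_sum[symmetric]) (auto intro: ik)
      finally have m: "measure \<nu>' (cyl m b) = integral\<^sup>L \<nu>' g" .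
      have ig: "integrable \<nu>' g" unfolding g by (rule Bochner_Integration.integrable_sum) (auto intro: ik)
      have near: "\<bar>g x - gibbs n (\<lambda>x. ?f (win 0 m x))\<bar> \<le> ?e n" if "x \<in> space \<nu>'" for x
        unfolding g_def using that sp by (intro boundary_comparison[OF Xp_cube n(1)]) auto
      have "measure \<nu>' (cyl m b) - gibbs n (\<lambda>x. ?f (win 0 m x)) = integral\<^sup>L \<nu>' (\<lambda>x. g x - gibbs n (\<lambda>x. ?f (win 0 m x)))"
        unfolding m using ig by (simp add: N.prob_space)
      also have "\<bar>\<dots>\<bar> \<le> integral\<^sup>L \<nu>' (\<lambda>x. \<bar>g x - gibbs n (\<lambda>x. ?f (win 0 m x))\<bar>)" by (rule integral_abs_bound)
      also have "\<dots> \<le> integral\<^sup>L \<nu>' (\<lambda>x. ?e n)"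
        using ig near by (intro integral_mono) auto
      finally show ?thesis by (simp add: N.prob_space)
    qed
    then have "eventually (\<lambda>n. \<bar>measure \<nu>' (cyl m b) - gibbs n (\<lambda>x. ?f (win 0 m x))\<bar> \<le> (real m * (2 * ((1 + K) * \<beta>))) * \<tau> (n - m)) sequentially"
    proof -
      assume le: "\<And>n. m \<le> n \<Longrightarrow> 1 \<le> n \<Longrightarrow> \<bar>measure \<nu>' (cyl m b) - gibbs n (\<lambda>x. ?f (win 0 m x))\<bar> \<le> ?e n"
      have e: "?e n = (real m * (2 * ((1 + K) * \<beta>))) * \<tau> (n - m)" for n by simp
      show ?thesis using eventually_ge_at_top[of "m + 1"]
        by eventually_elim (use le in \<open>simp only: e; linarith\<close>)
    qed
    then have "(\<lambda>n. measure \<nu>' (cyl m b) - gibbs n (\<lambda>x. ?f (win 0 m x))) \<longlonglongrightarrow> 0"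
      by (intro Lim_null_comparison[OF _ tendsto_tail_bound[OF filterlim_minus_nat]]) simp
    moreover have "(\<lambda>n. measure \<nu>' (cyl m b) - gibbs n (\<lambda>x. ?f (win 0 m x))) \<longlonglongrightarrow> measure \<nu>' (cyl m b) - measure \<nu> (cyl m b)"
      by (intro tendsto_intros nu_cyl b)
    ultimately have "measure \<nu>' (cyl m b) - measure \<nu> (cyl m b) = 0" by (rule LIMSEQ_unique[rotated])
    then show "measure \<nu>' (cyl m b) = measure \<nu> (cyl m b)" by simp
  qed (simp_all add: N)
qed

end

section \<open>The eigenmeasure and the pressure\<close>

lemma sum_cfg_cons:
  "(\<Sum>y\<in>cfg {..<Suc n}. g y) = (\<Sum>x\<in>cfg {..<n}. \<Sum>c\<in>{-1, 1}. g (\<lambda>i\<in>{..<Suc n}. concat1 c x i))"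
proof -
  have "(\<Sum>y\<in>cfg {..<Suc n}. g y) = (\<Sum>(x, c)\<in>cfg {..<n} \<times> {-1, 1}. g (\<lambda>i\<in>{..<Suc n}. concat1 c x i))"
    by (rule sum.reindex_bij_witness[where j="\<lambda>y. (\<lambda>i\<in>{..<n}. y (Suc i), y 0)" and i="\<lambda>(x, c). \<lambda>i\<in>{..<Suc n}. concat1 c x i"])
      (auto simp: fun_eq_iff PiE_iff extensional_def concat1_def split: nat.splits intro!: arg_cong[where f=g])
  then show ?thesis by (simp only: sum.cartesian_product)
qed

lemma sum_cfg_snoc:
  "(\<Sum>y\<in>cfg {..<Suc n}. g y) = (\<Sum>x\<in>cfg {..<n}. \<Sum>c\<in>{-1, 1}. g (x(n := c)))"
proof -
  have "(\<Sum>y\<in>cfg {..<Suc n}. g y) = (\<Sum>(x, c)\<in>cfg {..<n} \<times> {-1, 1}. g (x(n := c)))"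
    by (rule sum.reindex_bij_witness[where j="\<lambda>y. (\<lambda>i\<in>{..<n}. y i, y n)" and i="\<lambda>(x, c). x(n := c)"])
      (auto simp: fun_eq_iff PiE_iff extensional_def less_Suc_eq intro!: arg_cong[where f=g], (metis lessThan_iff)+)
  then show ?thesis by (simp only: sum.cartesian_product)
qed

lemma gE_tilt:
  assumes "finite V"
  shows "gE V (\<lambda>x. U x + F x) f = gE V U (\<lambda>x. exp (F x) * f x) / gE V U (\<lambda>x. exp (F x))"
  using partition_pos[OF assms, of U] by (simp add: gE_def exp_add mult.assoc)

lemma concat1_measurable:
  "(\<lambda>(c, x). concat1 c x) \<in> measurable (count_space {-1, 1} \<Otimes>\<^sub>M Xp) Xp"
proof -
  have "(\<lambda>(c, x). concat1 c x) \<in> measurable (count_space {-1, 1} \<Otimes>\<^sub>M Xp) (PiM UNIV (\<lambda>_. count_space {-1, 1 :: real}))"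
  proof (rule measurable_PiM_single')
    show "(\<lambda>(c, x). concat1 c x) \<in> space (count_space {-1, 1} \<Otimes>\<^sub>M Xp) \<rightarrow> (\<Pi>\<^sub>E i\<in>UNIV. space (count_space {-1, 1 :: real}))"
      by (auto simp: space_pair_measure space_Xp PiE_iff concat1_def split: nat.splits)
    fix i :: nat
    show "(\<lambda>p. (case p of (c, x) \<Rightarrow> concat1 c x) i) \<in> measurable (count_space {-1, 1} \<Otimes>\<^sub>M Xp) (count_space {-1, 1 :: real})"
    proof (cases i)
      case 0
      then show ?thesis by (simp add: concat1_def split_beta)
    next
      case (Suc j)
      have "(\<lambda>p. snd p j) \<in> measurable (count_space {-1, 1 :: real} \<Otimes>\<^sub>M Xp) (count_space {-1, 1 :: real})"
        by (rule measurable_compose[OF measurable_snd coord_measurable])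
      then show ?thesis by (simp add: concat1_def split_beta Suc)
    qed
  qed
  then show ?thesis by (simp only: Xp_def)
qed

lemma concat1_measurable_snd: "c \<in> {-1, 1} \<Longrightarrow> concat1 c \<in> measurable Xp Xp"
  using measurable_compose[OF measurable_Pair1' concat1_measurable, of c] by simp

lemma concat1_Xp: "c \<in> {-1, 1} \<Longrightarrow> x \<in> space Xp \<Longrightarrow> concat1 c x \<in> space Xp"
  by (auto simp: space_Xp concat1_def split: nat.split)

lemma local_setsI: "local_set m Q \<in> local_sets"
  by (auto simp: local_sets_def)

lemma local_setsE:
  assumes "B \<in> local_sets" obtains m Q where "B = local_set m Q"
  using assms by (auto simp: local_sets_def)

text \<open>The sets approximable in both measures by one and the same local set form a
  sigma-algebra. The common B is what carries inequalities between the measures from local sets to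
  all measurable sets.\<close>

lemma local_approximation:
  assumes M: "finite_measure M" "sets M = sets Xp" and N: "finite_measure N" "sets N = sets Xp"
    and A: "A \<in> sets Xp" and "0 < e"
  shows "\<exists>B\<in>local_sets. measure M ((A - B) \<union> (B - A)) < e \<and> measure N ((A - B) \<union> (B - A)) < e"
proof -
  define D where "D A B = (A - B) \<union> (B - A)" for A B :: "(nat \<Rightarrow> real) set"
  define P where "P A \<longleftrightarrow> A \<in> sets Xp \<and> (\<forall>e>0. \<exists>B\<in>local_sets. measure M (D A B) < e \<and> measure N (D A B) < e)" for A
  have ls: "B \<in> sets Xp" if "B \<in> local_sets" for B using that by (auto simp: local_sets_def local_set_sets)
  have D_sets: "D A B \<in> sets Xp" if "A \<in> sets Xp" "B \<in> sets Xp" for A B using that by (auto simp: D_def)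
  have cover: "measure L X \<le> measure L Y + measure L Z"
    if "X \<subseteq> Y \<union> Z" "X \<in> sets Xp" "Y \<in> sets Xp" "Z \<in> sets Xp" "L = M \<or> L = N" for L X Y Z
  proof -
    have L: "finite_measure L" "sets L = sets Xp" using that(5) M N by auto
    have "measure L X \<le> measure L (Y \<union> Z)"
      using that L by (intro finite_measure.finite_measure_mono) auto
    also have "\<dots> \<le> measure L Y + measure L Z"
      using that L by (intro measure_Un_le) auto
    finally show ?thesis .
  qed
  have local: "P B" if "B \<in> local_sets" for B
    unfolding P_def using that ls by (auto simp: D_def intro!: bexI[of _ B])
  have compl: "P (space Xp - A)" if "P A" for A
    unfolding P_def
  proof (intro conjI allI impI)
    show "space Xp - A \<in> sets Xp" using that by (auto simp: P_def)
    fix e :: real assume "0 < e"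
    then obtain B where B: "B \<in> local_sets" "measure M (D A B) < e" "measure N (D A B) < e"
      using \<open>P A\<close> unfolding P_def by blast
    have "A \<subseteq> space Xp" using that sets.sets_into_space by (auto simp: P_def)
    moreover have "B \<subseteq> space Xp" using ls[OF B(1)] sets.sets_into_space by auto
    ultimately have "D (space Xp - A) (space Xp - B) = D A B" by (auto simp: D_def)
    moreover have "space Xp - B \<in> local_sets" using B(1) by (elim local_setsE) (simp add: local_set_compl local_setsI)
    ultimately show "\<exists>B\<in>local_sets. measure M (D (space Xp - A) B) < e \<and> measure N (D (space Xp - A) B) < e"
      using B by metis
  qed
  have un: "P (A \<union> A')" if "P A" "P A'" for A A'
    unfolding P_def
  proof (intro conjI allI impI)
    show s: "A \<union> A' \<in> sets Xp" using that by (auto simp: P_def)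
    fix e :: real assume "0 < e"
    then have "0 < e / 2" by simp
    then obtain B where B: "B \<in> local_sets" "measure M (D A B) < e / 2" "measure N (D A B) < e / 2"
      using \<open>P A\<close> unfolding P_def by blast
    obtain B' where B': "B' \<in> local_sets" "measure M (D A' B') < e / 2" "measure N (D A' B') < e / 2"
      using \<open>P A'\<close> \<open>0 < e / 2\<close> unfolding P_def by blast
    have BB: "B \<union> B' \<in> local_sets" using B(1) B'(1) by (elim local_setsE) (simp add: local_set_Un local_setsI)
    have "measure L (D (A \<union> A') (B \<union> B')) \<le> measure L (D A B) + measure L (D A' B')" if "L = M \<or> L = N" for L
      using that s ls[OF B(1)] ls[OF B'(1)] ls[OF BB] \<open>P A\<close> \<open>P A'\<close>
      by (intro cover D_sets) (auto simp: D_def P_def)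
    from this[of M] this[of N] have "measure M (D (A \<union> A') (B \<union> B')) < e" "measure N (D (A \<union> A') (B \<union> B')) < e"
      using B B' by auto
    then show "\<exists>B\<in>local_sets. measure M (D (A \<union> A') B) < e \<and> measure N (D (A \<union> A') B) < e" using BB by blast
  qed
  have "P A" using A unfolding sets_Xp_local
  proof (induction rule: sigma_sets.induct)
    case (Basic B)
    then show ?case by (rule local)
  next
    case Empty
    have "{} = local_set 0 {}" by (simp add: local_set_def)
    then show ?case by (intro local) (auto simp: local_sets_def)
  next
    case (Compl A)
    then show ?case by (intro compl)
  next
    case (Union A)
    define U where "U n = (\<Union>i<n. A i)" for n :: nat
    have PU: "P (U n)" for n
    proof (induction n)
      case 0
      have "{} = local_set 0 {}" by (simp add: local_set_def)
      then show ?case by (simp add: U_def) (intro local, auto simp: local_sets_def)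
    next
      case (Suc n)
      have "U (Suc n) = U n \<union> A n" by (auto simp: U_def less_Suc_eq)
      then show ?case using un[OF Suc Union.IH] by simp
    qed
    have As: "A i \<in> sets Xp" for i using Union.IH by (simp add: P_def)
    have Us: "U n \<in> sets Xp" for n using PU by (simp add: P_def)
    have UA: "(\<Union>i. A i) \<in> sets Xp" using As by auto
    \<comment> \<open>Countable unions are cut at a finite stage, by continuity from above in both
      measures.\<close>
    have lim: "(\<lambda>n. measure L ((\<Union>i. A i) - U n)) \<longlonglongrightarrow> 0" if "L = M \<or> L = N" for L
    proof -
      interpret L: finite_measure L using that M N by auto
      have Ls: "sets L = sets Xp" using that M N by auto
      have "(\<lambda>n. measure L ((\<Union>i. A i) - U n)) \<longlonglongrightarrow> measure L (\<Inter>n. (\<Union>i. A i) - U n)"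
      proof (rule L.finite_Lim_measure_decseq)
        show "range (\<lambda>n. (\<Union>i. A i) - U n) \<subseteq> sets L" using UA Us Ls by auto
        show "decseq (\<lambda>n. (\<Union>i. A i) - U n)" by (fastforce simp: decseq_def U_def)
      qed
      moreover have "(\<Inter>n. (\<Union>i. A i) - U n) = {}" by (auto simp: U_def)
      ultimately show ?thesis by (simp only: measure_empty)
    qed
    show ?case unfolding P_def
    proof (intro conjI allI impI UA)
      fix e :: real assume "0 < e"
      then have e: "0 < e / 2" by simp
      have "eventually (\<lambda>n. measure M ((\<Union>i. A i) - U n) < e / 2 \<and> measure N ((\<Union>i. A i) - U n) < e / 2) sequentially"
        using order_tendstoD(2)[OF lim[of M] e] order_tendstoD(2)[OF lim[of N] e] by (simp add: eventually_conj)
      then obtain n where n: "measure M ((\<Union>i. A i) - U n) < e / 2" "measure N ((\<Union>i. A i) - U n) < e / 2"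
        by (auto simp: eventually_sequentially)
      obtain B where B: "B \<in> local_sets" "measure M (D (U n) B) < e / 2" "measure N (D (U n) B) < e / 2"
        using PU[of n] e unfolding P_def by blast
      have "measure L (D (\<Union>i. A i) B) \<le> measure L ((\<Union>i. A i) - U n) + measure L (D (U n) B)" if "L = M \<or> L = N" for L
        using that UA Us ls[OF B(1)] by (intro cover D_sets) (auto simp: D_def U_def)
      from this[of M] this[of N] show "\<exists>B\<in>local_sets. measure M (D (\<Union>i. A i) B) < e \<and> measure N (D (\<Union>i. A i) B) < e"
        using B n by (intro bexI[of _ B]) auto
    qed
  qed
  then show ?thesis using \<open>0 < e\<close> unfolding P_def D_def by blast
qed

context high_temperature
begin

lemma nu_total [simp]: "measure \<nu> (space Xp) = 1" "emeasure \<nu> (space Xp) = 1"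
  using prob_space.prob_space[OF nu_prob] prob_space.emeasure_space_1[OF nu_prob] by simp_all

definition Z :: "nat \<Rightarrow> real" where
  "Z n = (\<Sum>x\<in>cfg {..<n}. exp (H {..<n} x))"

lemma Z_pos: "0 < Z n"
  unfolding Z_def by (rule partition_pos) simp

text \<open>Prepending c to x adds \<phi>(cx) to the energy and produces the free block of length n
  + 1. So the dual of the transfer operator maps free measures to free measures, up to the ratio of
  partition functions.\<close>

lemma gibbs_transfer:
  "gibbs n (\<lambda>x. transfer \<phi> F (ext n x)) = Z (Suc n) / Z n * gibbs (Suc n) (\<lambda>y. F (ext (Suc n) y))"
proof -
  have "exp (H {..<n} x) * (\<Sum>c\<in>{-1, 1}. exp (\<phi> (concat1 c (ext n x))) * F (concat1 c (ext n x)))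
     = (\<Sum>c\<in>{-1, 1}. exp (H {..<Suc n} (\<lambda>i\<in>{..<Suc n}. concat1 c x i)) * F (ext (Suc n) (\<lambda>i\<in>{..<Suc n}. concat1 c x i)))"
    if x: "x \<in> cfg {..<n}" for x
    unfolding sum_distrib_left
  proof (rule sum.cong[OF refl])
    fix c :: real assume c: "c \<in> {-1, 1}"
    let ?y = "\<lambda>i\<in>{..<Suc n}. concat1 c x i"
    have y: "?y \<in> cfg {..<Suc n}"
      using cfg_val[OF x] c by (auto simp: PiE_iff concat1_def split: nat.splits)
    have ey: "ext (Suc n) ?y = concat1 c (ext n x)" by (auto simp: ext_def concat1_def fun_eq_iff split: nat.splits)
    have "H {..<Suc n} ?y = birkhoff_sum (1 + n) \<phi> (concat1 c (ext n x))"
      using birkhoff_ext[OF y] by (simp add: ey)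
    also have "\<dots> = \<phi> (concat1 c (ext n x)) + birkhoff_sum n \<phi> (\<lambda>i. concat1 c (ext n x) (1 + i))"
      unfolding birkhoff_sum_add by (simp add: birkhoff_sum_def)
    also have "(\<lambda>i. concat1 c (ext n x) (1 + i)) = ext n x" by (simp add: concat1_def)
    finally have "H {..<Suc n} ?y = \<phi> (concat1 c (ext n x)) + H {..<n} x" by (simp only: birkhoff_ext[OF x])
    then show "exp (H {..<n} x) * (exp (\<phi> (concat1 c (ext n x))) * F (concat1 c (ext n x)))
      = exp (H {..<Suc n} ?y) * F (ext (Suc n) ?y)" unfolding ey by (simp add: exp_add)
  qed
  then have "(\<Sum>x\<in>cfg {..<n}. exp (H {..<n} x) * transfer \<phi> F (ext n x)) = (\<Sum>y\<in>cfg {..<Suc n}. exp (H {..<Suc n} y) * F (ext (Suc n) y))"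
    unfolding transfer_def sum_cfg_cons by (intro sum.cong refl)
  then show ?thesis using Z_pos[of "Suc n"] by (simp add: gE_def Z_def)
qed

lemma continuous_transfer:
  assumes F: "continuous_on cube F"
  shows "continuous_on cube (transfer \<phi> F)"
proof -
  have "continuous_on cube (\<lambda>x. \<Sum>c\<in>{-1, 1 :: real}. exp (\<phi> (concat1 c x)) * F (concat1 c x))"
    by (intro continuous_on_sum continuous_on_mult continuous_on_exp continuous_concat1[OF F] continuous_concat1[OF continuous_dyson]) auto
  then show ?thesis by (simp only: transfer_def[abs_def])
qed

text \<open>The eigenvalue of the dual operator at \<nu>, later identified with the exponential of
  the pressure.\<close>

definition growth_rate :: real where
  "growth_rate = integral\<^sup>L \<nu> (transfer \<phi> (\<lambda>_. 1))"

lemma Z_ratio: "(\<lambda>n. Z (Suc n) / Z n) \<longlonglongrightarrow> growth_rate"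
proof -
  have "(\<lambda>n. gibbs n (\<lambda>x. transfer \<phi> (\<lambda>_. 1) (ext n x))) \<longlonglongrightarrow> growth_rate"
    unfolding growth_rate_def by (intro nu_lim_continuous continuous_transfer continuous_on_const)
  then show ?thesis by (simp add: gibbs_transfer)
qed

lemma growth_rate_pos: "0 < growth_rate"
proof -
  interpret prob_space \<nu> by (rule nu_prob)
  obtain B where B: "\<And>x. x \<in> cube \<Longrightarrow> \<bar>\<phi> x\<bar> \<le> B" using continuous_cube_bounded[OF continuous_dyson] by blast
  have "integral\<^sup>L \<nu> (\<lambda>_. exp (- B)) \<le> growth_rate" unfolding growth_rate_def
  proof (rule integral_mono)
    show "integrable \<nu> (transfer \<phi> (\<lambda>_. 1))"
      by (intro continuous_cube_integrable continuous_transfer continuous_on_const nu_prob nu_sets)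
    fix x assume "x \<in> space \<nu>"
    then have "concat1 1 x \<in> cube" by (intro concat1_cube Xp_cube) auto
    then have "exp (- B) \<le> exp (\<phi> (concat1 1 x))" using B[of "concat1 1 x"] by simp
    then show "exp (- B) \<le> transfer \<phi> (\<lambda>_. 1) x" by (simp add: transfer_def add_increasing)
  qed simp
  then show ?thesis using exp_gt_zero[of "- B"] by (simp del: exp_gt_zero)
qed

text \<open>Both sides of \<open>gibbs_transfer\<close> converge, the prefactor by
  \<open>Z_ratio\<close>.\<close>

lemma nu_eigen:
  assumes F: "continuous_on cube F"
  shows "integral\<^sup>L \<nu> (transfer \<phi> F) = growth_rate * integral\<^sup>L \<nu> F"
proof (rule LIMSEQ_unique)
  show "(\<lambda>n. gibbs n (\<lambda>x. transfer \<phi> F (ext n x))) \<longlonglongrightarrow> integral\<^sup>L \<nu> (transfer \<phi> F)"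
    by (intro nu_lim_continuous continuous_transfer F)
  have "(\<lambda>n. gibbs (Suc n) (\<lambda>x. F (ext (Suc n) x))) \<longlonglongrightarrow> integral\<^sup>L \<nu> F"
    using nu_lim_continuous[OF F] by (rule LIMSEQ_Suc)
  then show "(\<lambda>n. gibbs n (\<lambda>x. transfer \<phi> F (ext n x))) \<longlonglongrightarrow> growth_rate * integral\<^sup>L \<nu> F"
    unfolding gibbs_transfer by (intro tendsto_mult Z_ratio)
qed

lemma dyson_measurable [measurable]: "\<phi> \<in> borel_measurable Xp"
  by (rule continuous_cube_measurable[OF continuous_dyson])

text \<open>The extension to measurable functions serves the density of \<mu>, which is a priori
  only integrable. Both sides integrate f against a finite measure, and the two measures agree on
  cylinders by \<open>nu_eigen\<close> applied to \<open>chi\<close>.\<close>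

lemma nu_eigen_nn:
  assumes f: "f \<in> borel_measurable Xp"
  shows "(\<integral>\<^sup>+x. (\<Sum>c\<in>{-1, 1 :: real}. ennreal (exp (\<phi> (concat1 c x))) * f (concat1 c x)) \<partial>\<nu>) = ennreal growth_rate * (\<integral>\<^sup>+x. f x \<partial>\<nu>)"
proof -
  interpret prob_space \<nu> by (rule nu_prob)
  let ?P = "count_space {-1, 1 :: real} \<Otimes>\<^sub>M \<nu>"
  let ?T = "\<lambda>(c, x). concat1 c x"
  have T [measurable]: "?T \<in> measurable ?P Xp"
    using concat1_measurable by (simp cong: measurable_cong_sets sets_pair_measure_cong)
  define M where "M = distr (density ?P (\<lambda>p. ennreal (exp (\<phi> (?T p))))) Xp ?T"
  have M: "(\<integral>\<^sup>+x. f x \<partial>M) = (\<integral>\<^sup>+x. (\<Sum>c\<in>{-1, 1 :: real}. ennreal (exp (\<phi> (concat1 c x))) * f (concat1 c x)) \<partial>\<nu>)"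
    if f [measurable]: "f \<in> borel_measurable Xp" for f
  proof -
    have em: "(\<lambda>p. ennreal (exp (\<phi> (?T p)))) \<in> borel_measurable ?P"
      by (rule measurable_compose[OF T]) measurable
    have fm: "(\<lambda>p. f (?T p)) \<in> borel_measurable ?P"
      by (rule measurable_compose[OF T f])
    have "(\<integral>\<^sup>+x. f x \<partial>M) = (\<integral>\<^sup>+p. f (?T p) \<partial>density ?P (\<lambda>p. ennreal (exp (\<phi> (?T p)))))"
      unfolding M_def by (rule nn_integral_distr) (use T f in simp_all)
    also have "\<dots> = (\<integral>\<^sup>+p. ennreal (exp (\<phi> (?T p))) * f (?T p) \<partial>?P)"
      by (rule nn_integral_density[OF em fm])
    also have "\<dots> = (\<integral>\<^sup>+c. \<integral>\<^sup>+x. ennreal (exp (\<phi> (concat1 c x))) * f (concat1 c x) \<partial>\<nu> \<partial>count_space {-1, 1})"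
      using em fm by (subst nn_integral_fst[symmetric]) simp_all
    also have "\<dots> = (\<Sum>c\<in>{-1, 1}. \<integral>\<^sup>+x. ennreal (exp (\<phi> (concat1 c x))) * f (concat1 c x) \<partial>\<nu>)"
      by (rule nn_integral_count_space_finite) simp
    also have "\<dots> = (\<integral>\<^sup>+x. (\<Sum>c\<in>{-1, 1 :: real}. ennreal (exp (\<phi> (concat1 c x))) * f (concat1 c x)) \<partial>\<nu>)"
    proof (rule nn_integral_sum[symmetric])
      fix c :: real assume "c \<in> {-1, 1}"
      note c = concat1_measurable_snd[OF this]
      have "(\<lambda>x. ennreal (exp (\<phi> (concat1 c x))) * f (concat1 c x)) \<in> borel_measurable Xp"
        by (rule measurable_compose[OF c, of "\<lambda>y. ennreal (exp (\<phi> y)) * f y"]) measurable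
      then show "(\<lambda>x. ennreal (exp (\<phi> (concat1 c x))) * f (concat1 c x)) \<in> borel_measurable \<nu>"
        by (subst measurable_cong_sets[OF nu_sets refl])
    qed
    finally show ?thesis .
  qed
  have cylM: "emeasure M (cyl m a) = ennreal (growth_rate * measure \<nu> (cyl m a))" if a: "a \<in> cfg {..<m}" for m a
  proof -
    have cc: "continuous_on cube (chi m a)" using continuous_chi[of cube m a 0] by simp
    have "emeasure M (cyl m a) = (\<integral>\<^sup>+x. indicator (cyl m a) x \<partial>M)"
      using nn_integral_indicator[of "cyl m a" M] by (simp add: M_def cyl_sets)
    also have "\<dots> = (\<integral>\<^sup>+x. (\<Sum>c\<in>{-1, 1 :: real}. ennreal (exp (\<phi> (concat1 c x))) * indicator (cyl m a) (concat1 c x)) \<partial>\<nu>)"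
      by (rule M) (intro borel_measurable_indicator cyl_sets)
    also have "\<dots> = (\<integral>\<^sup>+x. ennreal (transfer \<phi> (chi m a) x) \<partial>\<nu>)"
    proof (rule nn_integral_cong)
      fix x assume "x \<in> space \<nu>"
      then have x: "concat1 c x \<in> space Xp" if "c \<in> {-1, 1}" for c using concat1_Xp[OF that] by simp
      have "transfer \<phi> (chi m a) x = (\<Sum>c\<in>{-1, 1 :: real}. exp (\<phi> (concat1 c x)) * indicator (cyl m a) (concat1 c x))"
        unfolding transfer_def by (intro sum.cong refl) (simp only: chi_Xp[OF a x])
      then show "(\<Sum>c\<in>{-1, 1 :: real}. ennreal (exp (\<phi> (concat1 c x))) * indicator (cyl m a) (concat1 c x)) = ennreal (transfer \<phi> (chi m a) x)"
        by (simp add: indicator_def ennreal_plus[symmetric] del: ennreal_plus)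
    qed
    also have "\<dots> = ennreal (integral\<^sup>L \<nu> (transfer \<phi> (chi m a)))"
    proof (rule nn_integral_eq_integral)
      show "integrable \<nu> (transfer \<phi> (chi m a))"
        by (intro continuous_cube_integrable continuous_transfer cc nu_prob nu_sets)
      show "AE x in \<nu>. 0 \<le> transfer \<phi> (chi m a) x"
      proof (rule AE_I2)
        fix x assume "x \<in> space \<nu>"
        then have x: "concat1 c x \<in> space Xp" if "c \<in> {-1, 1}" for c using concat1_Xp[OF that] by simp
        show "0 \<le> transfer \<phi> (chi m a) x"
          unfolding transfer_def by (intro sum_nonneg mult_nonneg_nonneg) (simp_all only: chi_Xp[OF a x] indicator_pos_le exp_ge_zero)
      qed
    qed
    also have "\<dots> = ennreal (growth_rate * measure \<nu> (cyl m a))"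
      by (simp only: nu_eigen[OF cc] integral_chi[OF nu_prob nu_sets a])
    finally show ?thesis .
  qed
  have "M = density \<nu> (\<lambda>_. ennreal growth_rate)"
  proof (rule measure_eq_Xp)
    have "space Xp = cyl 0 (\<lambda>_. undefined)" by simp
    then have "emeasure M (space M) \<noteq> \<infinity>"
      using cylM[of "\<lambda>_. undefined" 0] by (simp add: M_def)
    then show "finite_measure M" by (rule finite_measureI)
    show "finite_measure (density \<nu> (\<lambda>_. ennreal growth_rate))"
      by (rule finite_measureI, subst emeasure_density) (simp_all add: nn_integral_cmult_indicator)
    show "sets M = sets Xp" "sets (density \<nu> (\<lambda>_. ennreal growth_rate)) = sets Xp" by (simp_all add: M_def)
    fix m :: nat and a assume a: "a \<in> cfg {..<m}"
    have "emeasure (density \<nu> (\<lambda>_. ennreal growth_rate)) (cyl m a) = ennreal growth_rate * emeasure \<nu> (cyl m a)"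
      by (subst emeasure_density) (simp_all add: cyl_sets nn_integral_cmult_indicator)
    then have "emeasure (density \<nu> (\<lambda>_. ennreal growth_rate)) (cyl m a) = emeasure M (cyl m a)"
      unfolding cylM[OF a] emeasure_eq_measure using growth_rate_pos by (simp add: ennreal_mult)
    then show "measure M (cyl m a) = measure (density \<nu> (\<lambda>_. ennreal growth_rate)) (cyl m a)" by (simp add: measure_def)
  qed
  then have "(\<integral>\<^sup>+x. f x \<partial>M) = (\<integral>\<^sup>+x. ennreal growth_rate * f x \<partial>\<nu>)"
    using f by (simp add: nn_integral_density)
  also have "\<dots> = ennreal growth_rate * (\<integral>\<^sup>+x. f x \<partial>\<nu>)" using f by (intro nn_integral_cmult) simp
  finally show ?thesis using M[OF f] by simp
qed

section \<open>Pressure\<close>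

text \<open>Bounds the energy between the first n sites and all later ones. It grows without bound
  when \<alpha> \<le> 2, but only as o(n).\<close>

definition boundary_error :: "nat \<Rightarrow> real" where
  "boundary_error n = \<beta> * (\<Sum>k<n. \<tau> (Suc k))"

lemma boundary_error_tendsto: "(\<lambda>n. boundary_error n / real n) \<longlonglongrightarrow> 0"
proof -
  have "(\<lambda>n. \<beta> * ((\<Sum>k<n. \<tau> (Suc k)) / real n)) \<longlonglongrightarrow> \<beta> * 0"
    by (intro tendsto_mult tendsto_const Cesaro LIMSEQ_Suc tail_sum_tendsto alpha)
  then show ?thesis by (simp add: boundary_error_def)
qed

lemma sum_field_bound:
  assumes "\<And>k. k < n \<Longrightarrow> \<bar>y k\<bar> \<le> 1" "\<And>k. k < n \<Longrightarrow> \<bar>c k\<bar> \<le> \<tau> (n - k)"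
  shows "\<bar>\<beta> * (\<Sum>k<n. y k * c k)\<bar> \<le> boundary_error n"
proof -
  have "\<bar>\<Sum>k<n. y k * c k\<bar> \<le> (\<Sum>k<n. \<tau> (n - k))"
    using assms by (intro order_trans[OF sum_abs] sum_mono) (auto simp: abs_mult intro!: mult_left_le_one_le[THEN order_trans])
  also have "\<dots> = (\<Sum>k<n. \<tau> (Suc k))"
    by (subst sum.nat_diff_reindex[symmetric]) (intro sum.cong, auto simp: Suc_diff_Suc)
  finally show ?thesis using beta by (simp add: boundary_error_def abs_mult)
qed

lemma birkhoff_near: "y \<in> cube \<Longrightarrow> \<bar>birkhoff_sum n \<phi> y - H {..<n} y\<bar> \<le> boundary_error n"
  unfolding birkhoff_decomp by (simp, rule sum_field_bound) (simp_all add: cube_abs bfield_le)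

lemma H_cong: "(\<And>i. i \<in> V \<Longrightarrow> x i = y i) \<Longrightarrow> H V x = H V y"
  unfolding H_def by (rule ising_cong)

text \<open>A point of the n-fold preimage of x: x is moved n places to the right, whereas
  \<open>glue\<close> overwrites its beginning.\<close>

definition pre :: "nat \<Rightarrow> (nat \<Rightarrow> real) \<Rightarrow> (nat \<Rightarrow> real) \<Rightarrow> nat \<Rightarrow> real" where
  "pre n a x = (\<lambda>i. if i < n then a i else x (i - n))"

lemma transfer_pow:
  "(transfer \<phi> ^^ n) (\<lambda>_. 1) x = (\<Sum>a\<in>cfg {..<n}. exp (birkhoff_sum n \<phi> (pre n a x)))"
proof (induction n arbitrary: x)
  case 0
  then show ?case by (simp add: birkhoff_sum_def)
next
  case (Suc n)
  have eq: "exp (\<phi> (concat1 c x)) * exp (birkhoff_sum n \<phi> (pre n a (concat1 c x))) = exp (birkhoff_sum (Suc n) \<phi> (pre (Suc n) (a(n := c)) x))" for c a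
  proof -
    have p: "pre (Suc n) (a(n := c)) x = pre n a (concat1 c x)"
      by (auto simp: pre_def concat1_def fun_eq_iff less_Suc_eq split: nat.splits intro!: arg_cong[where f=x])
    have "birkhoff_sum (n + 1) \<phi> (pre n a (concat1 c x)) = birkhoff_sum n \<phi> (pre n a (concat1 c x)) + \<phi> (\<lambda>i. pre n a (concat1 c x) (n + i))"
      unfolding birkhoff_sum_add by (simp add: birkhoff_sum_def)
    also have "(\<lambda>i. pre n a (concat1 c x) (n + i)) = concat1 c x" by (simp add: pre_def)
    finally show ?thesis by (simp add: p exp_add mult.commute)
  qed
  have "(transfer \<phi> ^^ Suc n) (\<lambda>_. 1) x = (\<Sum>c\<in>{-1, 1}. \<Sum>a\<in>cfg {..<n}. exp (\<phi> (concat1 c x)) * exp (birkhoff_sum n \<phi> (pre n a (concat1 c x))))"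
    by (simp add: transfer_def Suc sum_distrib_left)
  also have "\<dots> = (\<Sum>a\<in>cfg {..<n}. \<Sum>c\<in>{-1, 1}. exp (birkhoff_sum (Suc n) \<phi> (pre (Suc n) (a(n := c)) x)))"
    unfolding eq by (rule sum.swap)
  also have "\<dots> = (\<Sum>a\<in>cfg {..<Suc n}. exp (birkhoff_sum (Suc n) \<phi> (pre (Suc n) a x)))"
    by (rule sum_cfg_snoc[symmetric])
  finally show ?case .
qed

text \<open>Telescoping: ln (Z n) is the sum of the logarithms of the converging ratios, so Cesaro
  averaging applies.\<close>

lemma ln_Z_tendsto: "(\<lambda>n. ln (Z n) / real n) \<longlonglongrightarrow> ln growth_rate"
proof -
  have "(\<lambda>n. ln (Z (Suc n) / Z n)) \<longlonglongrightarrow> ln growth_rate"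
    using growth_rate_pos by (intro tendsto_ln Z_ratio) simp
  then have "(\<lambda>n. (\<Sum>k<n. ln (Z (Suc k) / Z k)) / real n) \<longlonglongrightarrow> ln growth_rate" by (rule Cesaro)
  moreover have "(\<Sum>k<n. ln (Z (Suc k) / Z k)) = ln (Z n)" for n
  proof (induction n)
    case 0
    have "Z 0 = 1" by (simp add: Z_def H_def ising_def)
    then show ?case by simp
  next
    case (Suc n)
    then show ?case using Z_pos[of n] Z_pos[of "Suc n"] by (simp add: ln_div)
  qed
  ultimately show ?thesis by simp
qed

text \<open>Every n-fold preimage has a Birkhoff sum within \<open>boundary_error n\<close> of
  \<open>H\<close>, so the supremum is Z n up to a factor exp (o(n)).\<close>

lemma pressure_eq: "pressure \<phi> = ln growth_rate"
proof -
  let ?s = "\<lambda>n. SUP x\<in>space Xp. (transfer \<phi> ^^ n) (\<lambda>_. 1) x"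
  have bounds: "Z n * exp (- boundary_error n) \<le> (transfer \<phi> ^^ n) (\<lambda>_. 1) x" "(transfer \<phi> ^^ n) (\<lambda>_. 1) x \<le> Z n * exp (boundary_error n)"
    if x: "x \<in> space Xp" for n x
  proof -
    have near: "\<bar>birkhoff_sum n \<phi> (pre n a x) - H {..<n} a\<bar> \<le> boundary_error n" if a: "a \<in> cfg {..<n}" for a
    proof -
      have "pre n a x \<in> cube"
        using cfg_ivl[OF a] Xp_cube[OF x] by (auto simp: cube_def pre_def)
      moreover have "H {..<n} (pre n a x) = H {..<n} a" by (rule H_cong) (simp add: pre_def)
      ultimately show ?thesis using birkhoff_near by metis
    qed
    show "Z n * exp (- boundary_error n) \<le> (transfer \<phi> ^^ n) (\<lambda>_. 1) x"
      unfolding transfer_pow Z_def sum_distrib_right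
    proof (rule sum_mono)
      fix a assume "a \<in> cfg {..<n}"
      from near[OF this] show "exp (H {..<n} a) * exp (- boundary_error n) \<le> exp (birkhoff_sum n \<phi> (pre n a x))"
        unfolding exp_add[symmetric] exp_le_cancel_iff by linarith
    qed
    show "(transfer \<phi> ^^ n) (\<lambda>_. 1) x \<le> Z n * exp (boundary_error n)"
      unfolding transfer_pow Z_def sum_distrib_right
    proof (rule sum_mono)
      fix a assume "a \<in> cfg {..<n}"
      from near[OF this] show "exp (birkhoff_sum n \<phi> (pre n a x)) \<le> exp (H {..<n} a) * exp (boundary_error n)"
        unfolding exp_add[symmetric] exp_le_cancel_iff by linarith
    qed
  qed
  have one: "(\<lambda>_. 1) \<in> space Xp" by (simp add: space_Xp)
  have up: "?s n \<le> Z n * exp (boundary_error n)" for n using one bounds by (intro cSUP_least) auto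
  have lo: "Z n * exp (- boundary_error n) \<le> ?s n" for n
    using bounds(1)[OF one] bounds(2) by (intro cSUP_upper2[OF _ one]) (auto intro!: bdd_aboveI2)
  have ls: "\<bar>ln (?s n) - ln (Z n)\<bar> \<le> boundary_error n" for n
  proof -
    have p: "0 < Z n * exp (- boundary_error n)" using Z_pos[of n] by simp
    then have "ln (Z n * exp (- boundary_error n)) \<le> ln (?s n)" using lo[of n] by (intro ln_mono) auto
    moreover have "ln (?s n) \<le> ln (Z n * exp (boundary_error n))" using p lo[of n] up[of n] by (intro ln_mono) auto
    ultimately show ?thesis using Z_pos[of n] by (simp add: ln_mult abs_le_iff)
  qed
  have "(\<lambda>n. ln (?s n) / real n - ln (Z n) / real n) \<longlonglongrightarrow> 0"
  proof (rule Lim_null_comparison[OF _ boundary_error_tendsto])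
    show "eventually (\<lambda>n. norm (ln (?s n) / real n - ln (Z n) / real n) \<le> boundary_error n / real n) sequentially"
      using ls by (intro always_eventually allI) (simp add: diff_divide_distrib[symmetric] divide_right_mono)
  qed
  then have "(\<lambda>n. (ln (?s n) / real n - ln (Z n) / real n) + ln (Z n) / real n) \<longlonglongrightarrow> 0 + ln growth_rate"
    by (intro tendsto_add ln_Z_tendsto)
  then show ?thesis unfolding pressure_def by (intro limI) simp
qed

section \<open>Shift invariance of the bulk limit\<close>

text \<open>Both windows are compared with the same centred block, at the cost of one
  \<open>bulk_Cauchy\<close> each; this doubles the constant.\<close>

lemma mu_bulk:
  assumes r: "r \<le> k" "k + m + r \<le> N" and f: "\<And>a. a \<in> cfg {..<m} \<Longrightarrow> \<bar>f a\<bar> \<le> M"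
  shows "\<bar>gibbs N (\<lambda>x. f (win k m x)) - integral\<^sup>L \<mu> (\<lambda>x. f (win 0 m x))\<bar> \<le> real m * (8 * M * (1 + K) * \<beta>) * \<tau> r"
proof (rule LIMSEQ_le_const2)
  show "(\<lambda>R. \<bar>gibbs N (\<lambda>x. f (win k m x)) - gibbs (2 * R) (\<lambda>x. f (win R m x))\<bar>)
     \<longlonglongrightarrow> \<bar>gibbs N (\<lambda>x. f (win k m x)) - integral\<^sup>L \<mu> (\<lambda>x. f (win 0 m x))\<bar>"
    by (intro tendsto_rabs tendsto_diff tendsto_const mu_lim)
  show "\<exists>R0. \<forall>R\<ge>R0. \<bar>gibbs N (\<lambda>x. f (win k m x)) - gibbs (2 * R) (\<lambda>x. f (win R m x))\<bar> \<le> real m * (8 * M * (1 + K) * \<beta>) * \<tau> r"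
  proof (intro exI[of _ "m + r"] allI impI)
    fix R assume "m + r \<le> R"
    then have R: "r \<le> R" "R + m + r \<le> 2 * R" by auto
    have "real m * (8 * M * (1 + K) * \<beta>) * \<tau> r = 2 * (real m * (2 * M * (2 * (1 + K) * \<beta> * \<tau> r)))" by simp
    then show "\<bar>gibbs N (\<lambda>x. f (win k m x)) - gibbs (2 * R) (\<lambda>x. f (win R m x))\<bar> \<le> real m * (8 * M * (1 + K) * \<beta>) * \<tau> r"
      using bulk_Cauchy[where f=f and M=M, OF r f] bulk_Cauchy[where f=f and M=M, OF R f] by linarith
  qed
qed

text \<open>Moving the window from r to r + 1 keeps it deep inside the block, and
  \<open>mu_bulk\<close> is uniform in the position.\<close>

lemma mu_shift_invariant: "shift_invariant \<mu>"
  unfolding shift_invariant_def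
proof (intro conjI)
  show "prob_space \<mu>" "sets \<mu> = sets Xp" by (simp_all add: mu_prob)
  have sh: "shift = (\<lambda>x i. x (1 + i))" by (simp add: shift_def fun_eq_iff)
  have sm: "shift \<in> measurable \<mu> Xp" unfolding sh using shift_measurable[of 1] by (simp cong: measurable_cong_sets)
  interpret prob_space \<mu> by (rule mu_prob)
  show "distr \<mu> Xp shift = \<mu>"
  proof (rule measure_eq_Xp)
    show "finite_measure (distr \<mu> Xp shift)" by (rule finite_measure_distr[OF sm])
    show "finite_measure \<mu>" by unfold_locales
    fix m :: nat and a assume a: "a \<in> cfg {..<m}"
    let ?f = "\<lambda>b. of_bool (win 1 m b = a) :: real" and ?g = "\<lambda>b. of_bool (b = a) :: real"
    have w: "win 1 m (win k (Suc m) x) = win (Suc k) m x" for k x by (auto simp: win_def)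
    have "measure (distr \<mu> Xp shift) (cyl m a) = measure \<mu> (shift -` cyl m a \<inter> space \<mu>)"
      by (rule measure_distr[OF sm cyl_sets])
    also have "shift -` cyl m a \<inter> space \<mu> = local_set (Suc m) {b. win 1 m b = a}"
      unfolding cyl_eq_local_set[OF a] using w[of 0] by (auto simp: local_set_def shift_def space_Xp win_def)
    also have "measure \<mu> \<dots> = integral\<^sup>L \<mu> (\<lambda>x. ?f (win 0 (Suc m) x))"
      using measure_local_set_integral[OF mu_prob mu_sets] by simp
    finally have 1: "measure (distr \<mu> Xp shift) (cyl m a) = integral\<^sup>L \<mu> (\<lambda>x. ?f (win 0 (Suc m) x))" .
    have 2: "measure \<mu> (cyl m a) = integral\<^sup>L \<mu> (\<lambda>x. ?g (win 0 m x))"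
      unfolding cyl_eq_local_set[OF a] using measure_local_set_integral[OF mu_prob mu_sets, of m "{a}"] by simp
    have "(\<lambda>r. gibbs (2 * r) (\<lambda>x. ?f (win r (Suc m) x))) \<longlonglongrightarrow> measure \<mu> (cyl m a)"
    proof -
      have "(\<lambda>r. gibbs (2 * r) (\<lambda>x. ?g (win (Suc r) m x)) - measure \<mu> (cyl m a)) \<longlonglongrightarrow> 0"
      proof (rule Lim_null_comparison[OF _ tendsto_tail_bound[OF filterlim_minus_nat]])
        show "eventually (\<lambda>r. norm (gibbs (2 * r) (\<lambda>x. ?g (win (Suc r) m x)) - measure \<mu> (cyl m a))
            \<le> (real m * (8 * 1 * (1 + K) * \<beta>)) * \<tau> (r - Suc m)) sequentially"
          using eventually_ge_at_top[of "Suc m"]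
        proof eventually_elim
          case (elim r)
          then show ?case unfolding 2 real_norm_def by (intro mu_bulk) auto
        qed
      qed
      then show ?thesis unfolding w by (rule LIM_zero_cancel)
    qed
    moreover have "(\<lambda>r. gibbs (2 * r) (\<lambda>x. ?f (win r (Suc m) x))) \<longlonglongrightarrow> measure (distr \<mu> Xp shift) (cyl m a)"
      unfolding 1 by (rule mu_lim)
    ultimately show "measure (distr \<mu> Xp shift) (cyl m a) = measure \<mu> (cyl m a)" by (rule LIMSEQ_unique[rotated])
  qed simp_all
qed

text \<open>The word \<open>y\<close> is placed reflected on the left of the origin at site \<open>r\<close> and \<open>x\<close> on the right, so that \<open>Wlr\<close>
  is the interaction between the two half-lines.\<close>
definition lr :: "nat \<Rightarrow> (nat \<Rightarrow> real) \<Rightarrow> (nat \<Rightarrow> real) \<Rightarrow> nat \<Rightarrow> real" where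
  "lr r y x = (\<lambda>i\<in>{..<2 * r}. if i < r then y (r - Suc i) else x (i - r))"

definition Wlr :: "nat \<Rightarrow> (nat \<Rightarrow> real) \<Rightarrow> (nat \<Rightarrow> real) \<Rightarrow> real" where
  "Wlr r y x = (\<Sum>i<r. \<Sum>j<r. \<beta> * w 0 (Suc (i + j)) * (y i * x j))"

text \<open>The \<open>D\<^sub>r\<close> of the overview: y is averaged out under the free measure
  while x is frozen.\<close>

definition half_density :: "nat \<Rightarrow> (nat \<Rightarrow> real) \<Rightarrow> real" where
  "half_density r x = gibbs r (\<lambda>y. exp (Wlr r y x))"

lemma sum_upper_half: fixes r :: nat shows "(\<Sum>i\<in>{r..<2 * r}. f i) = (\<Sum>j<r. f (r + j))"
  by (rule sum.reindex_bij_witness[where i="\<lambda>j. r + j" and j="\<lambda>i. i - r"]) auto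

lemma sum_lower_half: "(\<Sum>i<r. f i) = (\<Sum>j<r. f (r - Suc j))"
  by (rule sum.nat_diff_reindex[symmetric])

lemma sum_lower_half2: "(\<Sum>i<r. \<Sum>j<r. f i j) = (\<Sum>i<r. \<Sum>j<r. f (r - Suc i) (r - Suc j))"
  by (rule trans[OF sum_lower_half]) (intro sum.cong refl sum_lower_half)

lemma w_reflect: "i < r \<Longrightarrow> j < r \<Longrightarrow> w (r - Suc i) (r - Suc j) = w i j"
  "i < r \<Longrightarrow> w (r - Suc i) (r + j) = w 0 (Suc (i + j))"
  by (simp_all add: wt_def of_nat_diff abs_minus_commute)

lemma lr_left: "i < r \<Longrightarrow> lr r y x (r - Suc i) = y i"
proof -
  assume "i < r"
  then have "r - Suc i < 2 * r" "r - Suc i < r" "r - Suc (r - Suc i) = i" by auto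
  then show ?thesis by (simp add: lr_def)
qed

lemma lr_right: "j < r \<Longrightarrow> lr r y x (r + j) = x j"
  by (simp add: lr_def)

lemma ising_lr:
  "ising {..<2 * r} (Jcross r 0) (\<lambda>_. 0) (lr r y x) = H {..<r} y + H {..<r} x"
proof -
  have l: "(\<Sum>i<r. \<Sum>j<r. \<beta> * w i j * lr r y x i * lr r y x j) = (\<Sum>i<r. \<Sum>j<r. \<beta> * w i j * y i * y j)"
    by (rule trans[OF sum_lower_half2]) (intro sum.cong refl, simp add: lr_left lr_right w_reflect)
  have u: "(\<Sum>i\<in>{r..<2 * r}. \<Sum>j\<in>{r..<2 * r}. \<beta> * w i j * lr r y x i * lr r y x j) = (\<Sum>i<r. \<Sum>j<r. \<beta> * w i j * x i * x j)"
    unfolding sum_upper_half by (intro sum.cong refl) (simp add: lr_def)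
  show ?thesis unfolding H_def ising_def Jcross_blocks l u by (simp add: add_divide_distrib)
qed

lemma Wcross_lr: "Wcross r (lr r y x) = Wlr r y x"
  unfolding Wcross_def Wlr_def sum_upper_half
  by (rule trans[OF sum_lower_half]) (intro sum.cong refl, simp add: lr_left lr_right w_reflect)

lemma lr_cfg: "y \<in> cfg {..<r} \<Longrightarrow> x \<in> cfg {..<r} \<Longrightarrow> lr r y x \<in> cfg {..<2 * r}"
  by (auto simp: lr_def PiE_iff)

lemma win_lr: "x \<in> cfg {..<r} \<Longrightarrow> win r r (lr r y x) = x"
  by (auto simp: lr_def win_def fun_eq_iff PiE_iff extensional_def)

lemma sum_cfg_lr: "(\<Sum>z\<in>cfg {..<2 * r}. g z) = (\<Sum>x\<in>cfg {..<r}. \<Sum>y\<in>cfg {..<r}. g (lr r y x))"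
proof -
  have "(\<Sum>z\<in>cfg {..<2 * r}. g z) = (\<Sum>(x, y)\<in>cfg {..<r} \<times> cfg {..<r}. g (lr r y x))"
  proof (rule sum.reindex_bij_witness[where i="\<lambda>(x, y). lr r y x" and j="\<lambda>z. (\<lambda>i\<in>{..<r}. z (r + i), \<lambda>i\<in>{..<r}. z (r - Suc i))"])
    fix p assume "p \<in> cfg {..<r} \<times> cfg {..<r}"
    then obtain x y where p: "p = (x, y)" "x \<in> cfg {..<r}" "y \<in> cfg {..<r}" by blast
    show "(case p of (x, y) \<Rightarrow> lr r y x) \<in> cfg {..<2 * r}" using p lr_cfg by simp
    have "(\<lambda>i\<in>{..<r}. lr r y x (r - Suc i)) = y"
      using p(3) by (auto simp: lr_def fun_eq_iff PiE_iff extensional_def)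
    moreover have "(\<lambda>i\<in>{..<r}. lr r y x (r + i)) = x" using win_lr[OF p(2), of y] by (simp add: win_def)
    ultimately show "(\<lambda>i\<in>{..<r}. (case p of (x, y) \<Rightarrow> lr r y x) (r + i), \<lambda>i\<in>{..<r}. (case p of (x, y) \<Rightarrow> lr r y x) (r - Suc i)) = p"
      using p by simp
  next
    fix z assume z: "z \<in> cfg {..<2 * r}"
    have "lr r (\<lambda>i\<in>{..<r}. z (r - Suc i)) (\<lambda>i\<in>{..<r}. z (r + i)) = z"
      using z by (auto simp: lr_def fun_eq_iff PiE_iff extensional_def)
    then show "(case (\<lambda>i\<in>{..<r}. z (r + i), \<lambda>i\<in>{..<r}. z (r - Suc i)) of (x, y) \<Rightarrow> lr r y x) = z"
      "(case (\<lambda>i\<in>{..<r}. z (r + i), \<lambda>i\<in>{..<r}. z (r - Suc i)) of (x, y) \<Rightarrow> g (lr r y x)) = g z" by simp_all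
    have "z (r + i) = -1 \<or> z (r + i) = 1" "z (r - Suc i) = -1 \<or> z (r - Suc i) = 1" if "i < r" for i
      using that by (auto intro!: cfg_val[OF z])
    then show "(\<lambda>i\<in>{..<r}. z (r + i), \<lambda>i\<in>{..<r}. z (r - Suc i)) \<in> cfg {..<r} \<times> cfg {..<r}"
      by (auto simp: PiE_iff)
  qed
  then show ?thesis by (simp only: sum.cartesian_product)
qed

lemma gE_Jcross_0:
  "gE {..<2 * r} (ising {..<2 * r} (Jcross r 0) (\<lambda>_. 0)) g = gibbs r (\<lambda>x. gibbs r (\<lambda>y. g (lr r y x)))"
proof -
  have e: "exp (H {..<r} y + H {..<r} x) = exp (H {..<r} x) * exp (H {..<r} y)" for x y by (simp add: exp_add)
  have "(\<Sum>z\<in>cfg {..<2 * r}. exp (ising {..<2 * r} (Jcross r 0) (\<lambda>_. 0) z) * f z)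
      = (\<Sum>x\<in>cfg {..<r}. exp (H {..<r} x) * (\<Sum>y\<in>cfg {..<r}. exp (H {..<r} y) * f (lr r y x)))" for f
    unfolding sum_cfg_lr ising_lr e by (simp only: sum_distrib_left mult.assoc)
  from this[of g] this[of "\<lambda>_. 1"] show ?thesis
    by (simp add: gE_def sum_distrib_right[symmetric] sum_divide_distrib[symmetric])
qed

text \<open>The block of length 2 r is the product of two free halves tilted by the cross energy;
  integrating out the left half leaves \<open>half_density\<close>, with its mean as
  normalisation.\<close>

lemma gibbs_two_sided:
  "gibbs (2 * r) (\<lambda>z. f (win r r z)) = gibbs r (\<lambda>x. f x * half_density r x) / gibbs r (half_density r)"
proof -
  have HW: "H {..<2 * r} = (\<lambda>x. ising {..<2 * r} (Jcross r 0) (\<lambda>_. 0) x + Wcross r x)"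
    using ising_Jcross[of r 1] by (simp add: Jcross_1[symmetric] fun_eq_iff)
  have "gibbs r (\<lambda>x. gibbs r (\<lambda>y. exp (Wlr r y x) * f (win r r (lr r y x)))) = gibbs r (\<lambda>x. f x * half_density r x)"
  proof (rule gE_cong[OF refl])
    fix x assume "x \<in> cfg {..<r}"
    then show "gibbs r (\<lambda>y. exp (Wlr r y x) * f (win r r (lr r y x))) = f x * half_density r x"
      using gE_cmult[of "{..<r}" "H {..<r}" "f x" "\<lambda>y. exp (Wlr r y x)"] by (simp add: win_lr half_density_def mult.commute)
  qed
  then show ?thesis
    unfolding HW by (simp add: gE_tilt gE_Jcross_0 Wcross_lr half_density_def[abs_def])
qed

lemma half_density_mean: "gibbs r (half_density r) \<le> exp K"
  using cross_mgf[of 1 r] by (simp add: gE_Jcross_0 Wcross_lr half_density_def[abs_def])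

text \<open>Cauchy-Schwarz against 1 in y moves the square inside and gives exp (2 W); this is why
  \<open>cross_mgf\<close> covers t = 2.\<close>

lemma half_density_second_moment: "gibbs r (\<lambda>x. (half_density r x)\<^sup>2) \<le> exp K"
proof -
  have "gibbs r (\<lambda>x. (half_density r x)\<^sup>2) \<le> gibbs r (\<lambda>x. gibbs r (\<lambda>y. exp (2 * Wlr r y x)))"
  proof (rule gE_mono[OF finite_lessThan])
    fix x
    show "(half_density r x)\<^sup>2 \<le> gibbs r (\<lambda>y. exp (2 * Wlr r y x))"
      using gE_Cauchy_Schwarz[OF finite_lessThan[of r], of "H {..<r}" "\<lambda>_. 1" "\<lambda>y. exp (Wlr r y x)"]
      by (simp add: half_density_def exp_double)
  qed
  also have "\<dots> \<le> exp K" using cross_mgf[of 2 r] by (simp add: gE_Jcross_0 Wcross_lr)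
  finally show ?thesis .
qed

text \<open>Flipping the left half changes the sign of W and preserves the free law, so exp W may be
  replaced by cosh W.\<close>

lemma half_density_ge_1: "1 \<le> half_density r x"
proof -
  have n: "gibbs r (\<lambda>y. exp (Wlr r y x)) = gibbs r (\<lambda>y. exp (- Wlr r y x))"
  proof -
    have "gibbs r (\<lambda>y. exp (Wlr r (\<lambda>k\<in>{..<r}. - y k) x)) = gibbs r (\<lambda>y. exp (Wlr r y x))"
      unfolding H_def by (rule gE_neg[OF even_on_ising])
    moreover have "Wlr r (\<lambda>k\<in>{..<r}. - y k) x = - Wlr r y x" for y
      by (simp add: Wlr_def sum_negf)
    ultimately show ?thesis by simp
  qed
  have "1 = gibbs r (\<lambda>_. 1)" by simp
  also have "\<dots> \<le> gibbs r (\<lambda>y. 1/2 * (exp (Wlr r y x) + exp (- Wlr r y x)))"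
  proof (rule gE_mono[OF finite_lessThan])
    fix y
    have "2 \<le> exp (Wlr r y x) + exp (- Wlr r y x)"
      using exp_ge_add_one_self[of "Wlr r y x"] exp_ge_add_one_self[of "- Wlr r y x"] by linarith
    then show "1 \<le> 1/2 * (exp (Wlr r y x) + exp (- Wlr r y x))" by simp
  qed
  also have "\<dots> = half_density r x" unfolding gE_cmult gE_add n[symmetric] half_density_def by simp
  finally show ?thesis .
qed

lemma gibbs_half_density_ge_1: "1 \<le> gibbs r (half_density r)"
  using gE_mono[OF finite_lessThan[of r], of "\<lambda>_. 1" "half_density r"] half_density_ge_1 by simp

lemma two_sided_local:
  assumes "m \<le> r"
  shows "gibbs (2 * r) (\<lambda>z. f (win r m z)) = gibbs r (\<lambda>x. f (win 0 m x) * half_density r x) / gibbs r (half_density r)"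
  using gibbs_two_sided[of r "\<lambda>x. f (win 0 m x)"] assms by (simp add: win_win)

text \<open>The numerator only grows when a density \<ge> 1 is inserted, and the normalisation is at
  most exp K.\<close>

lemma nu_le_mu_local: "measure \<nu> (local_set m Q) \<le> exp K * measure \<mu> (local_set m Q)"
proof -
  let ?f = "\<lambda>b. of_bool (b \<in> Q) :: real"
  have "integral\<^sup>L \<nu> (\<lambda>x. ?f (win 0 m x)) \<le> exp K * integral\<^sup>L \<mu> (\<lambda>x. ?f (win 0 m x))"
  proof (rule tendsto_le[OF trivial_limit_sequentially tendsto_mult[OF tendsto_const mu_lim] nu_lim])
    show "eventually (\<lambda>r. gibbs r (\<lambda>x. ?f (win 0 m x)) \<le> exp K * gibbs (2 * r) (\<lambda>x. ?f (win r m x))) sequentially"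
      using eventually_ge_at_top[of m]
    proof eventually_elim
      case (elim r)
      have "gibbs r (\<lambda>x. ?f (win 0 m x)) * gibbs r (half_density r) \<le> gibbs r (\<lambda>x. ?f (win 0 m x) * half_density r x) * exp K"
      proof (rule mult_mono)
        show "gibbs r (\<lambda>x. ?f (win 0 m x)) \<le> gibbs r (\<lambda>x. ?f (win 0 m x) * half_density r x)"
          using half_density_ge_1 by (intro gE_mono) auto
        show "0 \<le> gibbs r (\<lambda>x. ?f (win 0 m x) * half_density r x)"
          using half_density_ge_1[THEN order_trans[OF zero_le_one]] by (intro gE_nonneg) auto
      qed (use half_density_mean gibbs_half_density_ge_1[of r] in auto)
      then show ?case unfolding two_sided_local[OF elim, of ?f] using gibbs_half_density_ge_1[of r] by (simp add: field_simps)
    qed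
  qed
  then show ?thesis using measure_local_set_integral[OF nu_prob nu_sets] measure_local_set_integral[OF mu_prob mu_sets] by simp
qed

text \<open>Only a second moment of the density is available, so Cauchy-Schwarz bounds the square of
  \<mu> on local sets; this still forces null sets to be null.\<close>

lemma mu_le_nu_local: "(measure \<mu> (local_set m Q))\<^sup>2 \<le> exp K * measure \<nu> (local_set m Q)"
proof -
  let ?f = "\<lambda>b. of_bool (b \<in> Q) :: real"
  have "(integral\<^sup>L \<mu> (\<lambda>x. ?f (win 0 m x)))\<^sup>2 \<le> exp K * integral\<^sup>L \<nu> (\<lambda>x. ?f (win 0 m x))"
  proof (rule tendsto_le[OF trivial_limit_sequentially tendsto_mult[OF tendsto_const nu_lim] tendsto_power[OF mu_lim]])
    show "eventually (\<lambda>r. (gibbs (2 * r) (\<lambda>x. ?f (win r m x)))\<^sup>2 \<le> exp K * gibbs r (\<lambda>x. ?f (win 0 m x))) sequentially"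
      using eventually_ge_at_top[of m]
    proof eventually_elim
      case (elim r)
      let ?c = "gibbs r (\<lambda>x. ?f (win 0 m x) * half_density r x)"
      have c0: "0 \<le> ?c" using half_density_ge_1[THEN order_trans[OF zero_le_one]] by (intro gE_nonneg) auto
      have "?c / gibbs r (half_density r) \<le> ?c / 1"
        using c0 gibbs_half_density_ge_1[of r] by (intro divide_left_mono) auto
      then have "(?c / gibbs r (half_density r))\<^sup>2 \<le> ?c\<^sup>2"
        using c0 gibbs_half_density_ge_1[of r] by (intro power_mono) auto
      also have "\<dots> \<le> gibbs r (\<lambda>x. (?f (win 0 m x))\<^sup>2) * gibbs r (\<lambda>x. (half_density r x)\<^sup>2)"
        by (rule gE_Cauchy_Schwarz) simp
      also have "\<dots> \<le> gibbs r (\<lambda>x. (?f (win 0 m x))\<^sup>2) * exp K"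
        by (intro mult_left_mono half_density_second_moment gE_nonneg) auto
      also have "(\<lambda>x. (?f (win 0 m x))\<^sup>2) = (\<lambda>x. ?f (win 0 m x))" by (auto simp: fun_eq_iff)
      finally show ?case unfolding two_sided_local[OF elim, of ?f] by (simp only: mult.commute)
    qed
  qed
  then show ?thesis using measure_local_set_integral[OF nu_prob nu_sets] measure_local_set_integral[OF mu_prob mu_sets] by simp
qed

end

section \<open>Equivalence of the two measures and the integrable eigenfunction\<close>

text \<open>A quadratic bound on local sets suffices: approximate a null set of M by one local set
  in M and N together, so that its M-measure is tiny while its N-measure would stay bounded
  below.\<close>

lemma absolutely_continuous_local:
  assumes M: "finite_measure M" "sets M = sets Xp" and N: "finite_measure N" "sets N = sets Xp"
    and le: "\<And>B. B \<in> local_sets \<Longrightarrow> (measure N B)\<^sup>2 \<le> C * measure M B"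
  shows "absolutely_continuous M N"
  unfolding absolutely_continuous_def
proof
  interpret M: finite_measure M by fact
  interpret N: finite_measure N by fact
  fix A assume "A \<in> null_sets M"
  then have A: "A \<in> sets Xp" "measure M A = 0" using M(2) by (auto simp: null_sets_def measure_def)
  have "measure N A \<le> 0"
  proof (rule ccontr)
    define c where "c = measure N A"
    assume "\<not> measure N A \<le> 0"
    then have c: "0 < c" by (simp add: c_def)
    define C' where "C' = max C 1"
    have C': "1 \<le> C'" "C \<le> C'" by (auto simp: C'_def)
    \<comment> \<open>The first bound keeps \<open>measure N B\<close> above c / 2, and C' * e \<le>
      (c / 2)^2 then contradicts the hypothesis; C' \<ge> 1 makes e positive.\<close>
    define e where "e = min (c / 2) (c\<^sup>2 / (4 * C'))"
    have e: "0 < e" using c C' by (simp add: e_def)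
    obtain B where B: "B \<in> local_sets" "measure M ((A - B) \<union> (B - A)) < e" "measure N ((A - B) \<union> (B - A)) < e"
      using local_approximation[OF M N A(1) e] by blast
    have Bs: "B \<in> sets Xp" using B(1) by (auto simp: local_sets_def local_set_sets)
    let ?D = "(A - B) \<union> (B - A)"
    have "measure N A \<le> measure N (B \<union> ?D)" using A Bs N by (intro N.finite_measure_mono) auto
    also have "\<dots> \<le> measure N B + measure N ?D" using A Bs N by (intro measure_Un_le) auto
    finally have 1: "c / 2 < measure N B" using B(3) by (simp add: c_def e_def)
    have "measure M B \<le> measure M (A \<union> ?D)" using A Bs M by (intro M.finite_measure_mono) auto
    also have "\<dots> \<le> measure M A + measure M ?D" using A Bs M by (intro measure_Un_le) auto
    finally have 2: "measure M B < e" using B(2) A(2) by simp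
    have "(c / 2)\<^sup>2 < (measure N B)\<^sup>2" using 1 c by (intro power_strict_mono) auto
    also have "\<dots> \<le> C' * measure M B" using le[OF B(1)] mult_right_mono[OF C'(2), of "measure M B"] by simp
    also have "\<dots> \<le> C' * e" using 2 C' by (intro mult_left_mono) auto
    also have "\<dots> \<le> C' * (c\<^sup>2 / (4 * C'))" using C' by (intro mult_left_mono) (auto simp: e_def)
    also have "\<dots> = (c / 2)\<^sup>2" using C' by (simp add: power2_eq_square)
    finally show False by simp
  qed
  then have "measure N A = 0" using measure_nonneg[of N A] by linarith
  then show "A \<in> null_sets N" using A(1) N by (simp add: null_sets_def N.emeasure_eq_measure)
qed

context high_temperature
begin

lemma mu_finite: "finite_measure \<mu>" and nu_finite: "finite_measure \<nu>"
  using mu_prob nu_prob by (auto simp: prob_space_def)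

lemma mu_abs_nu: "absolutely_continuous \<nu> \<mu>"
proof (rule absolutely_continuous_local[OF nu_finite nu_sets mu_finite mu_sets])
  fix B assume "B \<in> local_sets"
  then show "(measure \<mu> B)\<^sup>2 \<le> exp K * measure \<nu> B" using mu_le_nu_local by (auto simp: local_sets_def)
qed

text \<open>The linear bound is weakened to a quadratic one, as probabilities are at most 1, so that
  the same criterion applies.\<close>

lemma nu_abs_mu: "absolutely_continuous \<mu> \<nu>"
proof (rule absolutely_continuous_local[OF mu_finite mu_sets nu_finite nu_sets])
  fix B assume "B \<in> local_sets"
  then have "measure \<nu> B \<le> exp K * measure \<mu> B" using nu_le_mu_local by (auto simp: local_sets_def)
  moreover have "(measure \<nu> B)\<^sup>2 \<le> measure \<nu> B"
    using mult_left_le_one_le[OF measure_nonneg measure_nonneg, of \<nu> B \<nu> B] prob_space.prob_le_1[OF nu_prob, of B]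
    by (simp add: power2_eq_square)
  ultimately show "(measure \<nu> B)\<^sup>2 \<le> exp K * measure \<mu> B" by linarith
qed

lemma exp_pressure: "exp (pressure \<phi>) = growth_rate"
  using growth_rate_pos by (simp add: pressure_eq)

text \<open>Let h be the density of \<mu>. The \<nu>-integral over A of its image under the operator
  equals that of the image of h times the indicator of the preimage of A under S, hence the
  eigenvalue times \<mu> of that preimage; and \<mu> is shift invariant.\<close>

lemma L1_eigenfunction:
  "\<exists>h. integrable \<nu> h \<and> (AE x in \<nu>. 0 \<le> h x) \<and> \<not> (AE x in \<nu>. h x = 0) \<and>
     (AE x in \<nu>. transfer \<phi> h x = exp (pressure \<phi>) * h x)"
proof -
  interpret N: prob_space \<nu> by (rule nu_prob)
  interpret Mu: prob_space \<mu> by (rule mu_prob)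
  obtain h where h: "h \<in> borel_measurable \<nu>" "\<And>x. 0 \<le> h x" "density \<nu> (\<lambda>x. ennreal (h x)) = \<mu>"
  proof -
    obtain D where D: "D \<in> borel_measurable \<nu>" "AE x in \<nu>. RN_deriv \<nu> \<mu> x = ennreal (D x)" "\<And>x. 0 \<le> D x"
      using N.real_RN_deriv[OF mu_finite mu_abs_nu] by (auto simp: mu_sets)
    have "density \<nu> (\<lambda>x. ennreal (D x)) = density \<nu> (RN_deriv \<nu> \<mu>)"
    proof (rule density_cong)
      show "AE x in \<nu>. ennreal (D x) = RN_deriv \<nu> \<mu> x" using D(2) by eventually_elim simp
    qed (use D(1) in simp_all)
    also have "\<dots> = \<mu>" by (rule N.density_RN_deriv[OF mu_abs_nu]) simp
    finally show ?thesis using that D by blast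
  qed
  have hm [measurable]: "h \<in> borel_measurable Xp" using h(1) by (simp cong: measurable_cong_sets)
  have tot: "(\<integral>\<^sup>+x. ennreal (h x) \<partial>\<nu>) = 1"
  proof -
    have "emeasure (density \<nu> (\<lambda>x. ennreal (h x))) (space \<mu>) = 1" unfolding h(3) by (rule Mu.emeasure_space_1)
    then have "(\<integral>\<^sup>+x. ennreal (h x) * indicator (space \<mu>) x \<partial>\<nu>) = 1"
      using h(1) by (subst (asm) emeasure_density) simp_all
    moreover have "(\<integral>\<^sup>+x. ennreal (h x) * indicator (space \<mu>) x \<partial>\<nu>) = (\<integral>\<^sup>+x. ennreal (h x) \<partial>\<nu>)"
      by (rule nn_integral_cong) simp
    ultimately show ?thesis by simp
  qed
  have int: "integrable \<nu> h"
    using h(1,2) tot by (intro integrableI_nonneg) auto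
  let ?Th = "\<lambda>x. \<Sum>c\<in>{-1, 1 :: real}. ennreal (exp (\<phi> (concat1 c x))) * ennreal (h (concat1 c x))"
  have [measurable]: "concat1 1 \<in> measurable Xp Xp" "concat1 (-1) \<in> measurable Xp Xp"
    by (auto intro: concat1_measurable_snd)
  have Thm: "?Th \<in> borel_measurable \<nu>" by simp
  have "AE x in \<nu>. ?Th x = ennreal growth_rate * ennreal (h x)"
  proof (rule N.density_unique_finite_measure)
    fix A assume "A \<in> sets \<nu>"
    then have A [measurable]: "A \<in> sets Xp" by simp
    let ?S = "\<lambda>x i. x (1 + i)"
    have SA: "?S -` A \<inter> space Xp \<in> sets Xp" by (rule measurable_sets[OF shift_measurable A])
    let ?g = "\<lambda>x. ennreal (h x) * indicator (?S -` A \<inter> space Xp) x"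
    have "(\<integral>\<^sup>+x. ?Th x * indicator A x \<partial>\<nu>) = (\<integral>\<^sup>+x. (\<Sum>c\<in>{-1, 1 :: real}. ennreal (exp (\<phi> (concat1 c x))) * ?g (concat1 c x)) \<partial>\<nu>)"
    proof (rule nn_integral_cong)
      fix x assume "x \<in> space \<nu>"
      then have "indicator (?S -` A \<inter> space Xp) (concat1 c x) = (indicator A x :: ennreal)" if "c \<in> {-1, 1}" for c
        using concat1_Xp[OF that, of x] by (simp add: indicator_def concat1_def)
      then show "?Th x * indicator A x = (\<Sum>c\<in>{-1, 1 :: real}. ennreal (exp (\<phi> (concat1 c x))) * ?g (concat1 c x))"
        by (simp add: sum_distrib_right distrib_right mult.assoc)
    qed
    also have "\<dots> = ennreal growth_rate * (\<integral>\<^sup>+x. ?g x \<partial>\<nu>)"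
      by (rule nu_eigen_nn) (use SA in measurable)
    also have "(\<integral>\<^sup>+x. ?g x \<partial>\<nu>) = emeasure \<mu> (?S -` A \<inter> space Xp)"
      using SA h(1) by (subst h(3)[symmetric], subst emeasure_density) simp_all
    also have "\<dots> = emeasure (distr \<mu> Xp shift) A"
    proof -
      have sh: "shift = ?S" by (simp add: shift_def fun_eq_iff)
      have "shift \<in> measurable \<mu> Xp" unfolding sh using shift_measurable[of 1] by (simp cong: measurable_cong_sets)
      then show ?thesis by (subst emeasure_distr) (simp_all add: sh)
    qed
    also have "\<dots> = emeasure \<mu> A" using mu_shift_invariant by (simp add: shift_invariant_def)
    also have "\<dots> = (\<integral>\<^sup>+x. ennreal (h x) * indicator A x \<partial>\<nu>)"
      using A h(1) by (subst h(3)[symmetric], subst emeasure_density) simp_all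
    also have "ennreal growth_rate * \<dots> = (\<integral>\<^sup>+x. ennreal growth_rate * (ennreal (h x) * indicator A x) \<partial>\<nu>)"
      by (rule nn_integral_cmult[symmetric]) (use A h(1) in measurable)
    finally show "(\<integral>\<^sup>+x. ?Th x * indicator A x \<partial>\<nu>) = (\<integral>\<^sup>+x. ennreal growth_rate * ennreal (h x) * indicator A x \<partial>\<nu>)"
      by (simp add: mult.assoc)
  qed (use Thm h(1) in auto)
  then have "AE x in \<nu>. transfer \<phi> h x = exp (pressure \<phi>) * h x"
  proof eventually_elim
    case (elim x)
    have "?Th x = ennreal (transfer \<phi> h x)"
      using h(2) by (simp add: transfer_def ennreal_mult[symmetric] ennreal_plus[symmetric] del: ennreal_plus)
    then have "ennreal (transfer \<phi> h x) = ennreal (growth_rate * h x)" using elim h(2) growth_rate_pos by (simp add: ennreal_mult)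
    moreover have "0 \<le> transfer \<phi> h x" using h(2) by (simp add: transfer_def)
    ultimately show ?case using h(2)[of x] growth_rate_pos by (simp add: exp_pressure)
  qed
  moreover have "\<not> (AE x in \<nu>. h x = 0)"
  proof
    assume "AE x in \<nu>. h x = 0"
    then have "(\<integral>\<^sup>+x. ennreal (h x) \<partial>\<nu>) = (\<integral>\<^sup>+x. 0 \<partial>\<nu>)" by (intro nn_integral_cong_AE) auto
    then show False using tot by simp
  qed
  ultimately show ?thesis using int h(2) by blast
qed

end

section \<open>Continuity of the density for exponents above 3/2\<close>

text \<open>The exponent 1 + \<delta> is reserved to keep the series convergent, and the remaining
  power is bounded by its value at l = 0. This loses \<delta> against the true order \<alpha> - 1,
  which the strict inequality \<alpha> > 3/2 can afford.\<close>

lemma tail_sum_le_powr: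
  assumes "1 < \<alpha>" "0 < \<delta>" "1 + \<delta> < \<alpha>" "0 < m"
  shows "tail_sum \<alpha> m \<le> tail_sum (1 + \<delta>) 1 * real m powr (- (\<alpha> - 1 - \<delta>))"
proof -
  have le: "real (m + l) powr (- \<alpha>) \<le> real (1 + l) powr (- (1 + \<delta>)) * real m powr (- (\<alpha> - 1 - \<delta>))" for l
  proof -
    have "real (m + l) powr (- \<alpha>) = real (m + l) powr (- (1 + \<delta>)) * real (m + l) powr (- (\<alpha> - 1 - \<delta>))"
      using assms by (simp add: powr_add[symmetric])
    also have "\<dots> \<le> real (1 + l) powr (- (1 + \<delta>)) * real m powr (- (\<alpha> - 1 - \<delta>))"
      using assms by (intro mult_mono powr_mono2') auto
    finally show ?thesis .
  qed
  have s: "summable (\<lambda>l. real (1 + l) powr (- (1 + \<delta>)))" by (rule summable_tail) (use assms in simp)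
  have "tail_sum \<alpha> m \<le> (\<Sum>l. real (1 + l) powr (- (1 + \<delta>)) * real m powr (- (\<alpha> - 1 - \<delta>)))"
    unfolding tail_sum_def by (intro suminf_le le summable_tail summable_mult2 s assms)
  also have "\<dots> = tail_sum (1 + \<delta>) 1 * real m powr (- (\<alpha> - 1 - \<delta>))"
    unfolding tail_sum_def by (rule suminf_mult2[OF s, symmetric])
  finally show ?thesis .
qed

lemma summable_tail_sum_sq:
  assumes "3/2 < \<alpha>"
  shows "summable (\<lambda>i. (tail_sum \<alpha> (Suc i))\<^sup>2)"
proof -
  \<comment> \<open>This choice gives 2 s = \<alpha> - 1/2 > 1.\<close>
  define \<delta> where "\<delta> = (\<alpha> - 3/2) / 2"
  define s where "s = \<alpha> - 1 - \<delta>"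
  have d: "1 < \<alpha>" "0 < \<delta>" "1 + \<delta> < \<alpha>" and s: "1 < 2 * s" using assms by (simp_all add: \<delta>_def s_def field_simps)
  have "summable (\<lambda>i. real (Suc i) powr (- (2 * s)))"
    using summable_tail[OF s, of 1] by simp
  then have sm: "summable (\<lambda>i. (tail_sum (1 + \<delta>) 1)\<^sup>2 * real (Suc i) powr (- (2 * s)))" by (rule summable_mult)
  show ?thesis
  proof (rule summable_comparison_test'[OF sm])
    fix i
    have "(tail_sum \<alpha> (Suc i))\<^sup>2 \<le> (tail_sum (1 + \<delta>) 1 * real (Suc i) powr (- s))\<^sup>2"
      unfolding s_def using d by (intro power_mono tail_sum_le_powr tail_sum_nonneg) auto
    also have "\<dots> = (tail_sum (1 + \<delta>) 1)\<^sup>2 * real (Suc i) powr (- (2 * s))"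
      by (simp add: power_mult_distrib power2_eq_square powr_add[symmetric])
    finally show "norm ((tail_sum \<alpha> (Suc i))\<^sup>2) \<le> (tail_sum (1 + \<delta>) 1)\<^sup>2 * real (Suc i) powr (- (2 * s))" by simp
  qed
qed

context high_temperature
begin

text \<open>Field of the right half-line x on the reflected left site i, which is at distance i + 1
  + l from the spin x l; unlike in \<open>bfield\<close> the factor \<beta> is included.\<close>

definition right_field :: "(nat \<Rightarrow> real) \<Rightarrow> nat \<Rightarrow> real" where
  "right_field x i = \<beta> * (\<Sum>l. w 0 (Suc i + l) * x l)"

lemma right_field_le: "x \<in> cube \<Longrightarrow> \<bar>right_field x i\<bar> \<le> \<beta> * \<tau> (Suc i)"
  using abs_suminf_w_le[of x 0 "Suc i"] cube_abs[of x] beta by (simp add: right_field_def abs_mult)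

lemma continuous_right_field: "continuous_on cube (\<lambda>x. right_field x i)"
proof -
  have "uniform_limit cube (\<lambda>N x. \<Sum>l<N. w 0 (Suc i + l) * x l) (\<lambda>x. \<Sum>l. w 0 (Suc i + l) * x l) sequentially"
  proof (rule Weierstrass_m_test[OF _ summable_w])
    fix l and x :: "nat \<Rightarrow> real" assume "x \<in> cube"
    then show "norm (w 0 (Suc i + l) * x l) \<le> w 0 (Suc i + l)"
      using cube_abs[of x l] mult_left_mono[of "\<bar>x l\<bar>" 1 "w 0 (Suc i + l)"] by (simp add: abs_mult)
  qed
  then have "continuous_on cube (\<lambda>x. \<Sum>l. w 0 (Suc i + l) * x l)"
    by (rule uniform_limit_theorem[rotated]) (auto intro!: continuous_intros always_eventually)
  then show ?thesis unfolding right_field_def by (intro continuous_on_mult continuous_on_const)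
qed

text \<open>With x frozen the coupling energy is linear in y, which reduces the density to
  exponential moments of linear functions.\<close>

lemma Wlr_right_field: "Wlr r y x = (\<Sum>i<r. y i * right_field (ext r x) i)"
proof -
  have "(\<Sum>l. w 0 (Suc i + l) * ext r x l) = (\<Sum>l<r. w 0 (Suc i + l) * x l)" for i
  proof -
    have "(\<Sum>l. w 0 (Suc i + l) * ext r x l) = (\<Sum>l<r. w 0 (Suc i + l) * ext r x l)"
      by (rule suminf_finite) (simp_all add: ext_def)
    then show ?thesis by (simp add: ext_def)
  qed
  then show ?thesis by (simp add: Wlr_def right_field_def sum_distrib_left mult_ac)
qed

text \<open>The spins are centred: \<open>Gaussian_bound\<close> with oscillations 2 |g i| gives the
  upper bound, exp u \<ge> 1 + u the lower one.\<close>

lemma linear_exp_bounds: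
  "gibbs r (\<lambda>y. exp (\<Sum>i<r. y i * g i)) \<le> exp (2 * (1 + K) * (\<Sum>i<r. (g i)\<^sup>2))"
  "1 \<le> gibbs r (\<lambda>y. exp (\<Sum>i<r. y i * g i))"
proof -
  have mean: "gibbs r (\<lambda>y. \<Sum>i<r. y i * g i) = 0"
  proof -
    have "gibbs r (\<lambda>y. \<Sum>i<r. g i * y i) = (\<Sum>i<r. g i * gibbs r (\<lambda>y. y i))"
      by (simp only: gE_sum[OF finite_lessThan] gE_cmult)
    also have "\<dots> = 0" unfolding H_def by (intro sum.neutral ballI) (simp add: gE_odd[OF even_on_ising])
    finally show ?thesis by (simp only: mult.commute)
  qed
  have os: "osc_le {..<r} (\<lambda>y. \<Sum>i<r. y i * g i) (\<lambda>i. 2 * \<bar>g i\<bar>)"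
    unfolding osc_le_def
  proof (intro ballI)
    fix y i assume i: "i \<in> {..<r}"
    have "(\<Sum>k<r. (y(i := 1)) k * g k) - (\<Sum>k<r. (y(i := -1)) k * g k) = (\<Sum>k<r. if k = i then 2 * g k else 0)"
      unfolding sum_subtractf[symmetric] by (intro sum.cong) (auto simp: algebra_simps)
    also have "\<dots> = 2 * g i" using i by simp
    finally show "\<bar>(\<Sum>k<r. (y(i := 1)) k * g k) - (\<Sum>k<r. (y(i := -1)) k * g k)\<bar> \<le> 2 * \<bar>g i\<bar>" by simp
  qed
  have "gibbs r (\<lambda>y. exp (\<Sum>i<r. y i * g i)) \<le> exp (gibbs r (\<lambda>y. \<Sum>i<r. y i * g i) + (1 + K) / 2 * (\<Sum>i<r. (2 * \<bar>g i\<bar>)\<^sup>2))"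
    by (rule Gaussian_bound[OF finite_lessThan weakly_coupled_H[OF finite_lessThan] os])
  moreover have "(1 + K) / 2 * (\<Sum>i<r. (2 * \<bar>g i\<bar>)\<^sup>2) = 2 * (1 + K) * (\<Sum>i<r. (g i)\<^sup>2)"
    by (simp add: power_mult_distrib sum_distrib_left[symmetric])
  ultimately show "gibbs r (\<lambda>y. exp (\<Sum>i<r. y i * g i)) \<le> exp (2 * (1 + K) * (\<Sum>i<r. (g i)\<^sup>2))"
    by (simp only: mean add_0_left)
  have "1 = gibbs r (\<lambda>y. 1 + (\<Sum>i<r. y i * g i))" by (simp add: gE_add mean)
  also have "\<dots> \<le> gibbs r (\<lambda>y. exp (\<Sum>i<r. y i * g i))" by (rule gE_mono) (simp_all add: exp_ge_add_one_self)
  finally show "1 \<le> gibbs r (\<lambda>y. exp (\<Sum>i<r. y i * g i))" .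
qed

text \<open>Only the M left sites nearest to the origin interact with x. At fixed M this is the mean
  of a local observable of y, for which the free measures converge; M = r corresponds to
  \<open>half_density\<close>.\<close>

definition trunc_density :: "nat \<Rightarrow> nat \<Rightarrow> (nat \<Rightarrow> real) \<Rightarrow> real" where
  "trunc_density r M x = gibbs r (\<lambda>y. exp (\<Sum>i<M. y i * right_field x i))"

lemma half_density_eq_trunc_density: "half_density r x = trunc_density r r (ext r x)"
  by (simp add: half_density_def trunc_density_def Wlr_right_field)

lemma trunc_density_ge_1: "1 \<le> trunc_density r r x"
  unfolding trunc_density_def by (rule linear_exp_bounds)

lemma continuous_trunc_density: "continuous_on cube (trunc_density r M)"
  unfolding trunc_density_def[abs_def] gE_def
  using partition_pos[OF finite_lessThan, of "H {..<r}" r]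
  by (intro continuous_on_divide continuous_on_sum continuous_on_mult continuous_on_exp continuous_on_const continuous_right_field ballI) auto

text \<open>Split the exponent into the part b of the sites below M and the rest u. Cauchy-Schwarz
  separates exp b from exp u - 1, and the latter is small in mean square because the squared fields
  have a small tail sum, uniformly in x and r.\<close>

lemma trunc_density_truncate:
  assumes a: "3/2 < \<alpha>"
  shows "\<exists>\<epsilon>. \<epsilon> \<longlonglongrightarrow> 0 \<and> (\<forall>M r x. M \<le> r \<longrightarrow> x \<in> cube \<longrightarrow> \<bar>trunc_density r r x - trunc_density r M x\<bar> \<le> \<epsilon> M)"
proof -
  define T where "T M = (\<Sum>i. (\<tau> (Suc (i + M)))\<^sup>2)" for M
  note sm = summable_tail_sum_sq[OF a]
  have T0: "T \<longlonglongrightarrow> 0"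
  proof -
    have "T = (\<lambda>M. (\<Sum>i. (\<tau> (Suc i))\<^sup>2) - (\<Sum>i<M. (\<tau> (Suc i))\<^sup>2))"
      unfolding T_def by (intro ext suminf_minus_initial_segment[OF sm])
    then show ?thesis using tendsto_diff[OF tendsto_const summable_LIMSEQ[OF sm], of "\<Sum>i. (\<tau> (Suc i))\<^sup>2"] by simp
  qed
  \<comment> \<open>Twice a field has square at most 4 \<beta>^2 times the squared tail sum, and the
    Gaussian bound contributes 2 (1 + K).\<close>
  define c where "c = 8 * (1 + K) * \<beta>\<^sup>2"
  have c: "0 \<le> c" using K_ge by (simp add: c_def)
  define \<epsilon> where "\<epsilon> M = sqrt (exp (c * T 0) * (exp (c * T M) - 1))" for M
  have "\<epsilon> \<longlonglongrightarrow> sqrt (exp (c * T 0) * (exp (c * 0) - 1))"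
    unfolding \<epsilon>_def by (intro tendsto_intros T0)
  moreover have "\<bar>trunc_density r r x - trunc_density r M x\<bar> \<le> \<epsilon> M" if Mr: "M \<le> r" and x: "x \<in> cube" for M r x
  proof -
    define b u where "b i = (if i < M then right_field x i else 0)" and "u i = (if i < M then 0 else right_field x i)" for i
    have sb: "(\<Sum>i<M. y i * right_field x i) = (\<Sum>i<r. y i * b i)" for y :: "nat \<Rightarrow> real"
      unfolding b_def using Mr by (intro sum.mono_neutral_cong_left) auto
    have sbu: "(\<Sum>i<r. y i * right_field x i) = (\<Sum>i<r. y i * b i) + (\<Sum>i<r. y i * u i)" for y :: "nat \<Rightarrow> real"
      unfolding sum.distrib[symmetric] by (intro sum.cong) (auto simp: b_def u_def)
    have hsq: "(right_field x i)\<^sup>2 \<le> \<beta>\<^sup>2 * (\<tau> (Suc i))\<^sup>2" for i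
      using power_mono[OF right_field_le[OF x, of i] abs_ge_zero, of 2] by (simp add: power_mult_distrib)
    have eb: "gibbs r (\<lambda>y. (exp (\<Sum>i<r. y i * b i))\<^sup>2) \<le> exp (c * T 0)"
    proof -
      have "(exp (\<Sum>i<r. y i * b i))\<^sup>2 = exp (\<Sum>i<r. y i * (2 * b i))" for y :: "nat \<Rightarrow> real"
        by (simp add: exp_double[symmetric] sum_distrib_left mult_ac)
      then have "gibbs r (\<lambda>y. (exp (\<Sum>i<r. y i * b i))\<^sup>2) \<le> exp (2 * (1 + K) * (\<Sum>i<r. (2 * b i)\<^sup>2))"
        using linear_exp_bounds(1)[of r "\<lambda>i. 2 * b i"] by simp
      also have "2 * (1 + K) * (\<Sum>i<r. (2 * b i)\<^sup>2) \<le> 2 * (1 + K) * (4 * \<beta>\<^sup>2 * T 0)"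
      proof (intro mult_left_mono)
        have "(\<Sum>i<r. (2 * b i)\<^sup>2) \<le> (\<Sum>i<r. 4 * \<beta>\<^sup>2 * (\<tau> (Suc i))\<^sup>2)"
          using hsq by (intro sum_mono) (auto simp: b_def power_mult_distrib)
        also have "\<dots> \<le> 4 * \<beta>\<^sup>2 * T 0"
          unfolding sum_distrib_left[symmetric] T_def using sum_le_suminf[OF sm, of "{..<r}"] by (intro mult_left_mono) auto
        finally show "(\<Sum>i<r. (2 * b i)\<^sup>2) \<le> 4 * \<beta>\<^sup>2 * T 0" .
      qed (use K_ge in simp)
      also have "2 * (1 + K) * (4 * \<beta>\<^sup>2 * T 0) = c * T 0" by (simp add: c_def algebra_simps)
      finally show ?thesis by simp
    qed
    \<comment> \<open>Expand the square; since exp u has mean at least 1, the last two terms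
      contribute at most -1, and only the mean of exp (2 u) minus 1 remains.\<close>
    have eu: "gibbs r (\<lambda>y. (exp (\<Sum>i<r. y i * u i) - 1)\<^sup>2) \<le> exp (c * T M) - 1"
    proof -
      have "(exp (\<Sum>i<r. y i * u i) - 1)\<^sup>2 = exp (\<Sum>i<r. y i * (2 * u i)) - (2 * exp (\<Sum>i<r. y i * u i) - 1)" for y :: "nat \<Rightarrow> real"
      proof -
        have "exp (\<Sum>i<r. y i * (2 * u i)) = (exp (\<Sum>i<r. y i * u i))\<^sup>2"
          by (simp add: exp_double[symmetric] sum_distrib_left mult_ac)
        then show ?thesis by (simp add: power2_eq_square algebra_simps)
      qed
      then have "gibbs r (\<lambda>y. (exp (\<Sum>i<r. y i * u i) - 1)\<^sup>2)
          = gibbs r (\<lambda>y. exp (\<Sum>i<r. y i * (2 * u i))) - (2 * gibbs r (\<lambda>y. exp (\<Sum>i<r. y i * u i)) - 1)"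
        by (simp add: gE_diff gE_cmult)
      also have "\<dots> \<le> exp (2 * (1 + K) * (\<Sum>i<r. (2 * u i)\<^sup>2)) - 1"
        using linear_exp_bounds(1)[of r "\<lambda>i. 2 * u i"] linear_exp_bounds(2)[of r u] by linarith
      also have "2 * (1 + K) * (\<Sum>i<r. (2 * u i)\<^sup>2) \<le> 2 * (1 + K) * (4 * \<beta>\<^sup>2 * T M)"
      proof (intro mult_left_mono)
        have "(\<Sum>i<r. (2 * u i)\<^sup>2) = (\<Sum>i\<in>{M..<r}. (2 * right_field x i)\<^sup>2)"
          by (rule sum.mono_neutral_cong_right) (auto simp: u_def)
        also have "\<dots> = (\<Sum>i<r - M. (2 * right_field x (i + M))\<^sup>2)"
          by (rule sum.reindex_bij_witness[where i="\<lambda>i. i + M" and j="\<lambda>i. i - M"]) auto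
        also have "\<dots> \<le> (\<Sum>i<r - M. 4 * \<beta>\<^sup>2 * (\<tau> (Suc (i + M)))\<^sup>2)"
          using hsq by (intro sum_mono) (simp add: power_mult_distrib)
        also have "\<dots> \<le> 4 * \<beta>\<^sup>2 * T M"
          unfolding sum_distrib_left[symmetric] T_def
          using sum_le_suminf[OF summable_ignore_initial_segment[OF sm, of M], of "{..<r - M}"] by (intro mult_left_mono) auto
        finally show "(\<Sum>i<r. (2 * u i)\<^sup>2) \<le> 4 * \<beta>\<^sup>2 * T M" .
      qed (use K_ge in simp)
      also have "2 * (1 + K) * (4 * \<beta>\<^sup>2 * T M) = c * T M" by (simp add: c_def algebra_simps)
      finally show ?thesis by simp
    qed
    have "trunc_density r r x - trunc_density r M x = gibbs r (\<lambda>y. exp (\<Sum>i<r. y i * b i) * (exp (\<Sum>i<r. y i * u i) - 1))"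
      unfolding trunc_density_def sb sbu by (simp add: exp_add right_diff_distrib gE_diff)
    then have "(trunc_density r r x - trunc_density r M x)\<^sup>2 \<le> gibbs r (\<lambda>y. (exp (\<Sum>i<r. y i * b i))\<^sup>2) * gibbs r (\<lambda>y. (exp (\<Sum>i<r. y i * u i) - 1)\<^sup>2)"
      using gE_Cauchy_Schwarz[OF finite_lessThan] by simp
    also have "\<dots> \<le> exp (c * T 0) * (exp (c * T M) - 1)"
      using eb eu by (intro mult_mono gE_nonneg) auto
    finally show ?thesis unfolding \<epsilon>_def by (intro real_le_rsqrt) simp
  qed
  ultimately show ?thesis by auto
qed

text \<open>Two scales: M is fixed first to make the truncation error small for all larger r, then r
  grows at fixed M.\<close>

lemma trunc_density_uniform_limit:
  assumes a: "3/2 < \<alpha>"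
  shows "\<exists>D. uniform_limit cube (\<lambda>r. trunc_density r r) D sequentially"
proof -
  obtain \<epsilon> where e0: "\<epsilon> \<longlonglongrightarrow> 0" and e: "\<And>M r x. M \<le> r \<Longrightarrow> x \<in> cube \<Longrightarrow> \<bar>trunc_density r r x - trunc_density r M x\<bar> \<le> \<epsilon> M"
    using trunc_density_truncate[OF a] by blast
  have "uniformly_Cauchy_on cube (\<lambda>r. trunc_density r r)"
    unfolding uniformly_Cauchy_on_def
  proof (intro allI impI)
    fix \<delta> :: real assume d: "0 < \<delta>"
    obtain M where M: "\<epsilon> M < \<delta> / 4"
      using order_tendstoD(2)[OF e0, of "\<delta> / 4"] d by (auto simp: eventually_sequentially)
    define C where "C = exp (\<Sum>i<M. \<beta> * \<tau> (Suc i))"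
    have lim: "(\<lambda>n. (real M * (2 * C * (2 * (1 + K) * \<beta>))) * \<tau> (n - M)) \<longlonglongrightarrow> 0"
      by (rule tendsto_tail_bound[OF filterlim_minus_nat])
    have "eventually (\<lambda>n. (real M * (2 * C * (2 * (1 + K) * \<beta>))) * \<tau> (n - M) < \<delta> / 4 \<and> M \<le> n) sequentially"
      using order_tendstoD(2)[OF lim, of "\<delta> / 4"] d by (intro eventually_conj eventually_ge_at_top) simp
    then obtain n where n: "(real M * (2 * C * (2 * (1 + K) * \<beta>))) * \<tau> (n - M) < \<delta> / 4" "M \<le> n"
      by (auto simp: eventually_sequentially)
    have near: "\<bar>trunc_density N N x - trunc_density n M x\<bar> < \<delta> / 2" if N: "n \<le> N" and x: "x \<in> cube" for N x
    proof -
      let ?f = "\<lambda>y. exp (\<Sum>i<M. y i * right_field x i)"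
      have w: "?f (win 0 M y) = ?f y" for y by (simp add: win_def)
      have "\<bar>gibbs N (\<lambda>y. ?f (win 0 M y)) - gibbs n (\<lambda>y. ?f (win 0 M y))\<bar> \<le> real M * (2 * C * (2 * (1 + K) * \<beta> * \<tau> (n - M)))"
      proof (rule half_line_Cauchy[OF n(2) N])
        fix y assume y: "y \<in> cfg {..<M}"
        have "(\<Sum>i<M. y i * right_field x i) \<le> (\<Sum>i<M. \<beta> * \<tau> (Suc i))"
        proof (rule sum_mono)
          fix i assume "i \<in> {..<M}"
          then have "\<bar>y i * right_field x i\<bar> \<le> \<beta> * \<tau> (Suc i)" using right_field_le[OF x, of i] cfg_abs[OF y] by (simp add: abs_mult)
          then show "y i * right_field x i \<le> \<beta> * \<tau> (Suc i)" by linarith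
        qed
        then show "\<bar>?f y\<bar> \<le> C" by (simp add: C_def)
      qed
      then have "\<bar>trunc_density N M x - trunc_density n M x\<bar> \<le> (real M * (2 * C * (2 * (1 + K) * \<beta>))) * \<tau> (n - M)"
        unfolding w trunc_density_def by (simp only: mult.assoc)
      moreover have "\<bar>trunc_density N N x - trunc_density N M x\<bar> \<le> \<epsilon> M" using n(2) N x by (intro e) auto
      ultimately show ?thesis using M n(1) by linarith
    qed
    have "dist (trunc_density k k x) (trunc_density N N x) < \<delta>" if "n \<le> k" "n \<le> N" "x \<in> cube" for k N x
      using near[OF that(1,3)] near[OF that(2,3)] unfolding dist_real_def by linarith
    then show "\<exists>M. \<forall>x\<in>cube. \<forall>m\<ge>M. \<forall>n\<ge>M. dist (trunc_density m m x) (trunc_density n n x) < \<delta>" by blast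
  qed
  then have "uniformly_convergent_on cube (\<lambda>r. trunc_density r r)" by (rule Cauchy_uniformly_convergent)
  then show ?thesis unfolding uniformly_convergent_on_def by simp
qed

text \<open>\<open>half_density\<close> is \<open>trunc_density\<close> at the truncated point, so
  uniform convergence on \<open>cube\<close> allows replacing it by the continuous D inside the free
  expectation.\<close>

lemma gibbs_half_density_limit:
  assumes D: "uniform_limit cube (\<lambda>r. trunc_density r r) D sequentially" and F: "continuous_on cube F"
  shows "(\<lambda>r. gibbs r (\<lambda>x. F (ext r x) * half_density r x)) \<longlonglongrightarrow> integral\<^sup>L \<nu> (\<lambda>x. F x * D x)"
proof -
  have Dc: "continuous_on cube D"
    by (rule uniform_limit_theorem[OF _ D]) (auto intro!: always_eventually continuous_trunc_density)
  obtain B where B: "0 \<le> B" "\<And>x. x \<in> cube \<Longrightarrow> \<bar>F x\<bar> \<le> B" using continuous_cube_bounded[OF F] by blast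
  have "(\<lambda>r. gibbs r (\<lambda>x. F (ext r x) * half_density r x) - gibbs r (\<lambda>x. F (ext r x) * D (ext r x))) \<longlonglongrightarrow> 0"
  proof (rule LIMSEQ_I)
    fix \<delta> :: real assume "0 < \<delta>"
    then have d: "0 < \<delta> / (2 * (B + 1))" using B(1) by simp
    obtain r0 where r0: "\<And>r x. r0 \<le> r \<Longrightarrow> x \<in> cube \<Longrightarrow> dist (trunc_density r r x) (D x) < \<delta> / (2 * (B + 1))"
      using D d unfolding uniform_limit_iff eventually_sequentially by meson
    have "\<bar>gibbs r (\<lambda>x. F (ext r x) * half_density r x) - gibbs r (\<lambda>x. F (ext r x) * D (ext r x))\<bar> \<le> \<delta> / 2" if r: "r0 \<le> r" for r
    proof (rule gE_diff_le[OF finite_lessThan])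
      fix x assume "x \<in> cfg {..<r}"
      then have x: "ext r x \<in> cube" by (rule ext_cube)
      have "\<bar>F (ext r x) * half_density r x - F (ext r x) * D (ext r x)\<bar> = \<bar>F (ext r x)\<bar> * \<bar>trunc_density r r (ext r x) - D (ext r x)\<bar>"
        by (simp add: half_density_eq_trunc_density abs_mult[symmetric] right_diff_distrib)
      also have "\<dots> \<le> (B + 1) * (\<delta> / (2 * (B + 1)))"
        using r0[OF r x] B(2)[OF x] B(1) by (intro mult_mono) (auto simp: dist_real_def)
      also have "\<dots> = \<delta> / 2"
      proof -
        have "C * (\<delta> / (2 * C)) = \<delta> / 2" if "C \<noteq> 0" for C :: real using that by simp
        then show ?thesis using B(1) by (metis add_nonneg_eq_0_iff zero_le_one zero_neq_one)
      qed
      finally show "\<bar>F (ext r x) * half_density r x - F (ext r x) * D (ext r x)\<bar> \<le> \<delta> / 2" .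
    qed
    then show "\<exists>no. \<forall>r\<ge>no. norm (gibbs r (\<lambda>x. F (ext r x) * half_density r x) - gibbs r (\<lambda>x. F (ext r x) * D (ext r x)) - 0) < \<delta>"
      using \<open>0 < \<delta>\<close> by (intro exI[of _ r0]) fastforce
  qed
  moreover have "(\<lambda>r. gibbs r (\<lambda>x. F (ext r x) * D (ext r x))) \<longlonglongrightarrow> integral\<^sup>L \<nu> (\<lambda>x. F x * D x)"
    by (intro nu_lim_continuous continuous_on_mult F Dc)
  ultimately show ?thesis by (rule Lim_transform[rotated])
qed

text \<open>The conditional weight of the word is continuous and positive on the compact cube, hence
  bounded below.\<close>

lemma nu_cyl_pos:
  assumes a: "a \<in> cfg {..<m}"
  shows "0 < measure \<nu> (cyl m a)"
proof -
  interpret prob_space \<nu> by (rule nu_prob)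
  \<comment> \<open>The empty word: with it \<open>nu_DLR_cyl\<close> becomes a statement on the
    first m spins alone.\<close>
  have u: "(\<lambda>_. undefined) \<in> cfg {..<0 :: nat}" by simp
  have "cube \<noteq> {}" using Xp_cube[of "\<lambda>_. 1"] by (auto simp: space_Xp)
  then obtain x0 where x0: "x0 \<in> cube" "\<And>y. y \<in> cube \<Longrightarrow> kern m a x0 \<le> kern m a y"
    using continuous_attains_inf[OF compact_cube _ continuous_kern[OF a]] by blast
  have "kern m a x0 = integral\<^sup>L \<nu> (\<lambda>_. kern m a x0)" by (simp add: prob_space)
  also have "\<dots> \<le> integral\<^sup>L \<nu> (kern m a)"
    using x0(2) Xp_cube by (intro integral_mono continuous_cube_integrable[OF continuous_kern[OF a] nu_prob nu_sets]) auto
  also have "\<dots> = measure \<nu> (cyl m a)"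
    using nu_DLR_cyl[OF a u] integral_chi[OF nu_prob nu_sets a] by (simp add: chi_def[of 0])
  finally show ?thesis using kern_pos[of m a x0] by linarith
qed

text \<open>The density is the uniform limit D divided by its \<nu>-mean; positivity is inherited
  from the lower bound 1 in finite volume.\<close>

lemma continuous_density:
  assumes a: "3/2 < \<alpha>"
  shows "\<exists>g. continuous_on cube g \<and> (\<forall>x\<in>cube. 0 < g x) \<and> density \<nu> (\<lambda>x. ennreal (g x)) = \<mu>"
proof -
  interpret N: prob_space \<nu> by (rule nu_prob)
  obtain D where D: "uniform_limit cube (\<lambda>r. trunc_density r r) D sequentially" using trunc_density_uniform_limit[OF a] by blast
  have Dc: "continuous_on cube D"
    by (rule uniform_limit_theorem[OF _ D]) (auto intro!: always_eventually continuous_trunc_density)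
  have D1: "1 \<le> D x" if "x \<in> cube" for x
    by (rule LIMSEQ_le_const[OF tendsto_uniform_limitI[OF D that]]) (auto simp: trunc_density_ge_1)
  define c where "c = integral\<^sup>L \<nu> D"
  have ci: "integrable \<nu> D" by (rule continuous_cube_integrable[OF Dc nu_prob nu_sets])
  have c1: "1 \<le> c"
  proof -
    have "integral\<^sup>L \<nu> (\<lambda>_. 1) \<le> c" unfolding c_def using D1 Xp_cube by (intro integral_mono ci) auto
    then show ?thesis by simp
  qed
  define g where "g x = D x / c" for x
  have gc: "continuous_on cube g" unfolding g_def using c1 by (intro continuous_on_divide Dc continuous_on_const) auto
  have gp: "0 < g x" if "x \<in> cube" for x using D1[OF that] c1 by (simp add: g_def)
  have gi: "integrable \<nu> g" by (rule continuous_cube_integrable[OF gc nu_prob nu_sets])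
  have gm: "(\<lambda>x. ennreal (g x)) \<in> borel_measurable \<nu>" using continuous_cube_measurable[OF gc] by simp
  have Dlim: "(\<lambda>r. gibbs r (half_density r)) \<longlonglongrightarrow> c"
    using gibbs_half_density_limit[OF D continuous_on_const[of _ 1]] by (simp add: c_def)
  have cylg: "integral\<^sup>L \<nu> (\<lambda>x. chi m a x * g x) = measure \<mu> (cyl m a)" if a: "a \<in> cfg {..<m}" for m a
  proof (rule LIMSEQ_unique)
    have "(\<lambda>r. gibbs r (\<lambda>x. chi m a (ext r x) * half_density r x) / gibbs r (half_density r)) \<longlonglongrightarrow> integral\<^sup>L \<nu> (\<lambda>x. chi m a x * D x) / c"
      using continuous_chi[of cube m a 0] c1 by (intro tendsto_divide gibbs_half_density_limit[OF D] Dlim) auto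
    also have "integral\<^sup>L \<nu> (\<lambda>x. chi m a x * D x) / c = integral\<^sup>L \<nu> (\<lambda>x. chi m a x * g x)"
      by (simp add: g_def)
    finally have lim: "(\<lambda>r. gibbs r (\<lambda>x. chi m a (ext r x) * half_density r x) / gibbs r (half_density r)) \<longlonglongrightarrow> integral\<^sup>L \<nu> (\<lambda>x. chi m a x * g x)" .
    have ev: "eventually (\<lambda>r. gibbs r (\<lambda>x. chi m a (ext r x) * half_density r x) / gibbs r (half_density r) = gibbs (2 * r) (\<lambda>z. of_bool (win r m z = a))) sequentially"
      using eventually_ge_at_top[of m]
    proof eventually_elim
      case (elim r)
      have "gibbs r (\<lambda>x. of_bool (win 0 m x = a) * half_density r x) = gibbs r (\<lambda>x. chi m a (ext r x) * half_density r x)"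
      proof (rule gE_cong[OF refl])
        fix x assume x: "x \<in> cfg {..<r}"
        have "chi m a (ext r x) = of_bool (\<forall>i<m. ext r x i = a i)"
          by (rule chi_eq[OF a]) (use elim cfg_val[OF x] in \<open>simp add: ext_def\<close>)
        also have "\<dots> = of_bool (win 0 m x = a)"
          using elim by (simp add: win_eq_iff[OF a] ext_def cong: imp_cong)
        finally show "of_bool (win 0 m x = a) * half_density r x = chi m a (ext r x) * half_density r x" by simp
      qed
      then show ?case using two_sided_local[OF elim, of "\<lambda>b. of_bool (b = a)"] by simp
    qed
    show "(\<lambda>r. gibbs (2 * r) (\<lambda>z. of_bool (win r m z = a))) \<longlonglongrightarrow> integral\<^sup>L \<nu> (\<lambda>x. chi m a x * g x)"
      using Lim_transform_eventually[OF lim ev] .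
    show "(\<lambda>r. gibbs (2 * r) (\<lambda>z. of_bool (win r m z = a))) \<longlonglongrightarrow> measure \<mu> (cyl m a)"
      using mu_lim[of "\<lambda>b. of_bool (b \<in> {a})" m] measure_local_set_integral[OF mu_prob mu_sets, of m "{a}"]
      by (simp add: cyl_eq_local_set[OF a] del: mem_Collect_eq)
  qed
  have "density \<nu> (\<lambda>x. ennreal (g x)) = \<mu>"
  proof (rule measure_eq_Xp)
    have em: "emeasure (density \<nu> (\<lambda>x. ennreal (g x))) (cyl m a) = ennreal (measure \<mu> (cyl m a))" if a: "a \<in> cfg {..<m}" for m a
    proof -
      have "emeasure (density \<nu> (\<lambda>x. ennreal (g x))) (cyl m a) = (\<integral>\<^sup>+x. ennreal (g x) * indicator (cyl m a) x \<partial>\<nu>)"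
        by (rule emeasure_density[OF gm]) (simp add: cyl_sets)
      also have "\<dots> = (\<integral>\<^sup>+x. ennreal (chi m a x * g x) \<partial>\<nu>)"
      proof (rule nn_integral_cong)
        fix x assume "x \<in> space \<nu>"
        then have "x \<in> space Xp" by (simp only: nu_space)
        then show "ennreal (g x) * indicator (cyl m a) x = ennreal (chi m a x * g x)"
          by (cases "x \<in> cyl m a") (simp_all only: chi_Xp[OF a] indicator_simps not_False_eq_True mult_1 mult_1_right mult_zero_left mult_zero_right ennreal_0)
      qed
      also have "\<dots> = ennreal (integral\<^sup>L \<nu> (\<lambda>x. chi m a x * g x))"
      proof (rule nn_integral_eq_integral)
        show "integrable \<nu> (\<lambda>x. chi m a x * g x)"
          using continuous_chi[of cube m a 0] by (intro continuous_cube_integrable continuous_on_mult gc nu_prob nu_sets) simp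
        show "AE x in \<nu>. 0 \<le> chi m a x * g x"
        proof (rule AE_I2)
          fix x assume "x \<in> space \<nu>"
          then have x: "x \<in> space Xp" by simp
          show "0 \<le> chi m a x * g x"
            unfolding chi_Xp[OF a x] using gp[OF Xp_cube[OF x]] by simp
        qed
      qed
      finally show ?thesis unfolding cylg[OF a] .
    qed
    have u: "(\<lambda>_. undefined) \<in> cfg {..<0 :: nat}" by simp
    show "finite_measure (density \<nu> (\<lambda>x. ennreal (g x)))"
      using em[OF u] by (intro finite_measureI) simp
    show "finite_measure \<mu>" by (rule mu_finite)
    fix m :: nat and a assume "a \<in> cfg {..<m}"
    then show "measure (density \<nu> (\<lambda>x. ennreal (g x))) (cyl m a) = measure \<mu> (cyl m a)"
      by (subst (1) measure_def) (simp only: em, simp)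
  qed simp_all
  then show ?thesis using gc gp by blast
qed

text \<open>The eigenvalue equation holds when tested on cylinders. Were the continuous defect E
  nonzero at x, it would keep its sign on a cylinder around x, which has positive mass.\<close>

lemma continuous_eigenfunction:
  assumes gc: "continuous_on cube g" and gp: "\<And>x. x \<in> cube \<Longrightarrow> 0 < g x" and dens: "density \<nu> (\<lambda>x. ennreal (g x)) = \<mu>"
    and x: "x \<in> space Xp"
  shows "transfer \<phi> g x = exp (pressure \<phi>) * g x"
proof (rule ccontr)
  interpret N: prob_space \<nu> by (rule nu_prob)
  define E where "E y = transfer \<phi> g y - growth_rate * g y" for y
  have Ec: "continuous_on cube E" unfolding E_def by (intro continuous_on_diff continuous_transfer continuous_on_mult continuous_on_const gc)
  assume "transfer \<phi> g x \<noteq> exp (pressure \<phi>) * g x"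
  then have "E x \<noteq> 0" by (simp add: E_def exp_pressure)
  define s where "s = sgn (E x)"
  define e where "e = \<bar>E x\<bar> / 2"
  have e: "0 < e" "s * E x = 2 * e" using \<open>E x \<noteq> 0\<close> by (auto simp: s_def e_def sgn_mult_abs sgn_if abs_if)
  obtain m where m: "\<And>x y. x \<in> cube \<Longrightarrow> y \<in> cube \<Longrightarrow> (\<And>i. i < m \<Longrightarrow> x i = y i) \<Longrightarrow> \<bar>E x - E y\<bar> < e"
    using continuous_cube_local[OF Ec e(1)] by blast
  define a where "a = win 0 m x"
  have a: "a \<in> cfg {..<m}" unfolding a_def by (rule Xp_ivl_cfg[OF x])
  have chc: "continuous_on cube (chi m a)" using continuous_chi[of cube m a 0] by simp
  have shc: "continuous_on cube (\<lambda>y. chi m a (\<lambda>i. y (1 + i)))" by (rule continuous_chi)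
  have mu_int: "integral\<^sup>L \<mu> F = integral\<^sup>L \<nu> (\<lambda>y. F y * g y)" if F: "continuous_on cube F" for F
  proof -
    have "integral\<^sup>L \<mu> F = integral\<^sup>L \<nu> (\<lambda>y. g y *\<^sub>R F y)"
      unfolding dens[symmetric] using gp Xp_cube continuous_cube_measurable[OF F] continuous_cube_measurable[OF gc]
      by (intro integral_density) (auto intro!: AE_I2 less_imp_le)
    then show ?thesis by (simp add: mult.commute)
  qed
  have zero: "integral\<^sup>L \<nu> (\<lambda>y. chi m a y * E y) = 0"
  proof -
    have i: "integrable \<nu> (\<lambda>y. chi m a y * transfer \<phi> g y)" "integrable \<nu> (\<lambda>y. chi m a y * (growth_rate * g y))"
      by (intro continuous_cube_integrable continuous_on_mult chc continuous_transfer continuous_on_const gc nu_prob nu_sets)+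
    have "integral\<^sup>L \<nu> (\<lambda>y. chi m a y * transfer \<phi> g y) = integral\<^sup>L \<nu> (transfer \<phi> (\<lambda>y. chi m a (\<lambda>i. y (1 + i)) * g y))"
      by (intro Bochner_Integration.integral_cong refl) (simp add: transfer_def concat1_def distrib_left mult_ac)
    also have "\<dots> = growth_rate * integral\<^sup>L \<nu> (\<lambda>y. chi m a (\<lambda>i. y (1 + i)) * g y)"
      by (intro nu_eigen continuous_on_mult shc gc)
    also have "integral\<^sup>L \<nu> (\<lambda>y. chi m a (\<lambda>i. y (1 + i)) * g y) = integral\<^sup>L \<mu> (\<lambda>y. chi m a (\<lambda>i. y (1 + i)))"
      by (rule mu_int[OF shc, symmetric])
    also have "\<dots> = integral\<^sup>L (distr \<mu> Xp shift) (chi m a)"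
    proof -
      have sh: "shift = (\<lambda>x i. x (1 + i))" by (simp add: shift_def fun_eq_iff)
      have "shift \<in> measurable \<mu> Xp" unfolding sh using shift_measurable[of 1] by (simp cong: measurable_cong_sets)
      then show ?thesis using continuous_cube_measurable[OF chc] by (subst integral_distr) (simp_all add: sh)
    qed
    also have "distr \<mu> Xp shift = \<mu>" using mu_shift_invariant by (simp add: shift_invariant_def)
    also have "integral\<^sup>L \<mu> (chi m a) = integral\<^sup>L \<nu> (\<lambda>y. chi m a y * g y)" by (rule mu_int[OF chc])
    also have "growth_rate * \<dots> = integral\<^sup>L \<nu> (\<lambda>y. chi m a y * (growth_rate * g y))"
      by (simp add: mult.left_commute)
    finally show ?thesis unfolding E_def right_diff_distrib by (subst Bochner_Integration.integral_diff[OF i]) simp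
  qed
  have "e * measure \<nu> (cyl m a) = integral\<^sup>L \<nu> (\<lambda>y. e * chi m a y)"
    using integral_chi[OF nu_prob nu_sets a] by simp
  also have "\<dots> \<le> integral\<^sup>L \<nu> (\<lambda>y. s * (chi m a y * E y))"
  proof (rule integral_mono)
    show "integrable \<nu> (\<lambda>y. e * chi m a y)" "integrable \<nu> (\<lambda>y. s * (chi m a y * E y))"
      by (intro continuous_cube_integrable continuous_on_mult chc Ec continuous_on_const nu_prob nu_sets)+
    fix y assume "y \<in> space \<nu>"
    then have y: "y \<in> space Xp" by simp
    show "e * chi m a y \<le> s * (chi m a y * E y)"
    proof (cases "\<forall>i<m. y i = a i")
      case True
      have "\<bar>E x - E y\<bar> < e" using True by (intro m Xp_cube x y) (simp add: a_def win_def)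
      moreover have "s * E y = s * E x - s * (E x - E y)" by (simp add: algebra_simps)
      moreover have "\<bar>s * (E x - E y)\<bar> \<le> \<bar>E x - E y\<bar>" by (simp add: s_def abs_mult sgn_if)
      ultimately have "e \<le> s * E y" using e(2) by linarith
      then show ?thesis using True y by (simp add: chi_Xp[OF a y] mult.left_commute)
    next
      case False
      then have "chi m a y = 0" by (simp add: chi_Xp[OF a y] indicator_def)
      then show ?thesis by simp
    qed
  qed
  also have "\<dots> = 0" using zero by simp
  finally show False using e(1) nu_cyl_pos[OF a] by (simp add: mult_le_0_iff)
qed

end

section \<open>Entropy and the equilibrium state\<close>

text \<open>\<open>entropy_rate\<close> is a bare \<open>lim\<close>, which carries information only
  once convergence is known; Fekete's lemma supplies it from subadditivity.\<close>

lemma Fekete: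
  fixes a :: "nat \<Rightarrow> real"
  assumes sub: "\<And>m n. a (m + n) \<le> a m + a n" and nn: "\<And>n. 0 \<le> a n"
  shows "convergent (\<lambda>n. a n / real n)"
proof -
  define L where "L = Inf ((\<lambda>n. a n / real n) ` {1..})"
  have bdd: "bdd_below ((\<lambda>n. a n / real n) ` {1..})" by (rule bdd_belowI2[of _ 0]) (simp add: nn)
  have lower: "L \<le> a n / real n" if "1 \<le> n" for n
    unfolding L_def using that by (intro cINF_lower bdd) auto
  have mult: "a (q * m) \<le> real q * a m" if "1 \<le> q" for q m
    using that
  proof (induction q rule: dec_induct)
    case (step q)
    have "a (Suc q * m) \<le> a m + a (q * m)" using sub[of m "q * m"] by simp
    then show ?case using step by (simp add: algebra_simps)
  qed simp
  have "(\<lambda>n. a n / real n) \<longlonglongrightarrow> L"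
  proof (rule LIMSEQ_I)
    fix e :: real assume e: "0 < e"
    have "\<exists>m\<in>{1..}. a m / real m < L + e / 2"
      using cINF_less_iff[OF _ bdd, of "L + e / 2"] e by (auto simp: L_def)
    then obtain m where m: "1 \<le> m" "a m / real m < L + e / 2" by auto
    define C where "C = (\<Sum>r<m. a r)"
    have C: "a r \<le> C" if "r < m" for r unfolding C_def using that nn by (intro member_le_sum) auto
    obtain n1 where n1: "C < real n1 * (e / 2)" using reals_Archimedean3[of "e / 2"] e by auto
    have "norm (a n / real n - L) < e" if n: "max (max m n1) 1 \<le> n" for n
    proof -
      have np: "0 < real n" "m \<le> n" using n by auto
      define q r where "q = n div m" and "r = n mod m"
      have qr: "n = q * m + r" "r < m" "1 \<le> q"
        using m np by (auto simp: q_def r_def div_greater_zero_iff Suc_le_eq)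
      have "a n \<le> a (q * m) + a r" unfolding qr(1) by (rule sub)
      also have "\<dots> \<le> real q * a m + C" using mult[OF qr(3)] C[OF qr(2)] by (rule add_mono)
      also have "real q * a m = (real q * real m) * (a m / real m)" using m by simp
      also have "\<dots> \<le> real n * (a m / real m)"
        using nn[of m] by (intro mult_right_mono) (simp_all add: qr(1))
      finally have "a n \<le> real n * (a m / real m) + C" by simp
      also have "\<dots> < real n * (L + e / 2) + real n * (e / 2)"
      proof (intro add_strict_mono mult_strict_left_mono m np)
        have "real n1 * (e / 2) \<le> real n * (e / 2)" using n e by (intro mult_right_mono) auto
        then show "C < real n * (e / 2)" using n1 by linarith
      qed
      also have "\<dots> = real n * (L + e)" by (simp add: algebra_simps)
      finally have "a n / real n < L + e" using np by (simp add: divide_less_eq mult.commute)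
      moreover have "L \<le> a n / real n" using n by (intro lower) simp
      ultimately show ?thesis by simp
    qed
    then show "\<exists>no. \<forall>n\<ge>no. norm (a n / real n - L) < e" by blast
  qed
  then show ?thesis by (rule convergentI)
qed

section \<open>Entropy of finite labellings\<close>

definition atom :: "'a measure \<Rightarrow> ('a \<Rightarrow> 'b) \<Rightarrow> 'b \<Rightarrow> real" where
  "atom M f v = measure M (f -` {v} \<inter> space M)"

lemma atom_nonneg [simp]: "0 \<le> atom M f v"
  by (simp add: atom_def)

lemma part_entropy_atom: "part_entropy M f = (\<Sum>v\<in>f ` space M. - (atom M f v * ln (atom M f v)))"
  unfolding part_entropy_def atom_def Let_def by (intro sum.cong) auto

lemma integral_label:
  fixes u :: "'b \<Rightarrow> real"
  assumes "prob_space M" "simple_function M f"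
  shows "integral\<^sup>L M (\<lambda>x. u (f x)) = (\<Sum>v\<in>f ` space M. atom M f v * u v)" "integrable M (\<lambda>x. u (f x))"
proof -
  interpret prob_space M by fact
  have fin: "finite (f ` space M)" and st: "\<And>v. v \<in> f ` space M \<Longrightarrow> f -` {v} \<inter> space M \<in> sets M"
    using assms(2) by (auto simp: simple_function_def)
  have eq: "u (f x) = (\<Sum>v\<in>f ` space M. indicator (f -` {v} \<inter> space M) x * u v)" if "x \<in> space M" for x
  proof -
    have "(\<Sum>v\<in>f ` space M. indicator (f -` {v} \<inter> space M) x * u v) = (\<Sum>v\<in>f ` space M. if v = f x then u v else 0)"
      using that by (intro sum.cong) (auto simp: indicator_def)
    also have "\<dots> = u (f x)" using fin that by simp
    finally show ?thesis by simp
  qed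
  have int: "integrable M (\<lambda>x. indicator (f -` {v} \<inter> space M) x * u v)" if "v \<in> f ` space M" for v
    using st[OF that] emeasure_finite by (intro integrable_mult_left integrable_real_indicator) (auto simp: less_top[symmetric])
  have "integral\<^sup>L M (\<lambda>x. u (f x)) = integral\<^sup>L M (\<lambda>x. \<Sum>v\<in>f ` space M. indicator (f -` {v} \<inter> space M) x * u v)"
    by (intro Bochner_Integration.integral_cong refl eq)
  also have "\<dots> = (\<Sum>v\<in>f ` space M. integral\<^sup>L M (\<lambda>x. indicator (f -` {v} \<inter> space M) x * u v))"
    by (rule Bochner_Integration.integral_sum) (rule int)
  also have "\<dots> = (\<Sum>v\<in>f ` space M. atom M f v * u v)"
    by (intro sum.cong refl) (simp add: atom_def Int_assoc)
  finally show "integral\<^sup>L M (\<lambda>x. u (f x)) = (\<Sum>v\<in>f ` space M. atom M f v * u v)" .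
  have "integrable M (\<lambda>x. \<Sum>v\<in>f ` space M. indicator (f -` {v} \<inter> space M) x * u v)"
    by (rule Bochner_Integration.integrable_sum) (rule int)
  then show "integrable M (\<lambda>x. u (f x))"
    by (subst Bochner_Integration.integrable_cong[OF refl eq])
qed

lemma sum_atom:
  assumes "prob_space M" "simple_function M f"
  shows "(\<Sum>v\<in>f ` space M. atom M f v) = 1"
  using integral_label(1)[OF assms, of "\<lambda>_. 1"] prob_space.prob_space[OF assms(1)] by simp

text \<open>Gibbs' inequality, from -p ln p \<le> -p ln r + (r - p) summed over the labels. The
  comparison weights q may have total mass below 1; positivity on charged labels is absolute
  continuity with respect to q.\<close>

lemma part_entropy_le:
  assumes M: "prob_space M" "simple_function M f"
    and q: "\<And>v. v \<in> f ` space M \<Longrightarrow> 0 \<le> q v" "\<And>v. v \<in> f ` space M \<Longrightarrow> 0 < atom M f v \<Longrightarrow> 0 < q v"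
      "(\<Sum>v\<in>f ` space M. q v) \<le> 1"
  shows "part_entropy M f \<le> - integral\<^sup>L M (\<lambda>x. ln (q (f x)))"
proof -
  have "- (p * ln p) \<le> - (p * ln r) + (r - p)" if "0 \<le> p" "0 \<le> r" "0 < p \<Longrightarrow> 0 < r" for p r :: real
  proof (cases "p = 0")
    case False
    then have p: "0 < p" "0 < r" using that by auto
    have "ln (r / p) \<le> r / p - 1" using p by (intro ln_le_minus_one) auto
    then have "p * ln (r / p) \<le> p * (r / p - 1)" using p by (intro mult_left_mono) auto
    also have "\<dots> = r - p" using p by (simp add: field_simps)
    finally show ?thesis using p by (simp add: ln_div algebra_simps)
  qed (use that in simp)
  then have "part_entropy M f \<le> (\<Sum>v\<in>f ` space M. - (atom M f v * ln (q v)) + (q v - atom M f v))"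
    unfolding part_entropy_atom using q(1,2) by (intro sum_mono) auto
  also have "\<dots> = - (\<Sum>v\<in>f ` space M. atom M f v * ln (q v)) + ((\<Sum>v\<in>f ` space M. q v) - 1)"
    by (simp add: sum.distrib sum_subtractf sum_negf sum_atom[OF M])
  also have "\<dots> \<le> - integral\<^sup>L M (\<lambda>x. ln (q (f x)))"
    using q(3) integral_label(1)[OF M, of "\<lambda>v. ln (q v)"] by simp
  finally show ?thesis .
qed

lemma atom_comp_le:
  assumes "finite_measure M" "simple_function M f"
  shows "atom M f v \<le> atom M (\<lambda>x. g (f x)) (g v)"
proof -
  have s: "simple_function M (\<lambda>x. g (f x))" by (rule simple_function_compose1[OF assms(2)])
  have "f -` {v} \<inter> space M \<subseteq> (\<lambda>x. g (f x)) -` {g v} \<inter> space M" by auto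
  then show ?thesis
    unfolding atom_def using simple_functionD(2)[OF s] by (intro finite_measure.finite_measure_mono[OF assms(1)])
qed

text \<open>Merging labels enlarges the atoms, and -ln is decreasing.\<close>

lemma part_entropy_comp_le:
  assumes M: "prob_space M" "simple_function M f"
  shows "part_entropy M (\<lambda>x. g (f x)) \<le> part_entropy M f"
proof -
  let ?h = "\<lambda>x. g (f x)"
  have fm: "finite_measure M" using M(1) by (simp add: prob_space_def)
  have s: "simple_function M ?h" by (rule simple_function_compose1[OF M(2)])
  have "part_entropy M ?h = - integral\<^sup>L M (\<lambda>x. ln (atom M ?h (?h x)))"
    unfolding part_entropy_atom using integral_label(1)[OF M(1) s, of "\<lambda>v. ln (atom M ?h v)"] by (simp add: sum_negf)
  also have "\<dots> = (\<Sum>v\<in>f ` space M. - (atom M f v * ln (atom M ?h (g v))))"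
    using integral_label(1)[OF M, of "\<lambda>v. ln (atom M ?h (g v))"] by (simp add: sum_negf)
  also have "\<dots> \<le> (\<Sum>v\<in>f ` space M. - (atom M f v * ln (atom M f v)))"
  proof (rule sum_mono)
    fix v
    have le: "atom M f v \<le> atom M ?h (g v)" by (rule atom_comp_le[OF fm M(2)])
    show "- (atom M f v * ln (atom M ?h (g v))) \<le> - (atom M f v * ln (atom M f v))"
    proof (cases "atom M f v = 0")
      case False
      then have "0 < atom M f v" using atom_nonneg[of M f v] by linarith
      then have "ln (atom M f v) \<le> ln (atom M ?h (g v))" using le by (intro ln_mono) auto
      then show ?thesis by (simp add: mult_left_mono)
    qed simp
  qed
  finally show ?thesis by (simp add: part_entropy_atom)
qed

lemma part_entropy_nonneg:
  assumes M: "prob_space M" "simple_function M f"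
  shows "0 \<le> part_entropy M f"
  unfolding part_entropy_atom
proof (rule sum_nonneg)
  fix v
  have "atom M f v \<le> 1" unfolding atom_def by (rule prob_space.prob_le_1[OF M(1)])
  moreover have "ln (atom M f v) \<le> ln 1" if "0 < atom M f v" using calculation that by (intro ln_mono) auto
  ultimately have "ln (atom M f v) \<le> 0"
    using atom_nonneg[of M f v] by (cases "atom M f v = 0") (simp_all add: less_le)
  then show "0 \<le> - (atom M f v * ln (atom M f v))" by (simp add: mult_nonneg_nonpos)
qed

lemma AE_atom_pos:
  assumes M: "prob_space M" "simple_function M f"
  shows "AE x in M. 0 < atom M f (f x)"
proof -
  interpret prob_space M by fact
  have "AE x in M. \<forall>v\<in>f ` space M. atom M f v = 0 \<longrightarrow> f x \<noteq> v"
  proof (rule AE_finite_allI)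
    show "finite (f ` space M)" using M(2) by (simp add: simple_function_def)
    fix v assume "v \<in> f ` space M"
    have s: "f -` {v} \<inter> space M \<in> sets M" by (rule simple_functionD(2)[OF M(2)])
    show "AE x in M. atom M f v = 0 \<longrightarrow> f x \<noteq> v"
    proof (cases "atom M f v = 0")
      case True
      then have "f -` {v} \<inter> space M \<in> null_sets M"
        using s by (simp add: null_sets_def atom_def emeasure_eq_measure)
      then have "AE x in M. x \<notin> f -` {v} \<inter> space M" by (rule AE_not_in)
      then show ?thesis using AE_space by eventually_elim auto
    qed simp
  qed
  then show ?thesis using AE_space
  proof eventually_elim
    case (elim x)
    then have "atom M f (f x) \<noteq> 0" by blast
    then show ?case using atom_nonneg[of M f "f x"] by linarith
  qed
qed

section \<open>Shift-invariant measures and refinements\<close>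

lemma shift_invariantD:
  assumes "shift_invariant M"
  shows "prob_space M" "sets M = sets Xp" "space M = space Xp"
  using assms sets_eq_imp_space_eq[of M Xp] by (auto simp: shift_invariant_def)

lemma shift_invariant_distr:
  assumes "shift_invariant M"
  shows "distr M Xp (\<lambda>x i. x (k + i)) = M"
proof (induction k)
  case 0
  then show ?case using shift_invariantD[OF assms] distr_id2[of Xp M] by simp
next
  case (Suc k)
  have m: "(\<lambda>x i. x (k + i)) \<in> measurable M Xp"
    using shift_measurable[of k] shift_invariantD(2)[OF assms] by (simp cong: measurable_cong_sets)
  have sh: "shift \<in> measurable Xp Xp" using shift_measurable[of 1] by (simp add: shift_def[abs_def])
  have "distr M Xp (\<lambda>x i. x (Suc k + i)) = distr (distr M Xp (\<lambda>x i. x (k + i))) Xp shift"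
    by (subst distr_distr[OF sh m]) (simp add: comp_def shift_def)
  then show ?case using Suc assms by (simp add: shift_invariant_def)
qed

lemma shift_invariant_integral:
  fixes u :: "_ \<Rightarrow> real"
  assumes M: "shift_invariant M" and u: "u \<in> borel_measurable Xp"
  shows "integral\<^sup>L M (\<lambda>x. u (\<lambda>i. x (k + i))) = integral\<^sup>L M u"
proof -
  have m: "(\<lambda>x i. x (k + i)) \<in> measurable M Xp"
    using shift_measurable[of k] shift_invariantD(2)[OF M] by (simp cong: measurable_cong_sets)
  have "integral\<^sup>L M u = integral\<^sup>L (distr M Xp (\<lambda>x i. x (k + i))) u" by (simp add: shift_invariant_distr[OF M])
  also have "\<dots> = integral\<^sup>L M (\<lambda>x. u (\<lambda>i. x (k + i)))" by (rule integral_distr[OF m u])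
  finally show ?thesis by simp
qed

lemma refine_eq: "refine n \<xi> x = map (\<lambda>k. \<xi> (\<lambda>i. x (k + i))) [0..<n]"
  by (simp add: refine_def shift_funpow)

lemma length_refine [simp]: "length (refine n \<xi> x) = n"
  by (simp add: refine_eq)

lemma refine_nth: "k < n \<Longrightarrow> refine n \<xi> x ! k = \<xi> (\<lambda>i. x (k + i))"
  by (simp add: refine_eq)

lemma refine_range: "x \<in> space Xp \<Longrightarrow> refine n \<xi> x \<in> {v. set v \<subseteq> \<xi> ` space Xp \<and> length v = n}"
  by (auto simp: refine_eq shift_Xp)

lemma finite_refine_range: "finite_partition \<xi> \<Longrightarrow> finite {v. set v \<subseteq> \<xi> ` space Xp \<and> length v = n}"
  by (auto simp: finite_partition_def intro: finite_lists_length_eq)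

lemma simple_refine:
  assumes "finite_partition \<xi>"
  shows "simple_function Xp (refine n \<xi>)"
  unfolding simple_function_def
proof (intro conjI ballI)
  show "finite (refine n \<xi> ` space Xp)"
    by (rule finite_subset[OF _ finite_refine_range[OF assms, of n]]) (use refine_range in blast)
  fix v assume "v \<in> refine n \<xi> ` space Xp"
  then have len: "length v = n" by (auto simp: refine_eq)
  have eq: "refine n \<xi> -` {v} \<inter> space Xp = {x\<in>space Xp. \<forall>k<n. \<xi> (\<lambda>i. x (k + i)) = v ! k}"
    using len by (auto simp: list_eq_iff_nth_eq refine_nth)
  have "{x\<in>space Xp. \<xi> (\<lambda>i. x (k + i)) = v ! k} \<in> sets Xp" for k
  proof -
    have "(\<lambda>x. \<xi> (\<lambda>i. x (k + i))) \<in> measurable Xp (count_space UNIV)"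
      using assms by (intro measurable_compose[OF shift_measurable]) (simp add: finite_partition_def)
    from measurable_sets[OF this, of "{v ! k}"]
    have "(\<lambda>x. \<xi> (\<lambda>i. x (k + i))) -` {v ! k} \<inter> space Xp \<in> sets Xp" by simp
    moreover have "(\<lambda>x. \<xi> (\<lambda>i. x (k + i))) -` {v ! k} \<inter> space Xp = {x\<in>space Xp. \<xi> (\<lambda>i. x (k + i)) = v ! k}" by blast
    ultimately show ?thesis by (simp only:)
  qed
  then show "refine n \<xi> -` {v} \<inter> space Xp \<in> sets Xp" unfolding eq by measurable
qed

lemma simple_function_sets_cong:
  "sets M = sets N \<Longrightarrow> simple_function M f = simple_function N f"
  using sets_eq_imp_space_eq[of M N] by (simp add: simple_function_def)

lemma simple_win: "simple_function Xp (win k m)"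
  unfolding simple_function_def
proof (intro conjI ballI)
  show "finite (win k m ` space Xp)"
    by (rule finite_subset[of _ "cfg {..<m}"]) (auto simp: Xp_ivl_cfg finite_cfg)
  fix v
  show "win k m -` {v} \<inter> space Xp \<in> sets Xp" by (rule measurable_sets[OF win_measurable]) simp
qed

lemma refine_add: "refine (m + n) \<xi> x = refine m \<xi> x @ refine n \<xi> (\<lambda>i. x (m + i))"
  by (rule nth_equalityI) (auto simp: refine_eq nth_append add.assoc)

text \<open>Gibbs' inequality against the product of the laws of the first m and the last n labels;
  invariance identifies the second law with that of \<open>refine n \<xi>\<close>.\<close>

lemma part_entropy_refine_subadditive:
  assumes M: "shift_invariant M" and \<xi>: "finite_partition \<xi>"
  shows "part_entropy M (refine (m + n) \<xi>) \<le> part_entropy M (refine m \<xi>) + part_entropy M (refine n \<xi>)"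
proof -
  note D = shift_invariantD[OF M]
  interpret prob_space M by (rule D(1))
  let ?f = "refine (m + n) \<xi>" let ?S = "\<lambda>x i. x (m + i)"
  define p1 p2 where "p1 v = atom M (refine m \<xi>) (take m v)" and "p2 v = atom M (refine n \<xi>) (drop m v)" for v
  have sf: "simple_function M (refine k \<xi>)" for k
    using simple_refine[OF \<xi>] simple_function_sets_cong[OF D(2)] by blast
  have tk: "take m (?f x) = refine m \<xi> x" and dr: "drop m (?f x) = refine n \<xi> (?S x)" for x
    by (simp_all add: refine_add)
  have inv: "atom M (\<lambda>x. refine n \<xi> (?S x)) v = atom M (refine n \<xi>) v" for v
  proof -
    have mm: "?S \<in> measurable M Xp" using shift_measurable[of m] D(2) by (simp cong: measurable_cong_sets)
    have st: "refine n \<xi> -` {v} \<inter> space Xp \<in> sets Xp" using simple_functionD(2)[OF simple_refine[OF \<xi>]] .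
    have "atom M (refine n \<xi>) v = measure (distr M Xp ?S) (refine n \<xi> -` {v} \<inter> space Xp)"
      unfolding shift_invariant_distr[OF M] by (simp add: atom_def D(3))
    also have "\<dots> = measure M (?S -` (refine n \<xi> -` {v} \<inter> space Xp) \<inter> space M)" by (rule measure_distr[OF mm st])
    also have "?S -` (refine n \<xi> -` {v} \<inter> space Xp) \<inter> space M = (\<lambda>x. refine n \<xi> (?S x)) -` {v} \<inter> space M"
      by (auto simp: D(3) shift_Xp)
    finally show ?thesis by (simp add: atom_def)
  qed
  have le1: "atom M ?f v \<le> p1 v" for v
    using atom_comp_le[OF finite_measure_axioms sf[of "m + n"], of v "take m"] by (simp add: p1_def tk)
  have le2: "atom M ?f v \<le> p2 v" for v
    using atom_comp_le[OF finite_measure_axioms sf[of "m + n"], of v "drop m"] by (simp add: p2_def dr inv)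
  have "part_entropy M ?f \<le> - integral\<^sup>L M (\<lambda>x. ln (p1 (?f x) * p2 (?f x)))"
  proof (rule part_entropy_le[OF D(1) sf])
    show "0 \<le> p1 v * p2 v" for v by (simp add: p1_def p2_def)
    show "0 < p1 v * p2 v" if "0 < atom M ?f v" for v
      using le1[of v] le2[of v] that by (intro mult_pos_pos) auto
    have inj: "inj_on (\<lambda>v. (take m v, drop m v)) (?f ` space M)"
      by (rule inj_onI) (metis append_take_drop_id prod.inject)
    have "(\<Sum>v\<in>?f ` space M. p1 v * p2 v)
        = (\<Sum>(a, b)\<in>(\<lambda>v. (take m v, drop m v)) ` ?f ` space M. atom M (refine m \<xi>) a * atom M (refine n \<xi>) b)"
      by (subst sum.reindex[OF inj]) (simp add: p1_def p2_def)
    also have "\<dots> \<le> (\<Sum>(a, b)\<in>refine m \<xi> ` space M \<times> refine n \<xi> ` space M. atom M (refine m \<xi>) a * atom M (refine n \<xi>) b)"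
    proof (rule sum_mono2)
      show "finite (refine m \<xi> ` space M \<times> refine n \<xi> ` space M)"
        by (intro finite_cartesian_product simple_functionD(1)[OF sf])
      show "(\<lambda>v. (take m v, drop m v)) ` ?f ` space M \<subseteq> refine m \<xi> ` space M \<times> refine n \<xi> ` space M"
        by (auto simp: tk dr D(3) shift_Xp)
    qed auto
    also have "\<dots> = (\<Sum>a\<in>refine m \<xi> ` space M. atom M (refine m \<xi>) a) * (\<Sum>b\<in>refine n \<xi> ` space M. atom M (refine n \<xi>) b)"
      by (simp add: sum_product sum.cartesian_product)
    also have "\<dots> = 1" by (simp add: sum_atom[OF D(1) sf])
    finally show "(\<Sum>v\<in>?f ` space M. p1 v * p2 v) \<le> 1" .
  qed
  also have "integral\<^sup>L M (\<lambda>x. ln (p1 (?f x) * p2 (?f x))) = integral\<^sup>L M (\<lambda>x. ln (p1 (?f x)) + ln (p2 (?f x)))"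
  proof (rule integral_cong_AE)
    show "(\<lambda>x. ln (p1 (?f x) * p2 (?f x))) \<in> borel_measurable M" "(\<lambda>x. ln (p1 (?f x)) + ln (p2 (?f x))) \<in> borel_measurable M"
      using integral_label(2)[OF D(1) sf[of "m + n"], of "\<lambda>v. ln (p1 v * p2 v)"]
        integral_label(2)[OF D(1) sf[of "m + n"], of "\<lambda>v. ln (p1 v) + ln (p2 v)"] by auto
    show "AE x in M. ln (p1 (?f x) * p2 (?f x)) = ln (p1 (?f x)) + ln (p2 (?f x))"
      using AE_atom_pos[OF D(1) sf[of "m + n"]]
    proof eventually_elim
      case (elim x)
      then have "0 < p1 (?f x)" "0 < p2 (?f x)" using le1[of "?f x"] le2[of "?f x"] by linarith+
      then show ?case by (simp add: ln_mult)
    qed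
  qed
  also have "\<dots> = integral\<^sup>L M (\<lambda>x. ln (p1 (?f x))) + integral\<^sup>L M (\<lambda>x. ln (p2 (?f x)))"
    by (intro Bochner_Integration.integral_add integral_label(2)[OF D(1) sf])
  also have "integral\<^sup>L M (\<lambda>x. ln (p1 (?f x))) = - part_entropy M (refine m \<xi>)"
    unfolding p1_def tk part_entropy_atom integral_label(1)[OF D(1) sf, of "\<lambda>v. ln (atom M (refine m \<xi>) v)"] by (simp add: sum_negf)
  also have "integral\<^sup>L M (\<lambda>x. ln (p2 (?f x))) = integral\<^sup>L M (\<lambda>x. ln (atom M (refine n \<xi>) (refine n \<xi> x)))"
    unfolding p2_def dr
  proof (rule shift_invariant_integral[OF M])
    have "(\<lambda>x. ln (atom M (refine n \<xi>) (refine n \<xi> x))) \<in> borel_measurable M"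
      using integral_label(2)[OF D(1) sf[of n], of "\<lambda>v. ln (atom M (refine n \<xi>) v)"] by auto
    then show "(\<lambda>x. ln (atom M (refine n \<xi>) (refine n \<xi> x))) \<in> borel_measurable Xp"
      by (subst measurable_cong_sets[OF D(2)[symmetric] refl])
  qed
  also have "\<dots> = - part_entropy M (refine n \<xi>)"
    unfolding part_entropy_atom integral_label(1)[OF D(1) sf, of "\<lambda>v. ln (atom M (refine n \<xi>) v)"] by (simp add: sum_negf)
  finally show ?thesis by simp
qed

lemma entropy_rate_LIMSEQ:
  assumes M: "shift_invariant M" and \<xi>: "finite_partition \<xi>"
  shows "(\<lambda>n. part_entropy M (refine n \<xi>) / real n) \<longlonglongrightarrow> entropy_rate M \<xi>"
proof -
  note D = shift_invariantD[OF M]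
  have "convergent (\<lambda>n. part_entropy M (refine n \<xi>) / real n)"
  proof (rule Fekete)
    show "0 \<le> part_entropy M (refine n \<xi>)" for n
      using simple_refine[OF \<xi>] simple_function_sets_cong[OF D(2)] by (intro part_entropy_nonneg D) blast
  qed (rule part_entropy_refine_subadditive[OF M \<xi>])
  then show ?thesis unfolding entropy_rate_def by (simp add: convergent_LIMSEQ_iff)
qed

text \<open>Normalises the noise kernel on words position by position.\<close>

lemma sum_lists_prod_le:
  fixes F :: "nat \<Rightarrow> 'b \<Rightarrow> real"
  assumes "finite R" "\<And>k u. 0 \<le> F k u" "\<And>k. (\<Sum>u\<in>R. F k u) \<le> 1"
  shows "(\<Sum>v\<in>{v. set v \<subseteq> R \<and> length v = n}. \<Prod>k<n. F k (v ! k)) \<le> 1"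
  using assms(2,3)
proof (induction n arbitrary: F)
  case 0
  have "{v :: 'b list. set v \<subseteq> R \<and> length v = 0} = {[]}" by auto
  then show ?case by simp
next
  case (Suc n)
  have inj: "inj_on (\<lambda>(xs, n). n # xs) ({xs. set xs \<subseteq> R \<and> length xs = n} \<times> R)" by (auto simp: inj_on_def)
  have "(\<Sum>v\<in>{v. set v \<subseteq> R \<and> length v = Suc n}. \<Prod>k<Suc n. F k (v ! k))
      = (\<Sum>(xs, u)\<in>{xs. set xs \<subseteq> R \<and> length xs = n} \<times> R. F 0 u * (\<Prod>k<n. F (Suc k) (xs ! k)))"
    unfolding lists_length_Suc_eq by (subst sum.reindex[OF inj]) (simp add: case_prod_beta prod.lessThan_Suc_shift del: prod.lessThan_Suc)
  also have "\<dots> = (\<Sum>xs\<in>{xs. set xs \<subseteq> R \<and> length xs = n}. \<Prod>k<n. F (Suc k) (xs ! k)) * (\<Sum>u\<in>R. F 0 u)"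
    unfolding sum.cartesian_product[symmetric] sum_product by (intro sum.cong refl mult.commute)
  also have "\<dots> \<le> 1 * 1"
    using Suc.IH[of "\<lambda>k. F (Suc k)"] Suc.prems by (intro mult_mono sum_nonneg prod_nonneg) auto
  finally show ?case by simp
qed

text \<open>Each atom of \<xi> is approximated by a local set, all of one depth l. Off the symmetric
  differences the window lies in exactly one of these sets, and its label is the right
  guess.\<close>

lemma local_partition_approximation:
  assumes M: "shift_invariant M" and \<xi>: "finite_partition \<xi>" and d: "0 < \<delta>"
  shows "\<exists>l e. measure M {x\<in>space Xp. \<xi> x \<noteq> e (win 0 l x)} < \<delta>"
proof -
  note D = shift_invariantD[OF M]
  interpret prob_space M by (rule D(1))
  define R where "R = \<xi> ` space Xp"
  have fR: "finite R" using \<xi> by (simp add: R_def finite_partition_def)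
  have "(\<lambda>_. 1) \<in> space Xp" by (simp add: space_Xp)
  then have Rne: "R \<noteq> {}" by (auto simp: R_def)
  define A where "A v = \<xi> -` {v} \<inter> space Xp" for v
  have A: "A v \<in> sets Xp" for v
    unfolding A_def using \<xi> by (intro measurable_sets[of \<xi> Xp "count_space UNIV"]) (auto simp: finite_partition_def)
  define \<delta>' where "\<delta>' = \<delta> / real (card R)"
  have d': "0 < \<delta>'" using d fR Rne by (simp add: \<delta>'_def card_gt_0_iff)
  have "\<forall>v. \<exists>p. measure M ((A v - local_set (fst p) (snd p)) \<union> (local_set (fst p) (snd p) - A v)) < \<delta>'"
  proof
    fix v
    obtain B where "B \<in> local_sets" "measure M ((A v - B) \<union> (B - A v)) < \<delta>'"
      using local_approximation[OF finite_measure_axioms D(2) finite_measure_axioms D(2) A d'] by blast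
    then show "\<exists>p. measure M ((A v - local_set (fst p) (snd p)) \<union> (local_set (fst p) (snd p) - A v)) < \<delta>'"
      by (elim local_setsE) (metis fst_conv snd_conv)
  qed
  then obtain p where p: "\<And>v. measure M ((A v - local_set (fst (p v)) (snd (p v))) \<union> (local_set (fst (p v)) (snd (p v)) - A v)) < \<delta>'"
    using choice[of "\<lambda>v p. measure M ((A v - local_set (fst p) (snd p)) \<union> (local_set (fst p) (snd p) - A v)) < \<delta>'"] by blast
  define l where "l = Max ((\<lambda>v. fst (p v)) ` R)"
  define Q where "Q v = {a. win 0 (fst (p v)) a \<in> snd (p v)}" for v
  have lQ: "local_set (fst (p v)) (snd (p v)) = local_set l (Q v)" if "v \<in> R" for v
    unfolding Q_def by (rule local_set_mono) (use fR that in \<open>auto simp: l_def\<close>)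
  define Dv where "Dv v = (A v - local_set l (Q v)) \<union> (local_set l (Q v) - A v)" for v
  have Dv: "measure M (Dv v) < \<delta>'" "Dv v \<in> sets M" if "v \<in> R" for v
    using p[of v] A[of v] by (auto simp: Dv_def lQ[OF that] D(2) local_set_sets)
  \<comment> \<open>Words lying in none or in several of the sets get an arbitrary choice; such
    words are met only inside the symmetric differences.\<close>
  define e where "e a = (SOME v. v \<in> R \<and> a \<in> Q v)" for a
  have "{x\<in>space Xp. \<xi> x \<noteq> e (win 0 l x)} \<subseteq> (\<Union>v\<in>R. Dv v)"
  proof
    fix x assume "x \<in> {x\<in>space Xp. \<xi> x \<noteq> e (win 0 l x)}"
    then have x: "x \<in> space Xp" "\<xi> x \<noteq> e (win 0 l x)" by auto
    show "x \<in> (\<Union>v\<in>R. Dv v)"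
    proof (rule ccontr)
      assume n: "x \<notin> (\<Union>v\<in>R. Dv v)"
      have "win 0 l x \<in> Q v \<longleftrightarrow> v = \<xi> x" if "v \<in> R" for v
      proof -
        have "x \<in> local_set l (Q v) \<longleftrightarrow> x \<in> A v" using n that unfolding Dv_def by blast
        then show ?thesis using x(1) by (simp add: A_def local_set_def eq_commute)
      qed
      then have "e (win 0 l x) = \<xi> x"
        unfolding e_def using x(1) by (intro some_equality) (auto simp: R_def)
      then show False using x(2) by simp
    qed
  qed
  then have "measure M {x\<in>space Xp. \<xi> x \<noteq> e (win 0 l x)} \<le> measure M (\<Union>v\<in>R. Dv v)"
    using Dv(2) fR by (intro finite_measure_mono) auto
  also have "\<dots> \<le> (\<Sum>v\<in>R. measure M (Dv v))"
    using Dv(2) fR by (intro finite_measure_subadditive_finite) auto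
  also have "\<dots> < (\<Sum>v\<in>R. \<delta>')" using Dv(1) fR Rne by (intro sum_strict_mono) auto
  also have "\<dots> = \<delta>" using fR Rne by (simp add: \<delta>'_def)
  finally show ?thesis by blast
qed

section \<open>Upper bound for entropy plus energy\<close>

context high_temperature
begin

lemma continuous_H: "continuous_on cube (H V)"
  unfolding H_def ising_def by (intro continuous_intros) simp

text \<open>Invariance makes the mean of the Birkhoff sum exactly N times that of \<phi>, and
  \<open>birkhoff_near\<close> replaces the sum by \<open>H\<close>.\<close>

lemma H_integral_near:
  assumes M: "shift_invariant M"
  shows "\<bar>integral\<^sup>L M (H {..<N}) - real N * integral\<^sup>L M \<phi>\<bar> \<le> boundary_error N"
proof -
  note D = shift_invariantD[OF M]
  interpret prob_space M by (rule D(1))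
  have ci: "continuous_on cube (\<lambda>x. \<phi> (\<lambda>i. x (k + i)))" for k
  proof (rule continuous_on_compose2[OF continuous_dyson])
    show "continuous_on cube (\<lambda>x i. x (k + i) :: real)"
      by (rule continuous_on_coordinatewise_then_product) (rule continuous_on_coord)
  qed (auto simp: cube_def)
  have ii: "integrable M (\<lambda>x. \<phi> (\<lambda>i. x (k + i)))" for k by (rule continuous_cube_integrable[OF ci D(1,2)])
  have S: "birkhoff_sum N \<phi> x = (\<Sum>k<N. \<phi> (\<lambda>i. x (k + i)))" for x by (simp add: birkhoff_sum_def shift_funpow)
  have Si: "integrable M (birkhoff_sum N \<phi>)" unfolding S by (rule Bochner_Integration.integrable_sum) (rule ii)
  have "integral\<^sup>L M (birkhoff_sum N \<phi>) = (\<Sum>k<N. integral\<^sup>L M (\<lambda>x. \<phi> (\<lambda>i. x (k + i))))"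
    unfolding S by (rule Bochner_Integration.integral_sum) (rule ii)
  also have "\<dots> = real N * integral\<^sup>L M \<phi>"
    by (simp add: shift_invariant_integral[OF M dyson_measurable])
  finally have 1: "integral\<^sup>L M (birkhoff_sum N \<phi>) = real N * integral\<^sup>L M \<phi>" .
  have Hi: "integrable M (H {..<N})" by (rule continuous_cube_integrable[OF continuous_H D(1,2)])
  have "integral\<^sup>L M (H {..<N}) - real N * integral\<^sup>L M \<phi> = integral\<^sup>L M (\<lambda>x. H {..<N} x - birkhoff_sum N \<phi> x)"
    unfolding 1[symmetric] using Hi Si by simp
  also have "\<bar>\<dots>\<bar> \<le> integral\<^sup>L M (\<lambda>x. \<bar>H {..<N} x - birkhoff_sum N \<phi> x\<bar>)" by (rule integral_abs_bound)
  also have "\<dots> \<le> integral\<^sup>L M (\<lambda>x. boundary_error N)"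
  proof (rule integral_mono)
    show "integrable M (\<lambda>x. \<bar>H {..<N} x - birkhoff_sum N \<phi> x\<bar>)" using Hi Si by simp
    fix x assume "x \<in> space M"
    then have "x \<in> cube" using D(3) Xp_cube by simp
    then show "\<bar>H {..<N} x - birkhoff_sum N \<phi> x\<bar> \<le> boundary_error N" using birkhoff_near[of x N] by (simp add: abs_minus_commute)
  qed simp
  finally show ?thesis by (simp add: prob_space)
qed

text \<open>Each spin enters at most m windows, so the oscillation of the exponent at a site is at
  most 2 M m |t|, and \<open>Gaussian_bound\<close> gives an error quadratic in t and linear in the
  volume.\<close>

lemma tilted_partition_bound:
  assumes psi: "\<And>a. a \<in> cfg {..<m} \<Longrightarrow> \<bar>\<psi> a\<bar> \<le> M" and N: "n + m \<le> N" and M0: "0 \<le> M"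
  shows "gibbs N (\<lambda>a. exp (t * (\<Sum>k<n. \<psi> (win k m a))))
      \<le> exp (t * (\<Sum>k<n. gibbs N (\<lambda>a. \<psi> (win k m a))) + 2 * (1 + K) * (M * real m)\<^sup>2 * t\<^sup>2 * real N)"
proof -
  have os: "osc_le {..<N} (\<lambda>a. t * (\<Sum>k<n. \<psi> (win k m a))) (\<lambda>_. \<bar>t\<bar> * (2 * M * real m))"
    unfolding osc_le_def
  proof (intro ballI)
    fix a i assume a: "a \<in> cfg {..<N}" and i: "i \<in> {..<N}"
    have bnd: "\<bar>\<psi> (win k m (a(i := s)))\<bar> \<le> M" if "k < n" "s \<in> {-1, 1}" for k s
      by (rule psi, rule win_cfg[OF cfg_upd[OF a i that(2)]]) (use that N in auto)
    have "\<bar>(\<Sum>k<n. \<psi> (win k m (a(i := 1)))) - (\<Sum>k<n. \<psi> (win k m (a(i := -1))))\<bar>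
        \<le> (\<Sum>k<n. \<bar>\<psi> (win k m (a(i := 1))) - \<psi> (win k m (a(i := -1)))\<bar>)"
      unfolding sum_subtractf[symmetric] by (rule sum_abs)
    \<comment> \<open>The windows containing site i start between i + 1 - m and i.\<close>
    also have "\<dots> \<le> (\<Sum>k<n. 2 * M * of_bool (k \<in> {i + 1 - m..i}))"
    proof (rule sum_mono)
      fix k assume k: "k \<in> {..<n}"
      show "\<bar>\<psi> (win k m (a(i := 1))) - \<psi> (win k m (a(i := -1)))\<bar> \<le> 2 * M * of_bool (k \<in> {i + 1 - m..i})"
      proof (cases "k \<in> {i + 1 - m..i}")
        case True
        have "\<bar>\<psi> (win k m (a(i := 1)))\<bar> \<le> M" "\<bar>\<psi> (win k m (a(i := -1)))\<bar> \<le> M" using bnd[of k] k by auto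
        then show ?thesis using True by simp
      next
        case False
        have eq: "win k m (a(i := 1)) = win k m (a(i := -1))" by (rule win_cong) (use False in auto)
        have "of_bool (k \<in> {i + 1 - m..i}) = (0::real)" using False by simp
        then show ?thesis unfolding eq by (simp only: diff_self abs_zero mult_zero_right order_refl)
      qed
    qed
    also have "\<dots> = 2 * M * (\<Sum>k<n. of_bool (k \<in> {i + 1 - m..i}))"
      by (rule sum_distrib_left[symmetric])
    also have "(\<Sum>k<n. of_bool (k \<in> {i + 1 - m..i}) :: real) = real (card ({..<n} \<inter> {i + 1 - m..i}))"
      by (simp add: of_bool_def sum.If_cases Int_def)
    also have "2 * M * real (card ({..<n} \<inter> {i + 1 - m..i})) \<le> 2 * M * real m"
    proof -
      have "card ({..<n} \<inter> {i + 1 - m..i}) \<le> card {i + 1 - m..i}" by (rule card_mono) auto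
      also have "\<dots> \<le> m" by simp
      finally show ?thesis using M0 by (intro mult_left_mono) auto
    qed
    finally show "\<bar>t * (\<Sum>k<n. \<psi> (win k m (a(i := 1)))) - t * (\<Sum>k<n. \<psi> (win k m (a(i := -1))))\<bar> \<le> \<bar>t\<bar> * (2 * M * real m)"
      unfolding right_diff_distrib[symmetric] abs_mult by (rule mult_left_mono[OF _ abs_ge_zero])
  qed
  have "gibbs N (\<lambda>a. exp (t * (\<Sum>k<n. \<psi> (win k m a))))
      \<le> exp (gibbs N (\<lambda>a. t * (\<Sum>k<n. \<psi> (win k m a))) + (1 + K) / 2 * (\<Sum>i<N. (\<bar>t\<bar> * (2 * M * real m))\<^sup>2))"
    by (rule Gaussian_bound[OF finite_lessThan weakly_coupled_H[OF finite_lessThan] os])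
  also have "gibbs N (\<lambda>a. t * (\<Sum>k<n. \<psi> (win k m a))) = t * (\<Sum>k<n. gibbs N (\<lambda>a. \<psi> (win k m a)))"
    by (simp add: gE_cmult gE_sum)
  also have "(1 + K) / 2 * (\<Sum>i<N. (\<bar>t\<bar> * (2 * M * real m))\<^sup>2) = 2 * (1 + K) * (M * real m)\<^sup>2 * t\<^sup>2 * real N"
    by (simp add: power_mult_distrib)
  finally show ?thesis .
qed

text \<open>The window at k is k sites from the left end and at least n - k from the right one, so
  the errors are tails at these distances, whose Cesaro averages vanish.\<close>

lemma bulk_average:
  assumes psi: "\<And>a. a \<in> cfg {..<m} \<Longrightarrow> \<bar>\<psi> a\<bar> \<le> M" and N: "n + m \<le> N" and M: "0 \<le> M"
  shows "\<bar>(\<Sum>k<n. gibbs N (\<lambda>a. \<psi> (win k m a))) - real n * integral\<^sup>L \<mu> (\<lambda>x. \<psi> (win 0 m x))\<bar>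
      \<le> real m * (8 * M * (1 + K) * \<beta>) * (\<Sum>k<n. \<tau> k + \<tau> (Suc k))"
proof -
  let ?I = "integral\<^sup>L \<mu> (\<lambda>x. \<psi> (win 0 m x))" and ?c = "real m * (8 * M * (1 + K) * \<beta>)"
  have c: "0 \<le> ?c" using M K_ge beta by simp
  have e1: "(\<Sum>k<n. gibbs N (\<lambda>a. \<psi> (win k m a))) - real n * ?I = (\<Sum>k<n. gibbs N (\<lambda>a. \<psi> (win k m a)) - ?I)"
    by (simp add: sum_subtractf)
  have e2: "\<bar>\<Sum>k<n. gibbs N (\<lambda>a. \<psi> (win k m a)) - ?I\<bar> \<le> (\<Sum>k<n. ?c * (\<tau> k + \<tau> (n - k)))"
  proof (intro order_trans[OF sum_abs] sum_mono)
    fix k assume k: "k \<in> {..<n}"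
    have "\<bar>gibbs N (\<lambda>a. \<psi> (win k m a)) - ?I\<bar> \<le> ?c * \<tau> (min k (n - k))"
      by (rule mu_bulk[where f=\<psi> and M=M, OF _ _ psi]) (use k N in auto)
    \<comment> \<open>The tail at the smaller distance is bounded by the sum of both tails.\<close>
    moreover have "?c * \<tau> (min k (n - k)) \<le> ?c * (\<tau> k + \<tau> (n - k))"
      using c tail_sum_nonneg[OF alpha] by (intro mult_left_mono) (auto simp: min_def)
    ultimately show "\<bar>gibbs N (\<lambda>a. \<psi> (win k m a)) - ?I\<bar> \<le> ?c * (\<tau> k + \<tau> (n - k))" by linarith
  qed
  have e3: "(\<Sum>k<n. \<tau> (n - k)) = (\<Sum>k<n. \<tau> (Suc k))"
    by (subst sum.nat_diff_reindex[symmetric]) (intro sum.cong, auto simp: Suc_diff_Suc)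
  have e4: "(\<Sum>k<n. ?c * (\<tau> k + \<tau> (n - k))) = ?c * (\<Sum>k<n. \<tau> k + \<tau> (Suc k))"
    unfolding sum_distrib_left[symmetric] sum.distrib e3 ..
  show ?thesis using e2 unfolding e1 e4 .
qed

lemma simple_function_partition:
  assumes "finite_partition \<xi>" shows "simple_function Xp \<xi>"
proof -
  have xm: "\<xi> \<in> measurable Xp (count_space UNIV)" and xf: "finite (\<xi> ` space Xp)"
    using assms unfolding finite_partition_def by blast+
  show ?thesis unfolding simple_function_def
    by (intro conjI xf ballI measurable_sets[OF xm]) (simp only: sets_count_space Pow_UNIV UNIV_I)
qed

text \<open>Gibbs' inequality for the joint law of \<open>refine n \<xi>\<close> and the first \<open>N\<close> spins, against the product of the Gibbs
  weights tilted by \<open>t \<Sum>\<psi>\<close> and a noise kernel that guesses \<open>\<xi>\<close> from \<open>l\<close> spins with error \<open>\<epsilon>\<close>.\<close>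
lemma entropy_upper_finite:
  assumes M: "shift_invariant \<mu>'" and \<xi>: "finite_partition \<xi>"
    and psi: "\<And>a. a \<in> cfg {..<m} \<Longrightarrow> \<bar>\<psi> a\<bar> \<le> B" and B: "0 \<le> B"
    and eps: "0 < \<epsilon>" "\<epsilon> < 1"
    and near: "measure \<mu>' {x\<in>space Xp. \<xi> x \<noteq> e (win 0 l x)} \<le> \<delta>"
    and R: "R = \<xi> ` space Xp" and N: "N = n + (l + m)"
  shows "part_entropy \<mu>' (refine n \<xi>) \<le> boundary_error N - real N * integral\<^sup>L \<mu>' \<phi> + ln (Z N)
     + real n * (t * (integral\<^sup>L \<mu> (\<lambda>x. \<psi> (win 0 m x)) - integral\<^sup>L \<mu>' (\<lambda>x. \<psi> (win 0 m x))))
     + \<bar>t\<bar> * (real m * (8 * B * (1 + K) * \<beta>) * (\<Sum>k<n. \<tau> k + \<tau> (Suc k)))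
     + 2 * (1 + K) * (B * real m)\<^sup>2 * t\<^sup>2 * real N
     + real n * (- ln (1 - \<epsilon>) + \<delta> * ln (real (card R) / \<epsilon>))"
proof -
  note D = shift_invariantD[OF M]
  interpret prob_space \<mu>' by (rule D(1))
  have fR: "finite R" using \<xi> by (simp add: R finite_partition_def)
  have "(\<lambda>_. 1) \<in> space Xp" by (simp add: space_Xp)
  then have Rne: "R \<noteq> {}" by (auto simp: R)
  define c where "c = real (card R)"
  have c: "1 \<le> c" using fR Rne by (simp add: c_def Suc_le_eq card_gt_0_iff)
  \<comment> \<open>A correct guess gets weight 1 - \<epsilon>; every wrong label gets \<epsilon> /
    c, so that the total is at most 1 and the logarithm stays finite where the guess fails.\<close>
  define rr where "rr u u' = (if u = u' then 1 - \<epsilon> else \<epsilon> / c)" for u u' :: nat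
  have rr_pos: "0 < rr u u'" for u u' using eps c by (simp add: rr_def)
  define \<Psi> where "\<Psi> a = (\<Sum>k<n. \<psi> (win k m a))" for a
  define Zt where "Zt = (\<Sum>a\<in>cfg {..<N}. exp (H {..<N} a + t * \<Psi> a))"
  have Zt: "0 < Zt" unfolding Zt_def by (rule partition_pos) simp
  define g where "g a = exp (H {..<N} a + t * \<Psi> a) / Zt" for a
  have g_pos: "0 < g a" for a using Zt by (simp add: g_def)
  define q where "q p = g (snd p) * (\<Prod>k<n. rr (fst p ! k) (e (win k l (snd p))))" for p
  have q_pos: "0 < q p" for p unfolding q_def by (intro mult_pos_pos g_pos prod_pos ballI rr_pos)
  let ?f = "\<lambda>x. (refine n \<xi> x, win 0 N x)"
  have sf: "simple_function \<mu>' ?f"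
    unfolding simple_function_sets_cong[OF D(2)]
    by (intro simple_function_Pair simple_refine[OF \<xi>] simple_win)
  \<comment> \<open>Adding the spins to the label does not decrease the entropy and makes the Gibbs
    weight available for comparison.\<close>
  have "part_entropy \<mu>' (refine n \<xi>) = part_entropy \<mu>' (\<lambda>x. fst (?f x))" by simp
  also have "\<dots> \<le> part_entropy \<mu>' ?f" by (rule part_entropy_comp_le[OF D(1) sf])
  also have "\<dots> \<le> - integral\<^sup>L \<mu>' (\<lambda>x. ln (q (?f x)))"
  proof (rule part_entropy_le[OF D(1) sf])
    have rrs: "(\<Sum>u\<in>R. rr u u') \<le> 1" for u'
    proof -
      have "(\<Sum>u\<in>R. rr u u') \<le> (\<Sum>u\<in>R. (if u = u' then 1 - \<epsilon> else 0) + \<epsilon> / c)"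
        using eps c by (intro sum_mono) (auto simp: rr_def)
      also have "\<dots> = (\<Sum>u\<in>R. if u = u' then 1 - \<epsilon> else 0) + c * (\<epsilon> / c)"
        by (simp add: sum.distrib c_def)
      also have "\<dots> \<le> (1 - \<epsilon>) + \<epsilon>"
        using fR eps c by (intro add_mono) auto
      finally show ?thesis by simp
    qed
    let ?L = "{v. set v \<subseteq> R \<and> length v = n}"
    have fL: "finite ?L" by (rule finite_lists_length_eq[OF fR])
    have "(\<Sum>p\<in>?f ` space \<mu>'. q p) \<le> (\<Sum>p\<in>?L \<times> cfg {..<N}. q p)"
    proof (rule sum_mono2)
      show "finite (?L \<times> cfg {..<N})" using fL by (simp add: finite_cfg)
      show "?f ` space \<mu>' \<subseteq> ?L \<times> cfg {..<N}"
        using refine_range[of _ n \<xi>] by (auto simp: D(3) R Xp_ivl_cfg)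
    qed (use q_pos in \<open>simp add: less_imp_le\<close>)
    also have "\<dots> = (\<Sum>a\<in>cfg {..<N}. \<Sum>v\<in>?L. g a * (\<Prod>k<n. rr (v ! k) (e (win k l a))))"
      by (subst sum.swap) (simp add: sum.cartesian_product q_def case_prod_beta)
    also have "\<dots> \<le> (\<Sum>a\<in>cfg {..<N}. g a * 1)"
      unfolding sum_distrib_left[symmetric]
    proof (intro sum_mono mult_left_mono)
      fix a
      show "(\<Sum>v\<in>?L. \<Prod>k<n. rr (v ! k) (e (win k l a))) \<le> 1"
        by (rule sum_lists_prod_le[OF fR, where F="\<lambda>k u. rr u (e (win k l a))"]) (use rrs rr_pos in \<open>auto simp: less_imp_le\<close>)
    qed (use g_pos in \<open>simp add: less_imp_le\<close>)
    also have "\<dots> = 1" using Zt by (simp add: g_def sum_divide_distrib[symmetric] Zt_def)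
    finally show "(\<Sum>p\<in>?f ` space \<mu>'. q p) \<le> 1" .
  qed (use q_pos in \<open>auto simp: less_imp_le\<close>)
  also have "integral\<^sup>L \<mu>' (\<lambda>x. ln (q (?f x)))
      = integral\<^sup>L \<mu>' (\<lambda>x. H {..<N} x + t * (\<Sum>k<n. \<psi> (win k m x)) - ln Zt + (\<Sum>k<n. ln (rr (\<xi> (\<lambda>i. x (k + i))) (e (win k l x)))))"
  proof (intro Bochner_Integration.integral_cong refl)
    fix x
    \<comment> \<open>N = n + (l + m), so all windows that start below n lie in the first N
      spins.\<close>
    have ww: "win k m (win 0 N x) = win k m x" "win k l (win 0 N x) = win k l x" if "k < n" for k
      using that N by (auto simp: win_def)
    have HH: "H {..<N} (win 0 N x) = H {..<N} x" by (rule H_cong) (simp add: win_def)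
    have "ln (q (?f x)) = ln (g (win 0 N x)) + (\<Sum>k<n. ln (rr (refine n \<xi> x ! k) (e (win k l (win 0 N x)))))"
    proof -
      have "ln (\<Prod>k<n. rr (refine n \<xi> x ! k) (e (win k l (win 0 N x)))) = (\<Sum>k<n. ln (rr (refine n \<xi> x ! k) (e (win k l (win 0 N x)))))"
        by (rule ln_prod) (simp_all add: rr_pos rr_pos[THEN less_imp_neq, symmetric])
      moreover have "0 < (\<Prod>k<n. rr (refine n \<xi> x ! k) (e (win k l (win 0 N x))))"
        by (intro prod_pos ballI rr_pos)
      ultimately show ?thesis by (simp only: q_def fst_conv snd_conv case_prod_conv ln_mult_pos g_pos)
    qed
    also have "ln (g (win 0 N x)) = H {..<N} x + t * (\<Sum>k<n. \<psi> (win k m x)) - ln Zt"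
      using Zt by (simp add: g_def ln_div HH \<Psi>_def ww)
    also have "(\<Sum>k<n. ln (rr (refine n \<xi> x ! k) (e (win k l (win 0 N x))))) = (\<Sum>k<n. ln (rr (\<xi> (\<lambda>i. x (k + i))) (e (win k l x))))"
      by (intro sum.cong refl) (simp add: refine_nth ww)
    finally show "ln (q (?f x)) = H {..<N} x + t * (\<Sum>k<n. \<psi> (win k m x)) - ln Zt + (\<Sum>k<n. ln (rr (\<xi> (\<lambda>i. x (k + i))) (e (win k l x))))" .
  qed
  also have "\<dots> = integral\<^sup>L \<mu>' (H {..<N}) + t * (real n * integral\<^sup>L \<mu>' (\<lambda>x. \<psi> (win 0 m x))) - ln Zt
      + real n * integral\<^sup>L \<mu>' (\<lambda>x. ln (rr (\<xi> x) (e (win 0 l x))))"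
  proof -
    \<comment> \<open>Reading windows through the shift lets invariance give every position the same
      mean.\<close>
    have w0: "win k j x = win 0 j (\<lambda>i. x (k + i))" for k j and x :: "nat \<Rightarrow> real" by (simp add: win_def)
    have 1: "integrable \<mu>' (H {..<N})" by (rule continuous_cube_integrable[OF continuous_H D(1,2)])
    have sw: "simple_function \<mu>' (win k j)" for k j using simple_win simple_function_sets_cong[OF D(2)] by blast
    have 2: "integrable \<mu>' (\<lambda>x. \<psi> (win k m x))" for k by (rule integral_label(2)[OF D(1) sw])
    have sx: "simple_function Xp (\<lambda>x. (\<xi> x, win 0 l x))"
    proof (rule simple_function_Pair[OF _ simple_win])
      show "simple_function Xp \<xi>" by (rule simple_function_partition[OF \<xi>])
    qed
    define u where "u x = ln (rr (\<xi> x) (e (win 0 l x)))" for x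
    have um: "u \<in> borel_measurable Xp"
    proof -
      have "simple_function Xp (\<lambda>x. (\<lambda>p. ln (rr (fst p) (e (snd p)))) (\<xi> x, win 0 l x))"
        using simple_function_compose1[OF sx] .
      then have "simple_function Xp u" by (simp add: u_def[abs_def])
      then show ?thesis by (rule borel_measurable_simple_function)
    qed
    have ub: "\<bar>u x\<bar> \<le> \<bar>ln (1 - \<epsilon>)\<bar> + \<bar>ln (\<epsilon> / c)\<bar>" for x by (simp add: u_def rr_def)
    have uk: "(\<lambda>x. ln (rr (\<xi> (\<lambda>i. x (k + i))) (e (win k l x)))) = (\<lambda>x. u (\<lambda>i. x (k + i)))" for k
      by (simp add: u_def w0[of k])
    have 3: "integrable \<mu>' (\<lambda>x. u (\<lambda>i. x (k + i)))" for k
    proof (rule integrable_const_bound[of _ "\<bar>ln (1 - \<epsilon>)\<bar> + \<bar>ln (\<epsilon> / c)\<bar>"])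
      show "(\<lambda>x. u (\<lambda>i. x (k + i))) \<in> borel_measurable \<mu>'"
        using measurable_compose[OF shift_measurable um] by (subst measurable_cong_sets[OF D(2) refl])
    qed (use ub in simp)
    have pk: "integral\<^sup>L \<mu>' (\<lambda>x. \<psi> (win k m x)) = integral\<^sup>L \<mu>' (\<lambda>x. \<psi> (win 0 m x))" for k
      using shift_invariant_integral[OF M local_fun_borel[of \<psi> 0 m], of k] by (simp add: w0[of k])
    have E1: "integral\<^sup>L \<mu>' (\<lambda>x. H {..<N} x + t * (\<Sum>k<n. \<psi> (win k m x)) - ln Zt + (\<Sum>k<n. u (\<lambda>i. x (k + i))))
        = integral\<^sup>L \<mu>' (H {..<N}) + t * (\<Sum>k<n. integral\<^sup>L \<mu>' (\<lambda>x. \<psi> (win k m x))) - ln Zt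
          + (\<Sum>k<n. integral\<^sup>L \<mu>' (\<lambda>x. u (\<lambda>i. x (k + i))))"
      using 1 2 3 by (simp add: prob_space)
    have E2: "(\<Sum>k<n. integral\<^sup>L \<mu>' (\<lambda>x. \<psi> (win k m x))) = (\<Sum>k<n. integral\<^sup>L \<mu>' (\<lambda>x. \<psi> (win 0 m x)))"
      by (intro sum.cong refl pk)
    have E3: "(\<Sum>k<n. integral\<^sup>L \<mu>' (\<lambda>x. u (\<lambda>i. x (k + i)))) = (\<Sum>k<n. integral\<^sup>L \<mu>' u)"
      by (intro sum.cong refl shift_invariant_integral[OF M um])
    have E4: "ln (rr (\<xi> (\<lambda>i. x (k + i))) (e (win k l x))) = u (\<lambda>i. x (k + i))" for k x
      by (simp add: u_def w0[of k])
    have E5: "integral\<^sup>L \<mu>' (\<lambda>x. ln (rr (\<xi> x) (e (win 0 l x)))) = integral\<^sup>L \<mu>' u"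
      by (simp add: u_def[abs_def])
    show ?thesis unfolding E4 E5 using E1 unfolding E2 E3 by (simp only: sum_constant card_lessThan)
  qed
  finally have main: "part_entropy \<mu>' (refine n \<xi>) \<le> - (integral\<^sup>L \<mu>' (H {..<N}) + t * (real n * integral\<^sup>L \<mu>' (\<lambda>x. \<psi> (win 0 m x))) - ln Zt
      + real n * integral\<^sup>L \<mu>' (\<lambda>x. ln (rr (\<xi> x) (e (win 0 l x)))))" .
  \<comment> \<open>The difference of the two logarithms is the log-moment generating function of
    the tilt, bounded by its linear part, the sum of free means, plus a quadratic error.\<close>
  have lnZt: "ln Zt \<le> ln (Z N) + (t * (\<Sum>k<n. gibbs N (\<lambda>a. \<psi> (win k m a))) + 2 * (1 + K) * (B * real m)\<^sup>2 * t\<^sup>2 * real N)"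
  proof -
    have "Zt = Z N * gibbs N (\<lambda>a. exp (t * \<Psi> a))"
      using Z_pos[of N] by (simp add: Zt_def gE_def Z_def exp_add)
    also have "\<dots> \<le> Z N * exp (t * (\<Sum>k<n. gibbs N (\<lambda>a. \<psi> (win k m a))) + 2 * (1 + K) * (B * real m)\<^sup>2 * t\<^sup>2 * real N)"
      unfolding \<Psi>_def using Z_pos[of N] N B by (intro mult_left_mono tilted_partition_bound psi) auto
    finally have "ln Zt \<le> ln (Z N * exp (t * (\<Sum>k<n. gibbs N (\<lambda>a. \<psi> (win k m a))) + 2 * (1 + K) * (B * real m)\<^sup>2 * t\<^sup>2 * real N))"
      using Zt by (intro ln_mono) auto
    then show ?thesis using Z_pos[of N] by (simp add: ln_mult)
  qed
  have tav: "t * (\<Sum>k<n. gibbs N (\<lambda>a. \<psi> (win k m a))) \<le> t * (real n * integral\<^sup>L \<mu> (\<lambda>x. \<psi> (win 0 m x)))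
      + \<bar>t\<bar> * (real m * (8 * B * (1 + K) * \<beta>) * (\<Sum>k<n. \<tau> k + \<tau> (Suc k)))"
  proof -
    let ?d = "(\<Sum>k<n. gibbs N (\<lambda>a. \<psi> (win k m a))) - real n * integral\<^sup>L \<mu> (\<lambda>x. \<psi> (win 0 m x))"
    have "t * ?d \<le> \<bar>t\<bar> * \<bar>?d\<bar>" by (metis abs_ge_self abs_mult)
    also have "\<dots> \<le> \<bar>t\<bar> * (real m * (8 * B * (1 + K) * \<beta>) * (\<Sum>k<n. \<tau> k + \<tau> (Suc k)))"
      using N B by (intro mult_left_mono bulk_average psi) auto
    finally show ?thesis by (simp add: right_diff_distrib)
  qed
  \<comment> \<open>A wrong guess costs at most ln (c / \<epsilon>) more and happens with
    probability at most \<delta>.\<close>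
  have lnrr: "- integral\<^sup>L \<mu>' (\<lambda>x. ln (rr (\<xi> x) (e (win 0 l x)))) \<le> - ln (1 - \<epsilon>) + \<delta> * ln (c / \<epsilon>)"
  proof -
    let ?A = "{x\<in>space Xp. \<xi> x \<noteq> e (win 0 l x)}"
    have sx: "simple_function \<mu>' (\<lambda>x. (\<xi> x, win 0 l x))"
    proof (rule simple_function_Pair)
      show "simple_function \<mu>' \<xi>" unfolding simple_function_sets_cong[OF D(2)]
        by (rule simple_function_partition[OF \<xi>])
      show "simple_function \<mu>' (win 0 l)" using simple_win simple_function_sets_cong[OF D(2)] by blast
    qed
    have ic: "- ln (rr (\<xi> x) (e (win 0 l x))) \<le> - ln (1 - \<epsilon>) + ln (c / \<epsilon>) * of_bool (\<xi> x \<noteq> e (win 0 l x))" for x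
      using eps c by (auto simp: rr_def ln_div)
    have i1: "integrable \<mu>' (\<lambda>x. - ln (rr (\<xi> x) (e (win 0 l x))))"
      using integral_label(2)[OF D(1) sx, of "\<lambda>p. - ln (rr (fst p) (e (snd p)))"] by simp
    have i2: "integrable \<mu>' (\<lambda>x. of_bool (\<xi> x \<noteq> e (win 0 l x)) :: real)"
      using integral_label(2)[OF D(1) sx, of "\<lambda>p. of_bool (fst p \<noteq> e (snd p))"] by simp
    have oa: "integral\<^sup>L \<mu>' (\<lambda>x. of_bool (\<xi> x \<noteq> e (win 0 l x)) :: real) = measure \<mu>' ?A"
    proof -
      have "integral\<^sup>L \<mu>' (\<lambda>x. of_bool (\<xi> x \<noteq> e (win 0 l x)) :: real) = integral\<^sup>L \<mu>' (indicator ?A)"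
        by (intro Bochner_Integration.integral_cong refl) (simp add: indicator_def D(3))
      also have "\<dots> = measure \<mu>' (?A \<inter> space \<mu>')" by (rule Bochner_Integration.integral_indicator)
      also have "?A \<inter> space \<mu>' = ?A" unfolding D(3) by blast
      finally show ?thesis .
    qed
    have "- integral\<^sup>L \<mu>' (\<lambda>x. ln (rr (\<xi> x) (e (win 0 l x)))) = integral\<^sup>L \<mu>' (\<lambda>x. - ln (rr (\<xi> x) (e (win 0 l x))))" by simp
    also have "\<dots> \<le> integral\<^sup>L \<mu>' (\<lambda>x. - ln (1 - \<epsilon>) + ln (c / \<epsilon>) * of_bool (\<xi> x \<noteq> e (win 0 l x)))"
      using i1 i2 ic by (intro integral_mono) auto
    also have "\<dots> = - ln (1 - \<epsilon>) + ln (c / \<epsilon>) * measure \<mu>' ?A"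
      using i2 by (simp add: prob_space oa)
    also have "\<dots> \<le> - ln (1 - \<epsilon>) + ln (c / \<epsilon>) * \<delta>"
      using near eps c by (intro add_left_mono mult_left_mono) auto
    finally show ?thesis by (simp add: mult.commute)
  qed
  have "real n * - integral\<^sup>L \<mu>' (\<lambda>x. ln (rr (\<xi> x) (e (win 0 l x)))) \<le> real n * (- ln (1 - \<epsilon>) + \<delta> * ln (c / \<epsilon>))"
    by (rule mult_left_mono[OF lnrr]) simp
  moreover have "- integral\<^sup>L \<mu>' (H {..<N}) \<le> boundary_error N - real N * integral\<^sup>L \<mu>' \<phi>"
    using H_integral_near[OF M, of N] by linarith
  ultimately show ?thesis
    using main lnZt tav unfolding c_def[symmetric] by (simp add: right_diff_distrib mult.left_commute[of t])
qed

text \<open>Divide by n and let n grow with l, \<epsilon>, \<delta> fixed: boundary errors and the l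
  + m additional spins disappear, and the noise terms are at most \<kappa>.\<close>

lemma entropy_upper:
  assumes M: "shift_invariant \<mu>'" and \<xi>: "finite_partition \<xi>"
    and psi: "\<And>a. a \<in> cfg {..<m} \<Longrightarrow> \<bar>\<psi> a\<bar> \<le> B" and B: "0 \<le> B"
  shows "entropy_rate \<mu>' \<xi> \<le> ln growth_rate - integral\<^sup>L \<mu>' \<phi>
     + t * (integral\<^sup>L \<mu> (\<lambda>x. \<psi> (win 0 m x)) - integral\<^sup>L \<mu>' (\<lambda>x. \<psi> (win 0 m x)))
     + 2 * (1 + K) * (B * real m)\<^sup>2 * t\<^sup>2"
proof (rule field_le_epsilon)
  fix \<kappa> :: real assume k: "0 < \<kappa>"
  define R where "R = \<xi> ` space Xp"
  \<comment> \<open>Chosen so that -ln (1 - \<epsilon>) is \<kappa> / 2; the choice of \<delta>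
    below takes the other half.\<close>
  define \<epsilon> where "\<epsilon> = 1 - exp (- (\<kappa> / 2))"
  have eps: "0 < \<epsilon>" "\<epsilon> < 1" and lneps: "- ln (1 - \<epsilon>) = \<kappa> / 2" using k by (simp_all add: \<epsilon>_def)
  define A where "A = \<bar>ln (real (card R) / \<epsilon>)\<bar> + 1"
  define \<delta> where "\<delta> = \<kappa> / 2 / A"
  have A: "0 < A" by (simp add: A_def)
  have d: "0 < \<delta>" using k A by (simp add: \<delta>_def)
  have dA: "\<delta> * ln (real (card R) / \<epsilon>) \<le> \<kappa> / 2"
  proof -
    have "\<delta> * ln (real (card R) / \<epsilon>) \<le> \<delta> * A" using d by (intro mult_left_mono) (auto simp: A_def)
    also have "\<dots> = \<kappa> / 2" using A by (simp add: \<delta>_def)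
    finally show ?thesis .
  qed
  obtain l e where le: "measure \<mu>' {x\<in>space Xp. \<xi> x \<noteq> e (win 0 l x)} < \<delta>"
    using local_partition_approximation[OF M \<xi> d] by blast
  define L where "L = l + m"
  define I where "I = integral\<^sup>L \<mu>' \<phi>"
  define J where "J = t * (integral\<^sup>L \<mu> (\<lambda>x. \<psi> (win 0 m x)) - integral\<^sup>L \<mu>' (\<lambda>x. \<psi> (win 0 m x)))"
  define c1 where "c1 = real m * (8 * B * (1 + K) * \<beta>)"
  define c2 where "c2 = 2 * (1 + K) * (B * real m)\<^sup>2 * t\<^sup>2"
  \<comment> \<open>The finite bound divided by n; the factor (n + L) / n converts from the N spins
    to the n labels.\<close>
  define b where "b n = (boundary_error (n + L) / real (n + L) - I + ln (Z (n + L)) / real (n + L) + c2) * (real (n + L) / real n)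
      + J + \<bar>t\<bar> * (c1 * ((\<Sum>k<n. \<tau> k + \<tau> (Suc k)) / real n)) + \<kappa>" for n
  have ratio: "(\<lambda>n. real (n + L) / real n) \<longlonglongrightarrow> 1"
  proof -
    have "(\<lambda>n. 1 + real L * (1 / real n)) \<longlonglongrightarrow> 1 + real L * 0"
      by (intro tendsto_intros lim_1_over_n)
    moreover have "eventually (\<lambda>n. 1 + real L * (1 / real n) = real (n + L) / real n) sequentially"
      using eventually_gt_at_top[of 0] by eventually_elim (simp add: field_simps)
    ultimately show ?thesis using Lim_transform_eventually by fastforce
  qed
  have tl: "(\<lambda>n. (\<Sum>k<n. \<tau> k + \<tau> (Suc k)) / real n) \<longlonglongrightarrow> 0 + 0"
    by (intro Cesaro tendsto_add LIMSEQ_Suc tail_sum_tendsto alpha)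
  have "b \<longlonglongrightarrow> (0 - I + ln growth_rate + c2) * 1 + J + \<bar>t\<bar> * (c1 * (0 + 0)) + \<kappa>"
    unfolding b_def
    by (intro tendsto_add tendsto_mult tendsto_diff tendsto_const ratio tl
        LIMSEQ_ignore_initial_segment[OF boundary_error_tendsto, of L] LIMSEQ_ignore_initial_segment[OF ln_Z_tendsto, of L])
  moreover have "eventually (\<lambda>n. part_entropy \<mu>' (refine n \<xi>) / real n \<le> b n) sequentially"
    using eventually_gt_at_top[of 0]
  proof eventually_elim
    case (elim n)
    define N where "N = n + L"
    have np: "0 < real n" "0 < real N" using elim by (auto simp: N_def)
    have "part_entropy \<mu>' (refine n \<xi>) \<le> boundary_error N - real N * I + ln (Z N) + real n * J
       + \<bar>t\<bar> * (c1 * (\<Sum>k<n. \<tau> k + \<tau> (Suc k))) + c2 * real N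
       + real n * (- ln (1 - \<epsilon>) + \<delta> * ln (real (card R) / \<epsilon>))"
      unfolding I_def J_def c1_def c2_def
      by (rule entropy_upper_finite[OF M \<xi> psi B eps less_imp_le[OF le] R_def]) (simp_all add: N_def L_def)
    also have "\<dots> \<le> boundary_error N - real N * I + ln (Z N) + real n * J + \<bar>t\<bar> * (c1 * (\<Sum>k<n. \<tau> k + \<tau> (Suc k))) + c2 * real N + real n * \<kappa>"
      using dA lneps by (intro add_left_mono mult_left_mono) auto
    also have "\<dots> = real n * b n"
      unfolding b_def N_def[symmetric] using np by (simp add: field_simps)
    finally show ?case using np by (simp add: divide_le_eq mult.commute)
  qed
  ultimately have "entropy_rate \<mu>' \<xi> \<le> (0 - I + ln growth_rate + c2) * 1 + J + \<bar>t\<bar> * (c1 * (0 + 0)) + \<kappa>"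
    by (intro tendsto_le[OF trivial_limit_sequentially _ entropy_rate_LIMSEQ[OF M \<xi>]])
  then show "entropy_rate \<mu>' \<xi> \<le> ln growth_rate - integral\<^sup>L \<mu>' \<phi>
     + t * (integral\<^sup>L \<mu> (\<lambda>x. \<psi> (win 0 m x)) - integral\<^sup>L \<mu>' (\<lambda>x. \<psi> (win 0 m x)))
     + 2 * (1 + K) * (B * real m)\<^sup>2 * t\<^sup>2 + \<kappa>"
    unfolding I_def J_def c2_def by simp
qed

lemma finite_partition_const: "finite_partition (\<lambda>_. 0)"
proof -
  have "(\<lambda>_. 0 :: nat) ` space Xp \<subseteq> {0}" by auto
  then show ?thesis unfolding finite_partition_def using finite_subset by auto
qed

text \<open>\<open>Sup\<close> is a least upper bound only for bounded sets; the trivial tilt t = 0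
  provides the bound.\<close>

lemma entropy_rate_bdd:
  assumes M: "shift_invariant \<mu>'"
  shows "bdd_above {entropy_rate \<mu>' \<xi> | \<xi>. finite_partition \<xi>}"
  using entropy_upper[OF M, of _ 0 "\<lambda>_. 0" 0 0] by (intro bdd_aboveI[of _ "ln growth_rate - integral\<^sup>L \<mu>' \<phi>"]) auto

lemma ks_upper:
  assumes M: "shift_invariant \<mu>'" and psi: "\<And>a. a \<in> cfg {..<m} \<Longrightarrow> \<bar>\<psi> a\<bar> \<le> B" and B: "0 \<le> B"
  shows "ks_entropy \<mu>' + integral\<^sup>L \<mu>' \<phi> \<le> ln growth_rate
     + t * (integral\<^sup>L \<mu> (\<lambda>x. \<psi> (win 0 m x)) - integral\<^sup>L \<mu>' (\<lambda>x. \<psi> (win 0 m x)))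
     + 2 * (1 + K) * (B * real m)\<^sup>2 * t\<^sup>2"
proof -
  have "ks_entropy \<mu>' \<le> ln growth_rate - integral\<^sup>L \<mu>' \<phi>
     + t * (integral\<^sup>L \<mu> (\<lambda>x. \<psi> (win 0 m x)) - integral\<^sup>L \<mu>' (\<lambda>x. \<psi> (win 0 m x)))
     + 2 * (1 + K) * (B * real m)\<^sup>2 * t\<^sup>2"
    unfolding ks_entropy_def
  proof (rule cSup_least)
    show "{entropy_rate \<mu>' \<xi> | \<xi>. finite_partition \<xi>} \<noteq> {}" using finite_partition_const by blast
    fix y assume "y \<in> {entropy_rate \<mu>' \<xi> | \<xi>. finite_partition \<xi>}"
    then obtain \<xi> where "y = entropy_rate \<mu>' \<xi>" "finite_partition \<xi>" by blast
    then show "y \<le> ln growth_rate - integral\<^sup>L \<mu>' \<phi>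
     + t * (integral\<^sup>L \<mu> (\<lambda>x. \<psi> (win 0 m x)) - integral\<^sup>L \<mu>' (\<lambda>x. \<psi> (win 0 m x)))
     + 2 * (1 + K) * (B * real m)\<^sup>2 * t\<^sup>2" using entropy_upper[OF M _ psi B] by simp
  qed
  then show ?thesis by simp
qed

section \<open>Lower bound for the entropy of \<mu>\<close>

text \<open>The boundary changes numerator and denominator by a factor of at most exp
  (boundary_error n) each, hence the 2.\<close>

lemma kern_le:
  assumes a: "a \<in> cfg {..<n}" and x: "x \<in> cube"
  shows "kern n a x \<le> exp (H {..<n} a + 2 * boundary_error n) / Z n"
proof -
  have near: "\<bar>birkhoff_sum n \<phi> (glue n b x) - H {..<n} b\<bar> \<le> boundary_error n" if b: "b \<in> cfg {..<n}" for b
  proof -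
    have "H {..<n} (glue n b x) = H {..<n} b" by (rule H_cong) (simp add: glue_def)
    then show ?thesis using birkhoff_near[OF glue_cube[OF b x], of n] by simp
  qed
  have den: "exp (- boundary_error n) * Z n \<le> (\<Sum>b\<in>cfg {..<n}. exp (birkhoff_sum n \<phi> (glue n b x)))"
    unfolding Z_def sum_distrib_left
  proof (rule sum_mono)
    fix b assume "b \<in> cfg {..<n}"
    from near[OF this] show "exp (- boundary_error n) * exp (H {..<n} b) \<le> exp (birkhoff_sum n \<phi> (glue n b x))"
      unfolding exp_add[symmetric] exp_le_cancel_iff by linarith
  qed
  have num: "exp (birkhoff_sum n \<phi> (glue n a x)) \<le> exp (H {..<n} a + boundary_error n)" using near[OF a] by simp
  have "kern n a x \<le> exp (H {..<n} a + boundary_error n) / (exp (- boundary_error n) * Z n)"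
    unfolding kern_def using num den Z_pos[of n] by (intro frac_le) auto
  also have "\<dots> = exp (H {..<n} a + 2 * boundary_error n) / Z n"
  proof -
    have "exp (H {..<n} a + 2 * boundary_error n) = exp (H {..<n} a + boundary_error n) * exp (boundary_error n)" by (simp add: exp_add[symmetric])
    then show ?thesis by (simp add: exp_minus divide_inverse)
  qed
  finally show ?thesis .
qed

lemma nu_cyl_le:
  assumes a: "a \<in> cfg {..<n}"
  shows "measure \<nu> (cyl n a) \<le> exp (H {..<n} a + 2 * boundary_error n) / Z n"
proof -
  interpret prob_space \<nu> by (rule nu_prob)
  have u: "(\<lambda>_. undefined) \<in> cfg {..<0 :: nat}" by simp
  have "measure \<nu> (cyl n a) = integral\<^sup>L \<nu> (kern n a)"
    using nu_DLR_cyl[OF a u] integral_chi[OF nu_prob nu_sets a] by (simp add: chi_def[of 0])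
  also have "\<dots> \<le> integral\<^sup>L \<nu> (\<lambda>_. exp (H {..<n} a + 2 * boundary_error n) / Z n)"
    using kern_le[OF a] Xp_cube by (intro integral_mono continuous_cube_integrable[OF continuous_kern[OF a] nu_prob nu_sets]) auto
  finally show ?thesis by simp
qed

text \<open>On each cylinder, Cauchy-Schwarz bounds the squared \<mu>-mass over the \<nu>-mass by
  the integral of the squared density there; summing gives the second moment, first in finite volume
  and then in the limit.\<close>

lemma mu_nu_chi_square: "(\<Sum>a\<in>cfg {..<n}. (measure \<mu> (cyl n a))\<^sup>2 / measure \<nu> (cyl n a)) \<le> exp K"
proof (rule LIMSEQ_le_const2)
  let ?p = "\<lambda>r a. gibbs (2 * r) (\<lambda>z. of_bool (win r n z = a))" and ?q = "\<lambda>r a. gibbs r (\<lambda>x. of_bool (win 0 n x = a))"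
  have pl: "(\<lambda>r. ?p r a) \<longlonglongrightarrow> measure \<mu> (cyl n a)" if a: "a \<in> cfg {..<n}" for a
    using mu_lim[of "\<lambda>b. of_bool (b \<in> {a})" n] measure_local_set_integral[OF mu_prob mu_sets, of n "{a}"]
    by (simp add: cyl_eq_local_set[OF a] del: mem_Collect_eq)
  show "(\<lambda>r. \<Sum>a\<in>cfg {..<n}. (?p r a)\<^sup>2 / ?q r a) \<longlonglongrightarrow> (\<Sum>a\<in>cfg {..<n}. (measure \<mu> (cyl n a))\<^sup>2 / measure \<nu> (cyl n a))"
  proof (rule tendsto_sum)
    fix a assume a: "a \<in> cfg {..<n}"
    show "(\<lambda>r. (?p r a)\<^sup>2 / ?q r a) \<longlonglongrightarrow> (measure \<mu> (cyl n a))\<^sup>2 / measure \<nu> (cyl n a)"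
      using nu_cyl_pos[OF a] by (intro tendsto_divide tendsto_power pl a nu_cyl) simp
  qed
  show "\<exists>R. \<forall>r\<ge>R. (\<Sum>a\<in>cfg {..<n}. (?p r a)\<^sup>2 / ?q r a) \<le> exp K"
  proof (intro exI allI impI)
    fix r assume r: "n \<le> r"
    have "(?p r a)\<^sup>2 / ?q r a \<le> gibbs r (\<lambda>x. of_bool (win 0 n x = a) * (half_density r x)\<^sup>2)" for a
    proof -
      let ?o = "\<lambda>x. of_bool (win 0 n x = a) :: real"
      let ?c = "gibbs r (\<lambda>x. ?o x * half_density r x)"
      have c0: "0 \<le> ?c" using half_density_ge_1[THEN order_trans[OF zero_le_one]] by (intro gE_nonneg) auto
      have q0: "0 \<le> ?q r a" by (intro gE_nonneg) auto
      have "?c / gibbs r (half_density r) \<le> ?c / 1"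
        using c0 gibbs_half_density_ge_1[of r] by (intro divide_left_mono) auto
      then have "(?p r a)\<^sup>2 \<le> ?c\<^sup>2"
        unfolding two_sided_local[OF r, of "\<lambda>b. of_bool (b = a)"]
        using c0 gibbs_half_density_ge_1[of r] by (intro power_mono) auto
      \<comment> \<open>The indicator is written twice so that Cauchy-Schwarz keeps it in both
        factors.\<close>
      also have "\<dots> = (gibbs r (\<lambda>x. ?o x * (?o x * half_density r x)))\<^sup>2"
        by (intro arg_cong[where f="\<lambda>y. y\<^sup>2"] gE_cong refl) (simp add: of_bool_def)
      also have "\<dots> \<le> gibbs r (\<lambda>x. (?o x)\<^sup>2) * gibbs r (\<lambda>x. (?o x * half_density r x)\<^sup>2)"
        by (rule gE_Cauchy_Schwarz) simp
      also have "\<dots> = ?q r a * gibbs r (\<lambda>x. ?o x * (half_density r x)\<^sup>2)"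
        by (intro arg_cong2[where f="(*)"] gE_cong refl) (simp_all add: of_bool_def)
      finally have le: "(?p r a)\<^sup>2 \<le> ?q r a * gibbs r (\<lambda>x. ?o x * (half_density r x)\<^sup>2)" .
      show ?thesis
      proof (cases "?q r a = 0")
        case True
        then show ?thesis by (simp add: gE_nonneg)
      next
        case False
        then show ?thesis using le q0 by (simp add: divide_le_eq mult.commute)
      qed
    qed
    then have "(\<Sum>a\<in>cfg {..<n}. (?p r a)\<^sup>2 / ?q r a) \<le> (\<Sum>a\<in>cfg {..<n}. gibbs r (\<lambda>x. of_bool (win 0 n x = a) * (half_density r x)\<^sup>2))"
      by (intro sum_mono)
    also have "\<dots> = gibbs r (\<lambda>x. \<Sum>a\<in>cfg {..<n}. of_bool (win 0 n x = a) * (half_density r x)\<^sup>2)"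
      by (rule gE_sum[symmetric]) (simp add: finite_cfg)
    also have "\<dots> \<le> gibbs r (\<lambda>x. (half_density r x)\<^sup>2)"
    proof (rule gE_mono[OF finite_lessThan])
      fix x
      have "(\<Sum>a\<in>cfg {..<n}. of_bool (win 0 n x = a) * (half_density r x)\<^sup>2) = (\<Sum>a\<in>cfg {..<n}. if a = win 0 n x then (half_density r x)\<^sup>2 else 0)"
        by (intro sum.cong) auto
      also have "\<dots> \<le> (half_density r x)\<^sup>2" by (subst sum.delta) (simp_all add: finite_cfg)
      finally show "(\<Sum>a\<in>cfg {..<n}. of_bool (win 0 n x = a) * (half_density r x)\<^sup>2) \<le> (half_density r x)\<^sup>2" .
    qed
    also have "\<dots> \<le> exp K" by (rule half_density_second_moment)
    finally show "(\<Sum>a\<in>cfg {..<n}. (?p r a)\<^sup>2 / ?q r a) \<le> exp K" .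
  qed
qed

text \<open>The relative entropy of \<open>\<mu>\<close> with respect to \<open>\<nu>\<close> on the first \<open>n\<close> spins is bounded by the chi-square
  distance, uniformly in \<open>n\<close>.\<close>
lemma mu_part_entropy_ge:
  "ln (Z n) - 3 * boundary_error n - K - real n * integral\<^sup>L \<mu> \<phi> \<le> part_entropy \<mu> (win 0 n)"
proof -
  interpret prob_space \<mu> by (rule mu_prob)
  have sw: "simple_function \<mu> (win 0 n)" using simple_win simple_function_sets_cong[OF mu_sets] by blast
  let ?p = "\<lambda>a. measure \<mu> (cyl n a)" and ?q = "\<lambda>a. measure \<nu> (cyl n a)"
  have at: "atom \<mu> (win 0 n) a = ?p a" if "a \<in> cfg {..<n}" for a
    unfolding atom_def cyl_eq_local_set[OF that] by (rule arg_cong[where f="measure \<mu>"]) (auto simp: local_set_def)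
  have sub: "win 0 n ` space \<mu> \<subseteq> cfg {..<n}" by (auto simp: Xp_ivl_cfg)
  have "?p a * ln (?p a) \<le> (?p a)\<^sup>2 / ?q a / exp K - ?p a + ?p a * K + ?p a * (H {..<n} a + 2 * boundary_error n - ln (Z n))"
    if a: "a \<in> cfg {..<n}" for a
  proof (cases "?p a = 0")
    case False
    then have p: "0 < ?p a" using measure_nonneg[of \<mu> "cyl n a"] by linarith
    note q = nu_cyl_pos[OF a]
    \<comment> \<open>Dividing by exp K before using ln u \<le> u - 1 makes the summed chi-square
      term at most 1, which cancels the -1 and leaves K.\<close>
    have "ln (?p a / ?q a / exp K) \<le> ?p a / ?q a / exp K - 1" using p q by (intro ln_le_minus_one) auto
    then have 1: "ln (?p a) \<le> ?p a / ?q a / exp K - 1 + K + ln (?q a)" using p q by (simp add: ln_div ln_mult)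
    have "ln (?q a) \<le> ln (exp (H {..<n} a + 2 * boundary_error n) / Z n)" using q nu_cyl_le[OF a] by (intro ln_mono) auto
    also have "\<dots> = H {..<n} a + 2 * boundary_error n - ln (Z n)" using Z_pos[of n] by (simp add: ln_div)
    finally have "ln (?p a) \<le> ?p a / ?q a / exp K - 1 + K + (H {..<n} a + 2 * boundary_error n - ln (Z n))" using 1 by linarith
    then have "?p a * ln (?p a) \<le> ?p a * (?p a / ?q a / exp K - 1 + K + (H {..<n} a + 2 * boundary_error n - ln (Z n)))"
      using p by (intro mult_left_mono) auto
    then show ?thesis by (simp add: power2_eq_square algebra_simps)
  qed simp
  then have "(\<Sum>a\<in>cfg {..<n}. ?p a * ln (?p a))
      \<le> (\<Sum>a\<in>cfg {..<n}. (?p a)\<^sup>2 / ?q a / exp K - ?p a + ?p a * K + ?p a * (H {..<n} a + 2 * boundary_error n - ln (Z n)))"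
    by (rule sum_mono)
  also have "\<dots> = (\<Sum>a\<in>cfg {..<n}. (?p a)\<^sup>2 / ?q a) / exp K - (\<Sum>a\<in>cfg {..<n}. ?p a) + (\<Sum>a\<in>cfg {..<n}. ?p a) * K
      + (\<Sum>a\<in>cfg {..<n}. ?p a * (H {..<n} a + 2 * boundary_error n - ln (Z n)))"
    by (simp add: sum.distrib sum_subtractf sum_divide_distrib sum_distrib_right)
  also have "(\<Sum>a\<in>cfg {..<n}. ?p a) = 1"
    using integral_local[OF mu_prob mu_sets, of "\<lambda>_. 1" n] prob_space by simp
  also have "(\<Sum>a\<in>cfg {..<n}. ?p a * (H {..<n} a + 2 * boundary_error n - ln (Z n))) = integral\<^sup>L \<mu> (\<lambda>x. H {..<n} (win 0 n x) + 2 * boundary_error n - ln (Z n))"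
    by (rule integral_local[OF mu_prob mu_sets, symmetric])
  also have "(\<lambda>x. H {..<n} (win 0 n x) + 2 * boundary_error n - ln (Z n)) = (\<lambda>x. H {..<n} x + 2 * boundary_error n - ln (Z n))"
  proof -
    have "H {..<n} (win 0 n x) = H {..<n} x" for x by (rule H_cong) (simp add: win_def)
    then show ?thesis by simp
  qed
  also have "integral\<^sup>L \<mu> (\<lambda>x. H {..<n} x + 2 * boundary_error n - ln (Z n)) = integral\<^sup>L \<mu> (H {..<n}) + 2 * boundary_error n - ln (Z n)"
    using continuous_cube_integrable[OF continuous_H mu_prob mu_sets, of "{..<n}"] prob_space by simp
  finally have "(\<Sum>a\<in>cfg {..<n}. ?p a * ln (?p a))
      \<le> (\<Sum>a\<in>cfg {..<n}. (?p a)\<^sup>2 / ?q a) / exp K - 1 + 1 * K + (integral\<^sup>L \<mu> (H {..<n}) + 2 * boundary_error n - ln (Z n))" .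
  moreover have "(\<Sum>a\<in>cfg {..<n}. (?p a)\<^sup>2 / ?q a) / exp K \<le> 1" using mu_nu_chi_square[of n] by (simp add: divide_le_eq)
  \<comment> \<open>The third boundary error arises here; the other two come from
    \<open>nu_cyl_le\<close>.\<close>
  moreover have "integral\<^sup>L \<mu> (H {..<n}) \<le> real n * integral\<^sup>L \<mu> \<phi> + boundary_error n"
    using H_integral_near[OF mu_shift_invariant, of n] by linarith
  ultimately have "(\<Sum>a\<in>cfg {..<n}. ?p a * ln (?p a)) \<le> K + real n * integral\<^sup>L \<mu> \<phi> + 3 * boundary_error n - ln (Z n)" by linarith
  moreover have "part_entropy \<mu> (win 0 n) = - (\<Sum>a\<in>cfg {..<n}. ?p a * ln (?p a))"
  proof -
    have "part_entropy \<mu> (win 0 n) = (\<Sum>a\<in>win 0 n ` space \<mu>. - (?p a * ln (?p a)))"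
      unfolding part_entropy_atom using at sub by (intro sum.cong refl) auto
    also have "\<dots> = (\<Sum>a\<in>cfg {..<n}. - (?p a * ln (?p a)))"
    proof (rule sum.mono_neutral_left[OF finite_cfg[OF finite_lessThan] sub], rule ballI)
      fix a assume a: "a \<in> cfg {..<n} - win 0 n ` space \<mu>"
      then have "win 0 n -` {a} \<inter> space \<mu> = {}" by auto
      then have "atom \<mu> (win 0 n) a = 0" by (simp add: atom_def)
      then show "- (?p a * ln (?p a)) = 0" using at[of a] a by simp
    qed
    finally show ?thesis by (simp add: sum_negf)
  qed
  ultimately show ?thesis by linarith
qed

text \<open>The partition by the spin at 0 refines to the partition into words, so its entropy rate
  alone is at least ln growth_rate minus the mean of \<phi>.\<close>

lemma ks_mu_ge: "ln growth_rate \<le> ks_entropy \<mu> + integral\<^sup>L \<mu> \<phi>"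
proof -
  let ?\<xi> = "\<lambda>x. if win 0 1 x 0 = 1 then 1 else 0 :: nat"
  have \<xi>: "finite_partition ?\<xi>"
  proof -
    have "?\<xi> ` space Xp \<subseteq> {0, 1}" by auto
    then show ?thesis unfolding finite_partition_def
      using local_fun_measurable[of "\<lambda>b. if b 0 = 1 then 1 else 0 :: nat" 0 1] finite_subset by blast
  qed
  have "ln (Z n) - 3 * boundary_error n - K - real n * integral\<^sup>L \<mu> \<phi> \<le> part_entropy \<mu> (refine n ?\<xi>)" for n
  proof -
    \<comment> \<open>g decodes the labels 0 and 1 into spins, which makes the word a function of
      the refined label.\<close>
    define g :: "nat list \<Rightarrow> nat \<Rightarrow> real" where "g v = (\<lambda>i\<in>{..<n}. if v ! i = 1 then 1 else -1)" for v
    have sr: "simple_function \<mu> (refine n ?\<xi>)" using simple_refine[OF \<xi>] simple_function_sets_cong[OF mu_sets] by blast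
    have gx: "g (refine n ?\<xi> x) = win 0 n x" if "x \<in> space \<mu>" for x
    proof -
      have "x i = 1 \<or> -1 = x i" for i using that unfolding mu_space space_Xp mem_Collect_eq by metis
      then show ?thesis by (auto simp: g_def win_def refine_nth fun_eq_iff)
    qed
    have "part_entropy \<mu> (win 0 n) = part_entropy \<mu> (\<lambda>x. g (refine n ?\<xi> x))"
    proof -
      have "win 0 n ` space \<mu> = (\<lambda>x. g (refine n ?\<xi> x)) ` space \<mu>" using gx by (intro image_cong) auto
      moreover have "win 0 n -` {v} \<inter> space \<mu> = (\<lambda>x. g (refine n ?\<xi> x)) -` {v} \<inter> space \<mu>" for v using gx by auto
      ultimately show ?thesis unfolding part_entropy_def by simp
    qed
    also have "\<dots> \<le> part_entropy \<mu> (refine n ?\<xi>)" by (rule part_entropy_comp_le[OF mu_prob sr])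
    finally show ?thesis using mu_part_entropy_ge[of n] by linarith
  qed
  then have "eventually (\<lambda>n. ln (Z n) / real n - 3 * (boundary_error n / real n) - K * (1 / real n) - integral\<^sup>L \<mu> \<phi>
      \<le> part_entropy \<mu> (refine n ?\<xi>) / real n) sequentially"
    using eventually_gt_at_top[of 0]
  proof (intro eventually_mono[OF eventually_gt_at_top[of 0]])
    fix n :: nat assume n: "0 < n"
    assume "\<And>n. ln (Z n) - 3 * boundary_error n - K - real n * integral\<^sup>L \<mu> \<phi> \<le> part_entropy \<mu> (refine n ?\<xi>)"
    then have "(ln (Z n) - 3 * boundary_error n - K - real n * integral\<^sup>L \<mu> \<phi>) / real n \<le> part_entropy \<mu> (refine n ?\<xi>) / real n"
      by (intro divide_right_mono) auto
    then show "ln (Z n) / real n - 3 * (boundary_error n / real n) - K * (1 / real n) - integral\<^sup>L \<mu> \<phi> \<le> part_entropy \<mu> (refine n ?\<xi>) / real n"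
      using n by (simp add: diff_divide_distrib)
  qed
  moreover have "(\<lambda>n. ln (Z n) / real n - 3 * (boundary_error n / real n) - K * (1 / real n) - integral\<^sup>L \<mu> \<phi>)
      \<longlonglongrightarrow> ln growth_rate - 3 * 0 - K * 0 - integral\<^sup>L \<mu> \<phi>"
    by (intro tendsto_diff tendsto_mult tendsto_const ln_Z_tendsto boundary_error_tendsto lim_1_over_n)
  ultimately have "ln growth_rate - 3 * 0 - K * 0 - integral\<^sup>L \<mu> \<phi> \<le> entropy_rate \<mu> ?\<xi>"
    by (intro tendsto_le[OF trivial_limit_sequentially entropy_rate_LIMSEQ[OF mu_shift_invariant \<xi>]])
  also have "\<dots> \<le> ks_entropy \<mu>"
    unfolding ks_entropy_def by (rule cSup_upper[OF _ entropy_rate_bdd[OF mu_shift_invariant]]) (use \<xi> in blast)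
  finally show ?thesis by simp
qed

section \<open>Existence and uniqueness of the equilibrium state\<close>

lemma mu_equilibrium: "equilibrium_state \<phi> \<mu>"
  unfolding equilibrium_state_def
proof (intro conjI allI impI mu_shift_invariant)
  fix \<mu>' assume "shift_invariant \<mu>'"
  from ks_upper[OF this, of 0 "\<lambda>_. 0" 0 0] ks_mu_ge
  show "ks_entropy \<mu>' + integral\<^sup>L \<mu>' \<phi> \<le> ks_entropy \<mu> + integral\<^sup>L \<mu> \<phi>" by simp
qed

lemma equilibrium_unique:
  assumes "equilibrium_state \<phi> \<mu>'"
  shows "\<mu>' = \<mu>"
proof -
  have M: "shift_invariant \<mu>'" and ge: "ks_entropy \<mu> + integral\<^sup>L \<mu> \<phi> \<le> ks_entropy \<mu>' + integral\<^sup>L \<mu>' \<phi>"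
    using assms mu_shift_invariant unfolding equilibrium_state_def by auto
  note D = shift_invariantD[OF M]
  show ?thesis
  proof (rule measure_eq_Xp)
    show "finite_measure \<mu>'" using D(1) by (simp add: prob_space_def)
    fix m :: nat and a assume a: "a \<in> cfg {..<m}"
    let ?\<psi> = "\<lambda>b. of_bool (b = a) :: real"
    define d where "d = integral\<^sup>L \<mu> (\<lambda>x. ?\<psi> (win 0 m x)) - integral\<^sup>L \<mu>' (\<lambda>x. ?\<psi> (win 0 m x))"
    \<comment> \<open>The summand 1 keeps C positive for the empty word.\<close>
    define C where "C = 2 * (1 + K) * (1 * real m)\<^sup>2 + 1"
    have C: "0 < C" using K_ge by (simp add: C_def add_nonneg_pos)
    have pos: "0 \<le> t * d + C * t\<^sup>2" for t
    proof -
      have "ks_entropy \<mu>' + integral\<^sup>L \<mu>' \<phi> \<le> ln growth_rate + t * d + 2 * (1 + K) * (1 * real m)\<^sup>2 * t\<^sup>2"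
        unfolding d_def by (rule ks_upper[OF M]) auto
      also have "\<dots> \<le> ln growth_rate + (t * d + C * t\<^sup>2)" by (simp add: C_def algebra_simps)
      finally show ?thesis using ge ks_mu_ge by linarith
    qed
    have "d = 0"
    proof (rule ccontr)
      assume "d \<noteq> 0"
      \<comment> \<open>t = -d / (2 C) minimises t d + C t^2.\<close>
      have "(- (d / (2 * C))) * d + C * (- (d / (2 * C)))\<^sup>2 = - (d\<^sup>2 / (4 * C))"
        using C by (simp add: power2_eq_square field_simps)
      then have "0 \<le> - (d\<^sup>2 / (4 * C))" using pos[of "- (d / (2 * C))"] by simp
      then show False using \<open>d \<noteq> 0\<close> C by (simp add: divide_le_0_iff)
    qed
    then show "measure \<mu>' (cyl m a) = measure \<mu> (cyl m a)"
      using measure_local_set_integral[OF mu_prob mu_sets, of m "{a}"] measure_local_set_integral[OF D(1,2), of m "{a}"]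
      by (simp add: d_def cyl_eq_local_set[OF a] del: mem_Collect_eq)
  qed (use mu_finite D in simp_all)
qed

lemma equilibrium_state_and_eigenfunctions:
  "\<exists>\<mu> \<nu>.
        equilibrium_state (dyson \<alpha> \<beta>) \<mu> \<and>
        (\<forall>\<mu>'. equilibrium_state (dyson \<alpha> \<beta>) \<mu>' \<longrightarrow> \<mu>' = \<mu>) \<and>
        half_line_gibbs (dyson \<alpha> \<beta>) \<nu> \<and>
        (\<forall>\<nu>'. half_line_gibbs (dyson \<alpha> \<beta>) \<nu>' \<longrightarrow> \<nu>' = \<nu>) \<and>
        absolutely_continuous \<nu> \<mu> \<and> absolutely_continuous \<mu> \<nu> \<and>
        (\<exists>h. integrable \<nu> h \<and> (AE x in \<nu>. 0 \<le> h x) \<and> \<not> (AE x in \<nu>. h x = 0) \<and>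
             (AE x in \<nu>. transfer (dyson \<alpha> \<beta>) h x = exp (pressure (dyson \<alpha> \<beta>)) * h x)) \<and>
        (\<alpha> > 3/2 \<longrightarrow>
           (\<exists>g. continuous_on (space Xp) g \<and> (AE x in \<nu>. RN_deriv \<nu> \<mu> x = ennreal (g x))) \<and>
           (\<exists>h. continuous_on (space Xp) h \<and> (\<forall>x\<in>space Xp. 0 \<le> h x) \<and>
                (\<exists>x\<in>space Xp. h x \<noteq> 0) \<and>
                (\<forall>x\<in>space Xp. transfer (dyson \<alpha> \<beta>) h x = exp (pressure (dyson \<alpha> \<beta>)) * h x)))"
proof -
  have iii: "(\<exists>g. continuous_on (space Xp) g \<and> (AE x in \<nu>. RN_deriv \<nu> \<mu> x = ennreal (g x))) \<and>
           (\<exists>h. continuous_on (space Xp) h \<and> (\<forall>x\<in>space Xp. 0 \<le> h x) \<and>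
                (\<exists>x\<in>space Xp. h x \<noteq> 0) \<and>
                (\<forall>x\<in>space Xp. transfer \<phi> h x = exp (pressure \<phi>) * h x))"
    if a: "3/2 < \<alpha>"
  proof
    interpret N: prob_space \<nu> by (rule nu_prob)
    obtain g where g: "continuous_on cube g" "\<And>x. x \<in> cube \<Longrightarrow> 0 < g x" "density \<nu> (\<lambda>x. ennreal (g x)) = \<mu>"
      using continuous_density[OF a] by blast
    have sub: "space Xp \<subseteq> cube" using Xp_cube by blast
    have gX: "continuous_on (space Xp) g" by (rule continuous_on_subset[OF g(1) sub])
    have gm: "(\<lambda>x. ennreal (g x)) \<in> borel_measurable \<nu>" using continuous_cube_measurable[OF g(1)] by simp
    have "AE x in \<nu>. RN_deriv \<nu> \<mu> x = ennreal (g x)"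
      using N.RN_deriv_unique[OF gm g(3)] by eventually_elim simp
    then show "\<exists>g. continuous_on (space Xp) g \<and> (AE x in \<nu>. RN_deriv \<nu> \<mu> x = ennreal (g x))" using gX by blast
    have one: "(\<lambda>_. 1) \<in> space Xp" by (simp add: space_Xp)
    have "\<forall>x\<in>space Xp. 0 \<le> g x" using g(2) sub by (auto intro: less_imp_le)
    moreover have "\<exists>x\<in>space Xp. g x \<noteq> 0" using g(2)[OF Xp_cube[OF one]] one by (intro bexI[of _ "\<lambda>_. 1"]) auto
    ultimately show "\<exists>h. continuous_on (space Xp) h \<and> (\<forall>x\<in>space Xp. 0 \<le> h x) \<and> (\<exists>x\<in>space Xp. h x \<noteq> 0) \<and>
        (\<forall>x\<in>space Xp. transfer (dyson \<alpha> \<beta>) h x = exp (pressure (dyson \<alpha> \<beta>)) * h x)"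
      using gX continuous_eigenfunction[OF g] by (intro exI[of _ g]) auto
  qed
  show ?thesis
    by (intro exI[of _ \<mu>] exI[of _ \<nu>] conjI allI impI mu_equilibrium equilibrium_unique nu_half_line_gibbs
        half_line_gibbs_unique mu_abs_nu nu_abs_mu L1_eigenfunction iii[THEN conjunct1] iii[THEN conjunct2])
qed

end

theorem theoremC:
  "\<forall>\<alpha>::real. \<alpha> > 1 \<longrightarrow> (\<exists>\<beta>0>0. \<forall>\<beta>::real. 0 < \<beta> \<and> \<beta> < \<beta>0 \<longrightarrow>
     (\<exists>\<mu> \<nu>.
        \<comment> \<open>(i) unique equilibrium state and unique half-line Gibbs measure\<close>
        equilibrium_state (dyson \<alpha> \<beta>) \<mu> \<and>
        (\<forall>\<mu>'. equilibrium_state (dyson \<alpha> \<beta>) \<mu>' \<longrightarrow> \<mu>' = \<mu>) \<and>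
        half_line_gibbs (dyson \<alpha> \<beta>) \<nu> \<and>
        (\<forall>\<nu>'. half_line_gibbs (dyson \<alpha> \<beta>) \<nu>' \<longrightarrow> \<nu>' = \<nu>) \<and>
        \<comment> \<open>(ii) equivalence and an L^1(nu) eigenfunction\<close>
        absolutely_continuous \<nu> \<mu> \<and> absolutely_continuous \<mu> \<nu> \<and>
        (\<exists>h. integrable \<nu> h \<and> (AE x in \<nu>. 0 \<le> h x) \<and> \<not> (AE x in \<nu>. h x = 0) \<and>
             (AE x in \<nu>. transfer (dyson \<alpha> \<beta>) h x = exp (pressure (dyson \<alpha> \<beta>)) * h x)) \<and>
        \<comment> \<open>(iii) continuous version of the density and continuous eigenfunction\<close>
        (\<alpha> > 3/2 \<longrightarrow>
           (\<exists>g. continuous_on (space Xp) g \<and> (AE x in \<nu>. RN_deriv \<nu> \<mu> x = ennreal (g x))) \<and>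
           (\<exists>h. continuous_on (space Xp) h \<and> (\<forall>x\<in>space Xp. 0 \<le> h x) \<and>
                (\<exists>x\<in>space Xp. h x \<noteq> 0) \<and>
                (\<forall>x\<in>space Xp. transfer (dyson \<alpha> \<beta>) h x = exp (pressure (dyson \<alpha> \<beta>)) * h x)))))"
proof (intro allI impI, goal_cases)
  case (1 \<alpha>)
  have c: "0 < conv_const \<alpha>" using tail_sum_1_ge_1[OF 1] by (simp add: conv_const_def)
  \<comment> \<open>The threshold on \<beta> is the smallness condition of the locale solved for
    \<beta>.\<close>
  have "high_temperature \<alpha> \<beta>" if "0 < \<beta> \<and> \<beta> < 1 / (8 * conv_const \<alpha>)" for \<beta>
    using 1 that c by (intro high_temperature.intro) (auto simp: field_simps)
  with c show ?case
    by (intro exI[of _ "1 / (8 * conv_const \<alpha>)"] conjI allI impI)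
      (simp, rule high_temperature.equilibrium_state_and_eigenfunctions, blast)
qed

end
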